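(* Let $A$ be a basic connected right artinian ring and let $\mathcal{E}=\{e_1,\dots,e_n\}$ be a complete set of primitive orthogonal idempotents of $A$. There is a one-to-one correspondence between: (1) the full subcategories $\mathcal{C}$ of $\mathrm{ind}_A$ closed under predecessors such that $\mathrm{add}(\mathcal{C})$ is an abelian exact subcategory of $\mathrm{mod}_A$; (2) the split torsion pairs in $\mathrm{mod}_A$ with torsion-free class closed under quotients; (3) the subsets $\Sigma\subseteq\mathcal{E}$ such that $(1-e_\Sigma)Ae_\Sigma$ is a hereditary injective $e_\Sigma A e_\Sigma$-module and $e_\Sigma A(1-e_\Sigma)=0$.
   Context: Connected means indecomposable as a ring. Modules are finitely generated right modules; $\mathrm{mod}_A$ is the category of finitely generated right $A$-modules, and $\mathrm{ind}_A$ is a full subcategory of $\mathrm{mod}_A$ consisting of a complete set of representatives of the isomorphism classes of indecomposable $A$-modules. All subcategories of $\mathrm{mod}_A$ or $\mathrm{ind}_A$ are assumed closed under isomorphic images (so a subcategory of $\mathrm{ind}_A$ amounts to a class of isomorphism classes of indecomposables). For a subset $\Sigma=\{e_{i_1},\dots,e_{i_r}\}$ of $\mathcal{E}$, $e_\Sigma=e_{i_1}+\cdots+e_{i_r}$. For a full subcategory $\mathcal{C}$ of $\mathrm{mod}_A$, $\mathrm{add}(\mathcal{C})$ is the full subcategory of $\mathrm{mod}_A$ whose objects are the direct summands of finite direct sums of modules in $\mathcal{C}$. For $X,Y\in\mathrm{ind}_A$, $X$ is a predecessor of $Y$ if there is a sequence $X=X_0\to X_1\to\cdots\to X_t=Y$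 of non-zero morphisms between indecomposable $A$-modules. A full subcategory $\mathcal{C}\subseteq\mathrm{ind}_A$ is closed under predecessors if every predecessor of a module in $\mathcal{C}$ lies in $\mathcal{C}$. A full subcategory $\mathcal{A}$ of $\mathrm{mod}_A$ is an abelian exact subcategory if it is abelian as a category and the inclusion functor $\mathcal{A}\hookrightarrow\mathrm{mod}_A$ is exact; equivalently, it is closed under kernels and cokernels. A torsion pair in $\mathrm{mod}_A$ is a pair $(\mathcal{T},\mathcal{F})$ of full subcategories such that $X\in\mathcal{T}$ iff $\mathrm{Hom}_A(X,F)=0$ for all $F\in\mathcal{F}$, and $X\in\mathcal{F}$ iff $\mathrm{Hom}_A(T,X)=0$ for all $T\in\mathcal{T}$; $\mathcal{F}$ is its torsion-free class. It is split if every indecomposable $A$-module belongs to $\mathcal{T}$ or to $\mathcal{F}$ (equivalently, the torsion submodule $t(X)$ is a direct summand of $X$ for every $X\in\mathrm{mod}_A$). A module $I$ is hereditary injective if every quotient of $I$ (or of $I^r$, $r>0$) is an injective module. *)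

theory Defs
  imports "HOL-Algebra.Chinese_Remainder" "HOL-Algebra.Module"
begin

section \<open>Right modules over a not necessarily commutative ring\<close>

text \<open>
  The locale \<^locale>\<open>module\<close> of the library is restricted to commutative rings.  As there, the record
  extends the ring record only to inherit the additive structure; its multiplicative fields carry
  no meaning.
\<close>

record ('a, 'm) rmodule = "'m ring" +
  ract :: "'m \<Rightarrow> 'a \<Rightarrow> 'm" (infixl \<open>\<triangleleft>\<index>\<close> 70)

locale right_module = R?: ring R + M?: abelian_group M
  for R :: "('a, 'r) ring_scheme" (structure) and M :: "('a, 'm) rmodule" (structure) +
  assumes ract_closed: "\<lbrakk>x \<in> carrier M; a \<in> carrier R\<rbrakk> \<Longrightarrow> x \<triangleleft>\<^bsub>M\<^esub> a \<in> carrier M"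
    and ract_add: "\<lbrakk>x \<in> carrier M; a \<in> carrier R; b \<in> carrier R\<rbrakk> \<Longrightarrow>
      x \<triangleleft>\<^bsub>M\<^esub> (a \<oplus>\<^bsub>R\<^esub> b) = x \<triangleleft>\<^bsub>M\<^esub> a \<oplus>\<^bsub>M\<^esub> x \<triangleleft>\<^bsub>M\<^esub> b"
    and add_ract: "\<lbrakk>x \<in> carrier M; y \<in> carrier M; a \<in> carrier R\<rbrakk> \<Longrightarrow>
      (x \<oplus>\<^bsub>M\<^esub> y) \<triangleleft>\<^bsub>M\<^esub> a = x \<triangleleft>\<^bsub>M\<^esub> a \<oplus>\<^bsub>M\<^esub> y \<triangleleft>\<^bsub>M\<^esub> a"
    and ract_mult: "\<lbrakk>x \<in> carrier M; a \<in> carrier R; b \<in> carrier R\<rbrakk> \<Longrightarrow>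
      x \<triangleleft>\<^bsub>M\<^esub> (a \<otimes>\<^bsub>R\<^esub> b) = (x \<triangleleft>\<^bsub>M\<^esub> a) \<triangleleft>\<^bsub>M\<^esub> b"
    and ract_one: "x \<in> carrier M \<Longrightarrow> x \<triangleleft>\<^bsub>M\<^esub> \<one>\<^bsub>R\<^esub> = x"

definition right_submodule ::
    "('a, 'r) ring_scheme \<Rightarrow> ('a, 'm) rmodule \<Rightarrow> 'm set \<Rightarrow> bool" where
  "right_submodule R M N \<longleftrightarrow>
     additive_subgroup N M \<and> (\<forall>x\<in>N. \<forall>a\<in>carrier R. x \<triangleleft>\<^bsub>M\<^esub> a \<in> N)"

definition fin_gen :: "('a, 'r) ring_scheme \<Rightarrow> ('a, 'm) rmodule \<Rightarrow> bool" where
  "fin_gen R M \<longleftrightarrow>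
     (\<exists>S. finite S \<and> S \<subseteq> carrier M \<and> (\<forall>N. right_submodule R M N \<and> S \<subseteq> N \<longrightarrow> N = carrier M))"

text \<open>
  Homomorphisms are extensional functions, so that equality of morphisms is equality in HOL;
  accordingly composition is \<^const>\<open>compose\<close>.
\<close>

definition rhom :: "('a, 'r) ring_scheme \<Rightarrow> ('a, 'm) rmodule \<Rightarrow> ('a, 'n) rmodule \<Rightarrow> ('m \<Rightarrow> 'n) set" where
  "rhom R M N = {h \<in> carrier M \<rightarrow>\<^sub>E carrier N.
     (\<forall>x\<in>carrier M. \<forall>y\<in>carrier M. h (x \<oplus>\<^bsub>M\<^esub> y) = h x \<oplus>\<^bsub>N\<^esub> h y) \<and>
     (\<forall>x\<in>carrier M. \<forall>a\<in>carrier R. h (x \<triangleleft>\<^bsub>M\<^esub> a) = h x \<triangleleft>\<^bsub>N\<^esub> a)}"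

definition zero_hom :: "('a, 'm) rmodule \<Rightarrow> ('a, 'n) rmodule \<Rightarrow> 'm \<Rightarrow> 'n" where
  "zero_hom M N = (\<lambda>x\<in>carrier M. \<zero>\<^bsub>N\<^esub>)"

definition rmod_iso :: "('a, 'r) ring_scheme \<Rightarrow> ('a, 'm) rmodule \<Rightarrow> ('a, 'n) rmodule \<Rightarrow> bool" where
  "rmod_iso R M N \<longleftrightarrow> (\<exists>h\<in>rhom R M N. bij_betw h (carrier M) (carrier N))"

definition quot_rmod :: "('a, 'm) rmodule \<Rightarrow> 'm set \<Rightarrow> ('a, 'm set) rmodule" where
  "quot_rmod M N = \<lparr>carrier = a_rcosets\<^bsub>M\<^esub> N, mult = undefined, one = undefined,
     zero = N, add = set_add M, ract = (\<lambda>X a. \<Union>x\<in>X. N +>\<^bsub>M\<^esub> (x \<triangleleft>\<^bsub>M\<^esub> a))\<rparr>"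

definition dsum_rmod :: "nat \<Rightarrow> (nat \<Rightarrow> ('a, 'm) rmodule) \<Rightarrow> ('a, nat \<Rightarrow> 'm) rmodule" where
  "dsum_rmod m X = \<lparr>carrier = (\<Pi>\<^sub>E i\<in>{..<m}. carrier (X i)), mult = undefined, one = undefined,
     zero = (\<lambda>i\<in>{..<m}. \<zero>\<^bsub>X i\<^esub>), add = (\<lambda>u v. \<lambda>i\<in>{..<m}. u i \<oplus>\<^bsub>X i\<^esub> v i),
     ract = (\<lambda>u a. \<lambda>i\<in>{..<m}. u i \<triangleleft>\<^bsub>X i\<^esub> a)\<rparr>"

definition internal_direct_sum ::
    "('a, 'r) ring_scheme \<Rightarrow> ('a, 'm) rmodule \<Rightarrow> 'm set \<Rightarrow> 'm set \<Rightarrow> bool" where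
  "internal_direct_sum R M N L \<longleftrightarrow> right_submodule R M N \<and> right_submodule R M L \<and>
     N <+>\<^bsub>M\<^esub> L = carrier M \<and> N \<inter> L = {\<zero>\<^bsub>M\<^esub>}"

definition direct_summand ::
    "('a, 'r) ring_scheme \<Rightarrow> ('a, 'n) rmodule \<Rightarrow> ('a, 'm) rmodule \<Rightarrow> bool" where
  "direct_summand R X M \<longleftrightarrow>
     (\<exists>N L. internal_direct_sum R M N L \<and> rmod_iso R X (M\<lparr>carrier := N\<rparr>))"

definition indecomposable :: "('a, 'r) ring_scheme \<Rightarrow> ('a, 'm) rmodule \<Rightarrow> bool" where
  "indecomposable R M \<longleftrightarrow> right_module R M \<and> carrier M \<noteq> {\<zero>\<^bsub>M\<^esub>} \<and>
     (\<forall>N L. internal_direct_sum R M N L \<longrightarrow> N = {\<zero>\<^bsub>M\<^esub>} \<or> L = {\<zero>\<^bsub>M\<^esub>})"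


section \<open>The category of finitely generated right modules\<close>

text \<open>
  A finitely generated right module over \<open>R\<close> is isomorphic to a quotient of some \<open>R\<^sup>n\<close>, whose
  elements are sets of functions \<open>nat \<Rightarrow> 'a\<close>.  Fixing that carrier type therefore loses no
  isomorphism class; see \<open>fg_mod_representative\<close> below.
\<close>

type_synonym 'a fgmodule = "('a, (nat \<Rightarrow> 'a) set) rmodule"

definition fg_mod :: "('a, 'r) ring_scheme \<Rightarrow> 'a fgmodule set" where
  "fg_mod R = {M. right_module R M \<and> fin_gen R M}"

definition ind_mod :: "('a, 'r) ring_scheme \<Rightarrow> 'a fgmodule set" where
  "ind_mod R = {M \<in> fg_mod R. indecomposable R M}"

definition iso_closed :: "('a, 'r) ring_scheme \<Rightarrow> 'a fgmodule set \<Rightarrow> bool" where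
  "iso_closed R \<C> \<longleftrightarrow> (\<forall>X\<in>\<C>. \<forall>Y\<in>fg_mod R. rmod_iso R X Y \<longrightarrow> Y \<in> \<C>)"

definition add_closure :: "('a, 'r) ring_scheme \<Rightarrow> 'a fgmodule set \<Rightarrow> 'a fgmodule set" where
  "add_closure R \<C> = {M \<in> fg_mod R. \<exists>m X. (\<forall>i<m. X i \<in> \<C>) \<and> direct_summand R M (dsum_rmod m X)}"

definition nonzero_step :: "('a, 'r) ring_scheme \<Rightarrow> 'a fgmodule \<Rightarrow> 'a fgmodule \<Rightarrow> bool" where
  "nonzero_step R X Y \<longleftrightarrow>
     X \<in> ind_mod R \<and> Y \<in> ind_mod R \<and> (\<exists>f\<in>rhom R X Y. f \<noteq> zero_hom X Y)"

definition predecessor :: "('a, 'r) ring_scheme \<Rightarrow> 'a fgmodule \<Rightarrow> 'a fgmodule \<Rightarrow> bool" where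
  "predecessor R X Y \<longleftrightarrow> X \<in> ind_mod R \<and> Y \<in> ind_mod R \<and> (nonzero_step R)\<^sup>*\<^sup>* X Y"

definition pred_closed :: "('a, 'r) ring_scheme \<Rightarrow> 'a fgmodule set \<Rightarrow> bool" where
  "pred_closed R \<C> \<longleftrightarrow> (\<forall>Y\<in>\<C>. \<forall>X. predecessor R X Y \<longrightarrow> X \<in> \<C>)"


section \<open>Abelian exact subcategories\<close>

text \<open>
  All notions below are relative to the full subcategory of finitely generated modules with
  object class \<open>\<A>\<close>; test objects range over \<open>\<A>\<close> only.
\<close>

definition is_zero_object :: "('a, 'r) ring_scheme \<Rightarrow> 'a fgmodule set \<Rightarrow> 'a fgmodule \<Rightarrow> bool" where
  "is_zero_object R \<A> Z \<longleftrightarrow> Z \<in> \<A> \<and>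
     (\<forall>W\<in>\<A>. (\<exists>!f. f \<in> rhom R Z W) \<and> (\<exists>!f. f \<in> rhom R W Z))"

definition is_product where
  "is_product R (\<A> :: 'a fgmodule set) X Y P p q \<longleftrightarrow>
     P \<in> \<A> \<and> p \<in> rhom R P X \<and> q \<in> rhom R P Y \<and>
     (\<forall>W\<in>\<A>. \<forall>f\<in>rhom R W X. \<forall>g\<in>rhom R W Y.
        \<exists>!u. u \<in> rhom R W P \<and> compose (carrier W) p u = f \<and> compose (carrier W) q u = g)"

definition is_coproduct where
  "is_coproduct R (\<A> :: 'a fgmodule set) X Y S i j \<longleftrightarrow>
     S \<in> \<A> \<and> i \<in> rhom R X S \<and> j \<in> rhom R Y S \<and>
     (\<forall>W\<in>\<A>. \<forall>f\<in>rhom R X W. \<forall>g\<in>rhom R Y W.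
        \<exists>!u. u \<in> rhom R S W \<and> compose (carrier X) u i = f \<and> compose (carrier Y) u j = g)"

definition is_kernel where
  "is_kernel R (\<A> :: 'a fgmodule set) X Y f K k \<longleftrightarrow>
     K \<in> \<A> \<and> k \<in> rhom R K X \<and> compose (carrier K) f k = zero_hom K Y \<and>
     (\<forall>W\<in>\<A>. \<forall>h\<in>rhom R W X. compose (carrier W) f h = zero_hom W Y \<longrightarrow>
        (\<exists>!u. u \<in> rhom R W K \<and> compose (carrier W) k u = h))"

definition is_cokernel where
  "is_cokernel R (\<A> :: 'a fgmodule set) X Y f C c \<longleftrightarrow>
     C \<in> \<A> \<and> c \<in> rhom R Y C \<and> compose (carrier X) c f = zero_hom X C \<and>
     (\<forall>W\<in>\<A>. \<forall>h\<in>rhom R Y W. compose (carrier X) h f = zero_hom X W \<longrightarrow>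
        (\<exists>!u. u \<in> rhom R C W \<and> compose (carrier Y) u c = h))"

definition is_mono where
  "is_mono R (\<A> :: 'a fgmodule set) X Y f \<longleftrightarrow>
     (\<forall>W\<in>\<A>. \<forall>u\<in>rhom R W X. \<forall>v\<in>rhom R W X.
        compose (carrier W) f u = compose (carrier W) f v \<longrightarrow> u = v)"

definition is_epi where
  "is_epi R (\<A> :: 'a fgmodule set) X Y f \<longleftrightarrow>
     (\<forall>W\<in>\<A>. \<forall>u\<in>rhom R Y W. \<forall>v\<in>rhom R Y W.
        compose (carrier X) u f = compose (carrier X) v f \<longrightarrow> u = v)"

definition abelian_subcategory :: "('a, 'r) ring_scheme \<Rightarrow> 'a fgmodule set \<Rightarrow> bool" where
  "abelian_subcategory R \<A> \<longleftrightarrow> \<A> \<subseteq> fg_mod R \<and>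
     (\<exists>Z. is_zero_object R \<A> Z) \<and>
     (\<forall>X\<in>\<A>. \<forall>Y\<in>\<A>. (\<exists>P p q. is_product R \<A> X Y P p q) \<and> (\<exists>S i j. is_coproduct R \<A> X Y S i j)) \<and>
     (\<forall>X\<in>\<A>. \<forall>Y\<in>\<A>. \<forall>f\<in>rhom R X Y.
        (\<exists>K k. is_kernel R \<A> X Y f K k) \<and> (\<exists>C c. is_cokernel R \<A> X Y f C c)) \<and>
     (\<forall>X\<in>\<A>. \<forall>Y\<in>\<A>. \<forall>f\<in>rhom R X Y. is_mono R \<A> X Y f \<longrightarrow>
        (\<exists>Z\<in>\<A>. \<exists>g\<in>rhom R Y Z. is_kernel R \<A> Y Z g X f)) \<and>
     (\<forall>X\<in>\<A>. \<forall>Y\<in>\<A>. \<forall>f\<in>rhom R X Y. is_epi R \<A> X Y f \<longrightarrow>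
        (\<exists>W\<in>\<A>. \<exists>g\<in>rhom R W X. is_cokernel R \<A> W X g Y f))"

text \<open>
  The inclusion is additive, so it is exact iff it sends kernels to kernels and cokernels to
  cokernels.
\<close>

definition exact_inclusion :: "('a, 'r) ring_scheme \<Rightarrow> 'a fgmodule set \<Rightarrow> bool" where
  "exact_inclusion R \<A> \<longleftrightarrow>
     (\<forall>X\<in>\<A>. \<forall>Y\<in>\<A>. \<forall>f\<in>rhom R X Y.
        (\<forall>K k. is_kernel R \<A> X Y f K k \<longrightarrow> is_kernel R (fg_mod R) X Y f K k) \<and>
        (\<forall>C c. is_cokernel R \<A> X Y f C c \<longrightarrow> is_cokernel R (fg_mod R) X Y f C c))"

definition abelian_exact_subcategory :: "('a, 'r) ring_scheme \<Rightarrow> 'a fgmodule set \<Rightarrow> bool" where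
  "abelian_exact_subcategory R \<A> \<longleftrightarrow> abelian_subcategory R \<A> \<and> exact_inclusion R \<A>"


section \<open>Torsion pairs\<close>

definition left_perp :: "('a, 'r) ring_scheme \<Rightarrow> 'a fgmodule set \<Rightarrow> 'a fgmodule set" where
  "left_perp R \<F> = {X \<in> fg_mod R. \<forall>F\<in>\<F>. rhom R X F = {zero_hom X F}}"

definition right_perp :: "('a, 'r) ring_scheme \<Rightarrow> 'a fgmodule set \<Rightarrow> 'a fgmodule set" where
  "right_perp R \<T> = {X \<in> fg_mod R. \<forall>T\<in>\<T>. rhom R T X = {zero_hom T X}}"

definition torsion_pair :: "('a, 'r) ring_scheme \<Rightarrow> 'a fgmodule set \<Rightarrow> 'a fgmodule set \<Rightarrow> bool" where
  "torsion_pair R \<T> \<F> \<longleftrightarrow> \<T> = left_perp R \<F> \<and> \<F> = right_perp R \<T>"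

definition split_torsion_pair ::
    "('a, 'r) ring_scheme \<Rightarrow> 'a fgmodule set \<Rightarrow> 'a fgmodule set \<Rightarrow> bool" where
  "split_torsion_pair R \<T> \<F> \<longleftrightarrow> torsion_pair R \<T> \<F> \<and> ind_mod R \<subseteq> \<T> \<union> \<F>"

definition quotient_closed :: "('a, 'r) ring_scheme \<Rightarrow> 'a fgmodule set \<Rightarrow> bool" where
  "quotient_closed R \<C> \<longleftrightarrow>
     (\<forall>X\<in>\<C>. \<forall>Y\<in>fg_mod R. \<forall>f\<in>rhom R X Y. f ` carrier X = carrier Y \<longrightarrow> Y \<in> \<C>)"


section \<open>Injective modules\<close>

text \<open>
  Injectivity is tested on finitely generated modules, i.e. in the module category above.  Every
  right ideal of a right artinian ring is finitely generated, so over such a ring Baer's criterion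
  makes this the same as injectivity among all right modules.
\<close>

definition injective_rmod :: "('a, 'r) ring_scheme \<Rightarrow> ('a, 'm) rmodule \<Rightarrow> bool" where
  "injective_rmod R Q \<longleftrightarrow> right_module R Q \<and>
     (\<forall>X\<in>fg_mod R. \<forall>Y\<in>fg_mod R. \<forall>f\<in>rhom R X Y. inj_on f (carrier X) \<longrightarrow>
        (\<forall>g\<in>rhom R X Q. \<exists>h\<in>rhom R Y Q. compose (carrier X) h f = g))"

text \<open>
  Allowing quotients of \<open>Q\<^sup>r\<close>, \<open>r > 0\<close>, gives the same notion: such a quotient is an extension of a
  quotient of \<open>Q\<close> by a quotient of \<open>Q\<^sup>r\<^sup>-\<^sup>1\<close>, which is injective by induction.
\<close>

definition hereditary_injective :: "('a, 'r) ring_scheme \<Rightarrow> ('a, 'm) rmodule \<Rightarrow> bool" where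
  "hereditary_injective R Q \<longleftrightarrow> right_module R Q \<and>
     (\<forall>N. right_submodule R Q N \<longrightarrow> injective_rmod R (quot_rmod Q N))"


section \<open>Rings and idempotents\<close>

text \<open>An additive subgroup \<open>S\<close> of \<open>A\<close>, acted upon from the right by multiplication in \<open>A\<close>.\<close>

definition mult_rmod :: "('a, 'r) ring_scheme \<Rightarrow> 'a set \<Rightarrow> ('a, 'a) rmodule" where
  "mult_rmod A S = \<lparr>carrier = S, mult = undefined, one = undefined,
     zero = \<zero>\<^bsub>A\<^esub>, add = add A, ract = mult A\<rparr>"

definition peirce :: "('a, 'r) ring_scheme \<Rightarrow> 'a \<Rightarrow> 'a \<Rightarrow> 'a set" where
  "peirce A e f = (\<lambda>a. e \<otimes>\<^bsub>A\<^esub> a \<otimes>\<^bsub>A\<^esub> f) ` carrier A"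

definition corner_ring :: "('a, 'r) ring_scheme \<Rightarrow> 'a \<Rightarrow> ('a, 'r) ring_scheme" where
  "corner_ring A e = A\<lparr>carrier := peirce A e e, one := e\<rparr>"

definition right_artinian :: "('a, 'r) ring_scheme \<Rightarrow> bool" where
  "right_artinian A \<longleftrightarrow>
     (\<forall>I :: nat \<Rightarrow> 'a set.
        (\<forall>n. right_submodule A (mult_rmod A (carrier A)) (I n) \<and> I (Suc n) \<subseteq> I n) \<longrightarrow>
        (\<exists>n. \<forall>m\<ge>n. I m = I n))"

text \<open>
  If \<open>A\<close> is isomorphic to a product of two rings, the factors can be realised as the ideals they
  correspond to, so carriers in \<open>'a\<close> suffice.
\<close>

definition connected_ring :: "('a, 'r) ring_scheme \<Rightarrow> bool" where
  "connected_ring A \<longleftrightarrow> carrier A \<noteq> {\<zero>\<^bsub>A\<^esub>} \<and>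
     (\<forall>(S :: 'a ring) (T :: 'a ring). ring S \<and> ring T \<and> A \<simeq> RDirProd S T \<longrightarrow>
        carrier S = {\<zero>\<^bsub>S\<^esub>} \<or> carrier T = {\<zero>\<^bsub>T\<^esub>})"

definition idempotents :: "('a, 'r) ring_scheme \<Rightarrow> 'a set" where
  "idempotents A = {e \<in> carrier A. e \<otimes>\<^bsub>A\<^esub> e = e}"

definition orthogonal :: "('a, 'r) ring_scheme \<Rightarrow> 'a \<Rightarrow> 'a \<Rightarrow> bool" where
  "orthogonal A e f \<longleftrightarrow> e \<otimes>\<^bsub>A\<^esub> f = \<zero>\<^bsub>A\<^esub> \<and> f \<otimes>\<^bsub>A\<^esub> e = \<zero>\<^bsub>A\<^esub>"

definition primitive_idempotent :: "('a, 'r) ring_scheme \<Rightarrow> 'a \<Rightarrow> bool" where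
  "primitive_idempotent A e \<longleftrightarrow> e \<in> idempotents A \<and> e \<noteq> \<zero>\<^bsub>A\<^esub> \<and>
     (\<forall>f\<in>idempotents A. \<forall>g\<in>idempotents A. orthogonal A f g \<and> e = f \<oplus>\<^bsub>A\<^esub> g \<longrightarrow>
        f = \<zero>\<^bsub>A\<^esub> \<or> g = \<zero>\<^bsub>A\<^esub>)"

definition idem_sum :: "('a, 'r) ring_scheme \<Rightarrow> 'a set \<Rightarrow> 'a" where
  "idem_sum A \<Sigma> = (\<Oplus>\<^bsub>A\<^esub>e\<in>\<Sigma>. e)"

definition complete_primitive_idempotents :: "('a, 'r) ring_scheme \<Rightarrow> 'a set \<Rightarrow> bool" where
  "complete_primitive_idempotents A E \<longleftrightarrow> finite E \<and> (\<forall>e\<in>E. primitive_idempotent A e) \<and>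
     (\<forall>e\<in>E. \<forall>f\<in>E. e \<noteq> f \<longrightarrow> orthogonal A e f) \<and> idem_sum A E = \<one>\<^bsub>A\<^esub>"

text \<open>
  \<open>E\<close> is meant to be a complete set of primitive orthogonal idempotents; over a right artinian
  ring the condition does not depend on its choice (Krull-Schmidt).
\<close>

definition basic_ring :: "('a, 'r) ring_scheme \<Rightarrow> 'a set \<Rightarrow> bool" where
  "basic_ring A E \<longleftrightarrow> (\<forall>e\<in>E. \<forall>f\<in>E. e \<noteq> f \<longrightarrow>
     \<not> rmod_iso A (mult_rmod A (peirce A e \<one>\<^bsub>A\<^esub>)) (mult_rmod A (peirce A f \<one>\<^bsub>A\<^esub>)))"


section \<open>The three classes of objects\<close>

definition abelian_pred_closed_subcategories :: "('a, 'r) ring_scheme \<Rightarrow> 'a fgmodule set set" where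
  "abelian_pred_closed_subcategories A =
     {\<C>. \<C> \<subseteq> ind_mod A \<and> iso_closed A \<C> \<and> pred_closed A \<C> \<and>
          abelian_exact_subcategory A (add_closure A \<C>)}"

definition split_quotient_closed_torsion_pairs ::
    "('a, 'r) ring_scheme \<Rightarrow> ('a fgmodule set \<times> 'a fgmodule set) set" where
  "split_quotient_closed_torsion_pairs A =
     {(\<T>, \<F>). split_torsion_pair A \<T> \<F> \<and> quotient_closed A \<F>}"

definition hereditary_injective_subsets :: "('a, 'r) ring_scheme \<Rightarrow> 'a set \<Rightarrow> 'a set set" where
  "hereditary_injective_subsets A E =
     {\<Sigma>. \<Sigma> \<subseteq> E \<and>
        (let e = idem_sum A \<Sigma>; e' = \<one>\<^bsub>A\<^esub> \<ominus>\<^bsub>A\<^esub> e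
         in hereditary_injective (corner_ring A e) (mult_rmod A (peirce A e' e)) \<and>
            peirce A e e' = {\<zero>\<^bsub>A\<^esub>})}"

text \<open>
  The maps realising the correspondence: a subcategory \<open>\<C>\<close> yields the torsion pair whose
  torsion-free class is \<open>add(\<C>)\<close>, and a set \<open>\<Sigma>\<close> of idempotents, with sum \<open>e\<close>, yields the
  indecomposable modules \<open>X\<close> with \<open>X(1 - e) = 0\<close>.  When \<open>eA(1 - e) = 0\<close>, these are the
  indecomposable \<open>eAe\<close>-modules, on which \<open>A\<close> acts through \<open>a \<mapsto> eae\<close>.
\<close>

definition torsion_pair_of ::
    "('a, 'r) ring_scheme \<Rightarrow> 'a fgmodule set \<Rightarrow> 'a fgmodule set \<times> 'a fgmodule set" where
  "torsion_pair_of A \<C> = (left_perp A (add_closure A \<C>), add_closure A \<C>)"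

definition supported_indecomposables :: "('a, 'r) ring_scheme \<Rightarrow> 'a set \<Rightarrow> 'a fgmodule set" where
  "supported_indecomposables A \<Sigma> =
     {X \<in> ind_mod A. \<forall>x\<in>carrier X. x \<triangleleft>\<^bsub>X\<^esub> (\<one>\<^bsub>A\<^esub> \<ominus>\<^bsub>A\<^esub> idem_sum A \<Sigma>) = \<zero>\<^bsub>X\<^esub>}"


section \<open>Adequacy of the carrier type\<close>

context right_module
begin

lemma zero_ract: "a \<in> carrier R \<Longrightarrow> \<zero>\<^bsub>M\<^esub> \<triangleleft>\<^bsub>M\<^esub> a = \<zero>\<^bsub>M\<^esub>"
  using add_ract[of "\<zero>\<^bsub>M\<^esub>" "\<zero>\<^bsub>M\<^esub>" a] ract_closed[of "\<zero>\<^bsub>M\<^esub>" a] by simp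

lemma ract_zero: "x \<in> carrier M \<Longrightarrow> x \<triangleleft>\<^bsub>M\<^esub> \<zero>\<^bsub>R\<^esub> = \<zero>\<^bsub>M\<^esub>"
  using ract_add[of x "\<zero>\<^bsub>R\<^esub>" "\<zero>\<^bsub>R\<^esub>"] ract_closed[of x "\<zero>\<^bsub>R\<^esub>"] by simp

lemma ract_minus: "x \<in> carrier M \<Longrightarrow> a \<in> carrier R \<Longrightarrow> x \<triangleleft>\<^bsub>M\<^esub> (\<ominus>\<^bsub>R\<^esub> a) = \<ominus>\<^bsub>M\<^esub> (x \<triangleleft>\<^bsub>M\<^esub> a)"
  using ract_add[of x "\<ominus>\<^bsub>R\<^esub> a" a] ract_zero[of x]
  by (simp add: R.l_neg ract_closed M.minus_equality)

lemma finsum_ract: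
  assumes "finite I" "\<And>i. i \<in> I \<Longrightarrow> f i \<in> carrier M" "a \<in> carrier R"
  shows "finsum M f I \<triangleleft>\<^bsub>M\<^esub> a = finsum M (\<lambda>i. f i \<triangleleft>\<^bsub>M\<^esub> a) I"
  using assms by (induction I rule: finite_induct)
    (auto simp: zero_ract add_ract ract_closed Pi_def M.finsum_insert)

end

text \<open>
  Every finitely generated right module, over any carrier type, is isomorphic to an object of
  \<^const>\<open>fg_mod\<close>.
\<close>

lemma fg_mod_representative:
  assumes "right_module R (M :: ('a, 'm) rmodule)" and "fin_gen R M"
  shows "\<exists>X\<in>fg_mod R. rmod_iso R M X"
proof -
  interpret right_module R M by (fact assms(1))
  obtain S where S: "finite S" "S \<subseteq> carrier M"
      "\<And>N. right_submodule R M N \<and> S \<subseteq> N \<Longrightarrow> N = carrier M"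
    using assms(2) unfolding fin_gen_def by (elim exE conjE) metis
  obtain g :: "nat \<Rightarrow> 'm" and n where g: "bij_betw g {..<n} S"
    using ex_bij_betw_nat_finite[OF S(1)] by (metis atLeast0LessThan)
  have gc: "g i \<in> carrier M" if "i < n" for i
    using g S(2) that by (auto simp: bij_betw_def)
  define V where "V = {..<n} \<rightarrow> carrier R"
  define \<phi> where "\<phi> v = (\<Oplus>\<^bsub>M\<^esub>i\<in>{..<n}. g i \<triangleleft>\<^bsub>M\<^esub> v i)" for v :: "nat \<Rightarrow> 'a"
  have cl: "(\<lambda>i. g i \<triangleleft>\<^bsub>M\<^esub> v i) \<in> {..<n} \<rightarrow> carrier M" if "v \<in> V" for v
    using that gc ract_closed by (auto simp: V_def Pi_def)
  have \<phi>_closed: "\<phi> v \<in> carrier M" if "v \<in> V" for v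
    unfolding \<phi>_def by (rule M.finsum_closed[OF cl[OF that]])
  have sub: "right_submodule R M (\<phi> ` V)"
    unfolding right_submodule_def
  proof (intro conjI ballI)
    show "additive_subgroup (\<phi> ` V) M"
    proof (rule additive_subgroup.intro, rule M.add.subgroupI)
      show "\<phi> ` V \<subseteq> carrier M" using \<phi>_closed by auto
      have "(\<lambda>_. \<zero>\<^bsub>R\<^esub>) \<in> V" by (auto simp: V_def)
      then show "\<phi> ` V \<noteq> {}" by blast
    next
      fix x assume "x \<in> \<phi> ` V"
      then obtain v where v: "v \<in> V" "x = \<phi> v" by blast
      define w where "w = (\<lambda>i. \<ominus>\<^bsub>R\<^esub> v i)"
      have w: "w \<in> V" using v by (auto simp: V_def w_def)
      have "\<phi> w \<oplus>\<^bsub>M\<^esub> \<phi> v = (\<Oplus>\<^bsub>M\<^esub>i\<in>{..<n}. g i \<triangleleft>\<^bsub>M\<^esub> w i \<oplus>\<^bsub>M\<^esub> g i \<triangleleft>\<^bsub>M\<^esub> v i)"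
        unfolding \<phi>_def using M.finsum_addf[OF cl[OF w] cl[OF v(1)]] by simp
      also have "\<dots> = (\<Oplus>\<^bsub>M\<^esub>i\<in>{..<n}. \<zero>\<^bsub>M\<^esub>)"
        using v gc by (intro M.finsum_cong')
          (auto simp: w_def V_def Pi_def ract_minus ract_closed M.l_neg)
      also have "\<dots> = \<zero>\<^bsub>M\<^esub>" by simp
      finally have "\<ominus>\<^bsub>M\<^esub> x = \<phi> w"
        using \<phi>_closed w v M.minus_equality by simp
      then show "\<ominus>\<^bsub>M\<^esub> x \<in> \<phi> ` V" using w by simp
    next
      fix x y assume "x \<in> \<phi> ` V" "y \<in> \<phi> ` V"
      then obtain v w where v: "v \<in> V" "x = \<phi> v" and w: "w \<in> V" "y = \<phi> w" by blast
      define u where "u = (\<lambda>i. v i \<oplus>\<^bsub>R\<^esub> w i)"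
      have u: "u \<in> V" using v w by (auto simp: V_def u_def)
      have "x \<oplus>\<^bsub>M\<^esub> y = (\<Oplus>\<^bsub>M\<^esub>i\<in>{..<n}. g i \<triangleleft>\<^bsub>M\<^esub> v i \<oplus>\<^bsub>M\<^esub> g i \<triangleleft>\<^bsub>M\<^esub> w i)"
        unfolding \<phi>_def v(2) w(2) using M.finsum_addf[OF cl[OF v(1)] cl[OF w(1)]] by simp
      also have "\<dots> = \<phi> u"
        unfolding \<phi>_def using v w gc
        by (intro M.finsum_cong') (auto simp: u_def V_def Pi_def ract_add ract_closed)
      finally show "x \<oplus>\<^bsub>M\<^esub> y \<in> \<phi> ` V" using u by auto
    qed
  next
    fix x a assume "x \<in> \<phi> ` V" and a: "a \<in> carrier R"
    then obtain v where v: "v \<in> V" "x = \<phi> v" by blast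
    define u where "u = (\<lambda>i. v i \<otimes>\<^bsub>R\<^esub> a)"
    have u: "u \<in> V" using v a by (auto simp: V_def u_def)
    have "x \<triangleleft>\<^bsub>M\<^esub> a = (\<Oplus>\<^bsub>M\<^esub>i\<in>{..<n}. (g i \<triangleleft>\<^bsub>M\<^esub> v i) \<triangleleft>\<^bsub>M\<^esub> a)"
      unfolding \<phi>_def v(2) using cl[OF v(1)] a by (intro finsum_ract) auto
    also have "\<dots> = \<phi> u"
      unfolding \<phi>_def using v gc a
      by (intro M.finsum_cong') (auto simp: u_def V_def Pi_def ract_mult ract_closed)
    finally show "x \<triangleleft>\<^bsub>M\<^esub> a \<in> \<phi> ` V" using u by auto
  qed
  have "S \<subseteq> \<phi> ` V"
  proof
    fix s assume "s \<in> S"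
    then obtain j where j: "j < n" "s = g j" using g by (auto simp: bij_betw_def)
    define v where "v = (\<lambda>i. if i = j then \<one>\<^bsub>R\<^esub> else \<zero>\<^bsub>R\<^esub>)"
    have v: "v \<in> V" by (auto simp: V_def v_def)
    have "\<phi> v = (\<Oplus>\<^bsub>M\<^esub>i\<in>{..<n}. if j = i then g i else \<zero>\<^bsub>M\<^esub>)"
      unfolding \<phi>_def using gc
      by (intro M.finsum_cong') (auto simp: v_def ract_one ract_zero)
    also have "\<dots> = g j"
      using j gc by (intro M.finsum_singleton) auto
    finally show "s \<in> \<phi> ` V" using v j(2) by (metis image_eqI)
  qed
  then have \<phi>V: "\<phi> ` V = carrier M" using S(3) sub by simp
  define F where "F x = {v \<in> V. \<phi> v = x}" for x
  have "inj_on F (carrier M)"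
  proof (rule inj_onI)
    fix x y assume x: "x \<in> carrier M" and eq: "F x = F y"
    have "x \<in> \<phi> ` V" using x by (simp only: \<phi>V)
    then obtain v where "v \<in> V" "\<phi> v = x" by (elim imageE) simp
    then have "v \<in> F x" by (simp add: F_def)
    then have "v \<in> F y" by (simp only: eq)
    then show "x = y" using \<open>\<phi> v = x\<close> by (simp add: F_def)
  qed
  define G where "G = inv_into (carrier M) F"
  have GF: "G (F x) = x" if "x \<in> carrier M" for x
    using \<open>inj_on F (carrier M)\<close> that by (simp add: G_def)
  define X :: "'a fgmodule" where "X = \<lparr>carrier = F ` carrier M, mult = undefined, one = undefined,
     zero = F \<zero>\<^bsub>M\<^esub>, add = (\<lambda>x y. F (G x \<oplus>\<^bsub>M\<^esub> G y)), ract = (\<lambda>x a. F (G x \<triangleleft>\<^bsub>M\<^esub> a))\<rparr>"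
  have X: "carrier X = F ` carrier M" "\<zero>\<^bsub>X\<^esub> = F \<zero>\<^bsub>M\<^esub>"
      "\<And>x y. x \<oplus>\<^bsub>X\<^esub> y = F (G x \<oplus>\<^bsub>M\<^esub> G y)" "\<And>x a. x \<triangleleft>\<^bsub>X\<^esub> a = F (G x \<triangleleft>\<^bsub>M\<^esub> a)"
    by (simp_all add: X_def)
  have "abelian_group X"
  proof (rule abelian_groupI)
    fix x assume "x \<in> carrier X"
    then obtain z where z: "z \<in> carrier M" "x = F z" by (auto simp: X)
    then show "\<exists>y\<in>carrier X. y \<oplus>\<^bsub>X\<^esub> x = \<zero>\<^bsub>X\<^esub>"
      by (intro bexI[of _ "F (\<ominus>\<^bsub>M\<^esub> z)"]) (auto simp: X GF M.l_neg)
  qed (auto simp: X GF M.a_ac)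
  then interpret X: abelian_group X .
  have rX: "right_module R X"
    by (unfold_locales) (auto simp: X GF ract_closed ract_add add_ract ract_mult ract_one)
  have "fin_gen R X"
    unfolding fin_gen_def
  proof (intro exI[of _ "F ` S"] conjI allI impI)
    fix N assume N: "right_submodule R X N \<and> F ` S \<subseteq> N"
    then interpret N: additive_subgroup N X by (simp add: right_submodule_def)
    have NX: "N \<subseteq> carrier X" by (rule N.a_subset)
    define N' where "N' = {x \<in> carrier M. F x \<in> N}"
    have "right_submodule R M N'"
      unfolding right_submodule_def
    proof (intro conjI ballI)
      show "additive_subgroup N' M"
      proof (rule additive_subgroup.intro, rule M.add.subgroupI)
        show "N' \<subseteq> carrier M" by (auto simp: N'_def)
        show "N' \<noteq> {}" using N.zero_closed by (auto simp: N'_def X)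
      next
        fix x assume x: "x \<in> N'"
        have "F (\<ominus>\<^bsub>M\<^esub> x) = \<ominus>\<^bsub>X\<^esub> F x"
          using x by (intro X.minus_equality[symmetric]) (auto simp: N'_def X GF M.l_neg)
        then show "\<ominus>\<^bsub>M\<^esub> x \<in> N'"
          using x N.a_inv_closed by (auto simp: N'_def)
      next
        fix x y assume "x \<in> N'" "y \<in> N'"
        then show "x \<oplus>\<^bsub>M\<^esub> y \<in> N'"
          using N.a_closed[of "F x" "F y"] by (auto simp: N'_def X GF)
      qed
    next
      fix x a assume "x \<in> N'" "a \<in> carrier R"
      moreover then have "F x \<triangleleft>\<^bsub>X\<^esub> a \<in> N" using N by (auto simp: N'_def right_submodule_def)
      ultimately show "x \<triangleleft>\<^bsub>M\<^esub> a \<in> N'" by (auto simp: N'_def X GF ract_closed)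
    qed
    moreover have "S \<subseteq> N'" using S(2) N by (auto simp: N'_def)
    ultimately have "N' = carrier M" using S(3) by simp
    then show "N = carrier X" using NX by (auto simp: N'_def X)
  qed (use S in \<open>auto simp: X\<close>)
  moreover have "rmod_iso R M X"
    unfolding rmod_iso_def
  proof (rule bexI)
    show "restrict F (carrier M) \<in> rhom R M X"
      by (auto simp: rhom_def X GF ract_closed)
    show "bij_betw (restrict F (carrier M)) (carrier M) (carrier X)"
      using \<open>inj_on F (carrier M)\<close> by (auto simp: bij_betw_def X inj_on_def)
  qed
  ultimately show ?thesis using rX by (auto simp: fg_mod_def)
qed

end

theory Submission
  imports Defs
begin

text \<open>
  Over a right artinian ring every finitely generated module has finite length (Hopkins--Levitzki),
  so it is a finite direct sum of indecomposables.  If \<^term>\<open>\<C>\<close> is closed under predecessors, a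
  finitely generated module lies in the additive closure of \<^term>\<open>\<C>\<close> iff every indecomposable with a
  non-zero map to it lies in \<^term>\<open>\<C>\<close>.  Hence the additive closure is closed under submodules and
  every indecomposable outside \<^term>\<open>\<C>\<close> has no non-zero map to it, which is a split torsion pair;
  exactness of the inclusion is closure under quotients.

  For the idempotents, write \<^term>\<open>e\<close> for the sum of \<^term>\<open>\<Sigma>\<close> and \<open>e' = 1 - e\<close>.  If \<open>e A e' = 0\<close>, the
  modules \<open>X\<close> with \<open>X e' = 0\<close> form a torsion-free class with torsion submodule \<open>X e' A\<close>.  Its part
  killed by \<open>e'\<close> is a finite sum of quotients of \<open>e' A e\<close>, so \<open>X e' A\<close> splits off when \<open>e' A e\<close> is
  hereditary injective, and in return splitting the torsion part of pushouts gives the extension of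
  homomorphisms into quotients of \<open>e' A e\<close>.  Conversely, a split torsion pair with torsion-free class
  closed under quotients determines \<open>\<Sigma>\<close> as the set of those \<open>e\<^sub>i\<close> for which \<open>e\<^sub>i A\<close> is torsion-free.
\<close>

section \<open>Linear maps and submodules\<close>

text \<open>The torsion-free class is pinned down by the projectives \<open>e_i R\<close>. For a
  vector x of a torsion-free module, x e_i is the image of e_i under a map from
  \<open>e_i R\<close>, so it vanishes whenever \<open>e_i R\<close> is torsion. Conversely, a
  non-zero torsion submodule of a supported module would have a non-zero cyclic quotient covered by
  a torsion-free \<open>e_i R\<close>; this is where closure under quotients enters. The condition
  \<open>e R e' = 0\<close> is the same vanishing, applied to the torsion-free \<open>e_i R\<close>
  themselves.

  Injectivity is asked for over the corner ring, while splittings take place over R; modules killed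
  by \<open>e'\<close> carry both structures on one record. In the pushout all of
  \<open>e' R / N\<close> is glued in and not only \<open>e' R e / N\<close>: its generator is fixed
  by \<open>e'\<close>, which makes the glued part torsion.

  Kernels and torsion parts must be finitely generated to be objects at all, which is why
  Hopkins-Levitzki is proved for submodules. Constructions are made on any carrier type and then
  replaced by isomorphic objects.\<close>

text \<open>Linear maps without the extensionality that is built into \<^const>\<open>rhom\<close>.\<close>

definition rlinear ::
    "('a, 'r) ring_scheme \<Rightarrow> ('a, 'm) rmodule \<Rightarrow> ('a, 'n) rmodule \<Rightarrow> ('m \<Rightarrow> 'n) \<Rightarrow> bool" where
  "rlinear R M N h \<longleftrightarrow> (\<forall>x\<in>carrier M. h x \<in> carrier N) \<and>
     (\<forall>x\<in>carrier M. \<forall>y\<in>carrier M. h (x \<oplus>\<^bsub>M\<^esub> y) = h x \<oplus>\<^bsub>N\<^esub> h y) \<and>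
     (\<forall>x\<in>carrier M. \<forall>a\<in>carrier R. h (x \<triangleleft>\<^bsub>M\<^esub> a) = h x \<triangleleft>\<^bsub>N\<^esub> a)"

lemma (in right_module) minus_ract:
  assumes "x \<in> carrier M" "a \<in> carrier R"
  shows "(\<ominus>\<^bsub>M\<^esub> x) \<triangleleft>\<^bsub>M\<^esub> a = \<ominus>\<^bsub>M\<^esub> (x \<triangleleft>\<^bsub>M\<^esub> a)"
proof -
  have "(\<ominus>\<^bsub>M\<^esub> x) \<triangleleft>\<^bsub>M\<^esub> a \<oplus>\<^bsub>M\<^esub> x \<triangleleft>\<^bsub>M\<^esub> a = \<zero>\<^bsub>M\<^esub>"
    using assms by (simp add: add_ract[symmetric] M.l_neg zero_ract)
  then show ?thesis using assms by (simp add: M.minus_equality ract_closed)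
qed

lemma (in right_module) diff_eq_zero_iff:
  assumes "x \<in> carrier M" "y \<in> carrier M"
  shows "x \<ominus>\<^bsub>M\<^esub> y = \<zero>\<^bsub>M\<^esub> \<longleftrightarrow> x = y"
proof
  assume "x \<ominus>\<^bsub>M\<^esub> y = \<zero>\<^bsub>M\<^esub>"
  then have "x = \<ominus>\<^bsub>M\<^esub> (\<ominus>\<^bsub>M\<^esub> y)"
    using assms M.minus_equality[of x "\<ominus>\<^bsub>M\<^esub> y"] by (simp add: a_minus_def)
  then show "x = y" using assms by simp
qed (use assms in \<open>simp add: a_minus_def M.r_neg\<close>)

lemma rlinearI:
  assumes "\<And>x. x \<in> carrier M \<Longrightarrow> h x \<in> carrier N"
    and "\<And>x y. x \<in> carrier M \<Longrightarrow> y \<in> carrier M \<Longrightarrow> h (x \<oplus>\<^bsub>M\<^esub> y) = h x \<oplus>\<^bsub>N\<^esub> h y"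
    and "\<And>x a. x \<in> carrier M \<Longrightarrow> a \<in> carrier R \<Longrightarrow> h (x \<triangleleft>\<^bsub>M\<^esub> a) = h x \<triangleleft>\<^bsub>N\<^esub> a"
  shows "rlinear R M N h"
  using assms by (simp add: rlinear_def)

lemma rlinearD:
  assumes "rlinear R M N h"
  shows "x \<in> carrier M \<Longrightarrow> h x \<in> carrier N"
    and "x \<in> carrier M \<Longrightarrow> y \<in> carrier M \<Longrightarrow> h (x \<oplus>\<^bsub>M\<^esub> y) = h x \<oplus>\<^bsub>N\<^esub> h y"
    and "x \<in> carrier M \<Longrightarrow> a \<in> carrier R \<Longrightarrow> h (x \<triangleleft>\<^bsub>M\<^esub> a) = h x \<triangleleft>\<^bsub>N\<^esub> a"
  using assms by (simp_all add: rlinear_def)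

lemma rhom_iff: "h \<in> rhom R M N \<longleftrightarrow> rlinear R M N h \<and> h \<in> extensional (carrier M)"
  by (auto simp: rhom_def rlinear_def PiE_def)

lemma rhom_rlinear: "h \<in> rhom R M N \<Longrightarrow> rlinear R M N h"
  by (simp add: rhom_iff)

lemma rhom_eqI:
  "\<lbrakk>f \<in> rhom R M N; g \<in> rhom R M N; \<And>x. x \<in> carrier M \<Longrightarrow> f x = g x\<rbrakk> \<Longrightarrow> f = g"
  by (auto simp: rhom_iff intro: extensionalityI)

lemma rlinear_cong:
  assumes "right_module R M" "rlinear R M N h" "\<And>x. x \<in> carrier M \<Longrightarrow> h x = h' x"
  shows "rlinear R M N h'"
proof -
  interpret right_module R M by fact
  show ?thesis using assms(2,3) ract_closed by (force simp: rlinear_def)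
qed

lemma restrict_rhom:
  assumes "right_module R M" "rlinear R M N h"
  shows "restrict h (carrier M) \<in> rhom R M N"
  using rlinear_cong[OF assms] by (simp add: rhom_iff)

lemma rlinear_comp:
  "\<lbrakk>rlinear R L M f; rlinear R M N g\<rbrakk> \<Longrightarrow> rlinear R L N (\<lambda>x. g (f x))"
  by (simp add: rlinear_def)

lemma compose_rhom:
  assumes "right_module R L" "f \<in> rhom R L M" "g \<in> rhom R M N"
  shows "compose (carrier L) g f \<in> rhom R L N"
  using restrict_rhom[OF assms(1) rlinear_comp[OF rhom_rlinear rhom_rlinear, OF assms(2,3)]]
  by (simp add: compose_def)

lemma rlinear_zero_map: "right_module R N \<Longrightarrow> rlinear R M N (\<lambda>x. \<zero>\<^bsub>N\<^esub>)"
proof -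
  assume "right_module R N"
  then interpret right_module R N .
  show ?thesis by (auto simp: rlinear_def zero_ract)
qed

lemma zero_hom_rhom: "right_module R M \<Longrightarrow> right_module R N \<Longrightarrow> zero_hom M N \<in> rhom R M N"
  unfolding zero_hom_def by (intro restrict_rhom rlinear_zero_map)

lemma rlinear_zero:
  assumes "right_module R M" "right_module R N" "rlinear R M N h"
  shows "h \<zero>\<^bsub>M\<^esub> = \<zero>\<^bsub>N\<^esub>"
proof -
  interpret M: right_module R M by fact
  interpret N: right_module R N by fact
  have "h \<zero>\<^bsub>M\<^esub> = h (\<zero>\<^bsub>M\<^esub> \<triangleleft>\<^bsub>M\<^esub> \<zero>\<^bsub>R\<^esub>)" by (simp add: M.zero_ract)
  also have "\<dots> = \<zero>\<^bsub>N\<^esub>" using rlinearD[OF assms(3)] by (simp add: N.ract_zero)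
  finally show ?thesis .
qed

lemma rlinear_minus:
  assumes "right_module R M" "right_module R N" "rlinear R M N h" "x \<in> carrier M"
  shows "h (\<ominus>\<^bsub>M\<^esub> x) = \<ominus>\<^bsub>N\<^esub> h x"
proof -
  interpret M: right_module R M by fact
  interpret N: right_module R N by fact
  have "h (\<ominus>\<^bsub>M\<^esub> x) = h (x \<triangleleft>\<^bsub>M\<^esub> (\<ominus>\<^bsub>R\<^esub> \<one>\<^bsub>R\<^esub>))" using assms(4) by (simp add: M.ract_minus M.ract_one)
  also have "\<dots> = \<ominus>\<^bsub>N\<^esub> h x" using assms(4) by (simp add: rlinearD[OF assms(3)] N.ract_minus N.ract_one)
  finally show ?thesis .
qed

lemma rlinear_diff:
  assumes "right_module R M" "right_module R N" "rlinear R M N h" "x \<in> carrier M" "y \<in> carrier M"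
  shows "h (x \<ominus>\<^bsub>M\<^esub> y) = h x \<ominus>\<^bsub>N\<^esub> h y"
proof -
  interpret M: right_module R M by fact
  interpret N: right_module R N by fact
  show ?thesis using assms(4,5)
    by (simp add: a_minus_def rlinearD[OF assms(3)] rlinear_minus[OF assms(1-3)])
qed

lemma rlinear_inj_iff:
  assumes "right_module R M" "right_module R N" "rlinear R M N h"
  shows "inj_on h (carrier M) \<longleftrightarrow> (\<forall>x\<in>carrier M. h x = \<zero>\<^bsub>N\<^esub> \<longrightarrow> x = \<zero>\<^bsub>M\<^esub>)"
proof -
  interpret M: right_module R M by fact
  interpret N: right_module R N by fact
  show ?thesis
  proof
    assume "inj_on h (carrier M)"
    then show "\<forall>x\<in>carrier M. h x = \<zero>\<^bsub>N\<^esub> \<longrightarrow> x = \<zero>\<^bsub>M\<^esub>"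
      using rlinear_zero[OF assms] by (metis M.zero_closed inj_onD)
  next
    assume *: "\<forall>x\<in>carrier M. h x = \<zero>\<^bsub>N\<^esub> \<longrightarrow> x = \<zero>\<^bsub>M\<^esub>"
    show "inj_on h (carrier M)"
    proof (rule inj_onI)
      fix x y assume xy: "x \<in> carrier M" "y \<in> carrier M" "h x = h y"
      have "h (x \<ominus>\<^bsub>M\<^esub> y) = \<zero>\<^bsub>N\<^esub>"
        unfolding rlinear_diff[OF assms xy(1,2)] using xy by (simp add: rlinearD[OF assms(3)] a_minus_def N.M.r_neg)
      moreover have "x \<ominus>\<^bsub>M\<^esub> y \<in> carrier M" using xy by (simp add: a_minus_def)
      ultimately have "x \<ominus>\<^bsub>M\<^esub> y = \<zero>\<^bsub>M\<^esub>" using * by blast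
      then show "x = y" using xy M.diff_eq_zero_iff by simp
    qed
  qed
qed

lemma rlinear_add_maps:
  assumes "right_module R N" "rlinear R M N f" "rlinear R M N g"
  shows "rlinear R M N (\<lambda>x. f x \<oplus>\<^bsub>N\<^esub> g x)"
proof -
  interpret right_module R N by fact
  show ?thesis using assms(2,3) by (auto simp: rlinear_def add_ract M.a_ac)
qed

lemma rlinear_minus_map:
  assumes "right_module R N" "rlinear R M N f"
  shows "rlinear R M N (\<lambda>x. \<ominus>\<^bsub>N\<^esub> f x)"
proof -
  interpret right_module R N by fact
  show ?thesis using assms(2) by (auto simp: rlinear_def M.minus_add minus_ract)
qed

text \<open>The inverse is kept as data: both directions are available as linear maps, symmetry is
  an exchange of arguments, and neither map has to be extensional.\<close>

definition iso_pair ::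
    "('a, 'r) ring_scheme \<Rightarrow> ('a, 'm) rmodule \<Rightarrow> ('a, 'n) rmodule \<Rightarrow> ('m \<Rightarrow> 'n) \<Rightarrow> ('n \<Rightarrow> 'm) \<Rightarrow> bool" where
  "iso_pair R M N f g \<longleftrightarrow> rlinear R M N f \<and> rlinear R N M g \<and>
     (\<forall>x\<in>carrier M. g (f x) = x) \<and> (\<forall>y\<in>carrier N. f (g y) = y)"

lemma iso_pairD:
  assumes "iso_pair R M N f g"
  shows "rlinear R M N f" "rlinear R N M g"
    "x \<in> carrier M \<Longrightarrow> g (f x) = x" "y \<in> carrier N \<Longrightarrow> f (g y) = y"
    "x \<in> carrier M \<Longrightarrow> f x \<in> carrier N" "y \<in> carrier N \<Longrightarrow> g y \<in> carrier M"
    "iso_pair R N M g f" "inj_on f (carrier M)" "f ` carrier M = carrier N"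
proof -
  show *: "rlinear R M N f" "rlinear R N M g" "iso_pair R N M g f"
    "x \<in> carrier M \<Longrightarrow> g (f x) = x" "y \<in> carrier N \<Longrightarrow> f (g y) = y"
    using assms by (simp_all add: iso_pair_def)
  show "x \<in> carrier M \<Longrightarrow> f x \<in> carrier N" by (rule rlinearD(1)[OF *(1)])
  show "y \<in> carrier N \<Longrightarrow> g y \<in> carrier M" by (rule rlinearD(1)[OF *(2)])
  show "inj_on f (carrier M)" using assms unfolding iso_pair_def by (metis inj_on_inverseI)
  show "f ` carrier M = carrier N"
  proof
    show "f ` carrier M \<subseteq> carrier N" using rlinearD(1)[OF *(1)] by blast
    show "carrier N \<subseteq> f ` carrier M"
    proof
      fix y assume "y \<in> carrier N"
      then have "g y \<in> carrier M" "y = f (g y)"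
        using assms rlinearD(1)[OF *(2)] by (simp_all add: iso_pair_def)
      then show "y \<in> f ` carrier M" by blast
    qed
  qed
qed

lemma iso_pair_inv_into:
  assumes "right_module R M" "rlinear R M N h" "bij_betw h (carrier M) (carrier N)"
  shows "iso_pair R M N h (inv_into (carrier M) h)"
proof -
  interpret M: right_module R M by fact
  let ?g = "inv_into (carrier M) h"
  have g: "?g y \<in> carrier M" "h (?g y) = y" if "y \<in> carrier N" for y
    using assms(3) that by (auto simp: bij_betw_def inv_into_into f_inv_into_f)
  have gh: "?g (h x) = x" if "x \<in> carrier M" for x
    using assms(3) that by (auto simp: bij_betw_def)
  have "rlinear R N M ?g"
  proof (rule rlinearI)
    show "?g (x \<oplus>\<^bsub>N\<^esub> y) = ?g x \<oplus>\<^bsub>M\<^esub> ?g y" if "x \<in> carrier N" "y \<in> carrier N" for x y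
      using gh[of "?g x \<oplus>\<^bsub>M\<^esub> ?g y"] g that by (simp add: rlinearD[OF assms(2)])
    show "?g (x \<triangleleft>\<^bsub>N\<^esub> a) = ?g x \<triangleleft>\<^bsub>M\<^esub> a" if "x \<in> carrier N" "a \<in> carrier R" for x a
      using gh[of "?g x \<triangleleft>\<^bsub>M\<^esub> a"] g that by (simp add: rlinearD[OF assms(2)] M.ract_closed)
  qed (rule g(1))
  then show ?thesis using assms(2) g gh by (simp add: iso_pair_def)
qed

lemma rmod_iso_iff:
  assumes "right_module R M"
  shows "rmod_iso R M N \<longleftrightarrow> (\<exists>f g. iso_pair R M N f g)"
proof
  assume "rmod_iso R M N"
  then show "\<exists>f g. iso_pair R M N f g"
    using iso_pair_inv_into[OF assms] rhom_rlinear unfolding rmod_iso_def by blast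
next
  assume "\<exists>f g. iso_pair R M N f g"
  then obtain f g where fg: "iso_pair R M N f g" by blast
  have "bij_betw (restrict f (carrier M)) (carrier M) (carrier N)"
    using iso_pairD(8,9)[OF fg] by (simp add: bij_betw_def)
  then show "rmod_iso R M N"
    using restrict_rhom[OF assms iso_pairD(1)[OF fg]] unfolding rmod_iso_def by blast
qed

lemma rmod_iso_bij:
  assumes "right_module R M" "rlinear R M N h" "inj_on h (carrier M)" "h ` carrier M = carrier N"
  shows "rmod_iso R M N"
  unfolding rmod_iso_iff[OF assms(1)]
  using iso_pair_inv_into[OF assms(1,2)] assms(3,4) by (auto simp: bij_betw_def)

lemma iso_pair_comp:
  assumes "iso_pair R L M f g" "iso_pair R M N f' g'"
  shows "iso_pair R L N (\<lambda>x. f' (f x)) (\<lambda>x. g (g' x))"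
  unfolding iso_pair_def
  using rlinear_comp[OF iso_pairD(1) iso_pairD(1), OF assms]
    rlinear_comp[OF iso_pairD(2) iso_pairD(2), OF assms(2,1)]
    iso_pairD(3-6)[OF assms(1)] iso_pairD(3-6)[OF assms(2)] by simp

lemma rmod_iso_trans:
  "\<lbrakk>right_module R L; right_module R M; rmod_iso R L M; rmod_iso R M N\<rbrakk> \<Longrightarrow> rmod_iso R L N"
  using iso_pair_comp by (metis rmod_iso_iff)

section \<open>Submodules, sums and spans\<close>

context right_module
begin

text \<open>Closure under negation comes from the action of -1.\<close>

lemma submodule_iff:
  "right_submodule R M N \<longleftrightarrow> N \<subseteq> carrier M \<and> \<zero>\<^bsub>M\<^esub> \<in> N \<and>
     (\<forall>x\<in>N. \<forall>y\<in>N. x \<oplus>\<^bsub>M\<^esub> y \<in> N) \<and> (\<forall>x\<in>N. \<forall>a\<in>carrier R. x \<triangleleft>\<^bsub>M\<^esub> a \<in> N)"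
proof
  assume N: "right_submodule R M N"
  then interpret N: additive_subgroup N M by (simp add: right_submodule_def)
  show "N \<subseteq> carrier M \<and> \<zero>\<^bsub>M\<^esub> \<in> N \<and>
     (\<forall>x\<in>N. \<forall>y\<in>N. x \<oplus>\<^bsub>M\<^esub> y \<in> N) \<and> (\<forall>x\<in>N. \<forall>a\<in>carrier R. x \<triangleleft>\<^bsub>M\<^esub> a \<in> N)"
    using N N.a_subset by (auto simp: right_submodule_def)
next
  assume N: "N \<subseteq> carrier M \<and> \<zero>\<^bsub>M\<^esub> \<in> N \<and>
     (\<forall>x\<in>N. \<forall>y\<in>N. x \<oplus>\<^bsub>M\<^esub> y \<in> N) \<and> (\<forall>x\<in>N. \<forall>a\<in>carrier R. x \<triangleleft>\<^bsub>M\<^esub> a \<in> N)"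
  have "\<ominus>\<^bsub>M\<^esub> x \<in> N" if "x \<in> N" for x
  proof -
    have "\<ominus>\<^bsub>M\<^esub> x = x \<triangleleft>\<^bsub>M\<^esub> (\<ominus>\<^bsub>R\<^esub> \<one>\<^bsub>R\<^esub>)" using that N by (auto simp: ract_minus ract_one)
    then show ?thesis using that N by simp
  qed
  then have "additive_subgroup N M"
    using N by (intro additive_subgroup.intro M.add.subgroupI) auto
  then show "right_submodule R M N" using N by (simp add: right_submodule_def)
qed

lemma submoduleI:
  assumes "N \<subseteq> carrier M" "\<zero>\<^bsub>M\<^esub> \<in> N" "\<And>x y. x \<in> N \<Longrightarrow> y \<in> N \<Longrightarrow> x \<oplus>\<^bsub>M\<^esub> y \<in> N"
    "\<And>x a. x \<in> N \<Longrightarrow> a \<in> carrier R \<Longrightarrow> x \<triangleleft>\<^bsub>M\<^esub> a \<in> N"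
  shows "right_submodule R M N"
  using assms by (simp add: submodule_iff)

lemma submoduleD:
  assumes "right_submodule R M N"
  shows "N \<subseteq> carrier M" "\<zero>\<^bsub>M\<^esub> \<in> N" "x \<in> N \<Longrightarrow> x \<in> carrier M"
    "x \<in> N \<Longrightarrow> y \<in> N \<Longrightarrow> x \<oplus>\<^bsub>M\<^esub> y \<in> N" "x \<in> N \<Longrightarrow> a \<in> carrier R \<Longrightarrow> x \<triangleleft>\<^bsub>M\<^esub> a \<in> N"
    "x \<in> N \<Longrightarrow> \<ominus>\<^bsub>M\<^esub> x \<in> N" "x \<in> N \<Longrightarrow> y \<in> N \<Longrightarrow> x \<ominus>\<^bsub>M\<^esub> y \<in> N"
proof -
  interpret N: additive_subgroup N M using assms by (simp add: right_submodule_def)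
  show "x \<in> N \<Longrightarrow> \<ominus>\<^bsub>M\<^esub> x \<in> N" by (rule N.a_inv_closed)
  then show "x \<in> N \<Longrightarrow> y \<in> N \<Longrightarrow> x \<ominus>\<^bsub>M\<^esub> y \<in> N"
    by (simp add: a_minus_def N.a_closed N.a_inv_closed)
qed (use assms submodule_iff in auto)

lemma carrier_submodule: "right_submodule R M (carrier M)"
  by (auto simp: submodule_iff ract_closed)

lemma zero_submodule: "right_submodule R M {\<zero>\<^bsub>M\<^esub>}"
  by (auto simp: submodule_iff zero_ract)

lemma Int_submodule:
  "right_submodule R M N \<Longrightarrow> right_submodule R M L \<Longrightarrow> right_submodule R M (N \<inter> L)"
  by (auto simp: submodule_iff)

lemma Inter_submodule:
  "\<N> \<noteq> {} \<Longrightarrow> (\<And>N. N \<in> \<N> \<Longrightarrow> right_submodule R M N) \<Longrightarrow> right_submodule R M (\<Inter>\<N>)"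
  unfolding submodule_iff by blast

lemma set_add_iff: "z \<in> N <+>\<^bsub>M\<^esub> L \<longleftrightarrow> (\<exists>x\<in>N. \<exists>y\<in>L. z = x \<oplus>\<^bsub>M\<^esub> y)"
  by (auto simp: set_add_def set_mult_def)

lemma set_add_submodule:
  assumes N: "right_submodule R M N" and L: "right_submodule R M L"
  shows "right_submodule R M (N <+>\<^bsub>M\<^esub> L)"
proof (rule submoduleI)
  note simps = submoduleD[OF N] submoduleD[OF L]
  show "N <+>\<^bsub>M\<^esub> L \<subseteq> carrier M" using simps by (auto simp: set_add_iff)
  show "\<zero>\<^bsub>M\<^esub> \<in> N <+>\<^bsub>M\<^esub> L" unfolding set_add_iff using simps(2) submoduleD(2)[OF L]
    by (intro bexI[of _ "\<zero>\<^bsub>M\<^esub>"]) simp_all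
  fix x y assume "x \<in> N <+>\<^bsub>M\<^esub> L" "y \<in> N <+>\<^bsub>M\<^esub> L"
  then obtain a b c d where *: "a \<in> N" "b \<in> L" "c \<in> N" "d \<in> L" "x = a \<oplus>\<^bsub>M\<^esub> b" "y = c \<oplus>\<^bsub>M\<^esub> d"
    unfolding set_add_iff by blast
  then have "x \<oplus>\<^bsub>M\<^esub> y = (a \<oplus>\<^bsub>M\<^esub> c) \<oplus>\<^bsub>M\<^esub> (b \<oplus>\<^bsub>M\<^esub> d)"
    by (simp add: simps M.a_ac)
  with * show "x \<oplus>\<^bsub>M\<^esub> y \<in> N <+>\<^bsub>M\<^esub> L"
    unfolding set_add_iff using submoduleD(4)[OF N] submoduleD(4)[OF L] by blast
next
  fix x a assume "x \<in> N <+>\<^bsub>M\<^esub> L" and a: "a \<in> carrier R"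
  then obtain b c where *: "b \<in> N" "c \<in> L" "x = b \<oplus>\<^bsub>M\<^esub> c" unfolding set_add_iff by blast
  then have "x \<triangleleft>\<^bsub>M\<^esub> a = b \<triangleleft>\<^bsub>M\<^esub> a \<oplus>\<^bsub>M\<^esub> c \<triangleleft>\<^bsub>M\<^esub> a"
    using a by (simp add: submoduleD(3)[OF N] submoduleD(3)[OF L] add_ract)
  with * a show "x \<triangleleft>\<^bsub>M\<^esub> a \<in> N <+>\<^bsub>M\<^esub> L"
    unfolding set_add_iff using submoduleD(5)[OF N] submoduleD(5)[OF L] by blast
qed

lemma set_add_least:
  "\<lbrakk>right_submodule R M P; N \<subseteq> P; L \<subseteq> P\<rbrakk> \<Longrightarrow> N <+>\<^bsub>M\<^esub> L \<subseteq> P"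
  unfolding subset_iff set_add_iff using submoduleD(4)[of P] by blast

lemma set_add_upper:
  assumes N: "right_submodule R M N" and L: "right_submodule R M L"
  shows "N \<subseteq> N <+>\<^bsub>M\<^esub> L" "L \<subseteq> N <+>\<^bsub>M\<^esub> L"
proof -
  note simps = submoduleD[OF N] submoduleD[OF L]
  show "N \<subseteq> N <+>\<^bsub>M\<^esub> L"
  proof
    fix x assume "x \<in> N"
    then have "x = x \<oplus>\<^bsub>M\<^esub> \<zero>\<^bsub>M\<^esub>" "\<zero>\<^bsub>M\<^esub> \<in> L" using simps by auto
    then show "x \<in> N <+>\<^bsub>M\<^esub> L" using \<open>x \<in> N\<close> set_add_iff by blast
  qed
  show "L \<subseteq> N <+>\<^bsub>M\<^esub> L"
  proof
    fix x assume "x \<in> L"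
    then have "x = \<zero>\<^bsub>M\<^esub> \<oplus>\<^bsub>M\<^esub> x" "\<zero>\<^bsub>M\<^esub> \<in> N" using simps by auto
    then show "x \<in> N <+>\<^bsub>M\<^esub> L" using \<open>x \<in> L\<close> set_add_iff by blast
  qed
qed

lemma restrict_module:
  assumes N: "right_submodule R M N"
  shows "right_module R (M\<lparr>carrier := N\<rparr>)"
proof -
  note simps = submoduleD[OF N]
  interpret N: abelian_group "M\<lparr>carrier := N\<rparr>"
  proof (rule abelian_groupI)
    fix x assume x: "x \<in> carrier (M\<lparr>carrier := N\<rparr>)"
    then have "\<ominus>\<^bsub>M\<^esub> x \<in> carrier (M\<lparr>carrier := N\<rparr>)"
      "\<ominus>\<^bsub>M\<^esub> x \<oplus>\<^bsub>M\<lparr>carrier := N\<rparr>\<^esub> x = \<zero>\<^bsub>M\<lparr>carrier := N\<rparr>\<^esub>"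
      using simps by (auto simp: M.l_neg)
    then show "\<exists>y\<in>carrier (M\<lparr>carrier := N\<rparr>). y \<oplus>\<^bsub>M\<lparr>carrier := N\<rparr>\<^esub> x = \<zero>\<^bsub>M\<lparr>carrier := N\<rparr>\<^esub>" by blast
  qed (use simps in \<open>auto simp: M.a_ac\<close>)
  show ?thesis
    by unfold_locales (use simps in \<open>auto simp: ract_add add_ract ract_mult ract_one\<close>)
qed

lemma submodule_restrict_iff:
  assumes N: "right_submodule R M N"
  shows "right_submodule R (M\<lparr>carrier := N\<rparr>) L \<longleftrightarrow> right_submodule R M L \<and> L \<subseteq> N"
  using submoduleD(1)[OF N] right_module.submodule_iff[OF restrict_module[OF N], of L] submodule_iff[of L]
  by auto

end

text \<open>If S leaves the carrier, no submodule contains it and the empty intersection is the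
  whole type; hence the inclusion assumed in \<open>rspan_submodule\<close> and its
  consequences.\<close>

definition rspan :: "('a, 'r) ring_scheme \<Rightarrow> ('a, 'm) rmodule \<Rightarrow> 'm set \<Rightarrow> 'm set" where
  "rspan R M S = \<Inter>{N. right_submodule R M N \<and> S \<subseteq> N}"

lemma rspan_superset: "S \<subseteq> rspan R M S"
  by (auto simp: rspan_def)

lemma rspan_least: "right_submodule R M N \<Longrightarrow> S \<subseteq> N \<Longrightarrow> rspan R M S \<subseteq> N"
  by (auto simp: rspan_def)

lemma rspan_mono: "S \<subseteq> T \<Longrightarrow> rspan R M S \<subseteq> rspan R M T"
  by (auto simp: rspan_def)

context right_module
begin

lemma rspan_submodule: "S \<subseteq> carrier M \<Longrightarrow> right_submodule R M (rspan R M S)"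
  unfolding rspan_def using carrier_submodule by (intro Inter_submodule) auto

lemma cyclic_submodule:
  assumes "x \<in> carrier M"
  shows "right_submodule R M ((\<lambda>a. x \<triangleleft>\<^bsub>M\<^esub> a) ` carrier R)"
proof (rule submoduleI)
  show "\<zero>\<^bsub>M\<^esub> \<in> (\<lambda>a. x \<triangleleft>\<^bsub>M\<^esub> a) ` carrier R"
    using ract_zero[OF assms] by (metis R.zero_closed image_eqI)
  fix y assume "y \<in> (\<lambda>a. x \<triangleleft>\<^bsub>M\<^esub> a) ` carrier R"
  then obtain a where a: "y = x \<triangleleft>\<^bsub>M\<^esub> a" "a \<in> carrier R" by blast
  show "y \<triangleleft>\<^bsub>M\<^esub> b \<in> (\<lambda>a. x \<triangleleft>\<^bsub>M\<^esub> a) ` carrier R" if "b \<in> carrier R" for b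
    using a that assms by (auto simp: ract_mult[symmetric])
  fix z assume "z \<in> (\<lambda>a. x \<triangleleft>\<^bsub>M\<^esub> a) ` carrier R"
  then show "y \<oplus>\<^bsub>M\<^esub> z \<in> (\<lambda>a. x \<triangleleft>\<^bsub>M\<^esub> a) ` carrier R"
    using a assms by (auto simp: ract_add[symmetric])
qed (use assms in \<open>auto simp: ract_closed\<close>)

lemma cyclic_subset:
  assumes "right_submodule R M N" "x \<in> N"
  shows "(\<lambda>a. x \<triangleleft>\<^bsub>M\<^esub> a) ` carrier R \<subseteq> N"
  using submoduleD(5)[OF assms] by blast

lemma cyclic_self: "x \<in> carrier M \<Longrightarrow> x \<in> (\<lambda>a. x \<triangleleft>\<^bsub>M\<^esub> a) ` carrier R"
  using ract_one by (metis R.one_closed image_eqI)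

lemma rspan_insert:
  assumes "S \<subseteq> carrier M" "x \<in> carrier M"
  shows "rspan R M (insert x S) = rspan R M S <+>\<^bsub>M\<^esub> (\<lambda>a. x \<triangleleft>\<^bsub>M\<^esub> a) ` carrier R"
proof
  note sub = rspan_submodule[OF assms(1)] cyclic_submodule[OF assms(2)]
  have "insert x S \<subseteq> rspan R M S <+>\<^bsub>M\<^esub> (\<lambda>a. x \<triangleleft>\<^bsub>M\<^esub> a) ` carrier R"
    using set_add_upper[OF sub] rspan_superset[of S R M] cyclic_self[OF assms(2)] by auto
  then show "rspan R M (insert x S) \<subseteq> rspan R M S <+>\<^bsub>M\<^esub> (\<lambda>a. x \<triangleleft>\<^bsub>M\<^esub> a) ` carrier R"
    by (rule rspan_least[OF set_add_submodule[OF sub]])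
  have *: "right_submodule R M (rspan R M (insert x S))" using assms by (intro rspan_submodule) auto
  show "rspan R M S <+>\<^bsub>M\<^esub> (\<lambda>a. x \<triangleleft>\<^bsub>M\<^esub> a) ` carrier R \<subseteq> rspan R M (insert x S)"
    using rspan_superset[of "insert x S" R M]
    by (intro set_add_least[OF *] cyclic_subset[OF *] rspan_mono) auto
qed

lemma rspan_Un:
  assumes "S \<subseteq> carrier M" "T \<subseteq> carrier M"
  shows "rspan R M (S \<union> T) = rspan R M S <+>\<^bsub>M\<^esub> rspan R M T"
proof
  note sub = assms[THEN rspan_submodule]
  have "S \<union> T \<subseteq> rspan R M S <+>\<^bsub>M\<^esub> rspan R M T"
    using set_add_upper[OF sub] rspan_superset[of _ R M] by blast
  then show "rspan R M (S \<union> T) \<subseteq> rspan R M S <+>\<^bsub>M\<^esub> rspan R M T"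
    by (rule rspan_least[OF set_add_submodule[OF sub]])
  have "right_submodule R M (rspan R M (S \<union> T))" using assms by (intro rspan_submodule) auto
  moreover have "rspan R M S \<subseteq> rspan R M (S \<union> T)" "rspan R M T \<subseteq> rspan R M (S \<union> T)"
    by (simp_all add: rspan_mono)
  ultimately show "rspan R M S <+>\<^bsub>M\<^esub> rspan R M T \<subseteq> rspan R M (S \<union> T)"
    by (rule set_add_least)
qed

lemma rspan_empty: "rspan R M {} = {\<zero>\<^bsub>M\<^esub>}"
  using rspan_least[OF zero_submodule, of "{}"] submoduleD(2)[OF rspan_submodule[of "{}"]] by auto

lemma rspan_restrict:
  assumes N: "right_submodule R M N" and "S \<subseteq> N"
  shows "rspan R (M\<lparr>carrier := N\<rparr>) S = rspan R M S"
proof -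
  show ?thesis
  proof
    show "rspan R (M\<lparr>carrier := N\<rparr>) S \<subseteq> rspan R M S"
    proof (unfold rspan_def, rule Inter_greatest)
      fix L assume "L \<in> {L. right_submodule R M L \<and> S \<subseteq> L}"
      then have "L \<inter> N \<in> {L. right_submodule R (M\<lparr>carrier := N\<rparr>) L \<and> S \<subseteq> L}"
        using assms by (auto simp: Int_submodule submodule_restrict_iff[OF N])
      then show "\<Inter> {L. right_submodule R (M\<lparr>carrier := N\<rparr>) L \<and> S \<subseteq> L} \<subseteq> L" by blast
    qed
    show "rspan R M S \<subseteq> rspan R (M\<lparr>carrier := N\<rparr>) S"
      unfolding rspan_def submodule_restrict_iff[OF N] by blast
  qed
qed

lemma fin_gen_iff: "fin_gen R M \<longleftrightarrow> (\<exists>S. finite S \<and> S \<subseteq> carrier M \<and> rspan R M S = carrier M)"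
proof -
  have "(\<forall>N. right_submodule R M N \<and> S \<subseteq> N \<longrightarrow> N = carrier M) \<longleftrightarrow> rspan R M S = carrier M"
    if "S \<subseteq> carrier M" for S
  proof
    assume "\<forall>N. right_submodule R M N \<and> S \<subseteq> N \<longrightarrow> N = carrier M"
    then show "rspan R M S = carrier M"
      using rspan_submodule[OF that] rspan_superset[of S R M] by simp
  next
    assume *: "rspan R M S = carrier M"
    show "\<forall>N. right_submodule R M N \<and> S \<subseteq> N \<longrightarrow> N = carrier M"
      using rspan_least[of R M _ S] * by (simp add: submoduleD(1) subset_antisym)
  qed
  then show ?thesis unfolding fin_gen_def by (simp cong: conj_cong)
qed

text \<open>Moves finite generation of a submodule into the ambient module, where generators can be
  added one at a time with \<open>rspan_insert\<close>.\<close>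

lemma fin_gen_restrict_iff:
  assumes N: "right_submodule R M N"
  shows "fin_gen R (M\<lparr>carrier := N\<rparr>) \<longleftrightarrow> (\<exists>S. finite S \<and> S \<subseteq> carrier M \<and> rspan R M S = N)"
proof -
  have "fin_gen R (M\<lparr>carrier := N\<rparr>) \<longleftrightarrow> (\<exists>S. finite S \<and> S \<subseteq> N \<and> rspan R (M\<lparr>carrier := N\<rparr>) S = N)"
    using right_module.fin_gen_iff[OF restrict_module[OF N]] by simp
  also have "\<dots> \<longleftrightarrow> (\<exists>S. finite S \<and> S \<subseteq> N \<and> rspan R M S = N)"
    using rspan_restrict[OF N] by auto
  also have "\<dots> \<longleftrightarrow> (\<exists>S. finite S \<and> S \<subseteq> carrier M \<and> rspan R M S = N)"
    using submoduleD(1)[OF N] rspan_superset[of _ R M] by (metis subset_trans)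
  finally show ?thesis .
qed

end

section \<open>Restriction, images and preimages under linear maps\<close>

lemma rlinear_restrict:
  "\<lbrakk>rlinear R M N h; L \<subseteq> carrier M\<rbrakk> \<Longrightarrow> rlinear R (M\<lparr>carrier := L\<rparr>) N h"
  unfolding rlinear_def subset_iff by simp

lemma rlinear_restrict_range:
  "\<lbrakk>rlinear R M N h; h ` carrier M \<subseteq> L\<rbrakk> \<Longrightarrow> rlinear R M (N\<lparr>carrier := L\<rparr>) h"
  by (auto simp: rlinear_def)

lemma rlinear_expand_range:
  "\<lbrakk>rlinear R M (N\<lparr>carrier := L\<rparr>) h; L \<subseteq> carrier N\<rbrakk> \<Longrightarrow> rlinear R M N h"
  by (auto simp: rlinear_def)

lemma rlinear_id: "rlinear R M M (\<lambda>x. x)"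
  by (simp add: rlinear_def)

lemma image_submodule:
  assumes "right_module R M" "right_module R N" "rlinear R M N h" "right_submodule R M L"
  shows "right_submodule R N (h ` L)"
proof -
  interpret M: right_module R M by fact
  interpret N: right_module R N by fact
  note L = M.submoduleD[OF assms(4)]
  show ?thesis
  proof (rule N.submoduleI)
    show "h ` L \<subseteq> carrier N" using L rlinearD(1)[OF assms(3)] by auto
    show "\<zero>\<^bsub>N\<^esub> \<in> h ` L" using L(2) rlinear_zero[OF assms(1-3)] by (metis image_eqI)
  next
    fix x y assume "x \<in> h ` L" "y \<in> h ` L"
    then show "x \<oplus>\<^bsub>N\<^esub> y \<in> h ` L"
      using L by (auto simp: rlinearD(2)[OF assms(3), symmetric])
  next
    fix x a assume "x \<in> h ` L" "a \<in> carrier R"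
    then show "x \<triangleleft>\<^bsub>N\<^esub> a \<in> h ` L"
      using L by (auto simp: rlinearD(3)[OF assms(3), symmetric])
  qed
qed

lemma range_submodule:
  assumes "right_module R M" "right_module R N" "rlinear R M N h"
  shows "right_submodule R N (h ` carrier M)"
  by (rule image_submodule[OF assms right_module.carrier_submodule[OF assms(1)]])

lemma preimage_submodule:
  assumes "right_module R M" "right_module R N" "rlinear R M N h" "right_submodule R N L"
  shows "right_submodule R M {x \<in> carrier M. h x \<in> L}"
proof -
  interpret M: right_module R M by fact
  interpret N: right_module R N by fact
  note L = N.submoduleD[OF assms(4)]
  show ?thesis
    by (rule M.submoduleI) (use L in \<open>auto simp: rlinearD[OF assms(3)] rlinear_zero[OF assms(1-3)] M.ract_closed\<close>)
qed

lemma kernel_submodule: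
  assumes "right_module R M" "right_module R N" "rlinear R M N h"
  shows "right_submodule R M {x \<in> carrier M. h x = \<zero>\<^bsub>N\<^esub>}"
  using preimage_submodule[OF assms right_module.zero_submodule[OF assms(2)]] by simp

lemma rspan_image:
  assumes "right_module R M" "right_module R N" "rlinear R M N h" "S \<subseteq> carrier M"
  shows "rspan R N (h ` S) = h ` rspan R M S"
proof
  interpret M: right_module R M by fact
  interpret N: right_module R N by fact
  have sub: "right_submodule R M (rspan R M S)" by (rule M.rspan_submodule[OF assms(4)])
  show "rspan R N (h ` S) \<subseteq> h ` rspan R M S"
    by (intro rspan_least image_submodule[OF assms(1-3) sub] image_mono rspan_superset)
  have "h ` S \<subseteq> carrier N" using assms(4) rlinearD(1)[OF assms(3)] by auto
  then have "right_submodule R N (rspan R N (h ` S))" by (rule N.rspan_submodule)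
  from preimage_submodule[OF assms(1-3) this]
  have "rspan R M S \<subseteq> {x \<in> carrier M. h x \<in> rspan R N (h ` S)}"
    by (rule rspan_least) (use assms(4) rspan_superset[of "h ` S" R N] in auto)
  then show "h ` rspan R M S \<subseteq> rspan R N (h ` S)" by auto
qed

lemma fin_gen_image:
  assumes "right_module R M" "right_module R N" "rlinear R M N h" "h ` carrier M = carrier N"
    and "fin_gen R M"
  shows "fin_gen R N"
proof -
  obtain S where S: "finite S" "S \<subseteq> carrier M" "rspan R M S = carrier M"
    using assms(5) unfolding right_module.fin_gen_iff[OF assms(1)] by blast
  then have "rspan R N (h ` S) = carrier N"
    using rspan_image[OF assms(1-3)] assms(4) by simp
  moreover have "h ` S \<subseteq> carrier N" "finite (h ` S)" using S(1,2) assms(4) by auto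
  ultimately show ?thesis unfolding right_module.fin_gen_iff[OF assms(2)] by blast
qed

lemma fg_modD: "X \<in> fg_mod R \<Longrightarrow> right_module R X" "X \<in> fg_mod R \<Longrightarrow> fin_gen R X"
  by (simp_all add: fg_mod_def)

lemma fg_rep:
  assumes "right_module R M" "fin_gen R M"
  obtains X f g where "X \<in> fg_mod R" "iso_pair R M X f g"
  using fg_mod_representative[OF assms] rmod_iso_iff[OF assms(1)] by blast

text \<open>M may live on any carrier type. Its submodule is represented by an object of
  \<open>fg_mod\<close> together with an embedding, the form in which subobjects enter the
  categorical statements.\<close>

lemma restrict_fg_rep:
  assumes "right_module R M" "right_submodule R M N" "fin_gen R (M\<lparr>carrier := N\<rparr>)"
  obtains X k where "X \<in> fg_mod R" "rlinear R X M k" "inj_on k (carrier X)" "k ` carrier X = N"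
    "rmod_iso R (M\<lparr>carrier := N\<rparr>) X"
proof -
  interpret right_module R M by fact
  note N = restrict_module[OF assms(2)]
  obtain X f g where X: "X \<in> fg_mod R" "iso_pair R (M\<lparr>carrier := N\<rparr>) X f g"
    by (rule fg_rep[OF N assms(3)])
  note D = iso_pairD[OF iso_pairD(7)[OF X(2)]]
  show thesis
  proof (rule that)
    show "rlinear R X M g" using D(1) submoduleD(1)[OF assms(2)] by (rule rlinear_expand_range)
    show "rmod_iso R (M\<lparr>carrier := N\<rparr>) X" using X(2) rmod_iso_iff[OF N] by blast
  qed (use X D in simp_all)
qed

section \<open>Quotients and products\<close>

context right_module
begin

context
  fixes N assumes N: "right_submodule R M N"
begin

interpretation N: abelian_subgroup N M
  using N M.abelian_group_axioms by (intro abelian_subgroupI3) (simp_all add: right_submodule_def)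

lemma coset_eq_iff:
  assumes "x \<in> carrier M" "y \<in> carrier M"
  shows "N +>\<^bsub>M\<^esub> x = N +>\<^bsub>M\<^esub> y \<longleftrightarrow> x \<ominus>\<^bsub>M\<^esub> y \<in> N"
proof -
  have "N +>\<^bsub>M\<^esub> x = N +>\<^bsub>M\<^esub> y \<longleftrightarrow> x \<in> N +>\<^bsub>M\<^esub> y"
    using N.a_rcos_self[OF assms(1)] N.a_repr_independence' assms by metis
  then show ?thesis using N.a_rcos_module[OF assms(2,1)] by (simp add: a_minus_def)
qed

lemma coset_self: "x \<in> carrier M \<Longrightarrow> x \<in> N +>\<^bsub>M\<^esub> x"
  by (rule N.a_rcos_self)

lemma coset_zero: "N +>\<^bsub>M\<^esub> \<zero>\<^bsub>M\<^esub> = N"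
  using submoduleD(1)[OF N] by simp

text \<open>The union in \<open>quot_rmod\<close> runs over all representatives y of the coset; y a
  - x a = (y - x) a lies in N, so its members coincide.\<close>

lemma coset_ract:
  assumes "x \<in> carrier M" "a \<in> carrier R"
  shows "(N +>\<^bsub>M\<^esub> x) \<triangleleft>\<^bsub>quot_rmod M N\<^esub> a = N +>\<^bsub>M\<^esub> (x \<triangleleft>\<^bsub>M\<^esub> a)"
proof -
  have "N +>\<^bsub>M\<^esub> (y \<triangleleft>\<^bsub>M\<^esub> a) = N +>\<^bsub>M\<^esub> (x \<triangleleft>\<^bsub>M\<^esub> a)" if "y \<in> N +>\<^bsub>M\<^esub> x" for y
  proof -
    have y: "y \<in> carrier M" using that assms(1) N.a_elemrcos_carrier by blast
    have "y \<ominus>\<^bsub>M\<^esub> x \<in> N" using that N.a_repr_independence'[OF that assms(1)] coset_eq_iff[OF y assms(1)] by simp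
    then have "(y \<ominus>\<^bsub>M\<^esub> x) \<triangleleft>\<^bsub>M\<^esub> a \<in> N" using N assms by (simp add: submodule_iff)
    moreover have "(y \<ominus>\<^bsub>M\<^esub> x) \<triangleleft>\<^bsub>M\<^esub> a = y \<triangleleft>\<^bsub>M\<^esub> a \<ominus>\<^bsub>M\<^esub> x \<triangleleft>\<^bsub>M\<^esub> a"
      using y assms by (simp add: a_minus_def add_ract minus_ract)
    ultimately show ?thesis using assms y by (simp add: coset_eq_iff ract_closed)
  qed
  then have "(\<Union>y\<in>N +>\<^bsub>M\<^esub> x. N +>\<^bsub>M\<^esub> (y \<triangleleft>\<^bsub>M\<^esub> a)) = (\<Union>y\<in>N +>\<^bsub>M\<^esub> x. N +>\<^bsub>M\<^esub> (x \<triangleleft>\<^bsub>M\<^esub> a))"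
    by (intro SUP_cong) simp_all
  also have "\<dots> = N +>\<^bsub>M\<^esub> (x \<triangleleft>\<^bsub>M\<^esub> a)" using coset_self[OF assms(1)] by blast
  finally show ?thesis by (simp add: quot_rmod_def)
qed

lemma coset_add:
  assumes "x \<in> carrier M" "y \<in> carrier M"
  shows "(N +>\<^bsub>M\<^esub> x) \<oplus>\<^bsub>quot_rmod M N\<^esub> (N +>\<^bsub>M\<^esub> y) = N +>\<^bsub>M\<^esub> (x \<oplus>\<^bsub>M\<^esub> y)"
  using N.a_rcos_sum[OF assms] by (simp add: quot_rmod_def)

lemma quot_carrier: "carrier (quot_rmod M N) = (\<lambda>x. N +>\<^bsub>M\<^esub> x) ` carrier M"
  by (auto simp: quot_rmod_def A_RCOSETS_def RCOSETS_def a_r_coset_def)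

lemma quot_zero: "\<zero>\<^bsub>quot_rmod M N\<^esub> = N"
  by (simp add: quot_rmod_def)

lemma quot_module: "right_module R (quot_rmod M N)"
proof -
  have z: "\<zero>\<^bsub>quot_rmod M N\<^esub> = N +>\<^bsub>M\<^esub> \<zero>\<^bsub>M\<^esub>" by (simp add: quot_zero coset_zero)
  interpret Q: abelian_group "quot_rmod M N"
  proof (rule abelian_groupI)
    fix X assume "X \<in> carrier (quot_rmod M N)"
    then obtain x where x: "x \<in> carrier M" "X = N +>\<^bsub>M\<^esub> x" by (auto simp: quot_carrier)
    show "\<exists>Y\<in>carrier (quot_rmod M N). Y \<oplus>\<^bsub>quot_rmod M N\<^esub> X = \<zero>\<^bsub>quot_rmod M N\<^esub>"
      by (rule bexI[of _ "N +>\<^bsub>M\<^esub> (\<ominus>\<^bsub>M\<^esub> x)"])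
        (use x in \<open>auto simp: quot_carrier z coset_add M.l_neg\<close>)
  qed (auto simp: quot_carrier z coset_add M.a_ac)
  show ?thesis
    by unfold_locales
      (auto simp: quot_carrier coset_add coset_ract ract_closed ract_add add_ract ract_mult ract_one)
qed

lemma rlinear_coset: "rlinear R M (quot_rmod M N) (\<lambda>x. N +>\<^bsub>M\<^esub> x)"
  by (rule rlinearI) (auto simp: quot_carrier coset_add coset_ract)

lemma coset_eq_zero_iff: "x \<in> carrier M \<Longrightarrow> N +>\<^bsub>M\<^esub> x = \<zero>\<^bsub>quot_rmod M N\<^esub> \<longleftrightarrow> x \<in> N"
  using coset_eq_iff[of x "\<zero>\<^bsub>M\<^esub>"] M.minus_equality[of "\<zero>\<^bsub>M\<^esub>" "\<zero>\<^bsub>M\<^esub>"]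
  by (simp add: quot_zero coset_zero a_minus_def)

lemma quot_fin_gen: "fin_gen R M \<Longrightarrow> fin_gen R (quot_rmod M N)"
  using fin_gen_image[OF right_module_axioms quot_module rlinear_coset] by (simp add: quot_carrier)

end

end

text \<open>A quotient is recorded as a surjection with prescribed kernel. By
  \<open>factor_surj\<close> this determines it up to isomorphism, so the coset model can be
  forgotten.\<close>

lemma quot_fg_rep:
  assumes "right_module R M" "right_submodule R M N" "fin_gen R M"
  obtains X c where "X \<in> fg_mod R" "rlinear R M X c" "c ` carrier M = carrier X"
    "\<And>x. x \<in> carrier M \<Longrightarrow> c x = \<zero>\<^bsub>X\<^esub> \<longleftrightarrow> x \<in> N"
proof -
  interpret right_module R M by fact
  note Q = quot_module[OF assms(2)]
  obtain X f g where X: "X \<in> fg_mod R" "iso_pair R (quot_rmod M N) X f g"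
    by (rule fg_rep[OF Q quot_fin_gen[OF assms(2,3)]])
  note D = iso_pairD[OF X(2)]
  interpret Q: right_module R "quot_rmod M N" by (rule Q)
  interpret X: right_module R X by (rule fg_modD[OF X(1)])
  have in_Q: "N +>\<^bsub>M\<^esub> x \<in> carrier (quot_rmod M N)" if "x \<in> carrier M" for x
    using that by (simp add: quot_carrier[OF assms(2)])
  show thesis
  proof (rule that)
    show "rlinear R M X (\<lambda>x. f (N +>\<^bsub>M\<^esub> x))"
      by (rule rlinear_comp[OF rlinear_coset[OF assms(2)] D(1)])
    show "(\<lambda>x. f (N +>\<^bsub>M\<^esub> x)) ` carrier M = carrier X"
      using D(9) unfolding quot_carrier[OF assms(2)] by (simp add: image_image)
    fix x assume x: "x \<in> carrier M"
    have "f (N +>\<^bsub>M\<^esub> x) = \<zero>\<^bsub>X\<^esub> \<longleftrightarrow> N +>\<^bsub>M\<^esub> x = \<zero>\<^bsub>quot_rmod M N\<^esub>"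
      using D(3)[OF in_Q[OF x]] D(3)[OF Q.zero_closed]
        rlinear_zero[OF Q X.right_module_axioms D(1)] by metis
    then show "f (N +>\<^bsub>M\<^esub> x) = \<zero>\<^bsub>X\<^esub> \<longleftrightarrow> x \<in> N"
      using coset_eq_zero_iff[OF assms(2) x] by simp
  qed (rule X(1))
qed

text \<open>Two preimages of a vector differ by an element of the kernel of \<open>c\<close>, on
  which \<open>h\<close> vanishes; so every choice of preimages gives the same linear map.\<close>

lemma factor_surj:
  assumes "right_module R M" "right_module R N" "right_module R L"
    and "rlinear R M N c" "c ` carrier M = carrier N" "rlinear R M L h"
    and "\<And>x. x \<in> carrier M \<Longrightarrow> c x = \<zero>\<^bsub>N\<^esub> \<Longrightarrow> h x = \<zero>\<^bsub>L\<^esub>"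
  obtains u where "rlinear R N L u" "\<And>x. x \<in> carrier M \<Longrightarrow> u (c x) = h x"
proof -
  interpret M: right_module R M by fact
  interpret N: right_module R N by fact
  interpret L: right_module R L by fact
  define u where "u y = h (inv_into (carrier M) c y)" for y
  have uc: "u (c x) = h x" if x: "x \<in> carrier M" for x
  proof -
    define z where "z = inv_into (carrier M) c (c x)"
    have z: "z \<in> carrier M" "c z = c x"
      using x by (auto simp: z_def inv_into_into f_inv_into_f)
    have "c (z \<ominus>\<^bsub>M\<^esub> x) = \<zero>\<^bsub>N\<^esub>"
      using x z rlinearD(1)[OF assms(4)] by (simp add: rlinear_diff[OF assms(1,2,4)] N.diff_eq_zero_iff)
    then have "h (z \<ominus>\<^bsub>M\<^esub> x) = \<zero>\<^bsub>L\<^esub>" using assms(7) x z by (simp add: a_minus_def)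
    then show ?thesis
      using x z rlinearD(1)[OF assms(6)] by (simp add: rlinear_diff[OF assms(1,3,6)] L.diff_eq_zero_iff u_def z_def[symmetric])
  qed
  have "rlinear R N L u"
  proof (rule rlinearI)
    fix y assume "y \<in> carrier N"
    then obtain x where x: "x \<in> carrier M" "y = c x" using assms(5) by blast
    then show "u y \<in> carrier L" using uc rlinearD(1)[OF assms(6)] by simp
    show "u (y \<triangleleft>\<^bsub>N\<^esub> a) = u y \<triangleleft>\<^bsub>L\<^esub> a" if "a \<in> carrier R" for a
      using x that uc M.ract_closed by (simp add: rlinearD(3)[OF assms(4), symmetric] rlinearD(3)[OF assms(6)])
    fix z assume "z \<in> carrier N"
    then obtain w where w: "w \<in> carrier M" "z = c w" using assms(5) by blast
    then show "u (y \<oplus>\<^bsub>N\<^esub> z) = u y \<oplus>\<^bsub>L\<^esub> u z"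
      using x uc by (simp add: rlinearD(2)[OF assms(4), symmetric] rlinearD(2)[OF assms(6)])
  qed
  then show thesis using uc that by blast
qed

lemma factor_inj:
  assumes "right_module R M" "right_module R N" "rlinear R M N k" "inj_on k (carrier M)"
    and "rlinear R L N h" "h ` carrier L \<subseteq> k ` carrier M"
  obtains u where "rlinear R L M u" "\<And>x. x \<in> carrier L \<Longrightarrow> k (u x) = h x"
proof -
  interpret N: right_module R N by fact
  have sub: "right_submodule R N (k ` carrier M)" by (rule range_submodule[OF assms(1-3)])
  let ?I = "N\<lparr>carrier := k ` carrier M\<rparr>"
  have "rlinear R M ?I k" by (rule rlinear_restrict_range[OF assms(3)]) simp
  then have p: "iso_pair R M ?I k (inv_into (carrier M) k)"
    using assms(1,4) by (intro iso_pair_inv_into) (simp_all add: bij_betw_def)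
  have h: "rlinear R L ?I h" by (rule rlinear_restrict_range[OF assms(5,6)])
  show thesis
  proof (rule that)
    show "rlinear R L M (\<lambda>x. inv_into (carrier M) k (h x))"
      by (rule rlinear_comp[OF h iso_pairD(2)[OF p]])
    show "k (inv_into (carrier M) k (h x)) = h x" if "x \<in> carrier L" for x
      by (rule iso_pairD(4)[OF p]) (use assms(6) that in auto)
  qed
qed

text \<open>Unlike \<open>dsum_rmod\<close>, which has one carrier type for all summands, this joins
  modules on different carrier types, as in the pushout of \<open>split_hereditary\<close>.\<close>

definition prod_rmod :: "('a, 'm) rmodule \<Rightarrow> ('a, 'n) rmodule \<Rightarrow> ('a, 'm \<times> 'n) rmodule" where
  "prod_rmod M N = \<lparr>carrier = carrier M \<times> carrier N, mult = undefined, one = undefined,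
     zero = (\<zero>\<^bsub>M\<^esub>, \<zero>\<^bsub>N\<^esub>), add = (\<lambda>u v. (fst u \<oplus>\<^bsub>M\<^esub> fst v, snd u \<oplus>\<^bsub>N\<^esub> snd v)),
     ract = (\<lambda>u a. (fst u \<triangleleft>\<^bsub>M\<^esub> a, snd u \<triangleleft>\<^bsub>N\<^esub> a))\<rparr>"

lemma prod_rmod_simps [simp]:
  "carrier (prod_rmod M N) = carrier M \<times> carrier N"
  "\<zero>\<^bsub>prod_rmod M N\<^esub> = (\<zero>\<^bsub>M\<^esub>, \<zero>\<^bsub>N\<^esub>)"
  "u \<oplus>\<^bsub>prod_rmod M N\<^esub> v = (fst u \<oplus>\<^bsub>M\<^esub> fst v, snd u \<oplus>\<^bsub>N\<^esub> snd v)"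
  "u \<triangleleft>\<^bsub>prod_rmod M N\<^esub> a = (fst u \<triangleleft>\<^bsub>M\<^esub> a, snd u \<triangleleft>\<^bsub>N\<^esub> a)"
  by (simp_all add: prod_rmod_def)

lemma prod_module:
  assumes "right_module R M" "right_module R N"
  shows "right_module R (prod_rmod M N)"
proof -
  interpret M: right_module R M by fact
  interpret N: right_module R N by fact
  interpret P: abelian_group "prod_rmod M N"
  proof (rule abelian_groupI)
    fix u assume "u \<in> carrier (prod_rmod M N)"
    then have "(\<ominus>\<^bsub>M\<^esub> fst u, \<ominus>\<^bsub>N\<^esub> snd u) \<in> carrier (prod_rmod M N)"
      "(\<ominus>\<^bsub>M\<^esub> fst u, \<ominus>\<^bsub>N\<^esub> snd u) \<oplus>\<^bsub>prod_rmod M N\<^esub> u = \<zero>\<^bsub>prod_rmod M N\<^esub>"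
      by (auto simp: M.M.l_neg N.M.l_neg)
    then show "\<exists>v\<in>carrier (prod_rmod M N). v \<oplus>\<^bsub>prod_rmod M N\<^esub> u = \<zero>\<^bsub>prod_rmod M N\<^esub>" by blast
  qed (auto simp: M.M.a_ac N.M.a_ac)
  show ?thesis
    by unfold_locales (auto simp: M.ract_closed N.ract_closed M.ract_add N.ract_add M.add_ract
        N.add_ract M.ract_mult N.ract_mult M.ract_one N.ract_one)
qed

lemma rlinear_prod:
  assumes "right_module R M" "right_module R N"
  shows "rlinear R (prod_rmod M N) M fst" "rlinear R (prod_rmod M N) N snd"
    "rlinear R M (prod_rmod M N) (\<lambda>x. (x, \<zero>\<^bsub>N\<^esub>))" "rlinear R N (prod_rmod M N) (\<lambda>y. (\<zero>\<^bsub>M\<^esub>, y))"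
proof -
  interpret M: right_module R M by fact
  interpret N: right_module R N by fact
  show "rlinear R (prod_rmod M N) M fst" "rlinear R (prod_rmod M N) N snd"
    "rlinear R M (prod_rmod M N) (\<lambda>x. (x, \<zero>\<^bsub>N\<^esub>))" "rlinear R N (prod_rmod M N) (\<lambda>y. (\<zero>\<^bsub>M\<^esub>, y))"
    by (auto simp: rlinear_def M.zero_ract N.zero_ract)
qed

lemma rlinear_pair:
  "\<lbrakk>rlinear R L M f; rlinear R L N g\<rbrakk> \<Longrightarrow> rlinear R L (prod_rmod M N) (\<lambda>x. (f x, g x))"
  by (simp add: rlinear_def)

lemma prod_fin_gen:
  assumes "right_module R M" "right_module R N" "fin_gen R M" "fin_gen R N"
  shows "fin_gen R (prod_rmod M N)"
proof -
  note P = prod_module[OF assms(1,2)]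
  obtain S where S: "finite S" "S \<subseteq> carrier M" "rspan R M S = carrier M"
    using assms(3) unfolding right_module.fin_gen_iff[OF assms(1)] by blast
  obtain T where T: "finite T" "T \<subseteq> carrier N" "rspan R N T = carrier N"
    using assms(4) unfolding right_module.fin_gen_iff[OF assms(2)] by blast
  let ?S = "(\<lambda>x. (x, \<zero>\<^bsub>N\<^esub>)) ` S" and ?T = "(\<lambda>y. (\<zero>\<^bsub>M\<^esub>, y)) ` T"
  interpret M: right_module R M by fact
  interpret N: right_module R N by fact
  have ST: "?S \<subseteq> carrier (prod_rmod M N)" "?T \<subseteq> carrier (prod_rmod M N)" using S T by auto
  then have "?S \<union> ?T \<subseteq> carrier (prod_rmod M N)" by blast
  moreover have "rspan R (prod_rmod M N) (?S \<union> ?T) = carrier (prod_rmod M N)"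
  proof -
    have "(x, y) \<in> rspan R (prod_rmod M N) (?S \<union> ?T)" if "x \<in> carrier M" "y \<in> carrier N" for x y
    proof -
      have "(x, \<zero>\<^bsub>N\<^esub>) \<in> rspan R (prod_rmod M N) ?S" "(\<zero>\<^bsub>M\<^esub>, y) \<in> rspan R (prod_rmod M N) ?T"
        using rspan_image[OF assms(1) P rlinear_prod(3)[OF assms(1,2)] S(2)]
          rspan_image[OF assms(2) P rlinear_prod(4)[OF assms(1,2)] T(2)] S(3) T(3) that by auto
      moreover have "(x, y) = (x, \<zero>\<^bsub>N\<^esub>) \<oplus>\<^bsub>prod_rmod M N\<^esub> (\<zero>\<^bsub>M\<^esub>, y)"
        using that by simp
      ultimately show ?thesis
        unfolding right_module.rspan_Un[OF P ST] right_module.set_add_iff[OF P] by blast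
    qed
    then have "carrier (prod_rmod M N) \<subseteq> rspan R (prod_rmod M N) (?S \<union> ?T)"
      unfolding prod_rmod_simps(1) by (intro subsetI, elim SigmaE) simp
    moreover have "right_submodule R (prod_rmod M N) (rspan R (prod_rmod M N) (?S \<union> ?T))"
      using S T by (intro right_module.rspan_submodule[OF P]) auto
    ultimately show ?thesis using right_module.submoduleD(1)[OF P] by (intro equalityI)
  qed
  ultimately show ?thesis
    unfolding right_module.fin_gen_iff[OF P]
    using finite_UnI[OF finite_imageI[OF S(1)] finite_imageI[OF T(1)]] by (intro exI[of _ "?S \<union> ?T"] conjI)
qed

section \<open>Artinian modules and the Hopkins--Levitzki theorem\<close>

definition artinian_rmod :: "('a, 'r) ring_scheme \<Rightarrow> ('a, 'm) rmodule \<Rightarrow> bool" where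
  "artinian_rmod R M \<longleftrightarrow> (\<forall>I :: nat \<Rightarrow> 'm set.
     (\<forall>n. right_submodule R M (I n) \<and> I (Suc n) \<subseteq> I n) \<longrightarrow> (\<exists>n. \<forall>m\<ge>n. I m = I n))"

text \<open>The descending chain condition in the form used for all inductions: strict inclusion of
  submodules is well-founded, because an infinite strict chain never becomes stationary.\<close>

lemma artinian_minimal:
  assumes "artinian_rmod R M" "right_submodule R M N0" "P N0"
  obtains N where "right_submodule R M N" "P N"
    "\<And>L. right_submodule R M L \<Longrightarrow> L \<subseteq> N \<Longrightarrow> P L \<Longrightarrow> L = N"
proof -
  let ?r = "{(L, N). right_submodule R M L \<and> right_submodule R M N \<and> L \<subset> N}"
  have "wf ?r"
    unfolding wf_iff_no_infinite_down_chain
  proof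
    assume "\<exists>f. \<forall>i. (f (Suc i), f i) \<in> ?r"
    then obtain f where f: "\<And>i. right_submodule R M (f i) \<and> f (Suc i) \<subset> f i"
      unfolding mem_Collect_eq case_prod_conv by blast
    then obtain n where "\<forall>m\<ge>n. f m = f n" using assms(1) unfolding artinian_rmod_def by blast
    then show False using f[of n] by (metis le_SucI order_refl psubset_eq)
  qed
  moreover have "N0 \<in> {N. right_submodule R M N \<and> P N}" using assms by simp
  ultimately obtain N where "N \<in> {N. right_submodule R M N \<and> P N}"
    "\<And>L. (L, N) \<in> ?r \<Longrightarrow> L \<notin> {N. right_submodule R M N \<and> P N}"
    by (rule wfE_min) blast
  then show thesis using that[of N] by blast
qed

lemma mult_rmod_simps [simp]:
  "carrier (mult_rmod A S) = S" "\<zero>\<^bsub>mult_rmod A S\<^esub> = \<zero>\<^bsub>A\<^esub>"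
  "x \<oplus>\<^bsub>mult_rmod A S\<^esub> y = x \<oplus>\<^bsub>A\<^esub> y" "x \<triangleleft>\<^bsub>mult_rmod A S\<^esub> a = x \<otimes>\<^bsub>A\<^esub> a"
  by (simp_all add: mult_rmod_def)

lemma mult_rmod_restrict: "(mult_rmod A T)\<lparr>carrier := S\<rparr> = mult_rmod A S"
  by (simp add: mult_rmod_def)

context ring
begin

abbreviation regular :: "('a, 'a) rmodule" where
  "regular \<equiv> mult_rmod R (carrier R)"

lemma regular_module: "right_module R regular"
proof -
  interpret abelian_group regular
  proof (rule abelian_groupI)
    show "\<exists>y\<in>carrier regular. y \<oplus>\<^bsub>regular\<^esub> x = \<zero>\<^bsub>regular\<^esub>" if "x \<in> carrier regular" for x
      using that by (intro bexI[of _ "\<ominus> x"]) (simp_all add: l_neg)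
  qed (simp_all add: a_ac)
  show ?thesis by unfold_locales (simp_all add: l_distr r_distr m_assoc)
qed

end

section \<open>Artinian modules, and submodules obtained from Zorn's lemma\<close>

context right_module
begin

lemma rlinear_act: "x \<in> carrier M \<Longrightarrow> rlinear R (mult_rmod R (carrier R)) M (\<lambda>a. x \<triangleleft>\<^bsub>M\<^esub> a)"
  by (rule rlinearI) (simp_all add: ract_closed ract_add ract_mult)

lemma colon_submodule:
  "\<lbrakk>right_submodule R M N; x \<in> carrier M\<rbrakk> \<Longrightarrow>
     right_submodule R (mult_rmod R (carrier R)) {a \<in> carrier R. x \<triangleleft>\<^bsub>M\<^esub> a \<in> N}"
  using preimage_submodule[OF R.regular_module right_module_axioms rlinear_act] by simp

text \<open>Induction on the generators, stated for chains inside the span so that the hypothesis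
  applies to the chain cut down to the smaller span. A new generator x adds a cyclic layer, and the
  chain is seen there as a chain of right ideals.\<close>

lemma artinian_rspan:
  assumes "right_artinian R" "finite S" "S \<subseteq> carrier M"
    and "\<And>n :: nat. right_submodule R M (I n)" "\<And>n. I (Suc n) \<subseteq> I n" "\<And>n. I n \<subseteq> rspan R M S"
  shows "\<exists>n. \<forall>m\<ge>n. I m = I n"
  using assms(2-)
proof (induction S arbitrary: I rule: finite_induct)
  case empty
  then have "I n = {\<zero>\<^bsub>M\<^esub>}" for n
    using submoduleD(2)[OF empty(2)[of n]] empty(4)[of n] unfolding rspan_empty by blast
  then show ?case by simp
next
  case (insert x S)
  have S: "S \<subseteq> carrier M" and x: "x \<in> carrier M" using insert.prems(1) by auto
  let ?N = "rspan R M S"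
  note N = rspan_submodule[OF S]
  note I = submoduleD[OF insert.prems(2)]
  have mono: "I m \<subseteq> I n" if "n \<le> m" for n m
    using insert.prems(3) that by (rule lift_Suc_antimono_le)
  obtain n1 where n1: "\<And>m. m \<ge> n1 \<Longrightarrow> I m \<inter> ?N = I n1 \<inter> ?N"
    using insert.IH[of "\<lambda>n. I n \<inter> ?N", OF S] Int_submodule[OF insert.prems(2) N] insert.prems(3) by blast
  \<comment> \<open>The coefficients of x that occur in \<open>I n\<close> modulo the smaller span;
    they form a right ideal, so the chain condition of the ring applies.\<close>
  define K where "K n = {a \<in> carrier R. x \<triangleleft>\<^bsub>M\<^esub> a \<in> I n <+>\<^bsub>M\<^esub> ?N}" for n
  have "right_submodule R (mult_rmod R (carrier R)) (K n)" for n
    unfolding K_def by (intro colon_submodule set_add_submodule insert.prems(2) N x)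
  moreover have "K (Suc n) \<subseteq> K n" for n
    unfolding K_def set_add_iff using insert.prems(3) by blast
  ultimately obtain n2 where n2: "\<And>m. m \<ge> n2 \<Longrightarrow> K m = K n2"
    using assms(1) unfolding right_artinian_def by blast
  have "I m = I (max n1 n2)" if "m \<ge> max n1 n2" for m
  proof
    let ?n = "max n1 n2"
    show "I m \<subseteq> I ?n" by (rule mono[OF that])
    show "I ?n \<subseteq> I m"
    proof
      fix u assume u: "u \<in> I ?n"
      then have uM: "u \<in> carrier M" by (rule I(3))
      obtain v a where v: "v \<in> ?N" "a \<in> carrier R" "u = v \<oplus>\<^bsub>M\<^esub> x \<triangleleft>\<^bsub>M\<^esub> a"
        using subsetD[OF insert.prems(4) u] unfolding rspan_insert[OF S x] set_add_iff by blast
      have vM: "v \<in> carrier M" and xa: "x \<triangleleft>\<^bsub>M\<^esub> a \<in> carrier M"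
        using v x by (simp_all add: submoduleD(3)[OF N] ract_closed)
      have "x \<triangleleft>\<^bsub>M\<^esub> a = u \<oplus>\<^bsub>M\<^esub> (\<ominus>\<^bsub>M\<^esub> v)"
        using vM xa by (simp add: v(3) M.a_ac M.r_neg2 M.r_neg)
      then have "a \<in> K ?n"
        unfolding K_def set_add_iff using u v submoduleD(6)[OF N] by blast
      then have "a \<in> K m" using n2[of ?n] n2[of m] that by simp
      then obtain u' v' where u': "u' \<in> I m" "v' \<in> ?N" "x \<triangleleft>\<^bsub>M\<^esub> a = u' \<oplus>\<^bsub>M\<^esub> v'"
        unfolding K_def set_add_iff by blast
      have u'M: "u' \<in> carrier M" and v'M: "v' \<in> carrier M"
        using I(3)[OF u'(1)] submoduleD(3)[OF N u'(2)] .
      have "u \<ominus>\<^bsub>M\<^esub> u' = (v \<oplus>\<^bsub>M\<^esub> v') \<oplus>\<^bsub>M\<^esub> (u' \<oplus>\<^bsub>M\<^esub> \<ominus>\<^bsub>M\<^esub> u')"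
        unfolding v(3) u'(3) a_minus_def using vM u'M v'M by (simp add: M.a_ac)
      then have "u \<ominus>\<^bsub>M\<^esub> u' = v \<oplus>\<^bsub>M\<^esub> v'" using vM u'M v'M by (simp add: M.r_neg)
      \<comment> \<open>Modular law: u and u' agree modulo the smaller span, and inside that span
        the two members of the chain already coincide.\<close>
      then have "u \<ominus>\<^bsub>M\<^esub> u' \<in> ?N" using submoduleD(4)[OF N] v(1) u'(2) by simp
      moreover have "u \<ominus>\<^bsub>M\<^esub> u' \<in> I ?n" using u u'(1) mono[OF that] I(7) by blast
      ultimately have "u \<ominus>\<^bsub>M\<^esub> u' \<in> I m" using n1[of m] n1[of ?n] that by auto
      then have "(u \<ominus>\<^bsub>M\<^esub> u') \<oplus>\<^bsub>M\<^esub> u' \<in> I m" using u'(1) by (rule I(4))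
      moreover have "(u \<ominus>\<^bsub>M\<^esub> u') \<oplus>\<^bsub>M\<^esub> u' = u"
        using uM u'M by (simp add: a_minus_def M.a_assoc M.l_neg)
      ultimately show "u \<in> I m" by simp
    qed
  qed
  then show ?case by blast
qed

lemma artinian_fin_gen:
  assumes "right_artinian R" "fin_gen R M"
  shows "artinian_rmod R M"
proof -
  obtain S where S: "finite S" "S \<subseteq> carrier M" "rspan R M S = carrier M"
    using assms(2) unfolding fin_gen_iff by blast
  show ?thesis
    unfolding artinian_rmod_def
  proof (intro allI impI)
    fix I :: "nat \<Rightarrow> _" assume "\<forall>n. right_submodule R M (I n) \<and> I (Suc n) \<subseteq> I n"
    then show "\<exists>n. \<forall>m\<ge>n. I m = I n"
      using submoduleD(1) by (intro artinian_rspan[OF assms(1) S(1,2)]) (simp_all add: S(3))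
  qed
qed

lemma Union_chain_submodule:
  assumes "\<C> \<noteq> {}" "\<And>L. L \<in> \<C> \<Longrightarrow> right_submodule R M L" "\<And>L L'. L \<in> \<C> \<Longrightarrow> L' \<in> \<C> \<Longrightarrow> L \<subseteq> L' \<or> L' \<subseteq> L"
  shows "right_submodule R M (\<Union>\<C>)"
proof (rule submoduleI)
  fix x y assume "x \<in> \<Union>\<C>" "y \<in> \<Union>\<C>"
  then obtain L where "L \<in> \<C>" "x \<in> L" "y \<in> L" using assms(3) by blast
  then show "x \<oplus>\<^bsub>M\<^esub> y \<in> \<Union>\<C>" using submoduleD(4)[OF assms(2)] by blast
next
  fix x a assume "x \<in> \<Union>\<C>" "a \<in> carrier R"
  then show "x \<triangleleft>\<^bsub>M\<^esub> a \<in> \<Union>\<C>" using submoduleD(5)[OF assms(2)] by blast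
next
  show "\<Union>\<C> \<subseteq> carrier M" using submoduleD(1)[OF assms(2)] by blast
  show "\<zero>\<^bsub>M\<^esub> \<in> \<Union>\<C>" using assms(1) submoduleD(2)[OF assms(2)] by blast
qed

text \<open>Used with s = 1 to obtain maximal right ideals, and with a vector s in the final step of
  Hopkins-Levitzki.\<close>

lemma maximal_submodule_avoiding:
  assumes "right_submodule R M V" "V \<subseteq> I" "s \<notin> V"
  obtains L where "right_submodule R M L" "V \<subseteq> L" "L \<subseteq> I" "s \<notin> L"
    "\<And>L'. right_submodule R M L' \<Longrightarrow> L \<subseteq> L' \<Longrightarrow> L' \<subseteq> I \<Longrightarrow> s \<notin> L' \<Longrightarrow> L' = L"
proof -
  define \<Z> where "\<Z> = {L. right_submodule R M L \<and> V \<subseteq> L \<and> L \<subseteq> I \<and> s \<notin> L}"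
  have "\<exists>L\<in>\<Z>. \<forall>L'\<in>\<Z>. L \<subseteq> L' \<longrightarrow> L' = L"
  proof (rule subset_Zorn_nonempty)
    show "\<Z> \<noteq> {}" using assms unfolding \<Z>_def by blast
    fix \<C> assume C: "\<C> \<noteq> {}" "subset.chain \<Z> \<C>"
    then have "L \<in> \<Z>" if "L \<in> \<C>" for L using that unfolding subset.chain_def by blast
    moreover have "right_submodule R M (\<Union>\<C>)"
      using C unfolding subset_chain_def \<Z>_def by (intro Union_chain_submodule) blast+
    ultimately show "\<Union>\<C> \<in> \<Z>" using C(1) unfolding \<Z>_def by blast
  qed
  then show thesis using that unfolding \<Z>_def by auto
qed

definition ideal_product :: "'m set \<Rightarrow> 'a set \<Rightarrow> 'm set" where
  "ideal_product I N = rspan R M {x \<triangleleft>\<^bsub>M\<^esub> a | x a. x \<in> I \<and> a \<in> N}"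

lemma ideal_product_submodule:
  "\<lbrakk>I \<subseteq> carrier M; N \<subseteq> carrier R\<rbrakk> \<Longrightarrow> right_submodule R M (ideal_product I N)"
  unfolding ideal_product_def by (intro rspan_submodule) (auto intro!: ract_closed)

lemma ideal_product_mem: "\<lbrakk>x \<in> I; a \<in> N\<rbrakk> \<Longrightarrow> x \<triangleleft>\<^bsub>M\<^esub> a \<in> ideal_product I N"
  unfolding ideal_product_def using rspan_superset[of "{x \<triangleleft>\<^bsub>M\<^esub> a | x a. x \<in> I \<and> a \<in> N}" R M] by blast

lemma ideal_product_least:
  "\<lbrakk>right_submodule R M L; \<And>x a. x \<in> I \<Longrightarrow> a \<in> N \<Longrightarrow> x \<triangleleft>\<^bsub>M\<^esub> a \<in> L\<rbrakk> \<Longrightarrow> ideal_product I N \<subseteq> L"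
  unfolding ideal_product_def by (rule rspan_least) auto

end

section \<open>Maximal right ideals and the Jacobson radical\<close>

context ring
begin

abbreviation right_ideal :: "'a set \<Rightarrow> bool" where
  "right_ideal I \<equiv> right_submodule R regular I"

interpretation reg: right_module R regular by (rule regular_module)

lemmas right_idealD = reg.submoduleD[unfolded mult_rmod_simps]

lemma right_ideal_carrier: "right_ideal (carrier R)"
  using reg.carrier_submodule by simp

lemma idem_ideal:
  assumes "f \<in> carrier R"
  shows "right_ideal (peirce R f \<one>)"
proof -
  have "peirce R f \<one> = (\<lambda>a. f \<otimes> a) ` carrier R" using assms by (auto simp: peirce_def)
  then show ?thesis using reg.cyclic_submodule[of f] assms by simp
qed

lemma ideal_module: "right_ideal I \<Longrightarrow> right_module R (mult_rmod R I)"
  using reg.restrict_module by (simp add: mult_rmod_restrict)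

lemma right_ideal_one: "\<lbrakk>right_ideal I; \<one> \<in> I\<rbrakk> \<Longrightarrow> I = carrier R"
  using right_idealD(1,5)[of I] by force

lemma colon_ideal: "\<lbrakk>right_ideal N; x \<in> carrier R\<rbrakk> \<Longrightarrow> right_ideal {a \<in> carrier R. x \<otimes> a \<in> N}"
  using reg.colon_submodule[of N x] by simp

definition maximal_right_ideal :: "'a set \<Rightarrow> bool" where
  "maximal_right_ideal K \<longleftrightarrow> right_ideal K \<and> \<one> \<notin> K \<and>
     (\<forall>L. right_ideal L \<longrightarrow> K \<subseteq> L \<longrightarrow> \<one> \<notin> L \<longrightarrow> L = K)"

definition jacobson :: "'a set" where
  "jacobson = {a \<in> carrier R. \<forall>K. maximal_right_ideal K \<longrightarrow> a \<in> K}"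

lemma maximal_right_idealD:
  assumes "maximal_right_ideal K"
  shows "right_ideal K" "\<one> \<notin> K" "right_ideal L \<Longrightarrow> K \<subseteq> L \<Longrightarrow> \<one> \<notin> L \<Longrightarrow> L = K"
  using assms by (simp_all add: maximal_right_ideal_def)

lemma exists_maximal_right_ideal:
  assumes "right_ideal K" "\<one> \<notin> K"
  obtains L where "maximal_right_ideal L" "K \<subseteq> L"
proof -
  obtain L where L: "right_ideal L" "K \<subseteq> L" "L \<subseteq> carrier R" "\<one> \<notin> L"
    "\<And>L'. right_ideal L' \<Longrightarrow> L \<subseteq> L' \<Longrightarrow> L' \<subseteq> carrier R \<Longrightarrow> \<one> \<notin> L' \<Longrightarrow> L' = L"
    by (rule reg.maximal_submodule_avoiding[OF assms(1) right_idealD(1)[OF assms(1)] assms(2)]) blast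
  show thesis
    using that[of L] L right_idealD(1) unfolding maximal_right_ideal_def by blast
qed

text \<open>Left multiplication by x embeds the quotient by this right ideal into R/K, which is
  simple, and the image is non-zero because x is not in K. The proof spells this out with
  elements.\<close>

lemma maximal_colon:
  assumes "maximal_right_ideal K" "x \<in> carrier R" "x \<notin> K"
  shows "maximal_right_ideal {a \<in> carrier R. x \<otimes> a \<in> K}"
  unfolding maximal_right_ideal_def
proof (intro conjI allI impI)
  note K = maximal_right_idealD[OF assms(1)]
  show "right_ideal {a \<in> carrier R. x \<otimes> a \<in> K}" by (rule colon_ideal[OF K(1) assms(2)])
  show "\<one> \<notin> {a \<in> carrier R. x \<otimes> a \<in> K}" using assms(2,3) by simp
  fix L assume L: "right_ideal L" "{a \<in> carrier R. x \<otimes> a \<in> K} \<subseteq> L" "\<one> \<notin> L"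
  note LD = right_idealD[OF L(1)]
  have "c \<in> {a \<in> carrier R. x \<otimes> a \<in> K}" if "c \<in> L" for c
  proof (rule ccontr)
    have c: "c \<in> carrier R" using that by (rule LD(3))
    assume "c \<notin> {a \<in> carrier R. x \<otimes> a \<in> K}"
    then have "x \<otimes> c \<notin> K" using c by simp
    let ?P = "K <+>\<^bsub>regular\<^esub> (\<lambda>a. (x \<otimes> c) \<otimes> a) ` carrier R"
    have cyc: "right_ideal ((\<lambda>a. (x \<otimes> c) \<otimes> a) ` carrier R)"
      using reg.cyclic_submodule[of "x \<otimes> c"] assms(2) c by simp
    have P: "right_ideal ?P" by (rule reg.set_add_submodule[OF K(1) cyc])
    have "K \<subseteq> ?P" "x \<otimes> c \<in> ?P"
      using reg.set_add_upper[OF K(1) cyc] reg.cyclic_self[of "x \<otimes> c"] assms(2) c by auto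
    \<comment> \<open>\<open>?P\<close> properly contains K, so maximality puts 1, and with it x,
      into K + x c R.\<close>
    then have "\<one> \<in> ?P" using K(3)[OF P] \<open>x \<otimes> c \<notin> K\<close> by blast
    then have "x \<in> ?P" using right_ideal_one[OF P] assms(2) by simp
    then obtain m r where m: "m \<in> K" "r \<in> carrier R" "x = m \<oplus> (x \<otimes> c) \<otimes> r"
      unfolding reg.set_add_iff by auto
    have mR: "m \<in> carrier R" using right_idealD(3)[OF K(1) m(1)] .
    have "x \<otimes> (\<one> \<ominus> c \<otimes> r) = x \<ominus> x \<otimes> c \<otimes> r"
      using assms(2) c m(2) by (simp add: minus_eq r_distr r_minus m_assoc)
    also have "\<dots> = (m \<oplus> (x \<otimes> c) \<otimes> r) \<ominus> x \<otimes> c \<otimes> r" using m(3) by simp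
    also have "\<dots> = m"
      using assms(2) c m(2) mR by (simp add: minus_eq a_assoc r_neg)
    finally have "x \<otimes> (\<one> \<ominus> c \<otimes> r) \<in> K" using m(1) by simp
    then have "\<one> \<ominus> c \<otimes> r \<in> L" using L(2) c m(2) by auto
    moreover have "c \<otimes> r \<in> L" using that m(2) by (rule LD(5))
    ultimately have "(\<one> \<ominus> c \<otimes> r) \<oplus> c \<otimes> r \<in> L" by (rule LD(4))
    moreover have "(\<one> \<ominus> c \<otimes> r) \<oplus> c \<otimes> r = \<one>"
      using c m(2) by (simp add: minus_eq a_assoc l_neg)
    ultimately show False using L(3) by simp
  qed
  then show "L = {a \<in> carrier R. x \<otimes> a \<in> K}" using L(2) by blast
qed

lemma jacobson_ideal: "right_ideal jacobson"
proof (rule reg.submoduleI)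
  note K = right_idealD[OF maximal_right_idealD(1)]
  show "jacobson \<subseteq> carrier regular" "\<zero>\<^bsub>regular\<^esub> \<in> jacobson"
    using K(2) by (auto simp: jacobson_def)
  show "x \<oplus>\<^bsub>regular\<^esub> y \<in> jacobson" if "x \<in> jacobson" "y \<in> jacobson" for x y
    using that K(4) by (auto simp: jacobson_def)
  show "x \<triangleleft>\<^bsub>regular\<^esub> a \<in> jacobson" if "x \<in> jacobson" "a \<in> carrier R" for x a
    using that K(5) by (auto simp: jacobson_def)
qed

text \<open>The radical is defined by right ideals only. It absorbs left factors because, for a
  outside K, the right ideal of all y with a y in K is again maximal and thus contains x.\<close>

lemma jacobson_left: "\<lbrakk>a \<in> carrier R; x \<in> jacobson\<rbrakk> \<Longrightarrow> a \<otimes> x \<in> jacobson"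
proof -
  assume a: "a \<in> carrier R" and x: "x \<in> jacobson"
  have "a \<otimes> x \<in> K" if K: "maximal_right_ideal K" for K
  proof (cases "a \<in> K")
    case True
    then show ?thesis
      using right_idealD(5)[OF maximal_right_idealD(1)[OF K]] x by (simp add: jacobson_def)
  next
    case False
    from maximal_colon[OF K a this] show ?thesis using x by (auto simp: jacobson_def)
  qed
  then show ?thesis using a x by (simp add: jacobson_def)
qed

text \<open>If 1 - n generated a proper right ideal, some maximal right ideal would contain both 1 -
  n and n.\<close>

lemma jacobson_right_inverse:
  assumes "n \<in> jacobson"
  obtains u where "u \<in> carrier R" "(\<one> \<ominus> n) \<otimes> u = \<one>"
proof -
  have n: "n \<in> carrier R" using assms by (simp add: jacobson_def)
  let ?P = "(\<lambda>a. (\<one> \<ominus> n) \<otimes> a) ` carrier R"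
  have P: "right_ideal ?P" using reg.cyclic_submodule[of "\<one> \<ominus> n"] n by simp
  have "\<one> \<in> ?P"
  proof (rule ccontr)
    assume "\<one> \<notin> ?P"
    then obtain K where K: "maximal_right_ideal K" "?P \<subseteq> K"
      by (rule exists_maximal_right_ideal[OF P])
    have "\<one> \<ominus> n \<in> K" using K(2) reg.cyclic_self[of "\<one> \<ominus> n"] n by auto
    moreover have "n \<in> K" using assms K(1) by (simp add: jacobson_def)
    ultimately have "(\<one> \<ominus> n) \<oplus> n \<in> K" by (rule right_idealD(4)[OF maximal_right_idealD(1)[OF K(1)]])
    moreover have "(\<one> \<ominus> n) \<oplus> n = \<one>" using n by (simp add: minus_eq a_assoc l_neg)
    ultimately show False using maximal_right_idealD(2)[OF K(1)] by simp
  qed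
  then show thesis using that by (metis imageE)
qed

text \<open>A minimal finite intersection of maximal right ideals does not shrink when one more is
  added, so it lies in all of them.\<close>

lemma jacobson_finite_Inter:
  assumes "right_artinian R"
  obtains F where "finite F" "\<And>K. K \<in> F \<Longrightarrow> maximal_right_ideal K" "jacobson = carrier R \<inter> \<Inter>F"
proof -
  let ?P = "\<lambda>L. \<exists>F. finite F \<and> (\<forall>K\<in>F. maximal_right_ideal K) \<and> L = carrier R \<inter> \<Inter>F"
  have art: "artinian_rmod R regular"
    using assms by (simp add: artinian_rmod_def right_artinian_def)
  have "?P (carrier R)" by (rule exI[of _ "{}"]) simp
  then obtain L where L: "right_ideal L" "?P L" "\<And>L'. right_ideal L' \<Longrightarrow> L' \<subseteq> L \<Longrightarrow> ?P L' \<Longrightarrow> L' = L"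
    by (rule artinian_minimal[where P="?P", OF art right_ideal_carrier]) presburger
  obtain F where F: "finite F" "\<forall>K\<in>F. maximal_right_ideal K" "L = carrier R \<inter> \<Inter>F"
    using L(2) by blast
  have "L \<subseteq> K" if K: "maximal_right_ideal K" for K
  proof -
    have "?P (L \<inter> K)" using F K by (intro exI[of _ "insert K F"]) auto
    then have "L \<inter> K = L"
      using L(3) reg.Int_submodule[OF L(1) maximal_right_idealD(1)[OF K]] by blast
    then show ?thesis by blast
  qed
  then have "L = jacobson" using F by (auto simp: jacobson_def)
  then show thesis using that F by blast
qed

text \<open>
  Modulo the radical, the ring is generated by elements that span simple submodules: if \<^term>\<open>F'\<close> is
  maximal among the subfamilies whose intersection is not contained in a given maximal right ideal,
  any element of that intersection outside the ideal is such a generator.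
\<close>

lemma right_ideal_eq_carrier:
  assumes "right_artinian R" "right_ideal K" "jacobson \<subseteq> K"
    and atomic: "\<And>a. a \<in> carrier R \<Longrightarrow> maximal_right_ideal {b \<in> carrier R. a \<otimes> b \<in> jacobson} \<Longrightarrow> a \<in> K"
  shows "K = carrier R"
proof (rule ccontr)
  assume "K \<noteq> carrier R"
  then have "\<one> \<notin> K" using right_ideal_one assms(2) by blast
  then obtain L where L: "maximal_right_ideal L" "K \<subseteq> L"
    by (rule exists_maximal_right_ideal[OF assms(2)])
  note LD = maximal_right_idealD[OF L(1)]
  obtain F where F: "finite F" "\<And>K. K \<in> F \<Longrightarrow> maximal_right_ideal K" "jacobson = carrier R \<inter> \<Inter>F"
    by (rule jacobson_finite_Inter[OF assms(1)]) blast
  define \<G> where "\<G> = {G \<in> Pow F. \<not> carrier R \<inter> \<Inter>G \<subseteq> L}"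
  have "{} \<in> \<G>" using LD(2) by (auto simp: \<G>_def)
  moreover have "finite \<G>" using F(1) by (simp add: \<G>_def)
  ultimately obtain G where G: "G \<in> \<G>" "\<And>H. H \<in> \<G> \<Longrightarrow> G \<subseteq> H \<Longrightarrow> G = H"
    using finite_has_maximal[of \<G>] by blast
  then obtain a where a: "a \<in> carrier R" "a \<in> \<Inter>G" "a \<notin> L" by (auto simp: \<G>_def)
  let ?T = "{b \<in> carrier R. a \<otimes> b \<in> L}"
  have T: "maximal_right_ideal ?T" by (rule maximal_colon[OF L(1) a(1,3)])
  have "a \<otimes> b \<in> H" if b: "b \<in> ?T" and H: "H \<in> F" for b H
  proof (cases "a \<in> H")
    case True
    then show ?thesis using right_idealD(5)[OF maximal_right_idealD(1)[OF F(2)[OF H]]] b by simp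
  next
    case False
    then have "H \<notin> G" using a(2) by blast
    then have "insert H G \<notin> \<G>" using G(2)[of "insert H G"] by blast
    then have "carrier R \<inter> \<Inter>(insert H G) \<subseteq> L" using G(1) H by (simp add: \<G>_def)
    moreover have "a \<otimes> c \<in> \<Inter>G" if "c \<in> carrier R" for c
    proof
      fix N assume "N \<in> G"
      then show "a \<otimes> c \<in> N"
        using G(1) a(2) that right_idealD(5)[OF maximal_right_idealD(1)[OF F(2)[of N]]] by (auto simp: \<G>_def)
    qed
    \<comment> \<open>By maximality of \<open>G\<close>, adding H to it brings the intersection into
      L, so a c in H forces a c in L. Both sides are maximal right ideals, so the inclusion becomes
      an equality.\<close>
    ultimately have "{c \<in> carrier R. a \<otimes> c \<in> H} \<subseteq> ?T" using a(1) by auto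
    moreover have "maximal_right_ideal {c \<in> carrier R. a \<otimes> c \<in> H}"
      by (rule maximal_colon[OF F(2)[OF H] a(1) False])
    ultimately have "?T = {c \<in> carrier R. a \<otimes> c \<in> H}"
      using maximal_right_idealD(1,2)[OF T] maximal_right_idealD(3) by blast
    then show ?thesis using b by blast
  qed
  then have "?T \<subseteq> {b \<in> carrier R. a \<otimes> b \<in> jacobson}" using a(1) by (auto simp: F(3))
  moreover have "{b \<in> carrier R. a \<otimes> b \<in> jacobson} \<subseteq> ?T" using assms(3) L(2) by blast
  ultimately have "{b \<in> carrier R. a \<otimes> b \<in> jacobson} = ?T" by blast
  then have "maximal_right_ideal {b \<in> carrier R. a \<otimes> b \<in> jacobson}" using T by simp
  then show False using atomic[OF a(1)] a(3) L(2) by blast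
qed

end

section \<open>Nakayama's lemma and finite generation of submodules\<close>

context right_module
begin

interpretation reg: right_module R "mult_rmod R (carrier R)" by (rule R.regular_module)

text \<open>A Nakayama lemma for arbitrary submodules, proved like nilpotence of the radical of an
  artinian ring. Among the left-stable right ideals inside the radical with I contained in I N, a
  minimal N satisfies N N = N, and such an N is zero.\<close>

lemma jacobson_product_eq_zero:
  assumes "right_artinian R" and I: "right_submodule R M I"
    and "I \<subseteq> ideal_product I R.jacobson"
  shows "I = {\<zero>\<^bsub>M\<^esub>}"
proof (rule ccontr)
  assume "I \<noteq> {\<zero>\<^bsub>M\<^esub>}"
  note ID = submoduleD[OF I]
  have art: "artinian_rmod R (mult_rmod R (carrier R))"
    using assms(1) by (simp add: artinian_rmod_def right_artinian_def)
  let ?P = "\<lambda>N. N \<subseteq> R.jacobson \<and> (\<forall>a\<in>carrier R. \<forall>n\<in>N. a \<otimes>\<^bsub>R\<^esub> n \<in> N) \<and> I \<subseteq> ideal_product I N"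
  have "?P R.jacobson" using assms(3) R.jacobson_left by blast
  then obtain N where N: "R.right_ideal N" "?P N"
    and min: "\<And>L. R.right_ideal L \<Longrightarrow> L \<subseteq> N \<Longrightarrow> ?P L \<Longrightarrow> L = N"
    by (rule artinian_minimal[where P="?P", OF art R.jacobson_ideal]) blast
  note ND = R.right_idealD[OF N(1)]
  define NN where "NN = reg.ideal_product N N"
  have NN: "R.right_ideal NN"
    unfolding NN_def using ND(1) by (intro reg.ideal_product_submodule) simp_all
  note NND = R.right_idealD[OF NN]
  have NN_mem: "a \<otimes>\<^bsub>R\<^esub> b \<in> NN" if "a \<in> N" "b \<in> N" for a b
    using reg.ideal_product_mem[OF that] by (simp add: NN_def)
  have sub: "NN \<subseteq> N"
    unfolding NN_def using ND(5)[OF _ ND(3)] by (intro reg.ideal_product_least[OF N(1)]) simp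
  have "NN = N"
  proof (rule min[OF NN sub], intro conjI ballI)
    show "NN \<subseteq> R.jacobson" using sub N(2) by blast
    fix a n assume a: "a \<in> carrier R" and "n \<in> NN"
    have "reg.ideal_product N N \<subseteq> {n \<in> carrier R. a \<otimes>\<^bsub>R\<^esub> n \<in> NN}"
    proof (rule reg.ideal_product_least)
      show "R.right_ideal {n \<in> carrier R. a \<otimes>\<^bsub>R\<^esub> n \<in> NN}" by (rule R.colon_ideal[OF NN a])
      fix x y assume xy: "x \<in> N" "y \<in> N"
      have "a \<otimes>\<^bsub>R\<^esub> (x \<otimes>\<^bsub>R\<^esub> y) = (a \<otimes>\<^bsub>R\<^esub> x) \<otimes>\<^bsub>R\<^esub> y"
        using a ND(3)[OF xy(1)] ND(3)[OF xy(2)] by (simp add: R.m_assoc)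
      moreover have "(a \<otimes>\<^bsub>R\<^esub> x) \<otimes>\<^bsub>R\<^esub> y \<in> NN" using N(2) a xy by (intro NN_mem) blast+
      ultimately show "x \<triangleleft>\<^bsub>mult_rmod R (carrier R)\<^esub> y \<in> {n \<in> carrier R. a \<otimes>\<^bsub>R\<^esub> n \<in> NN}"
        using ND(3)[OF xy(1)] ND(3)[OF xy(2)] by simp
    qed
    then show "a \<otimes>\<^bsub>R\<^esub> n \<in> NN" using \<open>n \<in> NN\<close> unfolding NN_def[symmetric] by blast
  next
    let ?W = "ideal_product I NN"
    have W: "right_submodule R M ?W" by (rule ideal_product_submodule[OF ID(1) NND(1)])
    \<comment> \<open>The vectors u with u N inside I (N N) form a submodule, as N absorbs left
      factors. It contains I N and hence I; therefore I N, and with it I, lies in I (N N).\<close>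
    have "ideal_product I N \<subseteq> {u \<in> carrier M. \<forall>n\<in>N. u \<triangleleft>\<^bsub>M\<^esub> n \<in> ?W}"
    proof (rule ideal_product_least)
      show "right_submodule R M {u \<in> carrier M. \<forall>n\<in>N. u \<triangleleft>\<^bsub>M\<^esub> n \<in> ?W}"
      proof (rule submoduleI)
        show "\<zero>\<^bsub>M\<^esub> \<in> {u \<in> carrier M. \<forall>n\<in>N. u \<triangleleft>\<^bsub>M\<^esub> n \<in> ?W}"
          using submoduleD(2)[OF W] ND(3) by (simp add: zero_ract)
        show "x \<oplus>\<^bsub>M\<^esub> y \<in> {u \<in> carrier M. \<forall>n\<in>N. u \<triangleleft>\<^bsub>M\<^esub> n \<in> ?W}"
          if "x \<in> {u \<in> carrier M. \<forall>n\<in>N. u \<triangleleft>\<^bsub>M\<^esub> n \<in> ?W}" "y \<in> {u \<in> carrier M. \<forall>n\<in>N. u \<triangleleft>\<^bsub>M\<^esub> n \<in> ?W}" for x y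
          using that submoduleD(4)[OF W] ND(3) by (simp add: add_ract)
        show "x \<triangleleft>\<^bsub>M\<^esub> a \<in> {u \<in> carrier M. \<forall>n\<in>N. u \<triangleleft>\<^bsub>M\<^esub> n \<in> ?W}"
          if "x \<in> {u \<in> carrier M. \<forall>n\<in>N. u \<triangleleft>\<^bsub>M\<^esub> n \<in> ?W}" "a \<in> carrier R" for x a
        proof -
          have "(x \<triangleleft>\<^bsub>M\<^esub> a) \<triangleleft>\<^bsub>M\<^esub> n \<in> ?W" if "n \<in> N" for n
          proof -
            have "a \<otimes>\<^bsub>R\<^esub> n \<in> N" using N(2) \<open>a \<in> carrier R\<close> that by blast
            moreover have "(x \<triangleleft>\<^bsub>M\<^esub> a) \<triangleleft>\<^bsub>M\<^esub> n = x \<triangleleft>\<^bsub>M\<^esub> (a \<otimes>\<^bsub>R\<^esub> n)"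
              using \<open>x \<in> _\<close> \<open>a \<in> carrier R\<close> ND(3)[OF that] by (simp add: ract_mult)
            ultimately show ?thesis using \<open>x \<in> _\<close> by simp
          qed
          then show ?thesis using that by (simp add: ract_closed)
        qed
      qed blast
      fix x a assume xa: "x \<in> I" "a \<in> N"
      have "(x \<triangleleft>\<^bsub>M\<^esub> a) \<triangleleft>\<^bsub>M\<^esub> n \<in> ?W" if "n \<in> N" for n
        using ideal_product_mem[OF xa(1) NN_mem[OF xa(2) that]] ID(3)[OF xa(1)] ND(3)[OF xa(2)] ND(3)[OF that]
        by (simp add: ract_mult)
      then show "x \<triangleleft>\<^bsub>M\<^esub> a \<in> {u \<in> carrier M. \<forall>n\<in>N. u \<triangleleft>\<^bsub>M\<^esub> n \<in> ?W}"
        using ID(3)[OF xa(1)] ND(3)[OF xa(2)] by (simp add: ract_closed)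
    qed
    then have *: "u \<triangleleft>\<^bsub>M\<^esub> n \<in> ?W" if "u \<in> I" "n \<in> N" for u n
      using that N(2) by blast
    have "ideal_product I N \<subseteq> ?W" by (rule ideal_product_least[OF W *])
    then show "I \<subseteq> ?W" using N(2) by blast
  qed
  obtain i where "i \<in> I" "i \<noteq> \<zero>\<^bsub>M\<^esub>" using \<open>I \<noteq> {\<zero>\<^bsub>M\<^esub>}\<close> ID(2) by blast
  have "\<exists>n\<in>N. n \<noteq> \<zero>\<^bsub>R\<^esub>"
  proof (rule ccontr)
    assume "\<not> (\<exists>n\<in>N. n \<noteq> \<zero>\<^bsub>R\<^esub>)"
    then have "n = \<zero>\<^bsub>R\<^esub>" if "n \<in> N" for n using that by blast
    then have "x \<triangleleft>\<^bsub>M\<^esub> n \<in> {\<zero>\<^bsub>M\<^esub>}" if "x \<in> I" "n \<in> N" for x n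
      using ID(3)[OF that(1)] \<open>\<And>n. n \<in> N \<Longrightarrow> n = \<zero>\<^bsub>R\<^esub>\<close>[OF that(2)] by (simp add: ract_zero)
    from ideal_product_least[OF zero_submodule this] have "ideal_product I N \<subseteq> {\<zero>\<^bsub>M\<^esub>}" .
    then show False using N(2) \<open>i \<in> I\<close> \<open>i \<noteq> \<zero>\<^bsub>M\<^esub>\<close> by blast
  qed
  then obtain n0 where n0: "n0 \<in> N" "n0 \<noteq> \<zero>\<^bsub>R\<^esub>" by blast
  \<comment> \<open>K is minimal among the right ideals not annihilated by N. For x in K with x N
    non-zero, (x N) N = x N is non-zero too, so x N = K and x = x n with n in the radical.\<close>
  let ?Q = "\<lambda>K. \<exists>k\<in>K. \<exists>n\<in>N. k \<otimes>\<^bsub>R\<^esub> n \<noteq> \<zero>\<^bsub>R\<^esub>"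
  have "?Q (carrier R)" using n0 ND(3) by (intro bexI[of _ "\<one>\<^bsub>R\<^esub>"] bexI[of _ n0]) simp_all
  then obtain K where K: "R.right_ideal K" "?Q K" "\<And>L. R.right_ideal L \<Longrightarrow> L \<subseteq> K \<Longrightarrow> ?Q L \<Longrightarrow> L = K"
    by (rule artinian_minimal[where P="?Q", OF art R.right_ideal_carrier]) blast
  obtain x m where x: "x \<in> K" "m \<in> N" "x \<otimes>\<^bsub>R\<^esub> m \<noteq> \<zero>\<^bsub>R\<^esub>" using K(2) by blast
  have xR: "x \<in> carrier R" by (rule R.right_idealD(3)[OF K(1) x(1)])
  let ?L = "(\<lambda>n. x \<otimes>\<^bsub>R\<^esub> n) ` N"
  have L: "R.right_ideal ?L"
    using image_submodule[OF reg.right_module_axioms reg.right_module_axioms reg.rlinear_act N(1), of x] xR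
    by simp
  have "?Q ?L"
  proof (rule ccontr)
    assume no: "\<not> ?Q ?L"
    have "reg.ideal_product N N \<subseteq> {a \<in> carrier R. x \<otimes>\<^bsub>R\<^esub> a \<in> {\<zero>\<^bsub>R\<^esub>}}"
    proof (rule reg.ideal_product_least)
      show "R.right_ideal {a \<in> carrier R. x \<otimes>\<^bsub>R\<^esub> a \<in> {\<zero>\<^bsub>R\<^esub>}}"
        using R.colon_ideal[OF _ xR, of "{\<zero>\<^bsub>R\<^esub>}"] reg.zero_submodule by simp
      fix a b assume ab: "a \<in> N" "b \<in> N"
      then have "(x \<otimes>\<^bsub>R\<^esub> a) \<otimes>\<^bsub>R\<^esub> b = \<zero>\<^bsub>R\<^esub>" using no by blast
      then show "a \<triangleleft>\<^bsub>mult_rmod R (carrier R)\<^esub> b \<in> {a \<in> carrier R. x \<otimes>\<^bsub>R\<^esub> a \<in> {\<zero>\<^bsub>R\<^esub>}}"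
        using ND(3)[OF ab(1)] ND(3)[OF ab(2)] xR by (simp add: R.m_assoc)
    qed
    then show False using \<open>NN = N\<close> x(2,3) unfolding NN_def[symmetric] by blast
  qed
  moreover have "?L \<subseteq> K" using R.right_idealD(5)[OF K(1) x(1) ND(3)] by blast
  ultimately have "?L = K" using K(3)[OF L] by blast
  then obtain n where n: "n \<in> N" "x = x \<otimes>\<^bsub>R\<^esub> n" using x(1) by blast
  have nR: "n \<in> carrier R" by (rule ND(3)[OF n(1)])
  obtain u where u: "u \<in> carrier R" "(\<one>\<^bsub>R\<^esub> \<ominus>\<^bsub>R\<^esub> n) \<otimes>\<^bsub>R\<^esub> u = \<one>\<^bsub>R\<^esub>"
    using R.jacobson_right_inverse n(1) N(2) by blast
  have "x = x \<otimes>\<^bsub>R\<^esub> ((\<one>\<^bsub>R\<^esub> \<ominus>\<^bsub>R\<^esub> n) \<otimes>\<^bsub>R\<^esub> u)" using u xR by simp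
  also have "\<dots> = (x \<otimes>\<^bsub>R\<^esub> (\<one>\<^bsub>R\<^esub> \<ominus>\<^bsub>R\<^esub> n)) \<otimes>\<^bsub>R\<^esub> u" using u xR nR by (simp add: R.m_assoc)
  also have "x \<otimes>\<^bsub>R\<^esub> (\<one>\<^bsub>R\<^esub> \<ominus>\<^bsub>R\<^esub> n) = \<zero>\<^bsub>R\<^esub>"
    using xR nR n(2)[symmetric] by (simp add: R.minus_eq R.r_distr R.r_minus R.r_neg)
  finally have "x = \<zero>\<^bsub>R\<^esub>" using u by simp
  then show False using x(3) ND(3)[OF x(2)] by simp
qed

text \<open>Take a minimal submodule I that is not finitely generated, and let V be the product of I
  with the radical, a proper submodule by the Nakayama lemma. As I/V has simple submodules in
  abundance, there is a proper submodule L containing V with I = L + s R. By minimality L is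
  finitely generated, and then so is I.\<close>

theorem hopkins_levitzki:
  assumes "right_artinian R" "artinian_rmod R M" "right_submodule R M I0"
  shows "fin_gen R (M\<lparr>carrier := I0\<rparr>)"
proof (rule ccontr)
  let ?fg = "\<lambda>I. \<exists>S. finite S \<and> S \<subseteq> carrier M \<and> rspan R M S = I"
  assume "\<not> fin_gen R (M\<lparr>carrier := I0\<rparr>)"
  then have "\<not> ?fg I0" by (simp add: fin_gen_restrict_iff[OF assms(3)])
  then obtain I where I: "right_submodule R M I" "\<not> ?fg I"
    and min: "\<And>L. right_submodule R M L \<Longrightarrow> L \<subseteq> I \<Longrightarrow> \<not> ?fg L \<Longrightarrow> L = I"
    by (rule artinian_minimal[where P="\<lambda>I. \<not> ?fg I", OF assms(2,3)]) blast
  note ID = submoduleD[OF I(1)]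
  define V where "V = ideal_product I R.jacobson"
  have JR: "R.jacobson \<subseteq> carrier R" by (rule R.right_idealD(1)[OF R.jacobson_ideal])
  have V: "right_submodule R M V"
    unfolding V_def using ID(1) JR by (rule ideal_product_submodule)
  have VI: "V \<subseteq> I"
    unfolding V_def using ID(5) JR by (intro ideal_product_least[OF I(1)]) blast
  have "rspan R M {} = {\<zero>\<^bsub>M\<^esub>}" by (rule rspan_empty)
  then have "I \<noteq> {\<zero>\<^bsub>M\<^esub>}" using I(2) by blast
  then have "\<not> I \<subseteq> V" using jacobson_product_eq_zero[OF assms(1) I(1)] unfolding V_def by blast
  then obtain x0 where x0: "x0 \<in> I" "x0 \<notin> V" by blast
  \<comment> \<open>An atomic vector outside V spans a simple submodule of the quotient by
    V.\<close>
  let ?atomic = "\<lambda>y. R.maximal_right_ideal {b \<in> carrier R. y \<triangleleft>\<^bsub>M\<^esub> b \<in> V}"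
  have atomic: "\<exists>y\<in>I. y \<notin> L \<and> ?atomic y" if L: "right_submodule R M L" "V \<subseteq> L" and x: "x \<in> I" "x \<notin> L" for x L
  proof -
    have xM: "x \<in> carrier M" by (rule ID(3)[OF x(1)])
    let ?K = "{b \<in> carrier R. x \<triangleleft>\<^bsub>M\<^esub> b \<in> L}"
    have K: "R.right_ideal ?K" by (rule colon_submodule[OF L(1) xM])
    have "R.jacobson \<subseteq> ?K"
      using ideal_product_mem[OF x(1)] L(2) JR unfolding V_def by blast
    moreover have "\<one>\<^bsub>R\<^esub> \<notin> ?K" using x(2) by (simp add: ract_one[OF xM])
    then have "?K \<noteq> carrier R" using R.one_closed by blast
    ultimately obtain a where a: "a \<in> carrier R"
      "R.maximal_right_ideal {b \<in> carrier R. a \<otimes>\<^bsub>R\<^esub> b \<in> R.jacobson}" "a \<notin> ?K"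
      using R.right_ideal_eq_carrier[OF assms(1) K] by blast
    let ?y = "x \<triangleleft>\<^bsub>M\<^esub> a"
    have y: "?y \<in> I" "?y \<notin> L" using a x ID(5) by auto
    \<comment> \<open>An atom a of the ring modulo its radical sends x to an atom modulo V: its
      maximal right ideal is contained in the proper right ideal attached to x a, so the two are
      equal.\<close>
    have "{b \<in> carrier R. a \<otimes>\<^bsub>R\<^esub> b \<in> R.jacobson} \<subseteq> {b \<in> carrier R. ?y \<triangleleft>\<^bsub>M\<^esub> b \<in> V}"
      using ideal_product_mem[OF x(1)] a(1) xM unfolding V_def by (auto simp: ract_mult[symmetric])
    moreover have "\<one>\<^bsub>R\<^esub> \<notin> {b \<in> carrier R. ?y \<triangleleft>\<^bsub>M\<^esub> b \<in> V}"
      using y L(2) ID(3)[OF y(1)] by (auto simp: ract_one)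
    ultimately have "{b \<in> carrier R. ?y \<triangleleft>\<^bsub>M\<^esub> b \<in> V} = {b \<in> carrier R. a \<otimes>\<^bsub>R\<^esub> b \<in> R.jacobson}"
      using R.maximal_right_idealD(3)[OF a(2) colon_submodule[OF V ID(3)[OF y(1)]]] by blast
    then show ?thesis using a(2) y by auto
  qed
  obtain s where s: "s \<in> I" "s \<notin> V" using x0 by blast
  obtain L where L: "right_submodule R M L" "V \<subseteq> L" "L \<subseteq> I" "s \<notin> L"
    "\<And>L'. right_submodule R M L' \<Longrightarrow> L \<subseteq> L' \<Longrightarrow> L' \<subseteq> I \<Longrightarrow> s \<notin> L' \<Longrightarrow> L' = L"
    by (rule maximal_submodule_avoiding[OF V VI s(2)]) blast
  let ?P = "L <+>\<^bsub>M\<^esub> (\<lambda>a. s \<triangleleft>\<^bsub>M\<^esub> a) ` carrier R"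
  have sM: "s \<in> carrier M" by (rule ID(3)[OF s(1)])
  note cyc = cyclic_submodule[OF sM]
  have P: "right_submodule R M ?P" by (rule set_add_submodule[OF L(1) cyc])
  have LP: "L \<subseteq> ?P" "s \<in> ?P" using set_add_upper[OF L(1) cyc] cyclic_self[OF sM] by blast+
  \<comment> \<open>Otherwise some atom y lies outside L + s R, and by the choice of L the larger
    submodule L + y R contains s = l + y b. Then y b is in L + s R, hence in V by maximality of the
    right ideal attached to y, and s would be in L.\<close>
  have "I \<subseteq> ?P"
  proof (rule ccontr)
    assume "\<not> I \<subseteq> ?P"
    then obtain x where x: "x \<in> I" "x \<notin> ?P" by blast
    obtain y where y: "y \<in> I" "y \<notin> ?P" "?atomic y"
      using atomic[OF P _ x] L(2) LP by blast
    have yM: "y \<in> carrier M" by (rule ID(3)[OF y(1)])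
    let ?L' = "L <+>\<^bsub>M\<^esub> (\<lambda>a. y \<triangleleft>\<^bsub>M\<^esub> a) ` carrier R"
    note cycy = cyclic_submodule[OF yM]
    have L': "right_submodule R M ?L'" by (rule set_add_submodule[OF L(1) cycy])
    have sup: "L \<subseteq> ?L'" "y \<in> ?L'" using set_add_upper[OF L(1) cycy] cyclic_self[OF yM] by blast+
    have "?L' \<subseteq> I" by (rule set_add_least[OF I(1) L(3) cyclic_subset[OF I(1) y(1)]])
    moreover have "?L' \<noteq> L" using sup(2) y(2) LP(1) by blast
    ultimately have "s \<in> ?L'" using L(5)[OF L' sup(1)] by blast
    then obtain l b where lb: "l \<in> L" "b \<in> carrier R" "s = l \<oplus>\<^bsub>M\<^esub> y \<triangleleft>\<^bsub>M\<^esub> b"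
      unfolding set_add_iff by blast
    have lM: "l \<in> carrier M" by (rule submoduleD(3)[OF L(1) lb(1)])
    have yb: "y \<triangleleft>\<^bsub>M\<^esub> b \<in> carrier M" using yM lb(2) by (rule ract_closed)
    have "y \<triangleleft>\<^bsub>M\<^esub> b = s \<ominus>\<^bsub>M\<^esub> l"
      unfolding lb(3) using lM yb by (simp add: a_minus_def M.a_ac M.r_neg2)
    moreover have "s \<ominus>\<^bsub>M\<^esub> l \<in> ?P" using LP lb(1) by (intro submoduleD(7)[OF P]) blast+
    ultimately have b: "b \<in> {c \<in> carrier R. y \<triangleleft>\<^bsub>M\<^esub> c \<in> ?P}" using lb(2) by simp
    have "V \<subseteq> ?P" using L(2) LP(1) by blast
    then have "{c \<in> carrier R. y \<triangleleft>\<^bsub>M\<^esub> c \<in> V} \<subseteq> {c \<in> carrier R. y \<triangleleft>\<^bsub>M\<^esub> c \<in> ?P}" by blast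
    moreover have "\<one>\<^bsub>R\<^esub> \<notin> {c \<in> carrier R. y \<triangleleft>\<^bsub>M\<^esub> c \<in> ?P}" using y(2) yM by (simp add: ract_one)
    ultimately have "{c \<in> carrier R. y \<triangleleft>\<^bsub>M\<^esub> c \<in> ?P} = {c \<in> carrier R. y \<triangleleft>\<^bsub>M\<^esub> c \<in> V}"
      using R.maximal_right_idealD(3)[OF y(3) colon_submodule[OF P yM]] by blast
    then have "y \<triangleleft>\<^bsub>M\<^esub> b \<in> L" using b L(2) by blast
    then have "s \<in> L" unfolding lb(3) using lb(1) by (intro submoduleD(4)[OF L(1)])
    then show False using L(4) by simp
  qed
  moreover have "?P \<subseteq> I" by (rule set_add_least[OF I(1) L(3) cyclic_subset[OF I(1) s(1)]])
  ultimately have "I = ?P" by (rule equalityI)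
  have "?fg L" using min[OF L(1,3)] L(4) s(1) by blast
  then obtain S where S: "finite S" "S \<subseteq> carrier M" "rspan R M S = L" by blast
  have "rspan R M (insert s S) = I" using rspan_insert[OF S(2) sM] S(3) \<open>I = ?P\<close> by simp
  moreover have "finite (insert s S)" "insert s S \<subseteq> carrier M" using S sM by simp_all
  ultimately show False using I(2) by blast
qed

text \<open>Finitely generated modules are noetherian; this is what turns kernels and summands into
  objects of \<open>fg_mod\<close>.\<close>

lemma submodule_fin_gen:
  assumes "right_artinian R" "fin_gen R M" "right_submodule R M N"
  shows "fin_gen R (M\<lparr>carrier := N\<rparr>)"
  using hopkins_levitzki[OF assms(1) artinian_fin_gen[OF assms(1,2)] assms(3)] .

end

context ring
begin

interpretation reg: right_module R regular by (rule regular_module)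

lemma ideal_fin_gen:
  assumes "right_artinian R" "right_ideal I"
  shows "fin_gen R (mult_rmod R I)"
proof -
  have "rspan R regular {\<one>} = carrier regular"
    using right_ideal_one[OF reg.rspan_submodule[of "{\<one>}"]] rspan_superset[of "{\<one>}" R regular] by simp
  then have "fin_gen R regular" unfolding reg.fin_gen_iff by (intro exI[of _ "{\<one>}"]) simp
  from reg.submodule_fin_gen[OF assms(1) this assms(2)] show ?thesis by (simp add: mult_rmod_restrict)
qed

end

section \<open>Decomposition into indecomposables\<close>

lemma indecomposable_iso:
  assumes "right_module R M" "right_module R N" "iso_pair R M N f g" "indecomposable R M"
  shows "indecomposable R N"
proof -
  interpret M: right_module R M by fact
  interpret N: right_module R N by fact
  note D = iso_pairD[OF assms(3)]
  note g0 = rlinear_zero[OF assms(2,1) D(2)]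
  have f0: "f x = \<zero>\<^bsub>N\<^esub> \<longleftrightarrow> x = \<zero>\<^bsub>M\<^esub>" if "x \<in> carrier M" for x
    using D(3)[OF that] g0 rlinear_zero[OF assms(1,2) D(1)] by metis
  have "A = {\<zero>\<^bsub>N\<^esub>} \<or> B = {\<zero>\<^bsub>N\<^esub>}" if AB: "internal_direct_sum R N A B" for A B
  proof -
    have A: "right_submodule R N A" and B: "right_submodule R N B"
      and sum: "A <+>\<^bsub>N\<^esub> B = carrier N" and int: "A \<inter> B = {\<zero>\<^bsub>N\<^esub>}"
      using AB by (simp_all add: internal_direct_sum_def)
    have gA: "right_submodule R M (g ` A)" and gB: "right_submodule R M (g ` B)"
      by (rule image_submodule[OF assms(2,1) D(2) A], rule image_submodule[OF assms(2,1) D(2) B])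
    have "carrier M \<subseteq> g ` A <+>\<^bsub>M\<^esub> g ` B"
    proof
      fix x assume x: "x \<in> carrier M"
      then obtain a b where ab: "a \<in> A" "b \<in> B" "f x = a \<oplus>\<^bsub>N\<^esub> b"
        using D(5) sum N.set_add_iff by blast
      then have "x = g a \<oplus>\<^bsub>M\<^esub> g b"
        using D(3)[OF x] rlinearD(2)[OF D(2) N.submoduleD(3)[OF A] N.submoduleD(3)[OF B]] by metis
      then show "x \<in> g ` A <+>\<^bsub>M\<^esub> g ` B" unfolding M.set_add_iff using ab by blast
    qed
    then have "g ` A <+>\<^bsub>M\<^esub> g ` B = carrier M"
      using M.submoduleD(1)[OF M.set_add_submodule[OF gA gB]] by blast
    moreover have "g ` A \<inter> g ` B = {\<zero>\<^bsub>M\<^esub>}"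
    proof -
      have "inj_on g (carrier N)" by (rule iso_pairD(8)[OF D(7)])
      then have "g ` A \<inter> g ` B = g ` (A \<inter> B)"
        using N.submoduleD(1)[OF A] N.submoduleD(1)[OF B] by (simp add: inj_on_image_Int)
      then show ?thesis using int g0 by simp
    qed
    ultimately have "internal_direct_sum R M (g ` A) (g ` B)"
      using gA gB by (simp add: internal_direct_sum_def)
    then have "g ` A = {\<zero>\<^bsub>M\<^esub>} \<or> g ` B = {\<zero>\<^bsub>M\<^esub>}" using assms(4) by (simp add: indecomposable_def)
    moreover have "S = {\<zero>\<^bsub>N\<^esub>}" if "right_submodule R N S" "g ` S = {\<zero>\<^bsub>M\<^esub>}" for S
    proof -
      have "x = \<zero>\<^bsub>N\<^esub>" if x: "x \<in> S" for x
        using D(4)[OF N.submoduleD(3)[OF \<open>right_submodule R N S\<close> x]] \<open>g ` S = {\<zero>\<^bsub>M\<^esub>}\<close> x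
          rlinear_zero[OF assms(1,2) D(1)] by (metis image_eqI singletonD)
      then show ?thesis using N.submoduleD(2)[OF that(1)] by blast
    qed
    ultimately show ?thesis using A B by blast
  qed
  moreover have "carrier N \<noteq> {\<zero>\<^bsub>N\<^esub>}"
  proof
    assume "carrier N = {\<zero>\<^bsub>N\<^esub>}"
    then have "x = \<zero>\<^bsub>M\<^esub>" if "x \<in> carrier M" for x using f0[OF that] D(5)[OF that] by blast
    then have "carrier M = {\<zero>\<^bsub>M\<^esub>}" using M.zero_closed by blast
    then show False using assms(4) by (simp add: indecomposable_def)
  qed
  ultimately show ?thesis using assms(2) by (simp add: indecomposable_def)
qed

lemma ind_mod_iff: "X \<in> ind_mod R \<longleftrightarrow> X \<in> fg_mod R \<and> indecomposable R X"
  by (simp add: ind_mod_def)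

lemma ind_mod_fg: "X \<in> ind_mod R \<Longrightarrow> X \<in> fg_mod R"
  by (simp add: ind_mod_iff)

lemma ind_mod_nonzero:
  assumes "X \<in> ind_mod R"
  obtains x where "x \<in> carrier X" "x \<noteq> \<zero>\<^bsub>X\<^esub>"
proof -
  interpret right_module R X using assms by (simp add: ind_mod_iff fg_modD)
  have "carrier X \<noteq> {\<zero>\<^bsub>X\<^esub>}" using assms by (simp add: ind_mod_iff indecomposable_def)
  then show thesis using that M.zero_closed by blast
qed

lemma indecomposable_rep:
  assumes "indecomposable R M" "fin_gen R M"
  obtains X f g where "X \<in> ind_mod R" "iso_pair R M X f g"
proof -
  have M: "right_module R M" using assms(1) by (simp add: indecomposable_def)
  obtain X f g where X: "X \<in> fg_mod R" "iso_pair R M X f g" by (rule fg_rep[OF M assms(2)])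
  then have "X \<in> ind_mod R"
    using indecomposable_iso[OF M fg_modD(1)[OF X(1)] X(2) assms(1)] by (simp add: ind_mod_iff)
  then show thesis using that X(2) by blast
qed

lemma set_add_restrict: "A <+>\<^bsub>M\<lparr>carrier := N\<rparr>\<^esub> B = A <+>\<^bsub>M\<^esub> B"
  by (simp add: set_add_def set_mult_def)

section \<open>Induction over direct sums of indecomposable submodules\<close>

context right_module
begin

text \<open>A minimal counterexample is neither zero nor indecomposable, so it is a direct sum of
  two smaller submodules. Zero is a case of its own because indecomposables are non-zero by
  definition.\<close>

lemma indecomposable_induct:
  assumes "artinian_rmod R M" "right_submodule R M N"
    and "P {\<zero>\<^bsub>M\<^esub>}"
    and "\<And>N. right_submodule R M N \<Longrightarrow> indecomposable R (M\<lparr>carrier := N\<rparr>) \<Longrightarrow> P N"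
    and "\<And>N L. right_submodule R M N \<Longrightarrow> right_submodule R M L \<Longrightarrow> N \<inter> L = {\<zero>\<^bsub>M\<^esub>} \<Longrightarrow>
      P N \<Longrightarrow> P L \<Longrightarrow> P (N <+>\<^bsub>M\<^esub> L)"
  shows "P N"
proof (rule ccontr)
  assume "\<not> P N"
  then obtain N where N: "right_submodule R M N" "\<not> P N"
    and min: "\<And>L. right_submodule R M L \<Longrightarrow> L \<subseteq> N \<Longrightarrow> \<not> P L \<Longrightarrow> L = N"
    by (rule artinian_minimal[where P="\<lambda>N. \<not> P N", OF assms(1,2)]) blast
  have "N \<noteq> {\<zero>\<^bsub>M\<^esub>}" "\<not> indecomposable R (M\<lparr>carrier := N\<rparr>)" using N assms(3,4) by blast+
  then obtain K L where "internal_direct_sum R (M\<lparr>carrier := N\<rparr>) K L" "K \<noteq> {\<zero>\<^bsub>M\<^esub>}" "L \<noteq> {\<zero>\<^bsub>M\<^esub>}"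
    unfolding indecomposable_def using restrict_module[OF N(1)] by auto
  then have KL: "right_submodule R M K" "right_submodule R M L" "K \<subseteq> N" "L \<subseteq> N"
    "K <+>\<^bsub>M\<^esub> L = N" "K \<inter> L = {\<zero>\<^bsub>M\<^esub>}" "K \<noteq> {\<zero>\<^bsub>M\<^esub>}" "L \<noteq> {\<zero>\<^bsub>M\<^esub>}"
    unfolding internal_direct_sum_def submodule_restrict_iff[OF N(1)] set_add_restrict by simp_all
  then have "K \<noteq> N" "L \<noteq> N" by blast+
  then have "P K" "P L" using min KL by blast+
  then show False using assms(5)[OF KL(1,2,6)] KL(5) N(2) by simp
qed

text \<open>The kernel of the addition map is an antidiagonal copy of the intersection of N and
  L.\<close>

lemma direct_sum_iso:
  assumes N: "right_submodule R M N" and L: "right_submodule R M L" and int: "N \<inter> L = {\<zero>\<^bsub>M\<^esub>}"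
  obtains f where "iso_pair R (prod_rmod (M\<lparr>carrier := N\<rparr>) (M\<lparr>carrier := L\<rparr>)) (M\<lparr>carrier := N <+>\<^bsub>M\<^esub> L\<rparr>)
    (\<lambda>u. fst u \<oplus>\<^bsub>M\<^esub> snd u) f"
proof -
  note ND = submoduleD[OF N] and LD = submoduleD[OF L]
  note NM = restrict_module[OF N] and LM = restrict_module[OF L]
    and SM = restrict_module[OF set_add_submodule[OF N L]]
  let ?P = "prod_rmod (M\<lparr>carrier := N\<rparr>) (M\<lparr>carrier := L\<rparr>)"
  have lin: "rlinear R ?P (M\<lparr>carrier := N <+>\<^bsub>M\<^esub> L\<rparr>) (\<lambda>u. fst u \<oplus>\<^bsub>M\<^esub> snd u)"
  proof (rule rlinearI)
    fix u v assume "u \<in> carrier ?P" "v \<in> carrier ?P"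
    then have "fst u \<in> carrier M" "snd u \<in> carrier M" "fst v \<in> carrier M" "snd v \<in> carrier M"
      using ND(3) LD(3) by auto
    then show "fst (u \<oplus>\<^bsub>?P\<^esub> v) \<oplus>\<^bsub>M\<^esub> snd (u \<oplus>\<^bsub>?P\<^esub> v) =
        (fst u \<oplus>\<^bsub>M\<^esub> snd u) \<oplus>\<^bsub>M\<lparr>carrier := N <+>\<^bsub>M\<^esub> L\<rparr>\<^esub> (fst v \<oplus>\<^bsub>M\<^esub> snd v)"
      by (simp add: M.a_ac)
  next
    fix u a assume "u \<in> carrier ?P" "a \<in> carrier R"
    moreover then have "fst u \<in> carrier M" "snd u \<in> carrier M" using ND(3) LD(3) by auto
    ultimately show "fst (u \<triangleleft>\<^bsub>?P\<^esub> a) \<oplus>\<^bsub>M\<^esub> snd (u \<triangleleft>\<^bsub>?P\<^esub> a) =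
        (fst u \<oplus>\<^bsub>M\<^esub> snd u) \<triangleleft>\<^bsub>M\<lparr>carrier := N <+>\<^bsub>M\<^esub> L\<rparr>\<^esub> a"
      by (simp add: add_ract)
  next
    fix u assume "u \<in> carrier ?P"
    then have "fst u \<in> N" "snd u \<in> L" by auto
    then show "fst u \<oplus>\<^bsub>M\<^esub> snd u \<in> carrier (M\<lparr>carrier := N <+>\<^bsub>M\<^esub> L\<rparr>)"
      using set_add_iff by simp blast
  qed
  have "inj_on (\<lambda>u. fst u \<oplus>\<^bsub>M\<^esub> snd u) (carrier ?P)"
    unfolding rlinear_inj_iff[OF prod_module[OF NM LM] SM lin]
  proof (intro ballI impI)
    fix u assume u: "u \<in> carrier ?P" and "fst u \<oplus>\<^bsub>M\<^esub> snd u = \<zero>\<^bsub>M\<lparr>carrier := N <+>\<^bsub>M\<^esub> L\<rparr>\<^esub>"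
    then have "fst u = \<ominus>\<^bsub>M\<^esub> snd u"
      using ND(3) LD(3) M.minus_equality[of "fst u" "snd u"] by auto
    then have "fst u \<in> N \<inter> L" using u LD(6) by auto
    then have "fst u = \<zero>\<^bsub>M\<^esub>" using int by blast
    moreover then have "snd u = \<zero>\<^bsub>M\<^esub>"
      using \<open>fst u \<oplus>\<^bsub>M\<^esub> snd u = _\<close> u LD(3) by auto
    ultimately show "u = \<zero>\<^bsub>?P\<^esub>" by (simp add: prod_eq_iff)
  qed
  moreover have "(\<lambda>u. fst u \<oplus>\<^bsub>M\<^esub> snd u) ` carrier ?P = N <+>\<^bsub>M\<^esub> L"
    by (simp add: set_eq_iff set_add_iff image_iff)
  ultimately show thesis
    using that iso_pair_inv_into[OF prod_module[OF NM LM] lin] by (simp add: bij_betw_def)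
qed

end

lemma prod_iso_cong:
  assumes "right_module R M" "right_module R N" "rmod_iso R M M'" "rmod_iso R N N'"
  shows "rmod_iso R (prod_rmod M N) (prod_rmod M' N')"
proof -
  obtain f g where fg: "iso_pair R M M' f g" using assms rmod_iso_iff[OF assms(1)] by blast
  obtain h k where hk: "iso_pair R N N' h k" using assms rmod_iso_iff[OF assms(2)] by blast
  note F = iso_pairD[OF fg] and H = iso_pairD[OF hk]
  have "iso_pair R (prod_rmod M N) (prod_rmod M' N') (map_prod f h) (map_prod g k)"
    unfolding iso_pair_def
    by (auto intro!: rlinearI simp: F(3-6) H(3-6) rlinearD[OF F(1)] rlinearD[OF F(2)]
        rlinearD[OF H(1)] rlinearD[OF H(2)])
  then show ?thesis using rmod_iso_iff[OF prod_module[OF assms(1,2)]] by blast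
qed

section \<open>Finite direct sums and the existence of decompositions\<close>

lemma dsum_rmod_simps [simp]:
  "carrier (dsum_rmod m X) = (\<Pi>\<^sub>E i\<in>{..<m}. carrier (X i))"
  "\<zero>\<^bsub>dsum_rmod m X\<^esub> = (\<lambda>i\<in>{..<m}. \<zero>\<^bsub>X i\<^esub>)"
  "u \<oplus>\<^bsub>dsum_rmod m X\<^esub> v = (\<lambda>i\<in>{..<m}. u i \<oplus>\<^bsub>X i\<^esub> v i)"
  "u \<triangleleft>\<^bsub>dsum_rmod m X\<^esub> a = (\<lambda>i\<in>{..<m}. u i \<triangleleft>\<^bsub>X i\<^esub> a)"
  by (simp_all add: dsum_rmod_def)

lemma dsum_module:
  assumes "ring R" "\<And>i. i < m \<Longrightarrow> right_module R (X i)"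
  shows "right_module R (dsum_rmod m X)"
proof -
  interpret R: ring R by fact
  note abel = assms(2)[THEN right_module.axioms(2)]
  note [simp] = abelian_group.axioms(1)[OF abel, THEN abelian_monoid.a_closed]
    abelian_group.axioms(1)[OF abel, THEN abelian_monoid.zero_closed]
    abelian_group.axioms(1)[OF abel, THEN abelian_monoid.l_zero]
    right_module.ract_closed[OF assms(2)]
  interpret abelian_group "dsum_rmod m X"
  proof (rule abelian_groupI)
    fix u assume u: "u \<in> carrier (dsum_rmod m X)"
    show "\<exists>v\<in>carrier (dsum_rmod m X). v \<oplus>\<^bsub>dsum_rmod m X\<^esub> u = \<zero>\<^bsub>dsum_rmod m X\<^esub>"
    proof (rule bexI[of _ "\<lambda>i\<in>{..<m}. \<ominus>\<^bsub>X i\<^esub> u i"])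
      show "(\<lambda>i\<in>{..<m}. \<ominus>\<^bsub>X i\<^esub> u i) \<oplus>\<^bsub>dsum_rmod m X\<^esub> u = \<zero>\<^bsub>dsum_rmod m X\<^esub>"
        using u by (auto simp: PiE_iff abelian_group.l_neg[OF abel] intro!: restrict_ext)
      show "(\<lambda>i\<in>{..<m}. \<ominus>\<^bsub>X i\<^esub> u i) \<in> carrier (dsum_rmod m X)"
        using u by (auto simp: PiE_iff abelian_group.a_inv_closed[OF abel])
    qed
  next
    fix u v w
    assume u: "u \<in> carrier (dsum_rmod m X)" and v: "v \<in> carrier (dsum_rmod m X)"
    show "u \<oplus>\<^bsub>dsum_rmod m X\<^esub> v = v \<oplus>\<^bsub>dsum_rmod m X\<^esub> u"
      using u v by (auto simp: PiE_iff abelian_monoid.a_comm[OF abelian_group.axioms(1)[OF abel]] intro!: restrict_ext)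
    assume w: "w \<in> carrier (dsum_rmod m X)"
    show "u \<oplus>\<^bsub>dsum_rmod m X\<^esub> v \<oplus>\<^bsub>dsum_rmod m X\<^esub> w = u \<oplus>\<^bsub>dsum_rmod m X\<^esub> (v \<oplus>\<^bsub>dsum_rmod m X\<^esub> w)"
      using u v w by (auto simp: PiE_iff abelian_monoid.a_assoc[OF abelian_group.axioms(1)[OF abel]] intro!: restrict_ext)
  next
    fix u assume "u \<in> carrier (dsum_rmod m X)"
    then show "\<zero>\<^bsub>dsum_rmod m X\<^esub> \<oplus>\<^bsub>dsum_rmod m X\<^esub> u = u"
      by (intro extensionalityI[of _ "{..<m}"]) (auto simp: PiE_iff)
  qed (auto simp: PiE_iff)
  show ?thesis
  proof unfold_locales
    fix u assume "u \<in> carrier (dsum_rmod m X)"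
    then show "u \<triangleleft>\<^bsub>dsum_rmod m X\<^esub> \<one>\<^bsub>R\<^esub> = u"
      by (intro extensionalityI[of _ "{..<m}"]) (auto simp: PiE_iff right_module.ract_one[OF assms(2)])
  qed (auto simp: PiE_iff right_module.ract_add[OF assms(2)] right_module.add_ract[OF assms(2)]
      right_module.ract_mult[OF assms(2)] intro!: restrict_ext)
qed

lemma rlinear_dsum_proj: "i < m \<Longrightarrow> rlinear R (dsum_rmod m X) (X i) (\<lambda>u. u i)"
  by (rule rlinearI) (auto simp: PiE_iff)

lemma rlinear_dsum_inj:
  assumes "\<And>j. j < m \<Longrightarrow> right_module R (X j)" "i < m"
  shows "rlinear R (X i) (dsum_rmod m X) (\<lambda>x. \<lambda>j\<in>{..<m}. if j = i then x else \<zero>\<^bsub>X j\<^esub>)"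
    and "inj_on (\<lambda>x. \<lambda>j\<in>{..<m}. if j = i then x else \<zero>\<^bsub>X j\<^esub>) (carrier (X i))"
proof -
  note abel = assms(1)[THEN right_module.axioms(2), THEN abelian_group.axioms(1)]
  show "rlinear R (X i) (dsum_rmod m X) (\<lambda>x. \<lambda>j\<in>{..<m}. if j = i then x else \<zero>\<^bsub>X j\<^esub>)"
    by (rule rlinearI) (auto simp: abelian_monoid.zero_closed[OF abel] abelian_monoid.l_zero[OF abel]
        right_module.zero_ract[OF assms(1)] intro!: restrict_ext)
  show "inj_on (\<lambda>x. \<lambda>j\<in>{..<m}. if j = i then x else \<zero>\<^bsub>X j\<^esub>) (carrier (X i))"
    by (rule inj_on_inverseI[where g="\<lambda>u. u i"]) (simp add: assms(2))
qed

text \<open>Concatenation of two families; an index i from m on refers to index i - m of the second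
  one.\<close>

lemma dsum_append_iso:
  assumes "ring R" "\<And>i. i < m \<Longrightarrow> right_module R (X i)" "\<And>i. i < n \<Longrightarrow> right_module R (Y i)"
  shows "rmod_iso R (prod_rmod (dsum_rmod m X) (dsum_rmod n Y))
     (dsum_rmod (m + n) (\<lambda>i. if i < m then X i else Y (i - m)))"
    (is "rmod_iso R ?P (dsum_rmod _ ?Z)")
proof -
  let ?f = "\<lambda>(u, v). \<lambda>i\<in>{..<m + n}. if i < m then u i else v (i - m)"
  have "rlinear R ?P (dsum_rmod (m + n) ?Z) ?f"
    by (rule rlinearI) (auto simp: PiE_iff intro!: restrict_ext)
  moreover have "inj_on ?f (carrier ?P)"
  proof (rule inj_on_inverseI)
    fix u assume u: "u \<in> carrier ?P"
    have "(\<lambda>i\<in>{..<m}. ?f u i) = fst u"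
      using u by (intro extensionalityI[of _ "{..<m}"]) (auto simp: PiE_iff)
    moreover have "(\<lambda>i\<in>{..<n}. ?f u (i + m)) = snd u"
      using u by (intro extensionalityI[of _ "{..<n}"]) (auto simp: PiE_iff)
    ultimately show "(\<lambda>w. (\<lambda>i\<in>{..<m}. w i, \<lambda>i\<in>{..<n}. w (i + m))) (?f u) = u" by (simp add: prod_eq_iff)
  qed
  moreover have "?f ` carrier ?P = carrier (dsum_rmod (m + n) ?Z)"
  proof
    show "?f ` carrier ?P \<subseteq> carrier (dsum_rmod (m + n) ?Z)" by (auto simp: PiE_iff)
    show "carrier (dsum_rmod (m + n) ?Z) \<subseteq> ?f ` carrier ?P"
    proof
      fix w assume w: "w \<in> carrier (dsum_rmod (m + n) ?Z)"
      have "(\<lambda>i\<in>{..<m}. w i, \<lambda>i\<in>{..<n}. w (i + m)) \<in> carrier ?P"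
        using w by (auto simp: PiE_iff split: if_splits)
      moreover have "w = ?f (\<lambda>i\<in>{..<m}. w i, \<lambda>i\<in>{..<n}. w (i + m))"
        using w by (intro extensionalityI[of _ "{..<m + n}"]) (auto simp: PiE_iff)
      ultimately show "w \<in> ?f ` carrier ?P" by (rule rev_image_eqI)
    qed
  qed
  moreover have "right_module R ?P" by (intro prod_module dsum_module assms)
  ultimately show ?thesis by (intro rmod_iso_bij[where h="?f"])
qed

lemma dsum_one_iso:
  assumes "right_module R M"
  shows "rmod_iso R M (dsum_rmod 1 (\<lambda>_. M))"
proof (rule rmod_iso_bij[OF assms])
  let ?f = "\<lambda>x. \<lambda>i\<in>{..<1::nat}. x"
  show "rlinear R M (dsum_rmod 1 (\<lambda>_. M)) ?f" by (rule rlinearI) (auto intro!: restrict_ext)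
  show "inj_on ?f (carrier M)" by (rule inj_on_inverseI[where g="\<lambda>u. u 0"]) simp
  show "?f ` carrier M = carrier (dsum_rmod 1 (\<lambda>_. M))"
  proof
    show "carrier (dsum_rmod 1 (\<lambda>_. M)) \<subseteq> ?f ` carrier M"
    proof
      fix u assume "u \<in> carrier (dsum_rmod 1 (\<lambda>_. M))"
      then have "u 0 \<in> carrier M" "u = ?f (u 0)"
        by (auto simp: PiE_iff intro!: extensionalityI[of _ "{..<1::nat}"])
      then show "u \<in> ?f ` carrier M" by blast
    qed
    show "?f ` carrier M \<subseteq> carrier (dsum_rmod 1 (\<lambda>_. M))"
      unfolding dsum_rmod_simps(1) by (intro image_subsetI restrict_PiE_iff[THEN iffD2] ballI)
  qed
qed

lemma dsum_zero_iso:
  assumes "right_module R M" "carrier M = {\<zero>\<^bsub>M\<^esub>}"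
  shows "rmod_iso R M (dsum_rmod 0 X)"
  \<comment> \<open>The only element of the empty direct sum is the extensional function on the
    empty set, which is \<open>undefined\<close> everywhere.\<close>
  by (rule rmod_iso_bij[OF assms(1), where h="\<lambda>_ _. undefined"])
    (auto simp: assms(2) rlinear_def restrict_def)

text \<open>Existence part of Krull-Schmidt: zero gives the empty family, an indecomposable a family
  of length one, and a direct sum the concatenation of two families.\<close>

theorem indecomposable_decomposition:
  assumes "right_artinian R" "right_module R M" "fin_gen R M"
  shows "\<exists>m X. (\<forall>i<m. X i \<in> ind_mod R) \<and> rmod_iso R M (dsum_rmod m X)"
proof -
  interpret right_module R M by fact
  note art = artinian_fin_gen[OF assms(1,3)]
  let ?P = "\<lambda>N. \<exists>m X. (\<forall>i<m. X i \<in> ind_mod R) \<and> rmod_iso R (M\<lparr>carrier := N\<rparr>) (dsum_rmod m X)"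
  have "?P (carrier M)"
  proof (rule indecomposable_induct[where P="?P", OF art carrier_submodule])
    show "?P {\<zero>\<^bsub>M\<^esub>}"
      using dsum_zero_iso[OF restrict_module[OF zero_submodule], of undefined] by (intro exI[of _ 0] exI) auto
  next
    fix N assume N: "right_submodule R M N" "indecomposable R (M\<lparr>carrier := N\<rparr>)"
    note NM = restrict_module[OF N(1)]
    obtain X f g where X: "X \<in> ind_mod R" "iso_pair R (M\<lparr>carrier := N\<rparr>) X f g"
      by (rule indecomposable_rep[OF N(2) submodule_fin_gen[OF assms(1,3) N(1)]])
    note XM = fg_modD(1)[OF ind_mod_fg[OF X(1)]]
    have "rmod_iso R (M\<lparr>carrier := N\<rparr>) X" using X(2) rmod_iso_iff[OF NM] by blast
    then have "rmod_iso R (M\<lparr>carrier := N\<rparr>) (dsum_rmod 1 (\<lambda>_. X))"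
      using rmod_iso_trans[OF NM XM _ dsum_one_iso[OF XM]] by blast
    then show "?P N" using X(1) by (intro exI[of _ 1] exI[of _ "\<lambda>_. X"]) simp
  next
    fix N L assume NL: "right_submodule R M N" "right_submodule R M L" "N \<inter> L = {\<zero>\<^bsub>M\<^esub>}" "?P N" "?P L"
    note NM = restrict_module[OF NL(1)] and LM = restrict_module[OF NL(2)]
      and SM = restrict_module[OF set_add_submodule[OF NL(1,2)]]
    let ?N = "M\<lparr>carrier := N\<rparr>" and ?L = "M\<lparr>carrier := L\<rparr>" and ?S = "M\<lparr>carrier := N <+>\<^bsub>M\<^esub> L\<rparr>"
    obtain m X where X: "\<forall>i<m. X i \<in> ind_mod R" "rmod_iso R ?N (dsum_rmod m X)" using NL(4) by blast
    obtain n Y where Y: "\<forall>i<n. Y i \<in> ind_mod R" "rmod_iso R ?L (dsum_rmod n Y)" using NL(5) by blast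
    have XM: "right_module R (X i)" if "i < m" for i using X(1) that by (simp add: ind_mod_fg fg_modD)
    have YM: "right_module R (Y i)" if "i < n" for i using Y(1) that by (simp add: ind_mod_fg fg_modD)
    let ?Z = "\<lambda>i. if i < m then X i else Y (i - m)"
    note P = prod_module[OF NM LM]
    have D: "right_module R (prod_rmod (dsum_rmod m X) (dsum_rmod n Y))"
      by (intro prod_module dsum_module R.ring_axioms XM YM)
    have app: "rmod_iso R (prod_rmod (dsum_rmod m X) (dsum_rmod n Y)) (dsum_rmod (m + n) ?Z)"
      by (rule dsum_append_iso[OF R.ring_axioms XM YM])
    obtain f where f: "iso_pair R (prod_rmod ?N ?L) ?S (\<lambda>u. fst u \<oplus>\<^bsub>M\<^esub> snd u) f"
      by (rule direct_sum_iso[OF NL(1-3)])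
    have "rmod_iso R ?S (prod_rmod ?N ?L)"
      using iso_pairD(7)[OF f] rmod_iso_iff[OF SM] by blast
    then have "rmod_iso R ?S (prod_rmod (dsum_rmod m X) (dsum_rmod n Y))"
      by (rule rmod_iso_trans[OF SM P _ prod_iso_cong[OF NM LM X(2) Y(2)]])
    then have "rmod_iso R ?S (dsum_rmod (m + n) ?Z)"
      by (rule rmod_iso_trans[OF SM D _ app])
    moreover have "\<forall>i<m + n. ?Z i \<in> ind_mod R" using X(1) Y(1) by auto
    ultimately show "?P (N <+>\<^bsub>M\<^esub> L)" by (intro exI[of _ "m + n"] exI[of _ ?Z] conjI)
  qed
  then show ?thesis by simp
qed

section \<open>Membership in additive closures\<close>

lemma add_closure_iso_dsum:
  assumes "M \<in> fg_mod R" "\<And>i. i < m \<Longrightarrow> X i \<in> \<C>" "\<C> \<subseteq> fg_mod R" "rmod_iso R M (dsum_rmod m X)"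
  shows "M \<in> add_closure R \<C>"
proof -
  interpret M: right_module R M by (rule fg_modD[OF assms(1)])
  interpret D: right_module R "dsum_rmod m X"
    using assms(2,3) by (intro dsum_module[OF M.R.ring_axioms]) (auto intro: fg_modD)
  let ?D = "dsum_rmod m X"
  have "carrier ?D \<subseteq> carrier ?D <+>\<^bsub>?D\<^esub> {\<zero>\<^bsub>?D\<^esub>}"
    by (rule D.set_add_upper[OF D.carrier_submodule D.zero_submodule])
  then have "carrier ?D <+>\<^bsub>?D\<^esub> {\<zero>\<^bsub>?D\<^esub>} = carrier ?D"
    using D.set_add_least[OF D.carrier_submodule, of "carrier ?D" "{\<zero>\<^bsub>?D\<^esub>}"] D.zero_closed by blast
  then have "internal_direct_sum R ?D (carrier ?D) {\<zero>\<^bsub>?D\<^esub>}"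
    unfolding internal_direct_sum_def using D.carrier_submodule D.zero_submodule D.zero_closed by blast
  moreover have "?D\<lparr>carrier := carrier ?D\<rparr> = ?D" by simp
  ultimately have "direct_summand R M ?D"
    unfolding direct_summand_def using assms(4) by metis
  then show ?thesis using assms(1,2) unfolding add_closure_def by blast
qed

lemma add_closure_embedding:
  assumes "M \<in> add_closure R \<C>"
  obtains m X h where "\<And>i. i < m \<Longrightarrow> X i \<in> \<C>" "rlinear R M (dsum_rmod m X) h" "inj_on h (carrier M)"
proof -
  obtain m X where X: "\<forall>i<m. X i \<in> \<C>" "direct_summand R M (dsum_rmod m X)"
    using assms unfolding add_closure_def by blast
  let ?D = "dsum_rmod m X"
  obtain N L where N: "internal_direct_sum R ?D N L" "rmod_iso R M (?D\<lparr>carrier := N\<rparr>)"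
    using X(2) unfolding direct_summand_def by blast
  then have sub: "N \<subseteq> carrier ?D"
    using additive_subgroup.a_subset unfolding internal_direct_sum_def right_submodule_def by blast
  obtain h where h: "h \<in> rhom R M (?D\<lparr>carrier := N\<rparr>)" "bij_betw h (carrier M) N"
    using N(2) unfolding rmod_iso_def by auto
  show thesis
  proof (rule that)
    show "rlinear R M ?D h" by (rule rlinear_expand_range[OF rhom_rlinear[OF h(1)] sub])
  qed (use X(1) h(2) in \<open>auto simp: bij_betw_def\<close>)
qed

lemma add_closure_fg: "add_closure R \<C> \<subseteq> fg_mod R"
  by (auto simp: add_closure_def)

lemma add_closure_superset:
  assumes "\<C> \<subseteq> fg_mod R"
  shows "\<C> \<subseteq> add_closure R \<C>"
proof
  fix M assume "M \<in> \<C>"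
  then show "M \<in> add_closure R \<C>"
    using assms fg_modD(1)[of M R] by (intro add_closure_iso_dsum[OF _ _ assms dsum_one_iso]) auto
qed

text \<open>The coordinates of the embedding into a direct sum separate the vectors of M, so a
  vector not killed by f survives in some summand from \<open>\<C>\<close>.\<close>

lemma add_closure_detect:
  assumes "M \<in> add_closure R \<C>" "\<C> \<subseteq> fg_mod R" "rlinear R Y M f" "y \<in> carrier Y" "f y \<noteq> \<zero>\<^bsub>M\<^esub>"
  obtains Z g where "Z \<in> \<C>" "rlinear R Y Z g" "g y \<noteq> \<zero>\<^bsub>Z\<^esub>"
proof -
  obtain m X h where X: "\<And>i. i < m \<Longrightarrow> X i \<in> \<C>" "rlinear R M (dsum_rmod m X) h" "inj_on h (carrier M)"
    by (rule add_closure_embedding[OF assms(1)]) blast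
  interpret M: right_module R M using assms(1) add_closure_fg fg_modD by blast
  interpret D: right_module R "dsum_rmod m X"
    using X(1) assms(2) by (intro dsum_module[OF M.R.ring_axioms]) (auto intro: fg_modD)
  have fy: "f y \<in> carrier M" by (rule rlinearD(1)[OF assms(3,4)])
  then have "h (f y) \<noteq> \<zero>\<^bsub>dsum_rmod m X\<^esub>"
    using X(3) assms(5) rlinear_inj_iff[OF M.right_module_axioms D.right_module_axioms X(2)] by blast
  moreover have "h (f y) \<in> carrier (dsum_rmod m X)" by (rule rlinearD(1)[OF X(2) fy])
  ultimately obtain i where i: "i < m" "h (f y) i \<noteq> \<zero>\<^bsub>X i\<^esub>"
    using extensionalityI[of "h (f y)" "{..<m}" "\<zero>\<^bsub>dsum_rmod m X\<^esub>"] by (auto simp: PiE_iff)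
  show thesis
  proof (rule that)
    show "rlinear R Y (X i) (\<lambda>y. h (f y) i)"
      by (rule rlinear_comp[OF rlinear_comp[OF assms(3) X(2)] rlinear_dsum_proj[OF i(1)]])
  qed (use X(1) i in auto)
qed

text \<open>The summands in a decomposition of M embed into M, so it is enough to know the
  indecomposables that embed.\<close>

lemma add_closure_decompose:
  assumes "right_artinian R" "M \<in> fg_mod R" "\<C> \<subseteq> fg_mod R"
    and "\<And>Y f. Y \<in> ind_mod R \<Longrightarrow> rlinear R Y M f \<Longrightarrow> inj_on f (carrier Y) \<Longrightarrow> Y \<in> \<C>"
  shows "M \<in> add_closure R \<C>"
proof -
  note M = fg_modD[OF assms(2)]
  obtain m X where X: "\<forall>i<m. X i \<in> ind_mod R" "rmod_iso R M (dsum_rmod m X)"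
    using indecomposable_decomposition[OF assms(1) M] by blast
  obtain f g where fg: "iso_pair R M (dsum_rmod m X) f g" using X(2) rmod_iso_iff[OF M(1)] by blast
  have XM: "right_module R (X i)" if "i < m" for i using X(1) that by (simp add: ind_mod_fg fg_modD)
  have "X i \<in> \<C>" if i: "i < m" for i
  proof (rule assms(4))
    let ?j = "\<lambda>x. \<lambda>j\<in>{..<m}. if j = i then x else \<zero>\<^bsub>X j\<^esub>"
    note j = rlinear_dsum_inj[where X=X and R=R, OF XM i]
    show "X i \<in> ind_mod R" using X(1) i by simp
    show "rlinear R (X i) M (\<lambda>x. g (?j x))" by (rule rlinear_comp[OF j(1) iso_pairD(2)[OF fg]])
    have "?j ` carrier (X i) \<subseteq> carrier (dsum_rmod m X)" using rlinearD(1)[OF j(1)] by blast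
    then show "inj_on (\<lambda>x. g (?j x)) (carrier (X i))"
      using comp_inj_on[OF j(2) inj_on_subset[OF iso_pairD(8)[OF iso_pairD(7)[OF fg]]]]
      by (simp add: comp_def)
  qed
  then show ?thesis using add_closure_iso_dsum[OF assms(2) _ assms(3) X(2)] by blast
qed

section \<open>Abelian exact subcategories\<close>

lemma compose_eq_iff:
  "compose S g f = h \<longleftrightarrow> h \<in> extensional S \<and> (\<forall>x\<in>S. g (f x) = h x)"
  by (auto simp: compose_def intro: extensionalityI[of _ S] restrict_ext)

lemma compose_eq_zero_hom_iff:
  "compose (carrier M) g f = zero_hom M N \<longleftrightarrow> (\<forall>x\<in>carrier M. g (f x) = \<zero>\<^bsub>N\<^esub>)"
  by (auto simp: compose_eq_iff zero_hom_def)

text \<open>Holds relative to every full subcategory containing the objects involved. One concrete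
  kernel thus serves inside \<open>\<A>\<close> and in the whole module category, which is what
  exactness of the inclusion compares.\<close>

lemma is_kernelI:
  assumes "\<A> \<subseteq> fg_mod R" "X \<in> \<A>" "Y \<in> \<A>" "K \<in> \<A>" "k \<in> rhom R K X"
    and "inj_on k (carrier K)" "k ` carrier K = {x \<in> carrier X. f x = \<zero>\<^bsub>Y\<^esub>}"
  shows "is_kernel R \<A> X Y f K k"
  unfolding is_kernel_def
proof (intro conjI ballI impI)
  note M = fg_modD(1)[OF subsetD[OF assms(1)]]
  show "compose (carrier K) f k = zero_hom K Y"
    using assms(7) by (auto simp: compose_eq_zero_hom_iff)
  fix W h assume W: "W \<in> \<A>" and h: "h \<in> rhom R W X" and "compose (carrier W) f h = zero_hom W Y"
  then have "h ` carrier W \<subseteq> k ` carrier K"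
    using rlinearD(1)[OF rhom_rlinear[OF h]] by (auto simp: compose_eq_zero_hom_iff assms(7))
  then obtain u where u: "rlinear R W K u" "\<And>x. x \<in> carrier W \<Longrightarrow> k (u x) = h x"
    by (rule factor_inj[OF M[OF assms(4)] M[OF assms(2)] rhom_rlinear[OF assms(5)] assms(6) rhom_rlinear[OF h]]) blast
  show "\<exists>!u. u \<in> rhom R W K \<and> compose (carrier W) k u = h"
  proof (rule ex1I[of _ "restrict u (carrier W)"])
    show "restrict u (carrier W) \<in> rhom R W K \<and> compose (carrier W) k (restrict u (carrier W)) = h"
      using restrict_rhom[OF M[OF W] u(1)] u(2) h by (simp add: compose_eq_iff rhom_iff)
    fix v assume v: "v \<in> rhom R W K \<and> compose (carrier W) k v = h"
    show "v = restrict u (carrier W)"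
    proof (rule rhom_eqI[of _ R W K])
      fix x assume x: "x \<in> carrier W"
      then have "k (v x) = k (u x)" using v u(2) by (simp add: compose_eq_iff)
      then show "v x = restrict u (carrier W) x"
        using inj_onD[OF assms(6)] rlinearD(1)[OF u(1)] rlinearD(1)[OF rhom_rlinear, of v R W K] v x by simp
    qed (use v restrict_rhom[OF M[OF W] u(1)] in simp_all)
  qed
qed (use assms in simp_all)

lemma is_cokernelI:
  assumes "\<A> \<subseteq> fg_mod R" "X \<in> \<A>" "Y \<in> \<A>" "C \<in> \<A>" "c \<in> rhom R Y C"
    and f: "f \<in> rhom R X Y"
    and "c ` carrier Y = carrier C" "\<And>y. y \<in> carrier Y \<Longrightarrow> c y = \<zero>\<^bsub>C\<^esub> \<longleftrightarrow> y \<in> f ` carrier X"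
  shows "is_cokernel R \<A> X Y f C c"
  unfolding is_cokernel_def
proof (intro conjI ballI impI)
  note M = fg_modD(1)[OF subsetD[OF assms(1)]]
  note fY = rlinearD(1)[OF rhom_rlinear[OF f]]
  show "compose (carrier X) c f = zero_hom X C"
    using assms(8) fY by (auto simp: compose_eq_zero_hom_iff)
  fix W h assume W: "W \<in> \<A>" and h: "h \<in> rhom R Y W" and "compose (carrier X) h f = zero_hom X W"
  then have "h y = \<zero>\<^bsub>W\<^esub>" if "y \<in> carrier Y" "c y = \<zero>\<^bsub>C\<^esub>" for y
    using that assms(8)[OF that(1)] by (auto simp: compose_eq_zero_hom_iff)
  then obtain u where u: "rlinear R C W u" "\<And>y. y \<in> carrier Y \<Longrightarrow> u (c y) = h y"
    by (rule factor_surj[OF M[OF assms(3)] M[OF assms(4)] M[OF W] rhom_rlinear[OF assms(5)] assms(7) rhom_rlinear[OF h]])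
      (assumption, assumption, rule that, simp_all)
  have cC: "c y \<in> carrier C" if "y \<in> carrier Y" for y using that assms(7) by blast
  show "\<exists>!u. u \<in> rhom R C W \<and> compose (carrier Y) u c = h"
  proof (rule ex1I[of _ "restrict u (carrier C)"])
    show "restrict u (carrier C) \<in> rhom R C W \<and> compose (carrier Y) (restrict u (carrier C)) c = h"
      using restrict_rhom[OF M[OF assms(4)] u(1)] u(2) h cC by (simp add: compose_eq_iff rhom_iff)
    fix v assume v: "v \<in> rhom R C W \<and> compose (carrier Y) v c = h"
    show "v = restrict u (carrier C)"
    proof (rule rhom_eqI[of _ R C W])
      fix z assume z: "z \<in> carrier C"
      then obtain y where "y \<in> carrier Y" "z = c y" using assms(7) by blast
      then show "v z = restrict u (carrier C) z"
        using v u(2) z by (simp add: compose_eq_iff)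
    qed (use v restrict_rhom[OF M[OF assms(4)] u(1)] in simp_all)
  qed
qed (use assms in simp_all)

text \<open>The isomorphism is compatible with the structure maps, so it carries injectivity and
  image of a concrete kernel over to any kernel given by its universal property.\<close>

lemma is_kernel_unique:
  assumes "is_kernel R \<A> X Y f K k" "is_kernel R \<A> X Y f L l" "\<A> \<subseteq> fg_mod R"
  obtains u v where "iso_pair R K L u v" "\<And>x. x \<in> carrier K \<Longrightarrow> l (u x) = k x"
    "\<And>x. x \<in> carrier L \<Longrightarrow> k (v x) = l x"
proof -
  have *: "\<exists>u. u \<in> rhom R K L \<and> compose (carrier K) l u = k"
    if "is_kernel R \<A> X Y f K k" "is_kernel R \<A> X Y f L l" for K k L l
    using that unfolding is_kernel_def by blast
  \<comment> \<open>The composite of u and v and the identity both factor \<open>k\<close> through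
    itself; the uniqueness clause identifies them.\<close>
  have uniq: "compose (carrier K) v u = (\<lambda>x\<in>carrier K. x)"
    if "is_kernel R \<A> X Y f K k" "u \<in> rhom R K L" "v \<in> rhom R L K"
      "compose (carrier K) l u = k" "compose (carrier L) k v = l" for K k L l u v
  proof -
    have K: "K \<in> \<A>" "right_module R K" "k \<in> rhom R K X" "compose (carrier K) f k = zero_hom K Y"
      using that(1) fg_modD(1) assms(3) by (auto simp: is_kernel_def)
    then have "\<exists>!w. w \<in> rhom R K K \<and> compose (carrier K) k w = k"
      using that(1) unfolding is_kernel_def by blast
    moreover have "compose (carrier K) v u \<in> rhom R K K" by (rule compose_rhom[OF K(2) that(2,3)])
    moreover have "compose (carrier K) k (compose (carrier K) v u) = k"
      using that(2,4,5) rlinearD(1)[OF rhom_rlinear[OF that(2)]]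
      by (auto simp: compose_eq_iff) (auto simp: compose_def)
    moreover have "(\<lambda>x\<in>carrier K. x) \<in> rhom R K K" by (rule restrict_rhom[OF K(2) rlinear_id])
    moreover have "compose (carrier K) k (\<lambda>x\<in>carrier K. x) = k"
      using K(3) by (simp add: compose_eq_iff rhom_iff)
    ultimately show ?thesis by blast
  qed
  obtain u where u: "u \<in> rhom R K L" "compose (carrier K) l u = k" using *[OF assms(1,2)] by blast
  obtain v where v: "v \<in> rhom R L K" "compose (carrier L) k v = l" using *[OF assms(2,1)] by blast
  have "iso_pair R K L u v"
    using uniq[OF assms(1) u(1) v(1) u(2) v(2)] uniq[OF assms(2) v(1) u(1) v(2) u(2)] u(1) v(1)
    by (simp add: compose_eq_iff iso_pair_def rhom_iff)
  then show thesis using that u(2) v(2) by (simp add: compose_eq_iff)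
qed

lemma is_cokernel_unique:
  assumes "is_cokernel R \<A> X Y f C c" "is_cokernel R \<A> X Y f D d" "\<A> \<subseteq> fg_mod R"
  obtains u v where "iso_pair R C D u v" "\<And>y. y \<in> carrier Y \<Longrightarrow> u (c y) = d y"
    "\<And>y. y \<in> carrier Y \<Longrightarrow> v (d y) = c y"
proof -
  have *: "\<exists>u. u \<in> rhom R C D \<and> compose (carrier Y) u c = d"
    if "is_cokernel R \<A> X Y f C c" "is_cokernel R \<A> X Y f D d" for C c D d
    using that unfolding is_cokernel_def by blast
  have uniq: "compose (carrier C) v u = (\<lambda>x\<in>carrier C. x)"
    if "is_cokernel R \<A> X Y f C c" "u \<in> rhom R C D" "v \<in> rhom R D C"
      "compose (carrier Y) u c = d" "compose (carrier Y) v d = c" for C c D d u v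
  proof -
    have C: "C \<in> \<A>" "right_module R C" "c \<in> rhom R Y C" "compose (carrier X) c f = zero_hom X C"
      using that(1) fg_modD(1) assms(3) by (auto simp: is_cokernel_def)
    then have "\<exists>!w. w \<in> rhom R C C \<and> compose (carrier Y) w c = c"
      using that(1) unfolding is_cokernel_def by blast
    moreover have "compose (carrier C) v u \<in> rhom R C C" by (rule compose_rhom[OF C(2) that(2,3)])
    moreover have "compose (carrier Y) (compose (carrier C) v u) c = c"
      using that(4,5) rlinearD(1)[OF rhom_rlinear[OF C(3)]]
      by (auto simp: compose_eq_iff) (auto simp: compose_def)
    moreover have "(\<lambda>x\<in>carrier C. x) \<in> rhom R C C" by (rule restrict_rhom[OF C(2) rlinear_id])
    moreover have "compose (carrier Y) (\<lambda>x\<in>carrier C. x) c = c"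
      using C(3) rlinearD(1)[OF rhom_rlinear[OF C(3)]] by (simp add: compose_eq_iff rhom_iff)
    ultimately show ?thesis by blast
  qed
  obtain u where u: "u \<in> rhom R C D" "compose (carrier Y) u c = d" using *[OF assms(1,2)] by blast
  obtain v where v: "v \<in> rhom R D C" "compose (carrier Y) v d = c" using *[OF assms(2,1)] by blast
  have "iso_pair R C D u v"
    using uniq[OF assms(1) u(1) v(1) u(2) v(2)] uniq[OF assms(2) v(1) u(1) v(2) u(2)] u(1) v(1)
    by (simp add: compose_eq_iff iso_pair_def rhom_iff)
  then show thesis using that u(2) v(2) by (simp add: compose_eq_iff)
qed

text \<open>Used twice: for torsion-free classes closed under quotients and for the modules killed
  by \<open>e'\<close>. Products are taken up to isomorphism because \<open>prod_rmod\<close> lives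
  on a pair type; non-emptiness supplies the zero object.\<close>

locale closed_class =
  fixes R :: "('a, 'r) ring_scheme" and \<A> :: "'a fgmodule set"
  assumes artinian: "right_artinian R"
    and fg: "\<A> \<subseteq> fg_mod R"
    and nonempty: "\<A> \<noteq> {}"
    and sub_closed: "\<lbrakk>X \<in> \<A>; Y \<in> fg_mod R; rlinear R Y X f; inj_on f (carrier Y)\<rbrakk> \<Longrightarrow> Y \<in> \<A>"
    and quot_closed: "\<lbrakk>X \<in> \<A>; Y \<in> fg_mod R; rlinear R X Y f; f ` carrier X = carrier Y\<rbrakk> \<Longrightarrow> Y \<in> \<A>"
    and prod_closed: "\<lbrakk>X \<in> \<A>; Y \<in> \<A>; P \<in> fg_mod R; rmod_iso R (prod_rmod X Y) P\<rbrakk> \<Longrightarrow> P \<in> \<A>"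
begin

lemma module: "X \<in> \<A> \<Longrightarrow> right_module R X" and fin_gen: "X \<in> \<A> \<Longrightarrow> fin_gen R X"
  using fg by (simp_all add: fg_modD subset_iff)

lemma sub_rep:
  assumes "X \<in> \<A>" "right_submodule R X N"
  obtains K k where "K \<in> \<A>" "k \<in> rhom R K X" "inj_on k (carrier K)" "k ` carrier K = N"
proof -
  interpret right_module R X by (rule module[OF assms(1)])
  obtain K k where K: "K \<in> fg_mod R" "rlinear R K X k" "inj_on k (carrier K)" "k ` carrier K = N"
    by (rule restrict_fg_rep[OF right_module_axioms assms(2)
          submodule_fin_gen[OF artinian fin_gen[OF assms(1)] assms(2)]])
  show thesis
  proof (rule that)
    show "K \<in> \<A>" by (rule sub_closed[OF assms(1) K(1-3)])
    show "restrict k (carrier K) \<in> rhom R K X" by (rule restrict_rhom[OF fg_modD(1)[OF K(1)] K(2)])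
  qed (use K in \<open>auto simp: inj_on_def\<close>)
qed

lemma quot_rep:
  assumes "Y \<in> \<A>" "right_submodule R Y N"
  obtains C c where "C \<in> \<A>" "c \<in> rhom R Y C" "c ` carrier Y = carrier C"
    "\<And>y. y \<in> carrier Y \<Longrightarrow> c y = \<zero>\<^bsub>C\<^esub> \<longleftrightarrow> y \<in> N"
proof -
  obtain C c where C: "C \<in> fg_mod R" "rlinear R Y C c" "c ` carrier Y = carrier C"
    "\<And>y. y \<in> carrier Y \<Longrightarrow> c y = \<zero>\<^bsub>C\<^esub> \<longleftrightarrow> y \<in> N"
    by (rule quot_fg_rep[OF module[OF assms(1)] assms(2) fin_gen[OF assms(1)]]) blast
  show thesis
  proof (rule that)
    show "C \<in> \<A>" by (rule quot_closed[OF assms(1) C(1-3)])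
    show "restrict c (carrier Y) \<in> rhom R Y C" by (rule restrict_rhom[OF module[OF assms(1)] C(2)])
  qed (use C in auto)
qed

text \<open>The last clause ranges over all full subcategories between \<open>\<A>\<close> and
  \<open>fg_mod\<close>; exactness of the inclusion uses both ends.\<close>

lemma kernel_rep:
  assumes "X \<in> \<A>" "Y \<in> \<A>" "f \<in> rhom R X Y"
  obtains K k where "K \<in> \<A>" "k \<in> rhom R K X" "inj_on k (carrier K)"
    "k ` carrier K = {x \<in> carrier X. f x = \<zero>\<^bsub>Y\<^esub>}" "\<And>\<B>. \<A> \<subseteq> \<B> \<Longrightarrow> \<B> \<subseteq> fg_mod R \<Longrightarrow> is_kernel R \<B> X Y f K k"
proof -
  obtain K k where K: "K \<in> \<A>" "k \<in> rhom R K X" "inj_on k (carrier K)"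
    "k ` carrier K = {x \<in> carrier X. f x = \<zero>\<^bsub>Y\<^esub>}"
    by (rule sub_rep[OF assms(1) kernel_submodule[OF module[OF assms(1)] module[OF assms(2)] rhom_rlinear[OF assms(3)]]])
  have "is_kernel R \<B> X Y f K k" if "\<A> \<subseteq> \<B>" "\<B> \<subseteq> fg_mod R" for \<B>
    using that assms K by (intro is_kernelI) auto
  then show thesis using that K by blast
qed

lemma cokernel_rep:
  assumes "X \<in> \<A>" "Y \<in> \<A>" "f \<in> rhom R X Y"
  obtains C c where "C \<in> \<A>" "c \<in> rhom R Y C" "c ` carrier Y = carrier C"
    "\<And>y. y \<in> carrier Y \<Longrightarrow> c y = \<zero>\<^bsub>C\<^esub> \<longleftrightarrow> y \<in> f ` carrier X"
    "\<And>\<B>. \<A> \<subseteq> \<B> \<Longrightarrow> \<B> \<subseteq> fg_mod R \<Longrightarrow> is_cokernel R \<B> X Y f C c"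
proof -
  obtain C c where C: "C \<in> \<A>" "c \<in> rhom R Y C" "c ` carrier Y = carrier C"
    "\<And>y. y \<in> carrier Y \<Longrightarrow> c y = \<zero>\<^bsub>C\<^esub> \<longleftrightarrow> y \<in> f ` carrier X"
    by (rule quot_rep[OF assms(2) range_submodule[OF module[OF assms(1)] module[OF assms(2)] rhom_rlinear[OF assms(3)]]]) blast
  have "is_cokernel R \<B> X Y f C c" if "\<A> \<subseteq> \<B>" "\<B> \<subseteq> fg_mod R" for \<B>
    using that assms C by (intro is_cokernelI) auto
  then show thesis using that C by blast
qed

lemma ind_iso_closed: "iso_closed R (\<A> \<inter> ind_mod R)"
  unfolding iso_closed_def
proof (intro ballI impI)
  fix X Y assume X: "X \<in> \<A> \<inter> ind_mod R" and Y: "Y \<in> fg_mod R" "rmod_iso R X Y"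
  have XM: "right_module R X" using X module by blast
  obtain f g where fg: "iso_pair R X Y f g" using Y(2) rmod_iso_iff[OF XM] by blast
  have "Y \<in> \<A>" using sub_closed[OF _ Y(1)] X iso_pairD(1,8)[OF iso_pairD(7)[OF fg]] by blast
  moreover have "Y \<in> ind_mod R"
    using indecomposable_iso[OF XM fg_modD(1)[OF Y(1)] fg] X Y(1) by (simp add: ind_mod_iff)
  ultimately show "Y \<in> \<A> \<inter> ind_mod R" by blast
qed

lemma subset_add_closure: "\<A> \<subseteq> add_closure R (\<A> \<inter> ind_mod R)"
proof
  fix M assume M: "M \<in> \<A>"
  show "M \<in> add_closure R (\<A> \<inter> ind_mod R)"
  proof (rule add_closure_decompose[OF artinian subsetD[OF fg M]])
    show "\<A> \<inter> ind_mod R \<subseteq> fg_mod R" using fg by blast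
    fix Y f assume "Y \<in> ind_mod R" "rlinear R Y M f" "inj_on f (carrier Y)"
    then show "Y \<in> \<A> \<inter> ind_mod R" using sub_closed[OF M] ind_mod_fg by blast
  qed
qed

lemma has_zero_object: "\<exists>Z. is_zero_object R \<A> Z"
proof -
  obtain X where X: "X \<in> \<A>" using nonempty by blast
  interpret X: right_module R X by (rule module[OF X])
  \<comment> \<open>The zero object is cut out of an arbitrary object as its zero submodule.\<close>
  obtain Z k where Z: "Z \<in> \<A>" "k \<in> rhom R Z X" "inj_on k (carrier Z)" "k ` carrier Z = {\<zero>\<^bsub>X\<^esub>}"
    by (rule sub_rep[OF X X.zero_submodule])
  interpret Z: right_module R Z by (rule module[OF Z(1)])
  have cZ: "x = \<zero>\<^bsub>Z\<^esub>" if "x \<in> carrier Z" for x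
    using Z(3,4) that Z.zero_closed by (metis image_eqI inj_onD singletonD)
  have "(\<exists>!f. f \<in> rhom R Z W) \<and> (\<exists>!f. f \<in> rhom R W Z)" if W: "W \<in> \<A>" for W
  proof
    interpret W: right_module R W by (rule module[OF W])
    show "\<exists>!f. f \<in> rhom R Z W"
    proof (rule ex1I[of _ "zero_hom Z W"])
      show "zero_hom Z W \<in> rhom R Z W" by (rule zero_hom_rhom) unfold_locales
      fix f assume f: "f \<in> rhom R Z W"
      show "f = zero_hom Z W"
        using cZ rlinear_zero[OF Z.right_module_axioms W.right_module_axioms rhom_rlinear[OF f]]
          zero_hom_rhom[OF Z.right_module_axioms W.right_module_axioms]
        by (intro rhom_eqI[OF f]) (auto simp: zero_hom_def)
    qed
    show "\<exists>!f. f \<in> rhom R W Z"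
    proof (rule ex1I[of _ "zero_hom W Z"])
      show "zero_hom W Z \<in> rhom R W Z" by (rule zero_hom_rhom) unfold_locales
      fix f assume f: "f \<in> rhom R W Z"
      show "f = zero_hom W Z"
        using cZ rlinearD(1)[OF rhom_rlinear[OF f]] zero_hom_rhom[OF W.right_module_axioms Z.right_module_axioms]
        by (intro rhom_eqI[OF f]) (auto simp: zero_hom_def)
    qed
  qed
  then show ?thesis using Z(1) unfolding is_zero_object_def by blast
qed

text \<open>A single representative of the binary product serves as product and as
  coproduct.\<close>

lemma biproduct:
  assumes "X \<in> \<A>" "Y \<in> \<A>"
  shows "\<exists>P p q. is_product R \<A> X Y P p q" and "\<exists>S i j. is_coproduct R \<A> X Y S i j"
proof -
  interpret X: right_module R X by (rule module[OF assms(1)])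
  interpret Y: right_module R Y by (rule module[OF assms(2)])
  let ?D = "prod_rmod X Y"
  note D = prod_module[OF X.right_module_axioms Y.right_module_axioms]
  note lin = rlinear_prod[OF X.right_module_axioms Y.right_module_axioms]
  obtain P f g where P: "P \<in> fg_mod R" "iso_pair R ?D P f g"
    by (rule fg_rep[OF D prod_fin_gen[OF X.right_module_axioms Y.right_module_axioms fin_gen[OF assms(1)] fin_gen[OF assms(2)]]])
  have PA: "P \<in> \<A>" using prod_closed[OF assms P(1)] P(2) rmod_iso_iff[OF D] by blast
  note I = iso_pairD[OF P(2)]
  interpret P: right_module R P by (rule fg_modD[OF P(1)])
  have pX: "restrict (\<lambda>x. fst (g x)) (carrier P) \<in> rhom R P X"
    by (rule restrict_rhom[OF P.right_module_axioms rlinear_comp[OF I(2) lin(1)]])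
  have pY: "restrict (\<lambda>x. snd (g x)) (carrier P) \<in> rhom R P Y"
    by (rule restrict_rhom[OF P.right_module_axioms rlinear_comp[OF I(2) lin(2)]])
  have iX: "restrict (\<lambda>x. f (x, \<zero>\<^bsub>Y\<^esub>)) (carrier X) \<in> rhom R X P"
    by (rule restrict_rhom[OF X.right_module_axioms rlinear_comp[OF lin(3) I(1)]])
  have iY: "restrict (\<lambda>y. f (\<zero>\<^bsub>X\<^esub>, y)) (carrier Y) \<in> rhom R Y P"
    by (rule restrict_rhom[OF Y.right_module_axioms rlinear_comp[OF lin(4) I(1)]])
  have "is_product R \<A> X Y P (restrict (\<lambda>x. fst (g x)) (carrier P)) (restrict (\<lambda>x. snd (g x)) (carrier P))"
    unfolding is_product_def
  proof (intro conjI ballI PA pX pY)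
    fix W a b assume W: "W \<in> \<A>" and a: "a \<in> rhom R W X" and b: "b \<in> rhom R W Y"
    interpret W: right_module R W by (rule module[OF W])
    note aD = rlinearD(1)[OF rhom_rlinear[OF a]] and bD = rlinearD(1)[OF rhom_rlinear[OF b]]
    let ?u = "restrict (\<lambda>w. f (a w, b w)) (carrier W)"
    have u: "?u \<in> rhom R W P"
      by (rule restrict_rhom[OF W.right_module_axioms rlinear_comp[OF rlinear_pair[OF rhom_rlinear[OF a] rhom_rlinear[OF b]] I(1)]])
    show "\<exists>!u. u \<in> rhom R W P \<and> compose (carrier W) (restrict (\<lambda>x. fst (g x)) (carrier P)) u = a \<and>
        compose (carrier W) (restrict (\<lambda>x. snd (g x)) (carrier P)) u = b"
    proof (rule ex1I[of _ ?u])
      have "fst (restrict g (carrier P) (f (a w, b w))) = a w" "snd (g (f (a w, b w))) = b w"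
        "f (a w, b w) \<in> carrier P" if "w \<in> carrier W" for w
        using that aD bD I(3)[of "(a w, b w)"] I(5)[of "(a w, b w)"] by simp_all
      then show "?u \<in> rhom R W P \<and> compose (carrier W) (restrict (\<lambda>x. fst (g x)) (carrier P)) ?u = a \<and>
          compose (carrier W) (restrict (\<lambda>x. snd (g x)) (carrier P)) ?u = b"
        using u a b by (simp add: compose_eq_iff rhom_iff)
      fix v assume v: "v \<in> rhom R W P \<and> compose (carrier W) (restrict (\<lambda>x. fst (g x)) (carrier P)) v = a \<and>
          compose (carrier W) (restrict (\<lambda>x. snd (g x)) (carrier P)) v = b"
      show "v = ?u"
      proof (rule rhom_eqI[OF _ u])
        fix w assume w: "w \<in> carrier W"
        then have vw: "v w \<in> carrier P" using v rlinearD(1)[OF rhom_rlinear, of v R W P] by simp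
        then have "fst (g (v w)) = a w" "snd (g (v w)) = b w" using v w by (auto simp: compose_eq_iff)
        then have "g (v w) = (a w, b w)" by (simp add: prod_eq_iff)
        then show "v w = ?u w" using I(4)[OF vw] w by simp
      qed (use v in simp)
    qed
  qed
  then show "\<exists>P p q. is_product R \<A> X Y P p q" by blast
  have "is_coproduct R \<A> X Y P (restrict (\<lambda>x. f (x, \<zero>\<^bsub>Y\<^esub>)) (carrier X)) (restrict (\<lambda>y. f (\<zero>\<^bsub>X\<^esub>, y)) (carrier Y))"
    unfolding is_coproduct_def
  proof (intro conjI ballI PA iX iY)
    fix W a b assume W: "W \<in> \<A>" and a: "a \<in> rhom R X W" and b: "b \<in> rhom R Y W"
    interpret W: right_module R W by (rule module[OF W])
    note aL = rhom_rlinear[OF a] and bL = rhom_rlinear[OF b]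
    have a0: "a \<zero>\<^bsub>X\<^esub> = \<zero>\<^bsub>W\<^esub>" by (rule rlinear_zero[OF _ _ aL]) unfold_locales
    have b0: "b \<zero>\<^bsub>Y\<^esub> = \<zero>\<^bsub>W\<^esub>" by (rule rlinear_zero[OF _ _ bL]) unfold_locales
    let ?w = "\<lambda>x. a (fst (g x)) \<oplus>\<^bsub>W\<^esub> b (snd (g x))"
    have u: "restrict ?w (carrier P) \<in> rhom R P W"
      by (rule restrict_rhom[OF P.right_module_axioms rlinear_add_maps[OF W.right_module_axioms
              rlinear_comp[OF rlinear_comp[OF I(2) lin(1)] aL] rlinear_comp[OF rlinear_comp[OF I(2) lin(2)] bL]]])
    have cX: "?w (f (x, \<zero>\<^bsub>Y\<^esub>)) = a x" "f (x, \<zero>\<^bsub>Y\<^esub>) \<in> carrier P" if "x \<in> carrier X" for x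
      using that I(3)[of "(x, \<zero>\<^bsub>Y\<^esub>)"] I(5)[of "(x, \<zero>\<^bsub>Y\<^esub>)"] b0 rlinearD(1)[OF aL that] by simp_all
    have cY: "?w (f (\<zero>\<^bsub>X\<^esub>, y)) = b y" "f (\<zero>\<^bsub>X\<^esub>, y) \<in> carrier P" if "y \<in> carrier Y" for y
      using that I(3)[of "(\<zero>\<^bsub>X\<^esub>, y)"] I(5)[of "(\<zero>\<^bsub>X\<^esub>, y)"] a0 rlinearD(1)[OF bL that] by simp_all
    show "\<exists>!u. u \<in> rhom R P W \<and> compose (carrier X) u (restrict (\<lambda>x. f (x, \<zero>\<^bsub>Y\<^esub>)) (carrier X)) = a \<and>
        compose (carrier Y) u (restrict (\<lambda>y. f (\<zero>\<^bsub>X\<^esub>, y)) (carrier Y)) = b"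
    proof (rule ex1I[of _ "restrict ?w (carrier P)"])
      show "restrict ?w (carrier P) \<in> rhom R P W \<and>
          compose (carrier X) (restrict ?w (carrier P)) (restrict (\<lambda>x. f (x, \<zero>\<^bsub>Y\<^esub>)) (carrier X)) = a \<and>
          compose (carrier Y) (restrict ?w (carrier P)) (restrict (\<lambda>y. f (\<zero>\<^bsub>X\<^esub>, y)) (carrier Y)) = b"
        using u a b cX cY by (simp add: compose_eq_iff rhom_iff)
      fix v assume v: "v \<in> rhom R P W \<and> compose (carrier X) v (restrict (\<lambda>x. f (x, \<zero>\<^bsub>Y\<^esub>)) (carrier X)) = a \<and>
          compose (carrier Y) v (restrict (\<lambda>y. f (\<zero>\<^bsub>X\<^esub>, y)) (carrier Y)) = b"
      then have vX: "v (f (x, \<zero>\<^bsub>Y\<^esub>)) = a x" if "x \<in> carrier X" for x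
        using that by (auto simp: compose_eq_iff)
      have vY: "v (f (\<zero>\<^bsub>X\<^esub>, y)) = b y" if "y \<in> carrier Y" for y
        using that v by (auto simp: compose_eq_iff)
      show "v = restrict ?w (carrier P)"
      proof (rule rhom_eqI[OF _ u])
        fix z assume z: "z \<in> carrier P"
        obtain x y where xy: "g z = (x, y)" "x \<in> carrier X" "y \<in> carrier Y"
          using I(6)[OF z] by auto
        \<comment> \<open>Every vector is a sum of vectors from the two inclusions, so the
          prescribed values determine \<open>v\<close>.\<close>
        have "z = f ((x, \<zero>\<^bsub>Y\<^esub>) \<oplus>\<^bsub>?D\<^esub> (\<zero>\<^bsub>X\<^esub>, y))" using I(4)[OF z] xy by simp
        also have "\<dots> = f (x, \<zero>\<^bsub>Y\<^esub>) \<oplus>\<^bsub>P\<^esub> f (\<zero>\<^bsub>X\<^esub>, y)"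
          using xy by (intro rlinearD(2)[OF I(1)]) simp_all
        finally have "v z = a x \<oplus>\<^bsub>W\<^esub> b y"
          using v cX(2)[OF xy(2)] cY(2)[OF xy(3)] vX[OF xy(2)] vY[OF xy(3)]
            rlinearD(2)[OF rhom_rlinear, of v R P W] by simp
        then show "v z = restrict ?w (carrier P) z" using z xy by simp
      qed (use v in simp)
    qed
  qed
  then show "\<exists>S i j. is_coproduct R \<A> X Y S i j" by blast
qed

text \<open>The embedding of the kernel and the zero map agree after f, and both start from an
  object of \<open>\<A>\<close>, because \<open>\<A>\<close> contains the kernel.\<close>

lemma mono_inj:
  assumes "X \<in> \<A>" "Y \<in> \<A>" "f \<in> rhom R X Y" "is_mono R \<A> X Y f"
  shows "inj_on f (carrier X)"
proof -
  note XM = module[OF assms(1)] and YM = module[OF assms(2)] and fL = rhom_rlinear[OF assms(3)]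
  obtain K k where K: "K \<in> \<A>" "k \<in> rhom R K X" "k ` carrier K = {x \<in> carrier X. f x = \<zero>\<^bsub>Y\<^esub>}"
    by (rule kernel_rep[OF assms(1-3)])
  have z: "zero_hom K X \<in> rhom R K X" by (rule zero_hom_rhom[OF module[OF K(1)] XM])
  have "compose (carrier K) f k = compose (carrier K) f (zero_hom K X)"
  proof -
    have "f (k x) = f \<zero>\<^bsub>X\<^esub>" if "x \<in> carrier K" for x
      using K(3) that rlinear_zero[OF XM YM fL] by auto
    then show ?thesis by (auto simp: compose_def zero_hom_def intro: restrict_ext)
  qed
  then have "k = zero_hom K X" using assms(4) K(1,2) z unfolding is_mono_def by blast
  then have "k ` carrier K \<subseteq> {\<zero>\<^bsub>X\<^esub>}" by (auto simp: zero_hom_def)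
  then show ?thesis unfolding rlinear_inj_iff[OF XM YM fL] K(3) by blast
qed

lemma epi_surj:
  assumes "X \<in> \<A>" "Y \<in> \<A>" "f \<in> rhom R X Y" "is_epi R \<A> X Y f"
  shows "f ` carrier X = carrier Y"
proof -
  note fL = rhom_rlinear[OF assms(3)]
  obtain C c where C: "C \<in> \<A>" "c \<in> rhom R Y C" "\<And>y. y \<in> carrier Y \<Longrightarrow> c y = \<zero>\<^bsub>C\<^esub> \<longleftrightarrow> y \<in> f ` carrier X"
    by (rule cokernel_rep[OF assms(1-3)]) (rule that, simp_all)
  have z: "zero_hom Y C \<in> rhom R Y C" by (rule zero_hom_rhom[OF module[OF assms(2)] module[OF C(1)]])
  have "compose (carrier X) c f = compose (carrier X) (zero_hom Y C) f"
    using C(3) rlinearD(1)[OF fL] by (auto simp: compose_def zero_hom_def fun_eq_iff)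
  then have "c = zero_hom Y C" using assms(4) C(1,2) z unfolding is_epi_def by blast
  then have "carrier Y \<subseteq> f ` carrier X" using C(3) by (auto simp: zero_hom_def)
  then show ?thesis using rlinearD(1)[OF fL] by blast
qed

text \<open>A monomorphism is injective and hence the kernel of its cokernel; an epimorphism is
  surjective and hence the cokernel of its kernel. For exactness, an abstract kernel or cokernel is
  compared with the concrete one by uniqueness.\<close>

theorem abelian_exact: "abelian_exact_subcategory R \<A>"
proof -
  have "\<exists>Z\<in>\<A>. \<exists>g\<in>rhom R Y Z. is_kernel R \<A> Y Z g X f"
    if X: "X \<in> \<A>" and Y: "Y \<in> \<A>" and f: "f \<in> rhom R X Y" and "is_mono R \<A> X Y f" for X Y f
  proof -
    obtain C c where C: "C \<in> \<A>" "c \<in> rhom R Y C" "\<And>y. y \<in> carrier Y \<Longrightarrow> c y = \<zero>\<^bsub>C\<^esub> \<longleftrightarrow> y \<in> f ` carrier X"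
      by (rule cokernel_rep[OF X Y f]) (rule that, simp_all)
    have "f ` carrier X = {y \<in> carrier Y. c y = \<zero>\<^bsub>C\<^esub>}"
      using C(3) rlinearD(1)[OF rhom_rlinear[OF f]] by blast
    then have "is_kernel R \<A> Y C c X f"
      using mono_inj[OF that] by (intro is_kernelI[OF fg Y C(1) X f])
    then show ?thesis using C by blast
  qed
  moreover have "\<exists>W\<in>\<A>. \<exists>g\<in>rhom R W X. is_cokernel R \<A> W X g Y f"
    if X: "X \<in> \<A>" and Y: "Y \<in> \<A>" and f: "f \<in> rhom R X Y" and "is_epi R \<A> X Y f" for X Y f
  proof -
    obtain K k where K: "K \<in> \<A>" "k \<in> rhom R K X" "k ` carrier K = {x \<in> carrier X. f x = \<zero>\<^bsub>Y\<^esub>}"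
      by (rule kernel_rep[OF X Y f])
    have "is_cokernel R \<A> K X k Y f"
      using epi_surj[OF that] K(3) by (intro is_cokernelI[OF fg K(1) X Y f K(2)]) auto
    then show ?thesis using K by blast
  qed
  moreover have "\<exists>K k. is_kernel R \<A> X Y f K k" if XYf: "X \<in> \<A>" "Y \<in> \<A>" "f \<in> rhom R X Y" for X Y f
  proof -
    obtain K k where "\<And>\<B>. \<A> \<subseteq> \<B> \<Longrightarrow> \<B> \<subseteq> fg_mod R \<Longrightarrow> is_kernel R \<B> X Y f K k"
      by (rule kernel_rep[OF XYf]) (rule that, simp_all)
    from this[OF subset_refl fg] show ?thesis by blast
  qed
  moreover have "\<exists>C c. is_cokernel R \<A> X Y f C c" if XYf: "X \<in> \<A>" "Y \<in> \<A>" "f \<in> rhom R X Y" for X Y f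
  proof -
    obtain C c where "\<And>\<B>. \<A> \<subseteq> \<B> \<Longrightarrow> \<B> \<subseteq> fg_mod R \<Longrightarrow> is_cokernel R \<B> X Y f C c"
      by (rule cokernel_rep[OF XYf]) (rule that, simp_all)
    from this[OF subset_refl fg] show ?thesis by blast
  qed
  ultimately have "abelian_subcategory R \<A>"
    unfolding abelian_subcategory_def using fg has_zero_object biproduct by simp
  moreover have "is_kernel R (fg_mod R) X Y f K k"
    if X: "X \<in> \<A>" "Y \<in> \<A>" "f \<in> rhom R X Y" and K: "is_kernel R \<A> X Y f K k" for X Y f K k
  proof -
    obtain L l where L: "inj_on l (carrier L)" "l ` carrier L = {x \<in> carrier X. f x = \<zero>\<^bsub>Y\<^esub>}"
      "\<And>\<B>. \<A> \<subseteq> \<B> \<Longrightarrow> \<B> \<subseteq> fg_mod R \<Longrightarrow> is_kernel R \<B> X Y f L l"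
      by (rule kernel_rep[OF X]) (rule that, simp_all)
    obtain u v where uv: "iso_pair R K L u v" "\<And>x. x \<in> carrier K \<Longrightarrow> l (u x) = k x"
      "\<And>x. x \<in> carrier L \<Longrightarrow> k (v x) = l x"
      by (rule is_kernel_unique[OF K L(3)[OF subset_refl fg] fg]) blast
    note D = iso_pairD[OF uv(1)]
    have "inj_on k (carrier K)"
      by (rule inj_onI) (metis D(3,5) L(1) inj_onD uv(2))
    moreover have "k ` carrier K = {x \<in> carrier X. f x = \<zero>\<^bsub>Y\<^esub>}"
    proof -
      have "k ` carrier K = l ` u ` carrier K" using uv(2) by (force simp: image_image)
      then show ?thesis using D(9) L(2) by simp
    qed
    ultimately show ?thesis
      using K X(1,2) fg by (intro is_kernelI) (auto simp: is_kernel_def)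
  qed
  moreover have "is_cokernel R (fg_mod R) X Y f C c"
    if X: "X \<in> \<A>" "Y \<in> \<A>" "f \<in> rhom R X Y" and C: "is_cokernel R \<A> X Y f C c" for X Y f C c
  proof -
    obtain D d where D: "D \<in> \<A>" "d ` carrier Y = carrier D"
      "\<And>y. y \<in> carrier Y \<Longrightarrow> d y = \<zero>\<^bsub>D\<^esub> \<longleftrightarrow> y \<in> f ` carrier X"
      "\<And>\<B>. \<A> \<subseteq> \<B> \<Longrightarrow> \<B> \<subseteq> fg_mod R \<Longrightarrow> is_cokernel R \<B> X Y f D d"
      by (rule cokernel_rep[OF X]) (rule that, simp_all)
    obtain u v where uv: "iso_pair R C D u v" "\<And>y. y \<in> carrier Y \<Longrightarrow> u (c y) = d y"
      "\<And>y. y \<in> carrier Y \<Longrightarrow> v (d y) = c y"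
      by (rule is_cokernel_unique[OF C D(4)[OF subset_refl fg] fg]) blast
    note I = iso_pairD[OF uv(1)]
    have CA: "C \<in> \<A>" "c \<in> rhom R Y C" using C by (simp_all add: is_cokernel_def)
    note CM = module[OF CA(1)] and DM = module[OF D(1)]
    have "c ` carrier Y = v ` d ` carrier Y" using uv(3) by (force simp: image_image)
    then have "c ` carrier Y = carrier C" using D(2) iso_pairD(9)[OF I(7)] by simp
    moreover have "c y = \<zero>\<^bsub>C\<^esub> \<longleftrightarrow> y \<in> f ` carrier X" if "y \<in> carrier Y" for y
      using D(3)[OF that] uv(2,3)[OF that] rlinear_zero[OF CM DM I(1)] rlinear_zero[OF DM CM I(2)]
      by metis
    ultimately show ?thesis
      using X fg CA by (intro is_cokernelI) auto
  qed
  ultimately show ?thesis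
    unfolding abelian_exact_subcategory_def exact_inclusion_def by blast
qed

end

section \<open>Torsion pairs and predecessor-closed subcategories\<close>

lemma rhom_zero_iff:
  assumes "right_module R X" "right_module R Y"
  shows "rhom R X Y = {zero_hom X Y} \<longleftrightarrow> (\<forall>h. rlinear R X Y h \<longrightarrow> (\<forall>x\<in>carrier X. h x = \<zero>\<^bsub>Y\<^esub>))"
proof
  assume *: "rhom R X Y = {zero_hom X Y}"
  show "\<forall>h. rlinear R X Y h \<longrightarrow> (\<forall>x\<in>carrier X. h x = \<zero>\<^bsub>Y\<^esub>)"
  proof (intro allI impI ballI)
    fix h x assume "rlinear R X Y h" and x: "x \<in> carrier X"
    then have "restrict h (carrier X) = zero_hom X Y" using restrict_rhom[OF assms(1)] * by blast
    then have "restrict h (carrier X) x = zero_hom X Y x" by simp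
    then show "h x = \<zero>\<^bsub>Y\<^esub>" using x by (simp add: zero_hom_def)
  qed
next
  assume *: "\<forall>h. rlinear R X Y h \<longrightarrow> (\<forall>x\<in>carrier X. h x = \<zero>\<^bsub>Y\<^esub>)"
  have z: "zero_hom X Y \<in> rhom R X Y" by (rule zero_hom_rhom[OF assms])
  have "h = zero_hom X Y" if "h \<in> rhom R X Y" for h
    using * rhom_rlinear[OF that] by (intro rhom_eqI[OF that z]) (simp add: zero_hom_def)
  then show "rhom R X Y = {zero_hom X Y}" using z by blast
qed

lemma left_perp_iff:
  assumes "\<F> \<subseteq> fg_mod R"
  shows "X \<in> left_perp R \<F> \<longleftrightarrow> X \<in> fg_mod R \<and>
     (\<forall>F\<in>\<F>. \<forall>h. rlinear R X F h \<longrightarrow> (\<forall>x\<in>carrier X. h x = \<zero>\<^bsub>F\<^esub>))"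
proof -
  have "rhom R X F = {zero_hom X F} \<longleftrightarrow> (\<forall>h. rlinear R X F h \<longrightarrow> (\<forall>x\<in>carrier X. h x = \<zero>\<^bsub>F\<^esub>))"
    if "X \<in> fg_mod R" "F \<in> \<F>" for F
    by (rule rhom_zero_iff[OF fg_modD(1)[OF that(1)] fg_modD(1)[OF subsetD[OF assms that(2)]]])
  then show ?thesis by (simp add: left_perp_def cong: conj_cong ball_cong)
qed

lemma right_perp_iff:
  assumes "\<T> \<subseteq> fg_mod R"
  shows "X \<in> right_perp R \<T> \<longleftrightarrow> X \<in> fg_mod R \<and>
     (\<forall>T\<in>\<T>. \<forall>h. rlinear R T X h \<longrightarrow> (\<forall>x\<in>carrier T. h x = \<zero>\<^bsub>X\<^esub>))"
proof -
  have "rhom R T X = {zero_hom T X} \<longleftrightarrow> (\<forall>h. rlinear R T X h \<longrightarrow> (\<forall>x\<in>carrier T. h x = \<zero>\<^bsub>X\<^esub>))"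
    if "X \<in> fg_mod R" "T \<in> \<T>" for T
    by (rule rhom_zero_iff[OF fg_modD(1)[OF subsetD[OF assms that(2)]] fg_modD(1)[OF that(1)]])
  then show ?thesis by (simp add: right_perp_def cong: conj_cong ball_cong)
qed

lemma left_perp_fg: "left_perp R \<F> \<subseteq> fg_mod R"
  by (auto simp: left_perp_def)

lemma right_perp_fg: "right_perp R \<T> \<subseteq> fg_mod R"
  by (auto simp: right_perp_def)

lemma nonzero_stepI:
  assumes "X \<in> ind_mod R" "Y \<in> ind_mod R" "rlinear R X Y h" "x \<in> carrier X" "h x \<noteq> \<zero>\<^bsub>Y\<^esub>"
  shows "nonzero_step R X Y"
proof -
  note M = fg_modD(1)[OF ind_mod_fg]
  have "restrict h (carrier X) \<noteq> zero_hom X Y"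
    using assms(4,5) by (auto simp: zero_hom_def fun_eq_iff)
  then show ?thesis
    using assms(1,2) restrict_rhom[OF M[OF assms(1)] assms(3)] unfolding nonzero_step_def by blast
qed

lemma nonzero_stepE:
  assumes "nonzero_step R X Y"
  obtains h x where "X \<in> ind_mod R" "Y \<in> ind_mod R" "rlinear R X Y h" "x \<in> carrier X" "h x \<noteq> \<zero>\<^bsub>Y\<^esub>"
proof -
  obtain h where h: "X \<in> ind_mod R" "Y \<in> ind_mod R" "h \<in> rhom R X Y" "h \<noteq> zero_hom X Y"
    using assms unfolding nonzero_step_def by blast
  note M = fg_modD(1)[OF ind_mod_fg]
  have "\<exists>x\<in>carrier X. h x \<noteq> \<zero>\<^bsub>Y\<^esub>"
    using h(4) rhom_eqI[OF h(3) zero_hom_rhom[OF M[OF h(1)] M[OF h(2)]]]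
    by (auto simp: zero_hom_def)
  then show thesis using that h rhom_rlinear by blast
qed

lemma pred_closed_step:
  assumes "pred_closed R \<C>" "Y \<in> \<C>" "X \<in> ind_mod R" "Y \<in> ind_mod R"
    and "rlinear R X Y h" "x \<in> carrier X" "h x \<noteq> \<zero>\<^bsub>Y\<^esub>"
  shows "X \<in> \<C>"
  using assms(1-4) nonzero_stepI[OF assms(3-)]
  unfolding pred_closed_def predecessor_def by blast

lemma pred_closedI:
  assumes "\<And>X Y. nonzero_step R X Y \<Longrightarrow> Y \<in> \<C> \<Longrightarrow> X \<in> \<C>"
  shows "pred_closed R \<C>"
proof -
  have "X \<in> \<C>" if "(nonzero_step R)\<^sup>*\<^sup>* X Y" "Y \<in> \<C>" for X Y
    using that by (induction rule: converse_rtranclp_induct) (use assms in blast)+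
  then show ?thesis unfolding pred_closed_def predecessor_def by blast
qed

text \<open>A non-zero map to M stays non-zero in a coordinate of the direct sum containing M, so
  its source precedes a member of \<open>\<C>\<close>; conversely the indecomposable summands of M
  embed into M. Summands have disappeared from the criterion, so it passes to submodules by
  composition.\<close>

lemma mem_add_closure_iff:
  assumes "right_artinian R" "\<C> \<subseteq> ind_mod R" "pred_closed R \<C>"
  shows "M \<in> add_closure R \<C> \<longleftrightarrow> M \<in> fg_mod R \<and>
     (\<forall>Y\<in>ind_mod R. \<forall>h. rlinear R Y M h \<longrightarrow> (\<exists>y\<in>carrier Y. h y \<noteq> \<zero>\<^bsub>M\<^esub>) \<longrightarrow> Y \<in> \<C>)"
proof
  have fg: "\<C> \<subseteq> fg_mod R" using assms(2) ind_mod_fg by blast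
  {
    assume M: "M \<in> add_closure R \<C>"
    show "M \<in> fg_mod R \<and>
      (\<forall>Y\<in>ind_mod R. \<forall>h. rlinear R Y M h \<longrightarrow> (\<exists>y\<in>carrier Y. h y \<noteq> \<zero>\<^bsub>M\<^esub>) \<longrightarrow> Y \<in> \<C>)"
    proof (intro conjI ballI allI impI)
      show "M \<in> fg_mod R" using M add_closure_fg by blast
      fix Y h assume Y: "Y \<in> ind_mod R" "rlinear R Y M h" "\<exists>y\<in>carrier Y. h y \<noteq> \<zero>\<^bsub>M\<^esub>"
      then obtain y where y: "y \<in> carrier Y" "h y \<noteq> \<zero>\<^bsub>M\<^esub>" by blast
      obtain Z g where Z: "Z \<in> \<C>" "rlinear R Y Z g" "g y \<noteq> \<zero>\<^bsub>Z\<^esub>"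
        by (rule add_closure_detect[OF M fg Y(2) y])
      have "Z \<in> ind_mod R" using Z(1) assms(2) by blast
      then show "Y \<in> \<C>" by (rule pred_closed_step[OF assms(3) Z(1) Y(1) _ Z(2) y(1) Z(3)])
    qed
  }
  assume M: "M \<in> fg_mod R \<and>
    (\<forall>Y\<in>ind_mod R. \<forall>h. rlinear R Y M h \<longrightarrow> (\<exists>y\<in>carrier Y. h y \<noteq> \<zero>\<^bsub>M\<^esub>) \<longrightarrow> Y \<in> \<C>)"
  show "M \<in> add_closure R \<C>"
  proof (rule add_closure_decompose[OF assms(1) _ fg])
    fix Y f assume Y: "Y \<in> ind_mod R" "rlinear R Y M f" "inj_on f (carrier Y)"
    obtain y where y: "y \<in> carrier Y" "y \<noteq> \<zero>\<^bsub>Y\<^esub>" by (rule ind_mod_nonzero[OF Y(1)])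
    have "right_module R M" using M fg_modD(1) by blast
    from rlinear_inj_iff[OF fg_modD(1)[OF ind_mod_fg[OF Y(1)]] this Y(2)] have "f y \<noteq> \<zero>\<^bsub>M\<^esub>"
      using Y(3) y by blast
    then show "Y \<in> \<C>" using M Y(1,2) y(1) by blast
  qed (use M in blast)
qed

text \<open>The identity of an indecomposable in the additive closure is a non-zero map, so the
  criterion applies to the module itself. Thus \<open>\<C>\<close> can be recovered from its
  additive closure.\<close>

lemma add_closure_Int_ind:
  assumes "right_artinian R" "\<C> \<subseteq> ind_mod R" "pred_closed R \<C>"
  shows "add_closure R \<C> \<inter> ind_mod R = \<C>"
proof
  show "\<C> \<subseteq> add_closure R \<C> \<inter> ind_mod R"
    using assms(2) add_closure_superset[of \<C> R] ind_mod_fg by blast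
  show "add_closure R \<C> \<inter> ind_mod R \<subseteq> \<C>"
  proof
    fix Y assume Y: "Y \<in> add_closure R \<C> \<inter> ind_mod R"
    then obtain y where "y \<in> carrier Y" "y \<noteq> \<zero>\<^bsub>Y\<^esub>" using ind_mod_nonzero by blast
    then show "Y \<in> \<C>" using Y rlinear_id mem_add_closure_iff[OF assms, of Y] by blast
  qed
qed

lemma ind_torsion:
  assumes "right_artinian R" "\<C> \<subseteq> ind_mod R" "pred_closed R \<C>" "Y \<in> ind_mod R" "Y \<notin> \<C>"
  shows "Y \<in> left_perp R (add_closure R \<C>)"
  unfolding left_perp_iff[OF add_closure_fg]
  using assms(4,5) mem_add_closure_iff[OF assms(1-3)] ind_mod_fg by blast

text \<open>Indecomposables outside \<open>\<C>\<close> are torsion. If a module receives only zero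
  maps from torsion modules, the indecomposables with a non-zero map to it all belong to
  \<open>\<C>\<close>, which is the criterion for the additive closure.\<close>

lemma split_torsion_pair_of:
  assumes "right_artinian R" "\<C> \<subseteq> ind_mod R" "pred_closed R \<C>"
  shows "split_torsion_pair R (left_perp R (add_closure R \<C>)) (add_closure R \<C>)"
proof -
  let ?F = "add_closure R \<C>" and ?T = "left_perp R (add_closure R \<C>)"
  have "?F = right_perp R ?T"
  proof
    show "?F \<subseteq> right_perp R ?T"
      using subsetD[OF add_closure_fg[of R \<C>]]
      by (auto simp: left_perp_iff[OF add_closure_fg] right_perp_iff[OF left_perp_fg])
    show "right_perp R ?T \<subseteq> ?F"
    proof
      fix X assume "X \<in> right_perp R ?T"
      then have X: "X \<in> fg_mod R" "\<And>T h x. T \<in> ?T \<Longrightarrow> rlinear R T X h \<Longrightarrow> x \<in> carrier T \<Longrightarrow> h x = \<zero>\<^bsub>X\<^esub>"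
        by (auto simp: right_perp_iff[OF left_perp_fg])
      show "X \<in> ?F"
        unfolding mem_add_closure_iff[OF assms] using X ind_torsion[OF assms] by blast
    qed
  qed
  moreover have "ind_mod R \<subseteq> ?T \<union> ?F"
    using ind_torsion[OF assms] add_closure_Int_ind[OF assms] by blast
  ultimately show ?thesis by (simp add: split_torsion_pair_def torsion_pair_def)
qed

text \<open>The kernel of the surjection is a submodule of X and so belongs to the additive closure.
  Its embedding has a cokernel there, which by exactness is a cokernel among all modules and
  therefore isomorphic to Y.\<close>

lemma quotient_closed_add_closure:
  assumes "right_artinian R" "\<C> \<subseteq> ind_mod R" "pred_closed R \<C>"
    and ab: "abelian_exact_subcategory R (add_closure R \<C>)"
  shows "quotient_closed R (add_closure R \<C>)"
  unfolding quotient_closed_def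
proof (intro ballI impI)
  let ?F = "add_closure R \<C>"
  note mem = mem_add_closure_iff[OF assms(1-3)]
  fix X Y f assume X: "X \<in> ?F" and Y: "Y \<in> fg_mod R" and f: "f \<in> rhom R X Y" "f ` carrier X = carrier Y"
  have Xfg: "X \<in> fg_mod R" using X mem by blast
  note XM = fg_modD[OF Xfg] and YM = fg_modD(1)[OF Y] and fL = rhom_rlinear[OF f(1)]
  note ker = kernel_submodule[OF XM(1) YM fL]
  obtain K k where K: "K \<in> fg_mod R" "rlinear R K X k" "inj_on k (carrier K)"
    "k ` carrier K = {x \<in> carrier X. f x = \<zero>\<^bsub>Y\<^esub>}"
    by (rule restrict_fg_rep[OF XM(1) ker right_module.submodule_fin_gen[OF XM(1) assms(1) XM(2) ker]])
  note KM = fg_modD(1)[OF K(1)]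
  have "K \<in> ?F"
  proof (unfold mem, intro conjI ballI allI impI K(1))
    fix Z h assume Z: "Z \<in> ind_mod R" "rlinear R Z K h" "\<exists>z\<in>carrier Z. h z \<noteq> \<zero>\<^bsub>K\<^esub>"
    then obtain z where z: "z \<in> carrier Z" "h z \<noteq> \<zero>\<^bsub>K\<^esub>" by blast
    then have "k (h z) \<noteq> \<zero>\<^bsub>X\<^esub>"
      using K(3) rlinear_inj_iff[OF KM XM(1) K(2)] rlinearD(1)[OF Z(2)] by blast
    then show "Z \<in> \<C>" using X mem Z(1) rlinear_comp[OF Z(2) K(2)] z(1) by blast
  qed
  let ?k = "restrict k (carrier K)"
  have k: "?k \<in> rhom R K X" by (rule restrict_rhom[OF KM K(2)])
  obtain C c where C: "is_cokernel R ?F K X ?k C c"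
    using ab \<open>K \<in> ?F\<close> X k unfolding abelian_exact_subcategory_def abelian_subcategory_def by blast
  then have C': "is_cokernel R (fg_mod R) K X ?k C c"
    using ab \<open>K \<in> ?F\<close> X k unfolding abelian_exact_subcategory_def exact_inclusion_def by blast
  have CF: "C \<in> ?F" using C by (simp add: is_cokernel_def)
  have "?k ` carrier K = {x \<in> carrier X. f x = \<zero>\<^bsub>Y\<^esub>}" using K(4) by simp
  then have "is_cokernel R (fg_mod R) K X ?k Y f"
    by (intro is_cokernelI[OF subset_refl K(1) Xfg Y f(1) k f(2)]) blast
  then obtain u v where uv: "iso_pair R C Y u v" by (rule is_cokernel_unique[OF C' _ subset_refl])
  note I = iso_pairD[OF uv]
  have CM: "right_module R C" using CF add_closure_fg fg_modD(1) by blast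
  show "Y \<in> ?F"
  proof (unfold mem, intro conjI ballI allI impI Y)
    fix Z h assume Z: "Z \<in> ind_mod R" "rlinear R Z Y h" "\<exists>z\<in>carrier Z. h z \<noteq> \<zero>\<^bsub>Y\<^esub>"
    then obtain z where z: "z \<in> carrier Z" "h z \<noteq> \<zero>\<^bsub>Y\<^esub>" by blast
    then have "v (h z) \<noteq> \<zero>\<^bsub>C\<^esub>"
      using I(4)[of "h z"] rlinear_zero[OF CM YM I(1)] rlinearD(1)[OF Z(2)] by metis
    then show "Z \<in> \<C>" using CF mem Z(1) rlinear_comp[OF Z(2) I(2)] z(1) by blast
  qed
qed

section \<open>From torsion pairs to subcategories\<close>

lemma zero_module_exists:
  assumes "ring R"
  obtains Z where "Z \<in> fg_mod R" "carrier Z = {\<zero>\<^bsub>Z\<^esub>}"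
proof -
  interpret ring R by fact
  interpret reg: right_module R "mult_rmod R (carrier R)" by (rule regular_module)
  have "\<exists>S. finite S \<and> S \<subseteq> carrier (mult_rmod R (carrier R)) \<and>
      rspan R (mult_rmod R (carrier R)) S = {\<zero>\<^bsub>mult_rmod R (carrier R)\<^esub>}"
    using reg.rspan_empty by (intro exI[of _ "{}"]) simp
  then have fg: "fin_gen R ((mult_rmod R (carrier R))\<lparr>carrier := {\<zero>\<^bsub>mult_rmod R (carrier R)\<^esub>}\<rparr>)"
    unfolding reg.fin_gen_restrict_iff[OF reg.zero_submodule] .
  obtain Z k where Z: "Z \<in> fg_mod R" "inj_on k (carrier Z)" "k ` carrier Z = {\<zero>\<^bsub>mult_rmod R (carrier R)\<^esub>}"
    by (rule restrict_fg_rep[OF reg.right_module_axioms reg.zero_submodule fg])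
  interpret Z: right_module R Z by (rule fg_modD[OF Z(1)])
  have "x = \<zero>\<^bsub>Z\<^esub>" if "x \<in> carrier Z" for x
    using Z(2,3) that Z.zero_closed by (metis image_eqI inj_onD singletonD)
  then show thesis using that Z(1) Z.zero_closed by blast
qed

lemma torsion_pairD:
  assumes "torsion_pair R \<T> \<F>"
  shows "\<T> \<subseteq> fg_mod R" "\<F> \<subseteq> fg_mod R"
    "\<lbrakk>T \<in> \<T>; F \<in> \<F>; rlinear R T F h; x \<in> carrier T\<rbrakk> \<Longrightarrow> h x = \<zero>\<^bsub>F\<^esub>"
    "\<lbrakk>X \<in> fg_mod R; \<And>T h x. \<lbrakk>T \<in> \<T>; rlinear R T X h; x \<in> carrier T\<rbrakk> \<Longrightarrow> h x = \<zero>\<^bsub>X\<^esub>\<rbrakk> \<Longrightarrow> X \<in> \<F>"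
    "\<lbrakk>X \<in> fg_mod R; \<And>F h x. \<lbrakk>F \<in> \<F>; rlinear R X F h; x \<in> carrier X\<rbrakk> \<Longrightarrow> h x = \<zero>\<^bsub>F\<^esub>\<rbrakk> \<Longrightarrow> X \<in> \<T>"
proof -
  have T: "\<T> = left_perp R \<F>" and F: "\<F> = right_perp R \<T>"
    using assms unfolding torsion_pair_def by (rule conjunct1, rule conjunct2)
  show T_fg: "\<T> \<subseteq> fg_mod R" unfolding T by (rule left_perp_fg)
  show F_fg: "\<F> \<subseteq> fg_mod R" unfolding F by (rule right_perp_fg)
  note T' = left_perp_iff[OF F_fg, folded T] and F' = right_perp_iff[OF T_fg, folded F]
  show "\<lbrakk>T \<in> \<T>; F \<in> \<F>; rlinear R T F h; x \<in> carrier T\<rbrakk> \<Longrightarrow> h x = \<zero>\<^bsub>F\<^esub>"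
    unfolding T' by simp
  show "\<lbrakk>X \<in> fg_mod R; \<And>T h x. \<lbrakk>T \<in> \<T>; rlinear R T X h; x \<in> carrier T\<rbrakk> \<Longrightarrow> h x = \<zero>\<^bsub>X\<^esub>\<rbrakk> \<Longrightarrow> X \<in> \<F>"
    unfolding F' by simp
  show "\<lbrakk>X \<in> fg_mod R; \<And>F h x. \<lbrakk>F \<in> \<F>; rlinear R X F h; x \<in> carrier X\<rbrakk> \<Longrightarrow> h x = \<zero>\<^bsub>F\<^esub>\<rbrakk> \<Longrightarrow> X \<in> \<T>"
    unfolding T' by simp
qed

text \<open>Submodules and products are torsion-free by composing with the embedding and with the
  projections; quotients are covered by the hypothesis.\<close>

lemma torsion_free_closed_class:
  assumes "ring R" "right_artinian R" "torsion_pair R \<T> \<F>" "quotient_closed R \<F>"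
  shows "closed_class R \<F>"
proof
  note TP = torsion_pairD[OF assms(3)]
  show "right_artinian R" "\<F> \<subseteq> fg_mod R" by fact (rule TP(2))
  obtain Z where Z: "Z \<in> fg_mod R" "carrier Z = {\<zero>\<^bsub>Z\<^esub>}" by (rule zero_module_exists[OF assms(1)])
  have "Z \<in> \<F>"
    by (rule TP(4)[OF Z(1)]) (use Z(2) rlinearD(1) in fastforce)
  then show "\<F> \<noteq> {}" by blast
  fix X Y :: "'a fgmodule" and f
  assume X: "X \<in> \<F>"
  note XM = fg_modD(1)[OF subsetD[OF TP(2) X]]
  {
    assume Y: "Y \<in> fg_mod R" "rlinear R Y X f" "inj_on f (carrier Y)"
    show "Y \<in> \<F>"
    proof (rule TP(4)[OF Y(1)])
      fix T h t assume T: "T \<in> \<T>" "rlinear R T Y h" "t \<in> carrier T"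
      have "f (h t) = \<zero>\<^bsub>X\<^esub>" by (rule TP(3)[OF T(1) X rlinear_comp[OF T(2) Y(2)] T(3)])
      then show "h t = \<zero>\<^bsub>Y\<^esub>"
        using Y(3) rlinear_inj_iff[OF fg_modD(1)[OF Y(1)] XM Y(2)] rlinearD(1)[OF T(2,3)] by blast
    qed
  }
  {
    assume Y: "Y \<in> fg_mod R" "rlinear R X Y f" "f ` carrier X = carrier Y"
    have "restrict f (carrier X) ` carrier X = carrier Y" using Y(3) by simp
    then show "Y \<in> \<F>"
      using assms(4) X Y(1) restrict_rhom[OF XM Y(2)] unfolding quotient_closed_def by blast
  }
  fix P :: "'a fgmodule"
  assume Y: "Y \<in> \<F>" and P: "P \<in> fg_mod R" "rmod_iso R (prod_rmod X Y) P"
  note YM = fg_modD(1)[OF subsetD[OF TP(2) Y]]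
  note D = prod_module[OF XM YM] and lin = rlinear_prod[OF XM YM]
  obtain f g where fg: "iso_pair R (prod_rmod X Y) P f g" using P(2) rmod_iso_iff[OF D] by blast
  note I = iso_pairD[OF fg]
  show "P \<in> \<F>"
  proof (rule TP(4)[OF P(1)])
    fix T h t assume T: "T \<in> \<T>" "rlinear R T P h" "t \<in> carrier T"
    have "fst (g (h t)) = \<zero>\<^bsub>X\<^esub>" "snd (g (h t)) = \<zero>\<^bsub>Y\<^esub>"
      by (rule TP(3)[OF T(1) X rlinear_comp[OF rlinear_comp[OF T(2) I(2)] lin(1)] T(3)],
          rule TP(3)[OF T(1) Y rlinear_comp[OF rlinear_comp[OF T(2) I(2)] lin(2)] T(3)])
    then have "g (h t) = \<zero>\<^bsub>prod_rmod X Y\<^esub>" by (simp add: prod_eq_iff)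
    then show "h t = \<zero>\<^bsub>P\<^esub>"
      using I(4)[OF rlinearD(1)[OF T(2,3)]] rlinear_zero[OF D fg_modD(1)[OF P(1)] I(1)] by simp
  qed
qed

text \<open>Splitting gives closure under predecessors: the source of a non-zero map to a
  torsion-free module is not torsion, and an indecomposable that is not torsion is
  torsion-free.\<close>

lemma torsion_free_ind:
  assumes "ring R" "right_artinian R" "split_torsion_pair R \<T> \<F>" "quotient_closed R \<F>"
  shows "\<F> \<inter> ind_mod R \<in> abelian_pred_closed_subcategories R"
    and "add_closure R (\<F> \<inter> ind_mod R) = \<F>"
proof -
  let ?C = "\<F> \<inter> ind_mod R"
  have tp: "torsion_pair R \<T> \<F>" and split: "ind_mod R \<subseteq> \<T> \<union> \<F>"
    using assms(3) by (simp_all add: split_torsion_pair_def)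
  note TP = torsion_pairD[OF tp]
  interpret closed_class R \<F> by (rule torsion_free_closed_class[OF assms(1,2) tp assms(4)])
  have C_fg: "?C \<subseteq> fg_mod R" using fg by blast
  show eq: "add_closure R ?C = \<F>"
  proof
    show "add_closure R ?C \<subseteq> \<F>"
    proof
      fix M assume M: "M \<in> add_closure R ?C"
      then have "M \<in> fg_mod R" using add_closure_fg by blast
      then show "M \<in> \<F>"
      proof (rule TP(4))
        fix T h t assume T: "T \<in> \<T>" "rlinear R T M h" "t \<in> carrier T"
        show "h t = \<zero>\<^bsub>M\<^esub>"
        proof (rule ccontr)
          assume "h t \<noteq> \<zero>\<^bsub>M\<^esub>"
          then obtain Z g where "Z \<in> ?C" "rlinear R T Z g" "g t \<noteq> \<zero>\<^bsub>Z\<^esub>"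
            by (rule add_closure_detect[OF M C_fg T(2,3)])
          then show False using TP(3) T(1,3) by blast
        qed
      qed
    qed
    show "\<F> \<subseteq> add_closure R ?C" by (rule subset_add_closure)
  qed
  have "iso_closed R ?C" by (rule ind_iso_closed)
  moreover have "pred_closed R ?C"
  proof (rule pred_closedI)
    fix X Y assume step: "nonzero_step R X Y" and Y: "Y \<in> ?C"
    obtain h x where "X \<in> ind_mod R" "rlinear R X Y h" "x \<in> carrier X" "h x \<noteq> \<zero>\<^bsub>Y\<^esub>"
      by (rule nonzero_stepE[OF step])
    then show "X \<in> ?C" using split TP(3) Y by blast
  qed
  moreover have "abelian_exact_subcategory R (add_closure R ?C)" unfolding eq by (rule abelian_exact)
  ultimately show "?C \<in> abelian_pred_closed_subcategories R"
    by (simp add: abelian_pred_closed_subcategories_def)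
qed

theorem torsion_pair_of_bij:
  assumes "ring R" "right_artinian R"
  shows "bij_betw (torsion_pair_of R) (abelian_pred_closed_subcategories R) (split_quotient_closed_torsion_pairs R)"
proof (rule bij_betw_imageI)
  show "inj_on (torsion_pair_of R) (abelian_pred_closed_subcategories R)"
  proof (rule inj_onI)
    fix \<C> \<D> assume C: "\<C> \<in> abelian_pred_closed_subcategories R" and D: "\<D> \<in> abelian_pred_closed_subcategories R"
      and "torsion_pair_of R \<C> = torsion_pair_of R \<D>"
    then have "add_closure R \<C> = add_closure R \<D>" by (simp add: torsion_pair_of_def)
    moreover have "add_closure R \<C> \<inter> ind_mod R = \<C>" "add_closure R \<D> \<inter> ind_mod R = \<D>"
      using C D add_closure_Int_ind[OF assms(2)] by (simp_all add: abelian_pred_closed_subcategories_def)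
    ultimately show "\<C> = \<D>" by metis
  qed
  show "torsion_pair_of R ` abelian_pred_closed_subcategories R = split_quotient_closed_torsion_pairs R"
  proof
    show "torsion_pair_of R ` abelian_pred_closed_subcategories R \<subseteq> split_quotient_closed_torsion_pairs R"
      using split_torsion_pair_of[OF assms(2)] quotient_closed_add_closure[OF assms(2)]
      by (simp add: image_subset_iff abelian_pred_closed_subcategories_def
          split_quotient_closed_torsion_pairs_def torsion_pair_of_def)
    show "split_quotient_closed_torsion_pairs R \<subseteq> torsion_pair_of R ` abelian_pred_closed_subcategories R"
    proof
      fix p assume "p \<in> split_quotient_closed_torsion_pairs R"
      then obtain \<T> \<F> where p: "p = (\<T>, \<F>)" and split: "split_torsion_pair R \<T> \<F>" and q: "quotient_closed R \<F>"
        by (auto simp: split_quotient_closed_torsion_pairs_def)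
      \<comment> \<open>A torsion class is the left orthogonal of its torsion-free class, so the
        second component determines the pair.\<close>
      have "p = torsion_pair_of R (\<F> \<inter> ind_mod R)"
        using split unfolding p torsion_pair_of_def torsion_free_ind(2)[OF assms split q]
          split_torsion_pair_def torsion_pair_def by blast
      then show "p \<in> torsion_pair_of R ` abelian_pred_closed_subcategories R"
        by (rule image_eqI) (rule torsion_free_ind(1)[OF assms split q])
    qed
  qed
qed

section \<open>Triangular decompositions and hereditary injectivity\<close>

text \<open>\<open>injective_rmod\<close> tests only objects of \<open>fg_mod\<close>; finitely
  generated modules on other carrier types are replaced by isomorphic objects.\<close>

lemma injective_extend:
  assumes "injective_rmod R Q" "right_module R M" "fin_gen R M" "right_module R N" "fin_gen R N"
    and "rlinear R M N f" "inj_on f (carrier M)" "rlinear R M Q g"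
  obtains h where "rlinear R N Q h" "\<And>x. x \<in> carrier M \<Longrightarrow> h (f x) = g x"
proof -
  obtain X u u' where X: "X \<in> fg_mod R" "iso_pair R M X u u'" by (rule fg_rep[OF assms(2,3)])
  obtain Y v v' where Y: "Y \<in> fg_mod R" "iso_pair R N Y v v'" by (rule fg_rep[OF assms(4,5)])
  note U = iso_pairD[OF X(2)] and V = iso_pairD[OF Y(2)]
  note XM = fg_modD(1)[OF X(1)] and YM = fg_modD(1)[OF Y(1)]
  let ?f = "restrict (\<lambda>x. v (f (u' x))) (carrier X)" and ?g = "restrict (\<lambda>x. g (u' x)) (carrier X)"
  have f: "?f \<in> rhom R X Y"
    by (rule restrict_rhom[OF XM rlinear_comp[OF rlinear_comp[OF U(2) assms(6)] V(1)]])
  have g: "?g \<in> rhom R X Q" by (rule restrict_rhom[OF XM rlinear_comp[OF U(2) assms(8)]])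
  have "inj_on ?f (carrier X)"
  proof (rule inj_onI)
    fix x y assume xy: "x \<in> carrier X" "y \<in> carrier X" "?f x = ?f y"
    then have "v (f (u' x)) = v (f (u' y))" by (simp only: restrict_apply if_True)
    then have "f (u' x) = f (u' y)"
      by (rule inj_onD[OF V(8)]) (simp_all add: rlinearD(1)[OF assms(6)] U(6) xy)
    then have "u' x = u' y" by (rule inj_onD[OF assms(7)]) (simp_all add: U(6) xy)
    then show "x = y" using U(4)[OF xy(1)] U(4)[OF xy(2)] by argo
  qed
  then obtain h where h: "h \<in> rhom R Y Q" "compose (carrier X) h ?f = ?g"
    using assms(1) X(1) Y(1) f g unfolding injective_rmod_def by blast
  show thesis
  proof (rule that)
    show "rlinear R N Q (\<lambda>x. h (v x))" by (rule rlinear_comp[OF V(1) rhom_rlinear[OF h(1)]])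
    fix x assume x: "x \<in> carrier M"
    have "compose (carrier X) h ?f (u x) = ?g (u x)" using h(2) by simp
    then show "h (v (f x)) = g x" using U(3)[OF x] U(5)[OF x] by (simp add: compose_def)
  qed
qed

text \<open>With f = 1 - e this is a ring of triangular matrices: diagonal entries from e R e and f
  R f, off-diagonal entries from f R e, and zero in the corner e R f.\<close>

locale triangular = ring R for R :: "('a, 'r) ring_scheme" (structure) +
  fixes e :: 'a
  assumes e_closed [simp]: "e \<in> carrier R"
    and e_idem [simp]: "e \<otimes> e = e"
    and upper_zero: "a \<in> carrier R \<Longrightarrow> e \<otimes> a \<otimes> (\<one> \<ominus> e) = \<zero>"
begin

definition e' :: 'a where "e' = \<one> \<ominus> e"

abbreviation corner :: "('a, 'r) ring_scheme" where "corner \<equiv> corner_ring R e"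

lemma e'_closed [simp]: "e' \<in> carrier R"
  by (simp add: e'_def)

lemma e_e' [simp]: "e \<otimes> e' = \<zero>" and e'_e [simp]: "e' \<otimes> e = \<zero>"
  by (simp_all add: e'_def minus_eq r_distr l_distr r_minus l_minus r_neg)

lemma e'_idem [simp]: "e' \<otimes> e' = e'"
  using e_e' by (simp add: e'_def minus_eq l_distr l_minus)

lemma e_add_e' [simp]: "e \<oplus> e' = \<one>"
proof -
  have "e \<oplus> (\<one> \<oplus> \<ominus> e) = \<one> \<oplus> (e \<oplus> \<ominus> e)" by (rule a_lcomm) simp_all
  then show ?thesis by (simp add: e'_def minus_eq r_neg)
qed

text \<open>It makes left multiplication by e a ring homomorphism from R onto the corner.\<close>

lemma e_act:
  assumes a: "a \<in> carrier R"
  shows "e \<otimes> a \<otimes> e = e \<otimes> a"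
proof -
  have "e \<otimes> a \<otimes> (e \<oplus> e') = e \<otimes> a \<otimes> e \<oplus> e \<otimes> a \<otimes> e'" using a by (intro r_distr) simp_all
  then show ?thesis using a upper_zero[OF a, folded e'_def] by simp
qed

lemma e_a_e': "a \<in> carrier R \<Longrightarrow> e \<otimes> a \<otimes> e' = \<zero>"
  using upper_zero by (simp add: e'_def)

lemma corner_simps [simp]:
  "\<one>\<^bsub>corner\<^esub> = e" "\<zero>\<^bsub>corner\<^esub> = \<zero>" "x \<oplus>\<^bsub>corner\<^esub> y = x \<oplus> y" "x \<otimes>\<^bsub>corner\<^esub> y = x \<otimes> y"
  by (simp_all add: corner_ring_def)

lemma peirce_iff:
  assumes "f \<in> carrier R" "f \<otimes> f = f" "g \<in> carrier R" "g \<otimes> g = g"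
  shows "x \<in> peirce R f g \<longleftrightarrow> x \<in> carrier R \<and> f \<otimes> x = x \<and> x \<otimes> g = x"
proof
  assume "x \<in> peirce R f g"
  then obtain a where a: "a \<in> carrier R" "x = f \<otimes> a \<otimes> g" by (auto simp: peirce_def)
  have "f \<otimes> (f \<otimes> a \<otimes> g) = (f \<otimes> f) \<otimes> a \<otimes> g" using a(1) assms(1,3) by (simp only: m_assoc m_closed)
  moreover have "f \<otimes> a \<otimes> g \<otimes> g = f \<otimes> a \<otimes> (g \<otimes> g)" using a(1) assms(1,3) by (simp only: m_assoc m_closed)
  ultimately show "x \<in> carrier R \<and> f \<otimes> x = x \<and> x \<otimes> g = x" using a assms by simp
next
  assume "x \<in> carrier R \<and> f \<otimes> x = x \<and> x \<otimes> g = x"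
  then show "x \<in> peirce R f g" unfolding peirce_def by (intro image_eqI[of _ _ x]) auto
qed

lemma corner_carrier: "x \<in> carrier corner \<longleftrightarrow> x \<in> carrier R \<and> e \<otimes> x = x \<and> x \<otimes> e = x"
  by (simp add: corner_ring_def peirce_iff)

lemma corner_subset: "x \<in> carrier corner \<Longrightarrow> x \<in> carrier R"
  by (simp add: corner_carrier)

lemma corner_e_act: "a \<in> carrier R \<Longrightarrow> e \<otimes> a \<in> carrier corner"
  by (simp add: corner_carrier e_act m_assoc[symmetric])

lemma corner_ring: "ring corner"
proof (rule ringI)
  show "abelian_group corner"
  proof (rule abelian_groupI)
    fix x assume x: "x \<in> carrier corner"
    then have "\<ominus> x \<in> carrier corner" "\<ominus> x \<oplus>\<^bsub>corner\<^esub> x = \<zero>\<^bsub>corner\<^esub>"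
      by (simp_all add: corner_carrier r_minus l_minus l_neg)
    then show "\<exists>y\<in>carrier corner. y \<oplus>\<^bsub>corner\<^esub> x = \<zero>\<^bsub>corner\<^esub>" by blast
  qed (simp_all add: corner_carrier r_distr l_distr a_ac)
  show "monoid corner"
  proof (rule monoidI)
    fix x y assume "x \<in> carrier corner" "y \<in> carrier corner"
    then show "x \<otimes>\<^bsub>corner\<^esub> y \<in> carrier corner"
      by (simp add: corner_carrier) (metis m_assoc e_closed)
  qed (simp_all add: corner_carrier m_assoc)
qed (simp_all add: corner_carrier l_distr r_distr)

definition supported :: "('a, 'm) rmodule \<Rightarrow> bool" where
  "supported M \<longleftrightarrow> (\<forall>x\<in>carrier M. x \<triangleleft>\<^bsub>M\<^esub> e' = \<zero>\<^bsub>M\<^esub>)"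

text \<open>Restriction of scalars along the homomorphism from R onto the corner that sends a to e
  a.\<close>

definition inflation :: "('a, 'm) rmodule \<Rightarrow> ('a, 'm) rmodule" where
  "inflation Y = Y\<lparr>ract := (\<lambda>y a. y \<triangleleft>\<^bsub>Y\<^esub> (e \<otimes> a))\<rparr>"

end

text \<open>Since e acts as the identity, the same record is a module over R and over the corner,
  with the same submodules. Injectivity over the corner thereby becomes usable for
  R-modules.\<close>

locale supported_module = triangular R e + right_module R M
  for R :: "('a, 'r) ring_scheme" (structure) and e :: 'a and M :: "('a, 'm) rmodule" +
  assumes supported: "supported M"
begin

lemma act_e: "x \<in> carrier M \<Longrightarrow> x \<triangleleft>\<^bsub>M\<^esub> e = x"
proof -
  assume x: "x \<in> carrier M"
  have "x = x \<triangleleft>\<^bsub>M\<^esub> (e \<oplus> e')" using x by (simp add: ract_one)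
  also have "\<dots> = x \<triangleleft>\<^bsub>M\<^esub> e \<oplus>\<^bsub>M\<^esub> x \<triangleleft>\<^bsub>M\<^esub> e'" using x by (simp only: ract_add e_closed e'_closed)
  also have "\<dots> = x \<triangleleft>\<^bsub>M\<^esub> e" using x supported by (simp add: supported_def ract_closed)
  finally show ?thesis by simp
qed

lemma act_corner: "x \<in> carrier M \<Longrightarrow> a \<in> carrier R \<Longrightarrow> x \<triangleleft>\<^bsub>M\<^esub> (e \<otimes> a) = x \<triangleleft>\<^bsub>M\<^esub> a"
  by (simp add: ract_mult act_e)

lemma corner_module: "right_module corner M"
proof -
  interpret S: ring corner by (rule corner_ring)
  show ?thesis
    by unfold_locales (simp_all add: corner_subset ract_closed ract_add add_ract ract_mult act_e)
qed

lemma corner_submodule_iff: "right_submodule corner M N \<longleftrightarrow> right_submodule R M N"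
proof -
  have "(\<forall>x\<in>N. \<forall>a\<in>carrier corner. x \<triangleleft>\<^bsub>M\<^esub> a \<in> N) \<longleftrightarrow> (\<forall>x\<in>N. \<forall>a\<in>carrier R. x \<triangleleft>\<^bsub>M\<^esub> a \<in> N)"
    if "N \<subseteq> carrier M"
  proof
    assume *: "\<forall>x\<in>N. \<forall>a\<in>carrier corner. x \<triangleleft>\<^bsub>M\<^esub> a \<in> N"
    show "\<forall>x\<in>N. \<forall>a\<in>carrier R. x \<triangleleft>\<^bsub>M\<^esub> a \<in> N"
    proof (intro ballI)
      fix x a assume x: "x \<in> N" and a: "a \<in> carrier R"
      have "x \<triangleleft>\<^bsub>M\<^esub> (e \<otimes> a) \<in> N" using * x corner_e_act[OF a] by blast
      then show "x \<triangleleft>\<^bsub>M\<^esub> a \<in> N" using act_corner[OF subsetD[OF that x] a] by simp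
    qed
  qed (use corner_subset in blast)
  then show ?thesis
    unfolding right_module.submodule_iff[OF corner_module] submodule_iff by blast
qed

lemma corner_fin_gen_iff: "fin_gen corner M \<longleftrightarrow> fin_gen R M"
  by (simp add: fin_gen_def corner_submodule_iff)

end

context triangular
begin

lemma supported_moduleI: "right_module R M \<Longrightarrow> supported M \<Longrightarrow> supported_module R e M"
  by (simp add: supported_module_def supported_module_axioms_def triangular_axioms)

lemma corner_rlinear_iff:
  assumes "right_module R M" "supported M" "right_module R N" "supported N"
  shows "rlinear corner M N h \<longleftrightarrow> rlinear R M N h"
proof -
  interpret M: supported_module R e M by (rule supported_moduleI[OF assms(1,2)])
  interpret N: supported_module R e N by (rule supported_moduleI[OF assms(3,4)])
  show ?thesis
  proof
    assume h: "rlinear corner M N h"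
    note D = rlinearD[OF h]
    show "rlinear R M N h"
    proof (rule rlinearI)
      fix x a assume x: "x \<in> carrier M" and a: "a \<in> carrier R"
      have "h (x \<triangleleft>\<^bsub>M\<^esub> a) = h (x \<triangleleft>\<^bsub>M\<^esub> (e \<otimes> a))" by (simp add: M.act_corner x a)
      also have "\<dots> = h x \<triangleleft>\<^bsub>N\<^esub> a" by (simp add: D(3) x a corner_e_act N.act_corner D(1))
      finally show "h (x \<triangleleft>\<^bsub>M\<^esub> a) = h x \<triangleleft>\<^bsub>N\<^esub> a" .
    qed (simp_all add: D(1,2))
  next
    assume h: "rlinear R M N h"
    show "rlinear corner M N h"
      by (rule rlinearI) (simp_all add: rlinearD[OF h] corner_subset)
  qed
qed

lemma inflation_simps [simp]:
  "carrier (inflation Y) = carrier Y" "\<zero>\<^bsub>inflation Y\<^esub> = \<zero>\<^bsub>Y\<^esub>"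
  "x \<oplus>\<^bsub>inflation Y\<^esub> y = x \<oplus>\<^bsub>Y\<^esub> y" "x \<triangleleft>\<^bsub>inflation Y\<^esub> a = x \<triangleleft>\<^bsub>Y\<^esub> (e \<otimes> a)"
  by (simp_all add: inflation_def)

lemma inflation_module:
  assumes "right_module corner Y"
  shows "right_module R (inflation Y)" "supported (inflation Y)"
proof -
  interpret Y: right_module corner Y by fact
  interpret I: abelian_group "inflation Y"
  proof (rule abelian_groupI)
    fix y assume y: "y \<in> carrier (inflation Y)"
    then show "\<exists>z\<in>carrier (inflation Y). z \<oplus>\<^bsub>inflation Y\<^esub> y = \<zero>\<^bsub>inflation Y\<^esub>"
      by (intro bexI[of _ "\<ominus>\<^bsub>Y\<^esub> y"]) (simp_all add: Y.M.l_neg)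
  qed (simp_all add: Y.M.a_ac)
  have add: "y \<triangleleft>\<^bsub>Y\<^esub> (a \<oplus> b) = y \<triangleleft>\<^bsub>Y\<^esub> a \<oplus>\<^bsub>Y\<^esub> y \<triangleleft>\<^bsub>Y\<^esub> b"
    if "y \<in> carrier Y" "a \<in> carrier corner" "b \<in> carrier corner" for y a b
    using Y.ract_add[OF that] by simp
  have mult: "y \<triangleleft>\<^bsub>Y\<^esub> (e \<otimes> (a \<otimes> b)) = (y \<triangleleft>\<^bsub>Y\<^esub> (e \<otimes> a)) \<triangleleft>\<^bsub>Y\<^esub> (e \<otimes> b)"
    if "y \<in> carrier Y" "a \<in> carrier R" "b \<in> carrier R" for y a b
  proof -
    \<comment> \<open>The zero corner enters here: e a = e a e makes the new action
      associative.\<close>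
    have "e \<otimes> (a \<otimes> b) = (e \<otimes> a \<otimes> e) \<otimes> b" unfolding e_act[OF that(2)] using that by (simp only: m_assoc e_closed)
    also have "\<dots> = (e \<otimes> a) \<otimes> (e \<otimes> b)" using that by (simp only: m_assoc e_closed m_closed)
    finally show ?thesis
      using Y.ract_mult[OF that(1) corner_e_act[OF that(2)] corner_e_act[OF that(3)]] by simp
  qed
  show "right_module R (inflation Y)"
    by unfold_locales
      (use Y.ract_one in \<open>simp_all add: Y.ract_closed corner_e_act r_distr add mult Y.add_ract\<close>)
  show "supported (inflation Y)"
    using Y.ract_zero by (simp add: supported_def)
qed

lemma rlinear_inflation:
  assumes "right_module corner Y"
  shows "rlinear corner Y (inflation Y) (\<lambda>y. y)" "rlinear corner (inflation Y) Y (\<lambda>y. y)"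
  by (simp_all add: rlinear_def corner_carrier)

lemma inflation_fin_gen:
  assumes "right_module corner Y" "fin_gen corner Y"
  shows "fin_gen R (inflation Y)"
proof -
  interpret I: supported_module R e "inflation Y"
    by (rule supported_moduleI[OF inflation_module[OF assms(1)]])
  have "fin_gen corner (inflation Y)"
    by (rule fin_gen_image[OF assms(1) I.corner_module rlinear_inflation(1)[OF assms(1)] _ assms(2)]) simp
  then show ?thesis by (simp add: I.corner_fin_gen_iff)
qed

text \<open>The off-diagonal entry of the triangular ring. It is the part of \<open>e' R\<close>
  killed by \<open>e'\<close>; that it is a right ideal of R depends on the zero corner.\<close>

abbreviation Q :: "('a, 'a) rmodule" where "Q \<equiv> mult_rmod R (peirce R e' e)"

abbreviation P :: "('a, 'a) rmodule" where "P \<equiv> mult_rmod R (peirce R e' \<one>)"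

lemma Q_iff: "x \<in> peirce R e' e \<longleftrightarrow> x \<in> carrier R \<and> e' \<otimes> x = x \<and> x \<otimes> e = x"
  by (simp add: peirce_iff)

lemma P_iff: "x \<in> peirce R e' \<one> \<longleftrightarrow> x \<in> carrier R \<and> e' \<otimes> x = x"
  by (auto simp: peirce_iff)

lemma Q_ideal: "right_ideal (peirce R e' e)"
proof -
  interpret reg: right_module R regular by (rule regular_module)
  have "x \<otimes> a \<in> peirce R e' e" if x: "x \<in> peirce R e' e" and a: "a \<in> carrier R" for x a
  proof -
    have xR: "x \<in> carrier R" "e' \<otimes> x = x" "x \<otimes> e = x" using x by (simp_all add: Q_iff)
    have "x \<otimes> a \<otimes> e = (x \<otimes> e) \<otimes> a \<otimes> e" by (simp only: xR(3))
    also have "\<dots> = x \<otimes> (e \<otimes> a \<otimes> e)" using xR(1) a by (simp only: m_assoc e_closed m_closed)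
    also have "\<dots> = (x \<otimes> e) \<otimes> a" unfolding e_act[OF a] using xR(1) a by (simp only: m_assoc e_closed)
    finally have "x \<otimes> a \<otimes> e = x \<otimes> a" by (simp only: xR(3))
    moreover have "e' \<otimes> (x \<otimes> a) = x \<otimes> a" using xR a by (simp add: m_assoc[symmetric])
    ultimately show ?thesis using xR(1) a by (simp add: Q_iff)
  qed
  then show ?thesis
    by (intro reg.submoduleI) (auto simp: Q_iff r_distr l_distr)
qed

lemma Q_module: "right_module R Q" "supported Q"
proof -
  show "right_module R Q"
    by (rule ideal_module[OF Q_ideal])
  show "supported Q"
    unfolding supported_def
  proof
    fix x assume "x \<in> carrier Q"
    then have x: "x \<in> carrier R" "x = x \<otimes> e" by (simp_all add: Q_iff)
    have "x \<otimes> e' = x \<otimes> (e \<otimes> e')" using x by (metis e_closed e'_closed m_assoc)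
    then show "x \<triangleleft>\<^bsub>Q\<^esub> e' = \<zero>\<^bsub>Q\<^esub>" using x(1) by simp
  qed
qed

end

section \<open>Splitting off the torsion part\<close>

context triangular
begin

lemma supported_image:
  assumes "right_module R M" "right_module R N" "rlinear R M N h" "h ` carrier M = carrier N" "supported M"
  shows "supported N"
  unfolding supported_def
proof
  fix y assume "y \<in> carrier N"
  then obtain x where x: "x \<in> carrier M" "y = h x" using assms(4) by blast
  then have "y \<triangleleft>\<^bsub>N\<^esub> e' = h (x \<triangleleft>\<^bsub>M\<^esub> e')" by (simp add: rlinearD(3)[OF assms(3)])
  also have "\<dots> = \<zero>\<^bsub>N\<^esub>" using x(1) assms(5) rlinear_zero[OF assms(1-3)] by (simp add: supported_def)
  finally show "y \<triangleleft>\<^bsub>N\<^esub> e' = \<zero>\<^bsub>N\<^esub>" .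
qed

lemma supported_inj:
  assumes "right_module R M" "right_module R N" "rlinear R M N h" "inj_on h (carrier M)" "supported N"
  shows "supported M"
  unfolding supported_def
proof
  fix x assume x: "x \<in> carrier M"
  interpret M: right_module R M by fact
  have "h (x \<triangleleft>\<^bsub>M\<^esub> e') = \<zero>\<^bsub>N\<^esub>"
    using x assms(5) rlinearD(1,3)[OF assms(3)] by (simp add: supported_def)
  then show "x \<triangleleft>\<^bsub>M\<^esub> e' = \<zero>\<^bsub>M\<^esub>"
    using assms(4) M.ract_closed[OF x e'_closed] unfolding rlinear_inj_iff[OF assms(1-3)] by blast
qed

text \<open>
  The part of \<open>X e' A\<close> killed by \<^term>\<open>e'\<close> is built up one generator at a time: if \<^term>\<open>r\<close>
  retracts onto what has been reached so far, the new generator contributes a quotient of \<^term>\<open>Q\<close>, which is injective, and a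
  retraction \<^term>\<open>s\<close> onto it turns \<^term>\<open>r\<close> into \<open>r + s (1 - r)\<close>.
\<close>

lemma hereditary_retraction:
  assumes art: "right_artinian R" and her: "hereditary_injective corner Q"
    and X: "right_module R X" "fin_gen R X"
    and V: "V = {x \<in> carrier X. x \<triangleleft>\<^bsub>X\<^esub> e' = \<zero>\<^bsub>X\<^esub>}" "right_submodule R X V"
    and Y: "finite Y" "Y \<subseteq> carrier X"
  obtains r where "rlinear R (X\<lparr>carrier := V\<rparr>) (X\<lparr>carrier := V\<rparr>) r"
    "\<And>y q. y \<in> Y \<Longrightarrow> q \<in> peirce R e' e \<Longrightarrow> r (y \<triangleleft>\<^bsub>X\<^esub> q) = y \<triangleleft>\<^bsub>X\<^esub> q"
    "\<And>v. v \<in> V \<Longrightarrow> r v \<in> rspan R X Y"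
proof -
  interpret X: right_module R X by (rule X(1))
  let ?V = "X\<lparr>carrier := V\<rparr>"
  note VD = X.submoduleD[OF V(2)]
  have VM: "right_module R ?V" by (rule X.restrict_module[OF V(2)])
  interpret VM: right_module R ?V by (rule VM)
  have Vs: "supported ?V" using V(1) by (simp add: supported_def)
  interpret VS: supported_module R e ?V by (rule supported_moduleI[OF VM Vs])
  interpret QS: supported_module R e Q by (rule supported_moduleI[OF Q_module])
  have yq: "y \<triangleleft>\<^bsub>X\<^esub> q \<in> V" if "y \<in> carrier X" "q \<in> peirce R e' e" for y q
  proof -
    have q: "q \<in> carrier R" using that(2) by (simp add: Q_iff)
    have "q \<otimes> e' = \<zero>" using Q_module(2) that(2) by (simp add: supported_def)
    then show ?thesis using that(1) q by (simp add: V(1) X.ract_closed X.ract_mult[symmetric] X.ract_zero)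
  qed
  have "\<exists>r. rlinear R ?V ?V r \<and> (\<forall>y\<in>Y. \<forall>q\<in>peirce R e' e. r (y \<triangleleft>\<^bsub>X\<^esub> q) = y \<triangleleft>\<^bsub>X\<^esub> q) \<and>
      (\<forall>v\<in>V. r v \<in> rspan R X Y)"
    using Y
  proof (induction Y rule: finite_induct)
    case empty
    have "rlinear R ?V ?V (\<lambda>_. \<zero>\<^bsub>?V\<^esub>)" by (rule rlinear_zero_map[OF VM])
    then show ?case by (intro exI[of _ "\<lambda>_. \<zero>\<^bsub>X\<^esub>"]) (simp add: X.rspan_empty)
  next
    case (insert y Y)
    then obtain r where r: "rlinear R ?V ?V r" "\<And>y q. y \<in> Y \<Longrightarrow> q \<in> peirce R e' e \<Longrightarrow> r (y \<triangleleft>\<^bsub>X\<^esub> q) = y \<triangleleft>\<^bsub>X\<^esub> q"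
      "\<And>v. v \<in> V \<Longrightarrow> r v \<in> rspan R X Y" by auto
    have y: "y \<in> carrier X" using insert.prems by simp
    have rV: "r v \<in> V" if "v \<in> V" for v using rlinearD(1)[OF r(1)] that by simp
    let ?d = "\<lambda>v. v \<oplus>\<^bsub>?V\<^esub> \<ominus>\<^bsub>?V\<^esub> r v"
    have d: "rlinear R ?V ?V ?d"
      by (rule rlinear_add_maps[OF VM rlinear_id rlinear_minus_map[OF VM r(1)]])
    have "rlinear R Q ?V (\<lambda>q. y \<triangleleft>\<^bsub>X\<^esub> q)"
      by (rule rlinearI) (simp_all add: yq y Q_iff X.ract_add X.ract_mult)
    \<comment> \<open>The map q to (1 - r)(y q) measures what r misses on the new generator; modulo
      its kernel it embeds a quotient of \<open>Q\<close>.\<close>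
    note \<phi> = rlinear_comp[OF this d]
    let ?\<phi> = "\<lambda>q. ?d (y \<triangleleft>\<^bsub>X\<^esub> q)"
    let ?N = "{q \<in> carrier Q. ?\<phi> q = \<zero>\<^bsub>?V\<^esub>}" and ?c = "\<lambda>q. {q \<in> carrier Q. ?\<phi> q = \<zero>\<^bsub>?V\<^esub>} +>\<^bsub>Q\<^esub> q"
    have N: "right_submodule R Q ?N" by (rule kernel_submodule[OF Q_module(1) VM \<phi>])
    let ?B = "quot_rmod Q ?N"
    note B = QS.quot_module[OF N]
    have c: "rlinear R Q ?B ?c" "?c ` carrier Q = carrier ?B"
      by (rule QS.rlinear_coset[OF N]) (simp only: QS.quot_carrier[OF N])
    have Bs: "supported ?B" by (rule supported_image[OF Q_module(1) B c Q_module(2)])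
    have c0: "?c q = \<zero>\<^bsub>?B\<^esub> \<longleftrightarrow> ?\<phi> q = \<zero>\<^bsub>?V\<^esub>" if "q \<in> carrier Q" for q
      using QS.coset_eq_zero_iff[OF N that] that by simp
    obtain j where j: "rlinear R ?B ?V j" "\<And>q. q \<in> carrier Q \<Longrightarrow> j (?c q) = ?\<phi> q"
      by (rule factor_surj[OF Q_module(1) B VM c \<phi>]) (use c0 in blast, rule that, simp_all)
    have inj: "inj_on j (carrier ?B)"
      unfolding rlinear_inj_iff[OF B VM j(1)]
    proof (intro ballI impI)
      fix b assume b: "b \<in> carrier ?B" "j b = \<zero>\<^bsub>?V\<^esub>"
      then obtain q where q: "q \<in> carrier Q" "b = ?c q" using c(2) by blast
      then show "b = \<zero>\<^bsub>?B\<^esub>" using b(2) j(2)[OF q(1)] c0[OF q(1)] by simp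
    qed
    have "right_submodule corner Q ?N" using N QS.corner_submodule_iff by simp
    then have "injective_rmod corner ?B" using her unfolding hereditary_injective_def by blast
    moreover have "right_module corner ?B" "fin_gen corner ?B"
    proof -
      interpret BS: supported_module R e ?B by (rule supported_moduleI[OF B Bs])
      show "right_module corner ?B" by (rule BS.corner_module)
      show "fin_gen corner ?B"
        unfolding BS.corner_fin_gen_iff by (rule QS.quot_fin_gen[OF N ideal_fin_gen[OF art Q_ideal]])
    qed
    moreover have "right_module corner ?V" "fin_gen corner ?V"
      using VS.corner_module X.submodule_fin_gen[OF art X(2) V(2)] by (simp_all add: VS.corner_fin_gen_iff)
    moreover have "rlinear corner ?B ?V j" using j(1) corner_rlinear_iff[OF B Bs VM Vs] by blast
    \<comment> \<open>Injectivity of the quotient of \<open>Q\<close> extends its identity along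
      \<open>j\<close>, so the embedding splits.\<close>
    ultimately obtain t where t: "rlinear corner ?V ?B t" "\<And>b. b \<in> carrier ?B \<Longrightarrow> t (j b) = b"
      using inj by - (rule injective_extend[OF _ _ _ _ _ _ _ rlinear_id], assumption+, rule that, simp_all)
    have t': "rlinear R ?V ?B t" using t(1) corner_rlinear_iff[OF VM Vs B Bs] by blast
    let ?s = "\<lambda>v. j (t v)"
    have s: "rlinear R ?V ?V ?s" by (rule rlinear_comp[OF t' j(1)])
    have s\<phi>: "?s (?\<phi> q) = ?\<phi> q" if "q \<in> carrier Q" for q
      using j(2)[OF that] t(2)[of "?c q"] c(2) that by (metis (no_types, lifting) image_eqI)
    define r' where "r' v = r v \<oplus>\<^bsub>?V\<^esub> ?s (?d v)" for v
    have "rlinear R ?V ?V r'"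
      unfolding r'_def by (rule rlinear_add_maps[OF VM r(1) rlinear_comp[OF d s]])
    moreover have "r' (z \<triangleleft>\<^bsub>X\<^esub> q) = z \<triangleleft>\<^bsub>X\<^esub> q" if z: "z \<in> insert y Y" and q: "q \<in> peirce R e' e" for z q
    proof (cases "z = y")
      case True
      let ?v = "y \<triangleleft>\<^bsub>X\<^esub> q"
      have v: "?v \<in> V" by (rule yq[OF y q])
      have rv: "r ?v \<in> V" by (rule rV[OF v])
      \<comment> \<open>(1 - r)(y q) lies in the range of \<open>j\<close>, which j t fixes; the two
        halves therefore add up to y q.\<close>
      have "r' ?v = r ?v \<oplus>\<^bsub>?V\<^esub> (?v \<oplus>\<^bsub>?V\<^esub> \<ominus>\<^bsub>?V\<^esub> r ?v)" unfolding r'_def using s\<phi> q by simp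
      also have "\<dots> = ?v \<oplus>\<^bsub>?V\<^esub> (r ?v \<oplus>\<^bsub>?V\<^esub> \<ominus>\<^bsub>?V\<^esub> r ?v)"
        by (rule VM.M.a_lcomm) (use v rv VM.M.a_inv_closed in simp_all)
      also have "\<dots> = ?v" using v rv VM.M.r_neg[of "r ?v"] VD(3) by simp
      finally show ?thesis using True by simp
    next
      case False
      then have zY: "z \<in> Y" using z by simp
      have v: "z \<triangleleft>\<^bsub>X\<^esub> q \<in> V" using zY insert.prems q by (intro yq) auto
      have "?d (z \<triangleleft>\<^bsub>X\<^esub> q) = \<zero>\<^bsub>?V\<^esub>" using r(2)[OF zY q] v VM.M.r_neg[of "z \<triangleleft>\<^bsub>X\<^esub> q"] by simp
      then have "r' (z \<triangleleft>\<^bsub>X\<^esub> q) = z \<triangleleft>\<^bsub>X\<^esub> q \<oplus>\<^bsub>X\<^esub> \<zero>\<^bsub>X\<^esub>"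
        unfolding r'_def using r(2)[OF zY q] rlinear_zero[OF VM VM s] by simp
      then show ?thesis using VD(3)[OF v] by simp
    qed
    moreover have "r' v \<in> rspan R X (insert y Y)" if v: "v \<in> V" for v
    proof -
      have sub: "right_submodule R X (rspan R X (insert y Y))"
        by (rule X.rspan_submodule[OF insert.prems])
      note SD = X.submoduleD[OF sub]
      have mono: "rspan R X Y \<subseteq> rspan R X (insert y Y)" by (rule rspan_mono) auto
      have dv: "?d v \<in> V" using rlinearD(1)[OF d] v by simp
      have "t (?d v) \<in> carrier ?B" using rlinearD(1)[OF t'] dv by simp
      \<comment> \<open>The correction term equals y q - r(y q) for some q, and both terms lie in
        the enlarged span.\<close>
      then obtain q where q: "q \<in> carrier Q" "t (?d v) = ?c q" using c(2) by blast
      then have qP: "q \<in> peirce R e' e" and qR: "q \<in> carrier R" by (simp_all add: Q_iff)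
      let ?u = "y \<triangleleft>\<^bsub>X\<^esub> q"
      have u: "?u \<in> V" by (rule yq[OF y qP])
      have "y \<in> rspan R X (insert y Y)" using rspan_superset[of "insert y Y" R X] by simp
      then have "?u \<in> rspan R X (insert y Y)" using qR by (rule SD(5))
      moreover have "\<ominus>\<^bsub>?V\<^esub> r ?u = \<ominus>\<^bsub>X\<^esub> r ?u"
        using rV[OF u] VD(3) VD(6) VM.M.l_neg[of "r ?u"]
        by (intro VM.M.minus_equality) (simp_all add: X.M.l_neg)
      ultimately have "?\<phi> q \<in> rspan R X (insert y Y)"
        using SD(4) SD(6) r(3)[OF u] mono by auto
      moreover have "?s (?d v) = ?\<phi> q" using q j(2) by simp
      ultimately show ?thesis unfolding r'_def using SD(4) r(3)[OF v] mono by auto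
    qed
    ultimately show ?case by blast
  qed
  then show thesis using that by blast
qed

text \<open>Let V be the vectors killed by \<open>e'\<close> and T the submodule generated by X e'.
  The map of \<open>hereditary_retraction\<close> sends V into T and fixes their intersection, so
  its kernel W is a complement of T: x = x e' + x e with x e in V, and x e = r(x e) + (x e - r(x
  e)).\<close>

lemma hereditary_splits:
  assumes art: "right_artinian R" and her: "hereditary_injective corner Q"
    and X: "right_module R X" "fin_gen R X"
  obtains T W where "internal_direct_sum R X T W" "\<And>w. w \<in> W \<Longrightarrow> w \<triangleleft>\<^bsub>X\<^esub> e' = \<zero>\<^bsub>X\<^esub>"
    "\<And>x. x \<in> carrier X \<Longrightarrow> x \<triangleleft>\<^bsub>X\<^esub> e' \<in> T" "T \<subseteq> rspan R X ((\<lambda>x. x \<triangleleft>\<^bsub>X\<^esub> e') ` carrier X)"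
proof -
  interpret X: right_module R X by (rule X(1))
  obtain G where G: "finite G" "G \<subseteq> carrier X" "rspan R X G = carrier X"
    using X(2) unfolding X.fin_gen_iff by blast
  let ?Y = "(\<lambda>g. g \<triangleleft>\<^bsub>X\<^esub> e') ` G"
  have Y: "finite ?Y" "?Y \<subseteq> carrier X" using G X.ract_closed by auto
  define V where "V = {x \<in> carrier X. x \<triangleleft>\<^bsub>X\<^esub> e' = \<zero>\<^bsub>X\<^esub>}"
  \<comment> \<open>Stability uses the zero corner: if x e' = 0, then x a e' = x e a e' + x e' a e'
    = 0.\<close>
  have V_sub: "right_submodule R X V"
  proof (rule X.submoduleI)
    fix x a assume x: "x \<in> V" and a: "a \<in> carrier R"
    then have xX: "x \<in> carrier X" "x \<triangleleft>\<^bsub>X\<^esub> e' = \<zero>\<^bsub>X\<^esub>" by (simp_all add: V_def)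
    have "x \<triangleleft>\<^bsub>X\<^esub> (a \<otimes> e') = x \<triangleleft>\<^bsub>X\<^esub> ((e \<oplus> e') \<otimes> (a \<otimes> e'))" using a by simp
    also have "(e \<oplus> e') \<otimes> (a \<otimes> e') = e \<otimes> (a \<otimes> e') \<oplus> e' \<otimes> (a \<otimes> e')" using a by (intro l_distr) simp_all
    also have "e \<otimes> (a \<otimes> e') = \<zero>" using e_a_e'[OF a] a by (simp add: m_assoc)
    also have "x \<triangleleft>\<^bsub>X\<^esub> (\<zero> \<oplus> e' \<otimes> (a \<otimes> e')) = (x \<triangleleft>\<^bsub>X\<^esub> e') \<triangleleft>\<^bsub>X\<^esub> (a \<otimes> e')" using a xX by (simp add: X.ract_mult)
    also have "\<dots> = \<zero>\<^bsub>X\<^esub>" unfolding xX(2) using a by (simp add: X.zero_ract)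
    finally show "x \<triangleleft>\<^bsub>X\<^esub> a \<in> V" using a xX(1) by (simp add: V_def X.ract_mult X.ract_closed)
  qed (auto simp: V_def X.zero_ract X.add_ract)
  let ?V = "X\<lparr>carrier := V\<rparr>"
  note VD = X.submoduleD[OF V_sub]
  have VM: "right_module R ?V" by (rule X.restrict_module[OF V_sub])
  obtain r where r: "rlinear R ?V ?V r"
    "\<And>y q. y \<in> ?Y \<Longrightarrow> q \<in> peirce R e' e \<Longrightarrow> r (y \<triangleleft>\<^bsub>X\<^esub> q) = y \<triangleleft>\<^bsub>X\<^esub> q"
    "\<And>v. v \<in> V \<Longrightarrow> r v \<in> rspan R X ?Y"
    by (rule hereditary_retraction[OF art her X V_def V_sub Y]) (erule that, simp_all)
  let ?T = "rspan R X ?Y"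
  have T: "right_submodule R X ?T" by (rule X.rspan_submodule[OF Y(2)])
  note TD = X.submoduleD[OF T]
  have Te': "x \<triangleleft>\<^bsub>X\<^esub> e' \<in> ?T" if x: "x \<in> carrier X" for x
  proof -
    \<comment> \<open>Strengthened to all b e', so that the condition is stable under the action and
      can be checked on generators.\<close>
    let ?Z = "{x \<in> carrier X. \<forall>b\<in>carrier R. x \<triangleleft>\<^bsub>X\<^esub> (b \<otimes> e') \<in> ?T}"
    have "right_submodule R X ?Z"
    proof (rule X.submoduleI)
      fix x a assume "x \<in> ?Z" "a \<in> carrier R"
      then show "x \<triangleleft>\<^bsub>X\<^esub> a \<in> ?Z" by (simp add: X.ract_closed X.ract_mult[symmetric] m_assoc[symmetric])
    qed (auto simp: X.zero_ract X.add_ract TD(2,4))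
    moreover have "G \<subseteq> ?Z"
    proof
      fix g assume g: "g \<in> G"
      then have gX: "g \<in> carrier X" using G(2) by blast
      have "g \<triangleleft>\<^bsub>X\<^esub> (b \<otimes> e') \<in> ?T" if b: "b \<in> carrier R" for b
      proof -
        have "b \<otimes> e' = (e \<oplus> e') \<otimes> (b \<otimes> e')" using b by simp
        also have "\<dots> = e \<otimes> (b \<otimes> e') \<oplus> e' \<otimes> (b \<otimes> e')" using b by (intro l_distr) simp_all
        also have "e \<otimes> (b \<otimes> e') = \<zero>" using e_a_e'[OF b] b by (simp add: m_assoc)
        finally have "b \<otimes> e' = e' \<otimes> (b \<otimes> e')" using b by simp
        then have "g \<triangleleft>\<^bsub>X\<^esub> (b \<otimes> e') = (g \<triangleleft>\<^bsub>X\<^esub> e') \<triangleleft>\<^bsub>X\<^esub> (b \<otimes> e')"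
          using gX b by (metis X.ract_mult e'_closed m_closed)
        moreover have "g \<triangleleft>\<^bsub>X\<^esub> e' \<in> ?T" using rspan_superset[of ?Y R X] g by blast
        ultimately show ?thesis using b by (simp add: TD(5))
      qed
      then show "g \<in> ?Z" using gX by simp
    qed
    ultimately have "carrier X \<subseteq> ?Z" using rspan_least[of R X ?Z G] G(3) by simp
    then have "x \<triangleleft>\<^bsub>X\<^esub> (\<one> \<otimes> e') \<in> ?T" using x by blast
    then show ?thesis by simp
  qed
  have fixed: "r t = t" if t: "t \<in> ?T" "t \<in> V" for t
  proof -
    \<comment> \<open>The claim is proved on T for x q in place of x, where q e = q. This form is
      stable under the action, since a q is of the same kind, and x q always lies in V, where r is
      linear. The choice q = e gives back the claim for vectors of V.\<close>
    let ?E = "{q \<in> carrier R. q \<otimes> e = q}"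
    have Ev: "x \<triangleleft>\<^bsub>X\<^esub> q \<in> V" if "x \<in> carrier X" "q \<in> ?E" for x q
    proof -
      have "(q \<otimes> e) \<otimes> e' = q \<otimes> (e \<otimes> e')" using that by (intro m_assoc) simp_all
      then have "q \<otimes> e' = \<zero>" using that by simp
      then show ?thesis using that by (simp add: V_def X.ract_closed X.ract_mult[symmetric] X.ract_zero)
    qed
    let ?Z = "{x \<in> carrier X. \<forall>q\<in>?E. r (x \<triangleleft>\<^bsub>X\<^esub> q) = x \<triangleleft>\<^bsub>X\<^esub> q}"
    have "right_submodule R X ?Z"
    proof (rule X.submoduleI)
      show "\<zero>\<^bsub>X\<^esub> \<in> ?Z" using rlinear_zero[OF VM VM r(1)] by (simp add: X.zero_ract)
      fix x assume x: "x \<in> ?Z"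
      show "x \<oplus>\<^bsub>X\<^esub> z \<in> ?Z" if z: "z \<in> ?Z" for z
      proof -
        have "r ((x \<oplus>\<^bsub>X\<^esub> z) \<triangleleft>\<^bsub>X\<^esub> q) = (x \<oplus>\<^bsub>X\<^esub> z) \<triangleleft>\<^bsub>X\<^esub> q" if q: "q \<in> ?E" for q
          using rlinearD(2)[OF r(1), of "x \<triangleleft>\<^bsub>X\<^esub> q" "z \<triangleleft>\<^bsub>X\<^esub> q"] Ev[of x q] Ev[of z q] x z q
          by (simp add: X.add_ract)
        then show ?thesis using x z by simp
      qed
      show "x \<triangleleft>\<^bsub>X\<^esub> a \<in> ?Z" if a: "a \<in> carrier R" for a
      proof -
        have "r ((x \<triangleleft>\<^bsub>X\<^esub> a) \<triangleleft>\<^bsub>X\<^esub> q) = (x \<triangleleft>\<^bsub>X\<^esub> a) \<triangleleft>\<^bsub>X\<^esub> q" if q: "q \<in> ?E" for q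
        proof -
          have "a \<otimes> q \<in> ?E" using a q by (simp add: m_assoc)
          then show ?thesis using x a q by (simp add: X.ract_mult[symmetric])
        qed
        then show ?thesis using x a by (simp add: X.ract_closed)
      qed
    qed auto
    moreover have "?Y \<subseteq> ?Z"
    proof
      fix y assume y: "y \<in> ?Y"
      then obtain g where g: "g \<in> carrier X" "y = g \<triangleleft>\<^bsub>X\<^esub> e'" using G(2) by blast
      have "r (y \<triangleleft>\<^bsub>X\<^esub> q) = y \<triangleleft>\<^bsub>X\<^esub> q" if q: "q \<in> ?E" for q
      proof -
        have "y \<triangleleft>\<^bsub>X\<^esub> q = y \<triangleleft>\<^bsub>X\<^esub> (e' \<otimes> q)"
          unfolding g(2) using g(1) q by (simp add: X.ract_mult[symmetric] X.ract_closed m_assoc[symmetric])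
        moreover have "e' \<otimes> q \<in> peirce R e' e"
          using q by (simp add: Q_iff m_assoc) (simp add: m_assoc[symmetric])
        ultimately show ?thesis using r(2)[OF y] by simp
      qed
      then show "y \<in> ?Z" using Y(2) y by blast
    qed
    ultimately have "?T \<subseteq> ?Z" by (rule rspan_least)
    then have "r (t \<triangleleft>\<^bsub>X\<^esub> e) = t \<triangleleft>\<^bsub>X\<^esub> e" using t(1) by auto
    moreover have "t \<triangleleft>\<^bsub>X\<^esub> e = t"
    proof -
      interpret VS: supported_module R e ?V
        by (rule supported_moduleI[OF VM]) (simp add: supported_def V_def)
      show ?thesis using VS.act_e t(2) by simp
    qed
    ultimately show ?thesis by simp
  qed
  let ?W = "{v \<in> V. r v = \<zero>\<^bsub>X\<^esub>}"
  have W: "right_submodule R X ?W"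
    using kernel_submodule[OF VM VM r(1)] X.submodule_restrict_iff[OF V_sub] by simp
  have rV: "r v \<in> V" if "v \<in> V" for v using rlinearD(1)[OF r(1)] that by simp
  have "carrier X \<subseteq> ?T <+>\<^bsub>X\<^esub> ?W"
  proof
    fix x assume x: "x \<in> carrier X"
    let ?v = "x \<triangleleft>\<^bsub>X\<^esub> e"
    have v: "?v \<in> V" using x by (simp add: V_def X.ract_closed X.ract_mult[symmetric] X.ract_zero)
    have vX: "?v \<in> carrier X" and rvX: "r ?v \<in> carrier X" and xe': "x \<triangleleft>\<^bsub>X\<^esub> e' \<in> carrier X"
      using v rV VD(3) x by (simp_all add: X.ract_closed)
    have "r (?v \<ominus>\<^bsub>X\<^esub> r ?v) = \<zero>\<^bsub>X\<^esub>"
    proof -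
      interpret VM: right_module R ?V by (rule VM)
      have eq: "a \<ominus>\<^bsub>?V\<^esub> b = a \<ominus>\<^bsub>X\<^esub> b" if "a \<in> V" "b \<in> V" for a b
      proof -
        have "\<ominus>\<^bsub>?V\<^esub> b = \<ominus>\<^bsub>X\<^esub> b"
          using that VD(3)[OF that(2)] VD(6)[OF that(2)] by (intro VM.M.minus_equality) (simp_all add: X.M.l_neg)
        then show ?thesis by (simp add: a_minus_def)
      qed
      have "r (?v \<ominus>\<^bsub>X\<^esub> r ?v) = r ?v \<ominus>\<^bsub>X\<^esub> r (r ?v)"
        using rlinear_diff[OF VM VM r(1), of ?v "r ?v"] v rV by (simp add: eq)
      also have "\<dots> = \<zero>\<^bsub>X\<^esub>"
        using fixed[OF r(3)[OF v] rV[OF v]] rvX by (simp add: X.diff_eq_zero_iff)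
      finally show ?thesis .
    qed
    then have w: "?v \<ominus>\<^bsub>X\<^esub> r ?v \<in> ?W" using VD(7)[OF v rV[OF v]] by simp
    have "x = x \<triangleleft>\<^bsub>X\<^esub> (e \<oplus> e')" using x by (simp add: X.ract_one)
    also have "\<dots> = ?v \<oplus>\<^bsub>X\<^esub> x \<triangleleft>\<^bsub>X\<^esub> e'" using x by (simp only: X.ract_add e_closed e'_closed)
    also have "\<dots> = (x \<triangleleft>\<^bsub>X\<^esub> e' \<oplus>\<^bsub>X\<^esub> r ?v) \<oplus>\<^bsub>X\<^esub> (?v \<ominus>\<^bsub>X\<^esub> r ?v)"
    proof -
      have "(x \<triangleleft>\<^bsub>X\<^esub> e' \<oplus>\<^bsub>X\<^esub> r ?v) \<oplus>\<^bsub>X\<^esub> (?v \<ominus>\<^bsub>X\<^esub> r ?v) = (?v \<oplus>\<^bsub>X\<^esub> x \<triangleleft>\<^bsub>X\<^esub> e') \<oplus>\<^bsub>X\<^esub> (r ?v \<oplus>\<^bsub>X\<^esub> \<ominus>\<^bsub>X\<^esub> r ?v)"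
        using vX rvX xe' by (simp add: a_minus_def X.M.a_ac)
      then show ?thesis using vX rvX xe' by (simp add: X.M.r_neg)
    qed
    finally have "x = (x \<triangleleft>\<^bsub>X\<^esub> e' \<oplus>\<^bsub>X\<^esub> r ?v) \<oplus>\<^bsub>X\<^esub> (?v \<ominus>\<^bsub>X\<^esub> r ?v)" .
    moreover have "x \<triangleleft>\<^bsub>X\<^esub> e' \<oplus>\<^bsub>X\<^esub> r ?v \<in> ?T" by (rule TD(4)[OF Te'[OF x] r(3)[OF v]])
    ultimately show "x \<in> ?T <+>\<^bsub>X\<^esub> ?W" using w unfolding X.set_add_iff by blast
  qed
  then have "?T <+>\<^bsub>X\<^esub> ?W = carrier X"
    using X.set_add_least[OF X.carrier_submodule TD(1) X.submoduleD(1)[OF W]] by blast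
  moreover have "?T \<inter> ?W = {\<zero>\<^bsub>X\<^esub>}"
  proof
    show "?T \<inter> ?W \<subseteq> {\<zero>\<^bsub>X\<^esub>}"
    proof
      fix w assume "w \<in> ?T \<inter> ?W"
      then have "w \<in> ?T" "w \<in> V" "r w = \<zero>\<^bsub>X\<^esub>" by simp_all
      then show "w \<in> {\<zero>\<^bsub>X\<^esub>}" using fixed by simp
    qed
    show "{\<zero>\<^bsub>X\<^esub>} \<subseteq> ?T \<inter> ?W" using TD(2) X.submoduleD(2)[OF W] by blast
  qed
  ultimately have "internal_direct_sum R X ?T ?W" using T W by (simp add: internal_direct_sum_def)
  moreover have "?T \<subseteq> rspan R X ((\<lambda>x. x \<triangleleft>\<^bsub>X\<^esub> e') ` carrier X)" using G(2) by (intro rspan_mono image_mono)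
  moreover have "w \<triangleleft>\<^bsub>X\<^esub> e' = \<zero>\<^bsub>X\<^esub>" if "w \<in> ?W" for w using that by (simp add: V_def)
  ultimately show thesis using Te' by (intro that[of ?T ?W])
qed

text \<open>On an indecomposable summand take zero if \<open>e'\<close> kills it and the identity if
  its multiples of \<open>e'\<close> generate it; direct sums glue these maps. The result is a
  retraction onto the submodule generated by M e'.\<close>

lemma split_retraction:
  assumes art: "right_artinian R" and M: "right_module R M" "fin_gen R M"
    and split: "\<And>X. X \<in> ind_mod R \<Longrightarrow> supported X \<or> rspan R X ((\<lambda>x. x \<triangleleft>\<^bsub>X\<^esub> e') ` carrier X) = carrier X"
  obtains \<tau> where "rlinear R M M \<tau>" "\<And>x. x \<in> carrier M \<Longrightarrow> \<tau> x \<in> rspan R M ((\<lambda>x. x \<triangleleft>\<^bsub>M\<^esub> e') ` carrier M)"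
    "\<And>x. x \<in> carrier M \<Longrightarrow> \<tau> (x \<triangleleft>\<^bsub>M\<^esub> e') = x \<triangleleft>\<^bsub>M\<^esub> e'"
proof -
  interpret M: right_module R M by (rule M(1))
  \<comment> \<open>The span is taken in M and not in N, so that the torsion parts of two summands
    are visibly contained in that of their sum.\<close>
  let ?tr = "\<lambda>N. rspan R M ((\<lambda>x. x \<triangleleft>\<^bsub>M\<^esub> e') ` N)"
  let ?P = "\<lambda>N. \<exists>\<tau>. rlinear R (M\<lparr>carrier := N\<rparr>) (M\<lparr>carrier := N\<rparr>) \<tau> \<and> (\<forall>x\<in>N. \<tau> x \<in> ?tr N) \<and>
    (\<forall>x\<in>N. \<tau> (x \<triangleleft>\<^bsub>M\<^esub> e') = x \<triangleleft>\<^bsub>M\<^esub> e')"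
  have tr_sub: "right_submodule R M (?tr N)" if "N \<subseteq> carrier M" for N
    using that M.ract_closed by (intro M.rspan_submodule) auto
  have "?P (carrier M)"
  proof (rule M.indecomposable_induct[where P="?P", OF M.artinian_fin_gen[OF art M(2)] M.carrier_submodule])
    show "?P {\<zero>\<^bsub>M\<^esub>}"
      by (intro exI[of _ "\<lambda>x. x"] conjI rlinear_id) (simp_all add: M.zero_ract rspan_superset[THEN subsetD])
  next
    fix N assume N: "right_submodule R M N" "indecomposable R (M\<lparr>carrier := N\<rparr>)"
    let ?N = "M\<lparr>carrier := N\<rparr>"
    note ND = M.submoduleD[OF N(1)] and NM = M.restrict_module[OF N(1)]
    obtain X f g where X: "X \<in> ind_mod R" "iso_pair R ?N X f g"
      by (rule indecomposable_rep[OF N(2) M.submodule_fin_gen[OF art M(2) N(1)]])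
    note XM = fg_modD(1)[OF ind_mod_fg[OF X(1)]] and I = iso_pairD[OF X(2)]
    from split[OF X(1)] show "?P N"
    proof
      assume "supported X"
      then have "supported ?N" by (rule supported_inj[OF NM XM I(1,8)])
      then show ?thesis
        using rlinear_zero_map[OF NM, of ?N] M.submoduleD(2)[OF tr_sub[OF ND(1)]]
        by (intro exI[of _ "\<lambda>_. \<zero>\<^bsub>M\<^esub>"]) (simp add: supported_def)
    next
      assume tr: "rspan R X ((\<lambda>x. x \<triangleleft>\<^bsub>X\<^esub> e') ` carrier X) = carrier X"
      interpret XM: right_module R X by (rule XM)
      have sub: "(\<lambda>x. x \<triangleleft>\<^bsub>X\<^esub> e') ` carrier X \<subseteq> carrier X" using XM.ract_closed by auto
      have "N = g ` carrier X" using iso_pairD(9)[OF I(7)] by simp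
      also have "\<dots> = rspan R ?N (g ` (\<lambda>x. x \<triangleleft>\<^bsub>X\<^esub> e') ` carrier X)"
        unfolding rspan_image[OF XM NM I(2) sub] tr ..
      also have "g ` (\<lambda>x. x \<triangleleft>\<^bsub>X\<^esub> e') ` carrier X = (\<lambda>x. x \<triangleleft>\<^bsub>M\<^esub> e') ` g ` carrier X"
        by (auto simp: image_image rlinearD(3)[OF I(2)])
      also have "g ` carrier X = N" using iso_pairD(9)[OF I(7)] by simp
      also have "rspan R ?N ((\<lambda>x. x \<triangleleft>\<^bsub>M\<^esub> e') ` N) = ?tr N"
        using ND(5) by (intro M.rspan_restrict[OF N(1)]) auto
      finally show ?thesis by (intro exI[of _ "\<lambda>x. x"] conjI rlinear_id) simp_all
    qed
  next
    fix N L assume N: "right_submodule R M N" and L: "right_submodule R M L" and int: "N \<inter> L = {\<zero>\<^bsub>M\<^esub>}"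
      and "?P N" "?P L"
    let ?N = "M\<lparr>carrier := N\<rparr>" and ?L = "M\<lparr>carrier := L\<rparr>" and ?S = "M\<lparr>carrier := N <+>\<^bsub>M\<^esub> L\<rparr>"
    note NM = M.restrict_module[OF N] and LM = M.restrict_module[OF L]
      and SM = M.restrict_module[OF M.set_add_submodule[OF N L]]
    note SD = M.submoduleD[OF M.set_add_submodule[OF N L]]
    note up = M.set_add_upper[OF N L]
    obtain \<sigma> where \<sigma>: "rlinear R ?N ?N \<sigma>" "\<forall>x\<in>N. \<sigma> x \<in> ?tr N" "\<forall>x\<in>N. \<sigma> (x \<triangleleft>\<^bsub>M\<^esub> e') = x \<triangleleft>\<^bsub>M\<^esub> e'"
      using \<open>?P N\<close> by blast
    obtain \<rho> where \<rho>: "rlinear R ?L ?L \<rho>" "\<forall>x\<in>L. \<rho> x \<in> ?tr L" "\<forall>x\<in>L. \<rho> (x \<triangleleft>\<^bsub>M\<^esub> e') = x \<triangleleft>\<^bsub>M\<^esub> e'"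
      using \<open>?P L\<close> by blast
    obtain f where f: "iso_pair R (prod_rmod ?N ?L) ?S (\<lambda>u. fst u \<oplus>\<^bsub>M\<^esub> snd u) f"
      by (rule M.direct_sum_iso[OF N L int])
    note I = iso_pairD[OF f]
    have \<sigma>': "rlinear R ?S ?S (\<lambda>x. \<sigma> (fst (f x)))"
      using rlinear_comp[OF rlinear_comp[OF I(2) rlinear_prod(1)[OF NM LM]] \<sigma>(1)] up(1)
      by (auto simp: rlinear_def)
    have \<rho>': "rlinear R ?S ?S (\<lambda>x. \<rho> (snd (f x)))"
      using rlinear_comp[OF rlinear_comp[OF I(2) rlinear_prod(2)[OF NM LM]] \<rho>(1)] up(2)
      by (auto simp: rlinear_def)
    let ?\<tau> = "\<lambda>x. \<sigma> (fst (f x)) \<oplus>\<^bsub>M\<^esub> \<rho> (snd (f x))"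
    have "rlinear R ?S ?S ?\<tau>" using rlinear_add_maps[OF SM \<sigma>' \<rho>'] by simp
    moreover have "?\<tau> x \<in> ?tr (N <+>\<^bsub>M\<^esub> L)" if x: "x \<in> N <+>\<^bsub>M\<^esub> L" for x
    proof -
      have "fst (f x) \<in> N" "snd (f x) \<in> L" using I(6)[of x] x by auto
      then have *: "\<sigma> (fst (f x)) \<in> ?tr N" "\<rho> (snd (f x)) \<in> ?tr L" using \<sigma>(2) \<rho>(2) by simp_all
      have "\<sigma> (fst (f x)) \<in> ?tr (N <+>\<^bsub>M\<^esub> L)" "\<rho> (snd (f x)) \<in> ?tr (N <+>\<^bsub>M\<^esub> L)"
        by (rule subsetD[OF rspan_mono[OF image_mono[OF up(1)]] *(1)],
            rule subsetD[OF rspan_mono[OF image_mono[OF up(2)]] *(2)])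
      then show ?thesis using M.submoduleD(4)[OF tr_sub[OF SD(1)]] by blast
    qed
    moreover have "?\<tau> (x \<triangleleft>\<^bsub>M\<^esub> e') = x \<triangleleft>\<^bsub>M\<^esub> e'" if x: "x \<in> N <+>\<^bsub>M\<^esub> L" for x
    proof -
      have n: "fst (f x) \<in> N" and l: "snd (f x) \<in> L" using I(6)[of x] x by auto
      have "f (x \<triangleleft>\<^bsub>M\<^esub> e') = (fst (f x) \<triangleleft>\<^bsub>M\<^esub> e', snd (f x) \<triangleleft>\<^bsub>M\<^esub> e')"
        using rlinearD(3)[OF I(2), of x e'] x by simp
      then have "?\<tau> (x \<triangleleft>\<^bsub>M\<^esub> e') = fst (f x) \<triangleleft>\<^bsub>M\<^esub> e' \<oplus>\<^bsub>M\<^esub> snd (f x) \<triangleleft>\<^bsub>M\<^esub> e'"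
        using \<sigma>(3) \<rho>(3) n l by simp
      also have "\<dots> = (fst (f x) \<oplus>\<^bsub>M\<^esub> snd (f x)) \<triangleleft>\<^bsub>M\<^esub> e'"
        using M.submoduleD(3)[OF N n] M.submoduleD(3)[OF L l] by (simp add: M.add_ract)
      also have "\<dots> = x \<triangleleft>\<^bsub>M\<^esub> e'" using I(4)[of x] x by simp
      finally show ?thesis .
    qed
    ultimately show "?P (N <+>\<^bsub>M\<^esub> L)" by (intro exI[of _ ?\<tau>]) simp
  qed
  then show thesis using that by auto
qed

text \<open>
  To extend \<^term>\<open>g\<close> along \<^term>\<open>f\<close>, form the pushout of \<^term>\<open>f\<close> with \<^term>\<open>g\<close>, composed with the inclusion
  of \<open>Q / N\<close> in \<open>e' A / N\<close>.  The image of \<open>e' A / N\<close> is generated by the image of \<^term>\<open>e'\<close>, so it is the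
  torsion part of the pushout and therefore a direct summand.
\<close>

lemma split_hereditary:
  assumes art: "right_artinian R"
    and split: "\<And>X. X \<in> ind_mod R \<Longrightarrow> supported X \<or> rspan R X ((\<lambda>x. x \<triangleleft>\<^bsub>X\<^esub> e') ` carrier X) = carrier X"
  shows "hereditary_injective corner Q"
  unfolding hereditary_injective_def
proof (intro conjI allI impI)
  interpret QS: supported_module R e Q by (rule supported_moduleI[OF Q_module])
  show "right_module corner Q" by (rule QS.corner_module)
  fix N assume "right_submodule corner Q N"
  then have N: "right_submodule R Q N" by (simp add: QS.corner_submodule_iff)
  have P_ideal: "right_ideal (peirce R e' \<one>)" by (rule idem_ideal) simp
  have PM: "right_module R P" by (rule ideal_module[OF P_ideal])
  interpret P: right_module R P by (rule PM)
  have QP: "peirce R e' e \<subseteq> peirce R e' \<one>" by (auto simp: Q_iff P_iff)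
  have NP: "right_submodule R P N"
    using N right_module.submodule_restrict_iff[OF regular_module Q_ideal, of N]
      right_module.submodule_restrict_iff[OF regular_module P_ideal, of N] QP
    by (auto simp: mult_rmod_restrict)
  let ?QN = "quot_rmod Q N" and ?B = "quot_rmod P N"
  \<comment> \<open>Cosets of N do not depend on the surrounding ideal, so the quotient of
    \<open>Q\<close> is literally a subset of the quotient of \<open>P\<close>, with the same
    operations.\<close>
  have coset: "N +>\<^bsub>Q\<^esub> x = N +>\<^bsub>P\<^esub> x" for x
    by (simp add: a_r_coset_def r_coset_def)
  have QN_sub: "carrier ?QN \<subseteq> carrier ?B"
    unfolding QS.quot_carrier[OF N] P.quot_carrier[OF NP] coset using QP by auto
  have ops: "x \<oplus>\<^bsub>?QN\<^esub> y = x \<oplus>\<^bsub>?B\<^esub> y" "x \<triangleleft>\<^bsub>?QN\<^esub> a = x \<triangleleft>\<^bsub>?B\<^esub> a" "\<zero>\<^bsub>?QN\<^esub> = \<zero>\<^bsub>?B\<^esub>" for x y a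
    by (simp_all add: quot_rmod_def coset set_add_def set_mult_def)
  have QNM: "right_module R ?QN" by (rule QS.quot_module[OF N])
  have QNs: "supported ?QN"
    by (rule supported_image[OF Q_module(1) QNM QS.rlinear_coset[OF N] QS.quot_carrier[OF N, symmetric] Q_module(2)])
  interpret QNS: supported_module R e ?QN by (rule supported_moduleI[OF QNM QNs])
  have BM: "right_module R ?B" by (rule P.quot_module[OF NP])
  have B_fg: "fin_gen R ?B" by (rule P.quot_fin_gen[OF NP ideal_fin_gen[OF art P_ideal]])
  show "injective_rmod corner ?QN"
    unfolding injective_rmod_def
  proof (intro conjI ballI impI)
    show "right_module corner ?QN" by (rule QNS.corner_module)
    fix X Y f g
    assume X: "X \<in> fg_mod corner" and Y: "Y \<in> fg_mod corner" and f: "f \<in> rhom corner X Y" "inj_on f (carrier X)"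
      and g: "g \<in> rhom corner X ?QN"
    note XM = fg_modD(1)[OF X] and YM = fg_modD(1)[OF Y]
    let ?X = "inflation X" and ?Y = "inflation Y"
    note X' = inflation_module[OF XM] and Y' = inflation_module[OF YM]
    interpret X': supported_module R e ?X by (rule supported_moduleI[OF X'])
    interpret Y': supported_module R e ?Y by (rule supported_moduleI[OF Y'])
    have f': "rlinear R ?X ?Y f"
      using rlinear_comp[OF rlinear_comp[OF rlinear_inflation(2)[OF XM] rhom_rlinear[OF f(1)]] rlinear_inflation(1)[OF YM]]
        corner_rlinear_iff[OF X' Y'] by blast
    have "rlinear R ?X ?QN g"
      using rlinear_comp[OF rlinear_inflation(2)[OF XM] rhom_rlinear[OF g]]
        corner_rlinear_iff[OF X' QNM QNs] by blast
    then have g': "rlinear R ?X ?B g"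
      using QN_sub by (auto simp: rlinear_def ops simp del: inflation_simps)
    let ?D = "prod_rmod ?B ?Y"
    have DM: "right_module R ?D" by (rule prod_module[OF BM Y'(1)])
    interpret D: right_module R ?D by (rule DM)
    have D_fg: "fin_gen R ?D"
      by (rule prod_fin_gen[OF BM Y'(1) B_fg inflation_fin_gen[OF YM fg_modD(2)[OF Y]]])
    \<comment> \<open>The quotient of the product by the antidiagonal image \<open>?K\<close> is the
      pushout of f and g.\<close>
    let ?k = "\<lambda>x. (g x, \<ominus>\<^bsub>?Y\<^esub> f x)" and ?K = "(\<lambda>x. (g x, \<ominus>\<^bsub>inflation Y\<^esub> f x)) ` carrier (inflation X)"
    have k: "rlinear R ?X ?D ?k" by (rule rlinear_pair[OF g' rlinear_minus_map[OF Y'(1) f']])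
    have K: "right_submodule R ?D ?K" by (rule range_submodule[OF X'(1) DM k])
    let ?M = "quot_rmod ?D ?K" and ?c = "\<lambda>u. ?K +>\<^bsub>prod_rmod (quot_rmod P N) (inflation Y)\<^esub> u"
    have MM: "right_module R ?M" by (rule D.quot_module[OF K])
    interpret M: right_module R ?M by (rule MM)
    have M_fg: "fin_gen R ?M" by (rule D.quot_fin_gen[OF K D_fg])
    note c = D.rlinear_coset[OF K]
    note lin = rlinear_prod[OF BM Y'(1)]
    let ?\<beta> = "\<lambda>b. ?c (b, \<zero>\<^bsub>inflation Y\<^esub>)"
    have \<beta>: "rlinear R ?B ?M ?\<beta>" by (rule rlinear_comp[OF lin(3) c])
    \<comment> \<open>(b, 0) = (g x, - f x) forces f x = 0, hence x = 0 and b = 0.\<close>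
    have \<beta>_inj: "inj_on ?\<beta> (carrier ?B)"
      unfolding rlinear_inj_iff[OF BM MM \<beta>]
    proof (intro ballI impI)
      fix b assume b: "b \<in> carrier ?B" "?\<beta> b = \<zero>\<^bsub>?M\<^esub>"
      then have "(b, \<zero>\<^bsub>?Y\<^esub>) \<in> ?K"
        using D.coset_eq_zero_iff[OF K, of "(b, \<zero>\<^bsub>?Y\<^esub>)"] Y'.M.zero_closed by auto
      then obtain x where x: "x \<in> carrier ?X" "b = g x" "\<zero>\<^bsub>?Y\<^esub> = \<ominus>\<^bsub>?Y\<^esub> f x" by blast
      have fx: "f x \<in> carrier ?Y" by (rule rlinearD(1)[OF f' x(1)])
      have "f x = \<zero>\<^bsub>?Y\<^esub>" using Y'.M.r_neg[OF fx] x(3)[symmetric] Y'.M.r_zero[OF fx] by simp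
      then have "x = \<zero>\<^bsub>?X\<^esub>" using rlinear_inj_iff[OF X'(1) Y'(1) f'] f(2) x(1) by simp
      then show "b = \<zero>\<^bsub>?B\<^esub>" using x(2) rlinear_zero[OF X'(1) BM g'] by simp
    qed
    obtain \<tau> where \<tau>: "rlinear R ?M ?M \<tau>"
      "\<And>x. x \<in> carrier ?M \<Longrightarrow> \<tau> x \<in> rspan R ?M ((\<lambda>x. x \<triangleleft>\<^bsub>?M\<^esub> e') ` carrier ?M)"
      "\<And>x. x \<in> carrier ?M \<Longrightarrow> \<tau> (x \<triangleleft>\<^bsub>?M\<^esub> e') = x \<triangleleft>\<^bsub>?M\<^esub> e'"
      by (rule split_retraction[OF art MM M_fg split]) (assumption, erule that, simp_all)
    have cD: "carrier ?M = ?c ` carrier ?D" by (rule D.quot_carrier[OF K])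
    \<comment> \<open>The factor Y contributes nothing, because \<open>e'\<close> kills it; the
      torsion part of the pushout lies in the copy of \<open>?B\<close>.\<close>
    have "rspan R ?M ((\<lambda>x. x \<triangleleft>\<^bsub>?M\<^esub> e') ` carrier ?M) \<subseteq> ?\<beta> ` carrier ?B"
    proof (rule rspan_least[OF range_submodule[OF BM MM \<beta>]], rule image_subsetI)
      fix m assume "m \<in> carrier ?M"
      then obtain b y where bb: "b \<in> carrier ?B" "y \<in> carrier ?Y" "m = ?c (b, y)" unfolding cD by auto
      have "m \<triangleleft>\<^bsub>?M\<^esub> e' = ?c ((b, y) \<triangleleft>\<^bsub>?D\<^esub> e')"
        unfolding bb(3) using bb(1,2) by (intro rlinearD(3)[OF c, symmetric]) simp_all
      also have "(b, y) \<triangleleft>\<^bsub>?D\<^esub> e' = (b \<triangleleft>\<^bsub>?B\<^esub> e', \<zero>\<^bsub>?Y\<^esub>)"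
        using Y'(2) bb(2) unfolding supported_def by simp
      finally show "m \<triangleleft>\<^bsub>?M\<^esub> e' \<in> ?\<beta> ` carrier ?B"
        using right_module.ract_closed[OF BM bb(1) e'_closed] by blast
    qed
    then have "\<tau> ` carrier ?M \<subseteq> ?\<beta> ` carrier ?B" using \<tau>(2) by blast
    then obtain u where u: "rlinear R ?M ?B u" "\<And>m. m \<in> carrier ?M \<Longrightarrow> ?\<beta> (u m) = \<tau> m"
      by (rule factor_inj[OF BM MM \<beta> \<beta>_inj \<tau>(1)]) (erule that, simp_all)
    \<comment> \<open>The coset of \<open>e'\<close> generates \<open>?B\<close> and is fixed by the
      action of \<open>e'\<close>, so its image is fixed by the retraction. Thus u is a left inverse
      of the inclusion of \<open>?B\<close>.\<close>
    have u\<beta>: "u (?\<beta> b) = b" if b: "b \<in> carrier ?B" for b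
    proof -
      obtain p where p: "p \<in> carrier P" "b = N +>\<^bsub>P\<^esub> p" using b unfolding P.quot_carrier[OF NP] by blast
      let ?e = "N +>\<^bsub>P\<^esub> e'"
      have e'P: "e' \<in> carrier P" by (simp add: P_iff)
      have e: "?e \<in> carrier ?B" unfolding P.quot_carrier[OF NP] using e'P by blast
      have pR: "p \<in> carrier R" "e' \<otimes> p = p" using p(1) by (simp_all add: P_iff)
      have be: "?e \<triangleleft>\<^bsub>?B\<^esub> p = b" "?e \<triangleleft>\<^bsub>?B\<^esub> e' = ?e"
        using P.coset_ract[OF NP e'P pR(1)] P.coset_ract[OF NP e'P e'_closed] pR(2) p(2) by simp_all
      have "\<tau> (?\<beta> ?e) = \<tau> (?\<beta> ?e \<triangleleft>\<^bsub>?M\<^esub> e')"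
        using rlinearD(3)[OF \<beta> e e'_closed] be(2) by simp
      also have "\<dots> = ?\<beta> ?e \<triangleleft>\<^bsub>?M\<^esub> e'" by (rule \<tau>(3)[OF rlinearD(1)[OF \<beta> e]])
      also have "\<dots> = ?\<beta> ?e" using rlinearD(3)[OF \<beta> e e'_closed] be(2) by simp
      finally have "\<tau> (?\<beta> ?e \<triangleleft>\<^bsub>?M\<^esub> p) = ?\<beta> ?e \<triangleleft>\<^bsub>?M\<^esub> p"
        using rlinearD(3)[OF \<tau>(1) rlinearD(1)[OF \<beta> e] pR(1)] by simp
      then have "\<tau> (?\<beta> b) = ?\<beta> b" using rlinearD(3)[OF \<beta> e pR(1)] be(1) by simp
      then have "?\<beta> (u (?\<beta> b)) = ?\<beta> b" using u(2)[OF rlinearD(1)[OF \<beta> b]] by simp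
      then show ?thesis
        using inj_onD[OF \<beta>_inj _ rlinearD(1)[OF u(1) rlinearD(1)[OF \<beta> b]] b] by simp
    qed
    let ?h = "\<lambda>y. u (?c (\<zero>\<^bsub>quot_rmod P N\<^esub>, y))"
    have h: "rlinear R ?Y ?B ?h" by (rule rlinear_comp[OF rlinear_comp[OF lin(4) c] u(1)])
    have hf: "?h (f x) = g x" if x: "x \<in> carrier X" for x
    proof -
      have xX: "x \<in> carrier ?X" using x by simp
      have gx: "g x \<in> carrier ?B" and fx: "f x \<in> carrier ?Y"
        using rlinearD(1)[OF g' xX] rlinearD(1)[OF f' xX] .
      interpret B: right_module R ?B by (rule BM)
      have z: "(\<zero>\<^bsub>?B\<^esub>, f x) \<in> carrier ?D" "(g x, \<zero>\<^bsub>?Y\<^esub>) \<in> carrier ?D" "?k x \<in> carrier ?D"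
        using gx fx B.M.zero_closed Y'.M.zero_closed Y'.M.a_inv_closed[OF fx] by simp_all
      have "(\<zero>\<^bsub>?B\<^esub>, f x) \<oplus>\<^bsub>?D\<^esub> ?k x = (g x, \<zero>\<^bsub>?Y\<^esub>)"
        using gx Y'.M.r_neg[OF fx] by simp
      then have "?c (g x, \<zero>\<^bsub>?Y\<^esub>) = ?c (\<zero>\<^bsub>?B\<^esub>, f x) \<oplus>\<^bsub>?M\<^esub> ?c (?k x)"
        using rlinearD(2)[OF c z(1,3)] by simp
      also have "?c (?k x) = \<zero>\<^bsub>?M\<^esub>"
        using D.coset_eq_zero_iff[OF K z(3)] xX by blast
      also have "?c (\<zero>\<^bsub>?B\<^esub>, f x) \<oplus>\<^bsub>?M\<^esub> \<zero>\<^bsub>?M\<^esub> = ?c (\<zero>\<^bsub>?B\<^esub>, f x)"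
        by (rule M.M.r_zero[OF rlinearD(1)[OF c z(1)]])
      finally show ?thesis using u\<beta>[OF gx] by simp
    qed
    \<comment> \<open>The extension lands in \<open>Q\<close> modulo N: y = y e gives h y = (h y) e,
      and right multiplication by e maps \<open>P\<close> into \<open>Q\<close>.\<close>
    have hQ: "?h y \<in> carrier ?QN" if y: "y \<in> carrier ?Y" for y
    proof -
      obtain p where p: "p \<in> carrier P" "?h y = N +>\<^bsub>P\<^esub> p"
        using rlinearD(1)[OF h y] unfolding P.quot_carrier[OF NP] by blast
      have "?h y = ?h (y \<triangleleft>\<^bsub>?Y\<^esub> e)" using Y'.act_e[OF y] by simp
      also have "\<dots> = ?h y \<triangleleft>\<^bsub>?B\<^esub> e" by (rule rlinearD(3)[OF h y e_closed])
      also have "\<dots> = N +>\<^bsub>P\<^esub> (p \<otimes> e)" unfolding p(2) using P.coset_ract[OF NP p(1) e_closed] by simp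
      finally have "?h y = N +>\<^bsub>Q\<^esub> (p \<otimes> e)" by (simp add: coset)
      moreover have "p \<otimes> e \<in> carrier Q"
      proof -
        have "p \<in> carrier R" "e' \<otimes> p = p" using p(1) by (simp_all add: P_iff)
        then show ?thesis by (simp add: Q_iff m_assoc) (simp add: m_assoc[symmetric])
      qed
      ultimately show ?thesis unfolding QS.quot_carrier[OF N] by blast
    qed
    have "rlinear R ?Y ?QN ?h"
      by (rule rlinearI) (use hQ rlinearD(2,3)[OF h] in \<open>simp_all add: ops del: inflation_simps\<close>)
    then have "rlinear corner ?Y ?QN ?h" using corner_rlinear_iff[OF Y' QNM QNs] by blast
    then have "restrict ?h (carrier Y) \<in> rhom corner Y ?QN"
      by (intro restrict_rhom[OF YM] rlinear_comp[OF rlinear_inflation(1)[OF YM]])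
    moreover have "compose (carrier X) (restrict ?h (carrier Y)) f = g"
      using hf rlinearD(1)[OF rhom_rlinear[OF f(1)]] g by (simp add: compose_eq_iff rhom_iff)
    ultimately show "\<exists>h\<in>rhom corner Y ?QN. compose (carrier X) h f = g" by blast
  qed
qed

end

section \<open>Subsets of idempotents\<close>

lemma cyclic_quotient:
  assumes "right_module R M" "finite S" "S \<subseteq> carrier M" "rspan R M S = carrier M" "carrier M \<noteq> {\<zero>\<^bsub>M\<^esub>}"
  obtains N s where "right_submodule R M N" "N \<noteq> carrier M" "s \<in> S"
    "carrier M = N <+>\<^bsub>M\<^esub> (\<lambda>a. s \<triangleleft>\<^bsub>M\<^esub> a) ` carrier R"
proof -
  interpret right_module R M by fact
  let ?G = "{T \<in> Pow S. rspan R M T = carrier M}"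
  have "finite ?G" "?G \<noteq> {}" using assms(2,4) by auto
  from finite_has_minimal[OF this] obtain T where T: "T \<in> ?G" "\<forall>U\<in>?G. U \<subseteq> T \<longrightarrow> T = U" ..
  have "T \<noteq> {}" using T(1) assms(5) rspan_empty by auto
  then obtain s where s: "s \<in> T" by blast
  let ?N = "rspan R M (T - {s})"
  have TM: "T - {s} \<subseteq> carrier M" "s \<in> carrier M" using T(1) s assms(3) by auto
  have "?N \<noteq> carrier M" using T s by blast
  moreover have "insert s (T - {s}) = T" using s by blast
  then have "carrier M = ?N <+>\<^bsub>M\<^esub> (\<lambda>a. s \<triangleleft>\<^bsub>M\<^esub> a) ` carrier R"
    using rspan_insert[OF TM] T(1) by simp
  ultimately show thesis using that rspan_submodule[OF TM(1)] s T(1) by blast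
qed

section \<open>The class of modules killed by the complementary idempotent\<close>

context triangular
begin

definition supported_class :: "'a fgmodule set" where
  "supported_class = {X \<in> fg_mod R. supported X}"

lemma supported_closed_class:
  assumes "right_artinian R"
  shows "closed_class R supported_class"
proof
  show "right_artinian R" by fact
  show "supported_class \<subseteq> fg_mod R" by (auto simp: supported_class_def)
  obtain Z where Z: "Z \<in> fg_mod R" "carrier Z = {\<zero>\<^bsub>Z\<^esub>}" by (rule zero_module_exists[OF ring_axioms])
  then have "Z \<in> supported_class"
    using right_module.zero_ract[OF fg_modD(1)[OF Z(1)] e'_closed] by (simp add: supported_class_def supported_def)
  then show "supported_class \<noteq> {}" by blast
  fix X Y :: "'a fgmodule" and f
  assume "X \<in> supported_class"
  then have X: "right_module R X" "supported X" by (simp_all add: supported_class_def fg_modD)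
  {
    assume Y: "Y \<in> fg_mod R" "rlinear R Y X f" "inj_on f (carrier Y)"
    then show "Y \<in> supported_class"
      using supported_inj[OF fg_modD(1)[OF Y(1)] X(1) Y(2,3) X(2)] by (simp add: supported_class_def)
  }
  {
    assume Y: "Y \<in> fg_mod R" "rlinear R X Y f" "f ` carrier X = carrier Y"
    then show "Y \<in> supported_class"
      using supported_image[OF X(1) fg_modD(1)[OF Y(1)] Y(2,3) X(2)] by (simp add: supported_class_def)
  }
  fix P' :: "'a fgmodule"
  assume "Y \<in> supported_class" and P: "P' \<in> fg_mod R" "rmod_iso R (prod_rmod X Y) P'"
  then have Y: "right_module R Y" "supported Y" by (simp_all add: supported_class_def fg_modD)
  note D = prod_module[OF X(1) Y(1)]
  obtain f g where fg: "iso_pair R (prod_rmod X Y) P' f g" using P(2) rmod_iso_iff[OF D] by blast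
  have "supported (prod_rmod X Y)" using X(2) Y(2) by (simp add: supported_def)
  then have "supported P'"
    using supported_image[OF D fg_modD(1)[OF P(1)] iso_pairD(1,9)[OF fg]] by blast
  then show "P' \<in> supported_class" using P(1) by (simp add: supported_class_def)
qed

text \<open>Every map to a supported module kills x e', so x e' is zero in each coordinate and hence
  zero. The other inclusion is decomposition within a closed class.\<close>

lemma add_closure_supported:
  assumes "right_artinian R"
  shows "add_closure R (supported_class \<inter> ind_mod R) = supported_class"
proof
  let ?C = "supported_class \<inter> ind_mod R"
  interpret closed_class R supported_class by (rule supported_closed_class[OF assms])
  have C_fg: "?C \<subseteq> fg_mod R" using fg by blast
  show "add_closure R ?C \<subseteq> supported_class"
  proof
    fix M assume M: "M \<in> add_closure R ?C"
    then have Mfg: "M \<in> fg_mod R" using add_closure_fg by blast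
    interpret M: right_module R M by (rule fg_modD[OF Mfg])
    have "x \<triangleleft>\<^bsub>M\<^esub> e' = \<zero>\<^bsub>M\<^esub>" if x: "x \<in> carrier M" for x
    proof (rule ccontr)
      assume "x \<triangleleft>\<^bsub>M\<^esub> e' \<noteq> \<zero>\<^bsub>M\<^esub>"
      then obtain Z g where Z: "Z \<in> ?C" "rlinear R M Z g" "g (x \<triangleleft>\<^bsub>M\<^esub> e') \<noteq> \<zero>\<^bsub>Z\<^esub>"
        by (rule add_closure_detect[OF M C_fg rlinear_id M.ract_closed[OF x e'_closed]])
      have "g (x \<triangleleft>\<^bsub>M\<^esub> e') = g x \<triangleleft>\<^bsub>Z\<^esub> e'" by (rule rlinearD(3)[OF Z(2) x e'_closed])
      also have "\<dots> = \<zero>\<^bsub>Z\<^esub>"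
        using Z(1) rlinearD(1)[OF Z(2) x] by (simp add: supported_class_def supported_def)
      finally show False using Z(3) by simp
    qed
    then show "M \<in> supported_class" using Mfg by (simp add: supported_class_def supported_def)
  qed
  show "supported_class \<subseteq> add_closure R ?C" by (rule subset_add_closure)
qed

text \<open>An indecomposable X equals one of the two summands of \<open>hereditary_splits\<close>.
  If X has a non-zero map to a supported module, it is not generated by X e', since the map kills X
  e'; so it is the supported summand.\<close>

lemma hereditary_pred_closed:
  assumes "right_artinian R" "hereditary_injective corner Q"
  shows "supported_class \<inter> ind_mod R \<in> abelian_pred_closed_subcategories R"
proof -
  let ?C = "supported_class \<inter> ind_mod R"
  interpret closed_class R supported_class by (rule supported_closed_class[OF assms(1)])
  have "iso_closed R ?C" by (rule ind_iso_closed)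
  moreover have "pred_closed R ?C"
  proof (rule pred_closedI)
    fix X Y assume step: "nonzero_step R X Y" and Y: "Y \<in> ?C"
    obtain h x where X: "X \<in> ind_mod R" and h: "rlinear R X Y h" and x: "x \<in> carrier X" "h x \<noteq> \<zero>\<^bsub>Y\<^esub>"
      by (rule nonzero_stepE[OF step])
    note XM = fg_modD[OF ind_mod_fg[OF X]]
    have YM: "right_module R Y" and Ys: "supported Y"
      using Y module by (auto simp: supported_class_def)
    obtain T W where TW: "internal_direct_sum R X T W" "\<And>w. w \<in> W \<Longrightarrow> w \<triangleleft>\<^bsub>X\<^esub> e' = \<zero>\<^bsub>X\<^esub>"
      "\<And>x. x \<in> carrier X \<Longrightarrow> x \<triangleleft>\<^bsub>X\<^esub> e' \<in> T" "T \<subseteq> rspan R X ((\<lambda>x. x \<triangleleft>\<^bsub>X\<^esub> e') ` carrier X)"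
      by (rule hereditary_splits[OF assms XM]) (rule that)
    interpret X: right_module R X by (rule XM(1))
    have T: "right_submodule R X T" and W: "right_submodule R X W" and sum: "T <+>\<^bsub>X\<^esub> W = carrier X"
      using TW(1) by (simp_all add: internal_direct_sum_def)
    have "T = {\<zero>\<^bsub>X\<^esub>} \<or> W = {\<zero>\<^bsub>X\<^esub>}"
      using X TW(1) by (simp add: ind_mod_iff indecomposable_def)
    then have "supported X"
    proof
      assume "T = {\<zero>\<^bsub>X\<^esub>}"
      then show ?thesis using TW(3) by (simp add: supported_def)
    next
      assume W0: "W = {\<zero>\<^bsub>X\<^esub>}"
      have "carrier X \<subseteq> T"
        unfolding sum[symmetric] by (rule X.set_add_least[OF T]) (use W0 X.submoduleD(2)[OF T] in auto)
      moreover have "(\<lambda>x. x \<triangleleft>\<^bsub>X\<^esub> e') ` carrier X \<subseteq> {x \<in> carrier X. h x = \<zero>\<^bsub>Y\<^esub>}"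
        using Ys rlinearD(1,3)[OF h] X.ract_closed by (auto simp: supported_def)
      then have "rspan R X ((\<lambda>x. x \<triangleleft>\<^bsub>X\<^esub> e') ` carrier X) \<subseteq> {x \<in> carrier X. h x = \<zero>\<^bsub>Y\<^esub>}"
        by (rule rspan_least[OF kernel_submodule[OF XM(1) YM h]])
      ultimately show ?thesis using TW(4) x by blast
    qed
    then show "X \<in> ?C" using X ind_mod_fg[OF X] by (simp add: supported_class_def)
  qed
  moreover have "abelian_exact_subcategory R (add_closure R ?C)"
    unfolding add_closure_supported[OF assms(1)] by (rule abelian_exact)
  ultimately show ?thesis by (simp add: abelian_pred_closed_subcategories_def)
qed

text \<open>The quotient of X by the submodule generated by X e' is supported, hence torsion-free;
  for a torsion module X it is therefore zero.\<close>

lemma torsion_split: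
  assumes "right_artinian R" "split_torsion_pair R \<T> supported_class" "X \<in> ind_mod R"
  shows "supported X \<or> rspan R X ((\<lambda>x. x \<triangleleft>\<^bsub>X\<^esub> e') ` carrier X) = carrier X"
proof (cases "X \<in> supported_class")
  case True
  then show ?thesis by (simp add: supported_class_def)
next
  case False
  then have XT: "X \<in> \<T>" using assms(2,3) by (auto simp: split_torsion_pair_def)
  note XM = fg_modD[OF ind_mod_fg[OF assms(3)]]
  interpret X: right_module R X by (rule XM(1))
  let ?t = "rspan R X ((\<lambda>x. x \<triangleleft>\<^bsub>X\<^esub> e') ` carrier X)"
  have t: "right_submodule R X ?t" using X.ract_closed by (intro X.rspan_submodule) auto
  obtain C c where C: "C \<in> fg_mod R" "rlinear R X C c" "c ` carrier X = carrier C"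
    "\<And>x. x \<in> carrier X \<Longrightarrow> c x = \<zero>\<^bsub>C\<^esub> \<longleftrightarrow> x \<in> ?t"
    by (rule quot_fg_rep[OF XM(1) t XM(2)]) (rule that)
  have "z \<triangleleft>\<^bsub>C\<^esub> e' = \<zero>\<^bsub>C\<^esub>" if z: "z \<in> carrier C" for z
  proof -
    obtain x where x: "x \<in> carrier X" "z = c x" using z C(3) by blast
    have "x \<triangleleft>\<^bsub>X\<^esub> e' \<in> ?t" by (rule subsetD[OF rspan_superset imageI[OF x(1)]])
    then show ?thesis
      using C(4)[OF X.ract_closed[OF x(1) e'_closed]] rlinearD(3)[OF C(2) x(1) e'_closed] x(2) by simp
  qed
  then have "C \<in> supported_class" using C(1) by (simp add: supported_class_def supported_def)
  moreover have "torsion_pair R \<T> supported_class" using assms(2) by (simp add: split_torsion_pair_def)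
  ultimately have c0: "c x = \<zero>\<^bsub>C\<^esub>" if "x \<in> carrier X" for x
    by (intro torsion_pairD(3)[OF _ XT _ C(2) that])
  have "carrier X \<subseteq> ?t"
  proof
    fix x assume x: "x \<in> carrier X"
    show "x \<in> ?t" using C(4)[OF x] c0[OF x] by blast
  qed
  then show ?thesis using X.submoduleD(1)[OF t] by (intro disjI2 equalityI)
qed

end

text \<open>A decomposition of f R writes f = n + l with orthogonal idempotents n and l. Primitivity
  makes one of them zero, and the summand that contains f is everything.\<close>

lemma idem_module_indecomposable:
  assumes "ring R" "primitive_idempotent R f"
  shows "indecomposable R (mult_rmod R (peirce R f \<one>\<^bsub>R\<^esub>))"
proof -
  interpret ring R by fact
  have f: "f \<in> carrier R" "f \<otimes>\<^bsub>R\<^esub> f = f" "f \<noteq> \<zero>\<^bsub>R\<^esub>"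
    using assms(2) by (simp_all add: primitive_idempotent_def idempotents_def)
  let ?fR = "peirce R f \<one>\<^bsub>R\<^esub>" and ?M = "mult_rmod R (peirce R f \<one>\<^bsub>R\<^esub>)"
  have M: "right_module R ?M" by (rule ideal_module[OF idem_ideal[OF f(1)]])
  interpret M: right_module R ?M by (rule M)
  have fx: "f \<otimes>\<^bsub>R\<^esub> x = x" "x \<in> carrier R" if "x \<in> ?fR" for x
    using that f(1,2) by (auto simp: peirce_def m_assoc[symmetric])
  have f_mem: "f \<in> ?fR" using f unfolding peirce_def by (intro image_eqI[of _ _ f]) simp_all
  have "N = {\<zero>\<^bsub>R\<^esub>} \<or> L = {\<zero>\<^bsub>R\<^esub>}" if NL: "internal_direct_sum R ?M N L" for N L
  proof -
    have N: "right_submodule R ?M N" and L: "right_submodule R ?M L"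
      and sum: "N <+>\<^bsub>?M\<^esub> L = ?fR" and int: "N \<inter> L = {\<zero>\<^bsub>R\<^esub>}"
      using NL by (simp_all add: internal_direct_sum_def)
    note ND = M.submoduleD[OF N] and LD = M.submoduleD[OF L]
    have "f \<in> N <+>\<^bsub>?M\<^esub> L" using sum f_mem by simp
    then obtain n l where nl: "n \<in> N" "l \<in> L" "f = n \<oplus>\<^bsub>R\<^esub> l" unfolding M.set_add_iff by auto
    have n: "n \<in> ?fR" "n \<in> carrier R" "f \<otimes>\<^bsub>R\<^esub> n = n" and l: "l \<in> ?fR" "l \<in> carrier R" "f \<otimes>\<^bsub>R\<^esub> l = l"
      using ND(3)[OF nl(1)] LD(3)[OF nl(2)] fx by simp_all
    \<comment> \<open>From x = f x = x x + y x, the element y x = x - x x lies in both summands and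
      so vanishes.\<close>
    have idem: "x \<otimes>\<^bsub>R\<^esub> x = x \<and> y \<otimes>\<^bsub>R\<^esub> x = \<zero>\<^bsub>R\<^esub>"
      if K: "right_submodule R ?M K" "right_submodule R ?M K'" "K \<inter> K' = {\<zero>\<^bsub>R\<^esub>}" and
        x: "x \<in> K" "x \<in> carrier R" "f \<otimes>\<^bsub>R\<^esub> x = x" and y: "y \<in> K'" "y \<in> carrier R" and xy: "f = x \<oplus>\<^bsub>R\<^esub> y" for K K' x y
    proof -
      have "x = x \<otimes>\<^bsub>R\<^esub> x \<oplus>\<^bsub>R\<^esub> y \<otimes>\<^bsub>R\<^esub> x" using x(2,3) y(2) unfolding xy by (simp add: l_distr)
      then have "y \<otimes>\<^bsub>R\<^esub> x = x \<ominus>\<^bsub>R\<^esub> x \<otimes>\<^bsub>R\<^esub> x"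
        using x(2) y(2) by (metis add.inv_solve_left' add.m_comm minus_eq m_closed a_inv_closed add.m_closed add.inv_solve_left)
      moreover have "x \<ominus>\<^bsub>R\<^esub> x \<otimes>\<^bsub>R\<^esub> x \<in> K"
      proof -
        have "x \<otimes>\<^bsub>R\<^esub> (\<one>\<^bsub>R\<^esub> \<ominus>\<^bsub>R\<^esub> x) \<in> K" using M.submoduleD(5)[OF K(1) x(1), of "\<one>\<^bsub>R\<^esub> \<ominus>\<^bsub>R\<^esub> x"] x(2) by simp
        then show ?thesis using x(2) by (simp add: minus_eq r_distr r_minus)
      qed
      moreover have "y \<otimes>\<^bsub>R\<^esub> x \<in> K'" using M.submoduleD(5)[OF K(2) y(1) x(2)] by simp
      ultimately have "y \<otimes>\<^bsub>R\<^esub> x = \<zero>\<^bsub>R\<^esub>" using K(3) by auto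
      then show ?thesis using \<open>x = x \<otimes>\<^bsub>R\<^esub> x \<oplus>\<^bsub>R\<^esub> y \<otimes>\<^bsub>R\<^esub> x\<close> x(2) by simp
    qed
    have "n \<otimes>\<^bsub>R\<^esub> n = n" "l \<otimes>\<^bsub>R\<^esub> n = \<zero>\<^bsub>R\<^esub>" using idem[OF N L int nl(1) n(2,3) nl(2) l(2) nl(3)] by simp_all
    moreover have "l \<otimes>\<^bsub>R\<^esub> l = l" "n \<otimes>\<^bsub>R\<^esub> l = \<zero>\<^bsub>R\<^esub>"
    proof -
      have "f = l \<oplus>\<^bsub>R\<^esub> n" using nl(3) n(2) l(2) by (simp add: a_comm)
      moreover have "L \<inter> N = {\<zero>\<^bsub>R\<^esub>}" using int by blast
      ultimately show "l \<otimes>\<^bsub>R\<^esub> l = l" "n \<otimes>\<^bsub>R\<^esub> l = \<zero>\<^bsub>R\<^esub>"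
        using idem[OF L N _ nl(2) l(2,3) nl(1) n(2)] by simp_all
    qed
    ultimately have nl0: "n = \<zero>\<^bsub>R\<^esub> \<or> l = \<zero>\<^bsub>R\<^esub>"
      using assms(2) nl(3) n(2) l(2) by (auto simp: primitive_idempotent_def idempotents_def orthogonal_def)
    have full: "K' = {\<zero>\<^bsub>R\<^esub>}"
      if K: "right_submodule R ?M K" "right_submodule R ?M K'" "K \<inter> K' = {\<zero>\<^bsub>R\<^esub>}" "f \<in> K" for K K'
    proof -
      have "x \<in> K" if "x \<in> K'" for x
        using M.submoduleD(5)[OF K(1) K(4), of x] M.submoduleD(3)[OF K(2) that] fx[of x] by simp
      then show ?thesis using K(3) M.submoduleD(2)[OF K(2)] by auto
    qed
    have int': "L \<inter> N = {\<zero>\<^bsub>R\<^esub>}" using int by blast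
    from nl0 show ?thesis
    proof
      assume "n = \<zero>\<^bsub>R\<^esub>"
      then have "f \<in> L" using nl l(2) by simp
      then show ?thesis using full[OF L N int'] by simp
    next
      assume "l = \<zero>\<^bsub>R\<^esub>"
      then have "f \<in> N" using nl n(2) by simp
      then show ?thesis using full[OF N L int] by simp
    qed
  qed
  moreover have "?fR \<noteq> {\<zero>\<^bsub>R\<^esub>}" using f_mem f(3) by blast
  ultimately show ?thesis using M by (simp add: indecomposable_def)
qed

section \<open>Recovering the set of idempotents from the subcategory\<close>

locale idempotent_system = ring R for R :: "('a, 'r) ring_scheme" (structure) +
  fixes E :: "'a set"
  assumes complete: "complete_primitive_idempotents R E"
begin

lemma finite_E: "finite E"
  and primitive: "f \<in> E \<Longrightarrow> primitive_idempotent R f"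
  and sum_E: "idem_sum R E = \<one>"
  using complete by (simp_all add: complete_primitive_idempotents_def)

lemma E_closed: "f \<in> E \<Longrightarrow> f \<in> carrier R" and E_idem: "f \<in> E \<Longrightarrow> f \<otimes> f = f" and E_nonzero: "f \<in> E \<Longrightarrow> f \<noteq> \<zero>"
  using primitive by (simp_all add: primitive_idempotent_def idempotents_def)

lemma E_mult: "\<lbrakk>f \<in> E; g \<in> E\<rbrakk> \<Longrightarrow> f \<otimes> g = (if f = g then f else \<zero>)"
  using complete E_idem by (auto simp: complete_primitive_idempotents_def orthogonal_def)

lemma idem_sum_mult:
  assumes "\<Sigma> \<subseteq> E"
  shows "idem_sum R \<Sigma> \<in> carrier R"
    and "a \<in> carrier R \<Longrightarrow> idem_sum R \<Sigma> \<otimes> a = (\<Oplus>f\<in>\<Sigma>. f \<otimes> a)"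
    and "f \<in> E \<Longrightarrow> f \<otimes> idem_sum R \<Sigma> = (if f \<in> \<Sigma> then f else \<zero>)"
    and "f \<in> E \<Longrightarrow> idem_sum R \<Sigma> \<otimes> f = (if f \<in> \<Sigma> then f else \<zero>)"
    and "idem_sum R \<Sigma> \<otimes> idem_sum R \<Sigma> = idem_sum R \<Sigma>"
proof -
  have fin: "finite \<Sigma>" using assms finite_E by (rule finite_subset)
  have cl: "(\<lambda>f. f) \<in> \<Sigma> \<rightarrow> carrier R" using assms E_closed by auto
  show closed: "idem_sum R \<Sigma> \<in> carrier R" unfolding idem_sum_def by (rule finsum_closed[OF cl])
  show left: "idem_sum R \<Sigma> \<otimes> a = (\<Oplus>f\<in>\<Sigma>. f \<otimes> a)" if "a \<in> carrier R" for a
    unfolding idem_sum_def by (rule finsum_ldistr[OF fin that cl])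
  have pick: "(\<Oplus>g\<in>\<Sigma>. if f = g then g else \<zero>) = (if f \<in> \<Sigma> then f else \<zero>)" for f
  proof (cases "f \<in> \<Sigma>")
    case True
    then show ?thesis using finsum_singleton[OF True fin cl] by simp
  next
    case False
    then have "(\<Oplus>g\<in>\<Sigma>. if f = g then g else \<zero>) = (\<Oplus>g\<in>\<Sigma>. \<zero>)" by (intro finsum_cong') auto
    then show ?thesis using False by simp
  qed
  show right: "f \<otimes> idem_sum R \<Sigma> = (if f \<in> \<Sigma> then f else \<zero>)" if f: "f \<in> E" for f
  proof -
    have "f \<otimes> idem_sum R \<Sigma> = (\<Oplus>g\<in>\<Sigma>. f \<otimes> g)"
      unfolding idem_sum_def by (rule finsum_rdistr[OF fin E_closed[OF f] cl])
    also have "\<dots> = (\<Oplus>g\<in>\<Sigma>. if f = g then g else \<zero>)"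
      using assms f E_mult cl by (intro finsum_cong') auto
    finally show ?thesis by (simp only: pick)
  qed
  show "idem_sum R \<Sigma> \<otimes> f = (if f \<in> \<Sigma> then f else \<zero>)" if f: "f \<in> E" for f
  proof -
    have "idem_sum R \<Sigma> \<otimes> f = (\<Oplus>g\<in>\<Sigma>. if f = g then g else \<zero>)"
      unfolding left[OF E_closed[OF f]] using assms f E_mult cl by (intro finsum_cong') auto
    then show ?thesis by (simp only: pick)
  qed
  have "(\<Oplus>f\<in>\<Sigma>. f \<otimes> idem_sum R \<Sigma>) = (\<Oplus>f\<in>\<Sigma>. f)"
    using assms right cl by (intro finsum_cong') auto
  then show "idem_sum R \<Sigma> \<otimes> idem_sum R \<Sigma> = idem_sum R \<Sigma>"
    unfolding left[OF closed] by (simp add: idem_sum_def)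
qed

text \<open>a is the sum of the products f a, because the idempotents sum to 1.\<close>

lemma mem_right_ideal:
  assumes I: "right_ideal I" and a: "a \<in> carrier R" and "\<And>f. f \<in> E \<Longrightarrow> f \<otimes> a \<in> I"
  shows "a \<in> I"
proof -
  note ID = right_idealD[OF I]
  have "(\<Oplus>f\<in>F. f \<otimes> a) \<in> I" if "finite F" "F \<subseteq> E" for F
    using that
  proof (induction F rule: finite_induct)
    case (insert f F)
    have "(\<Oplus>f\<in>insert f F. f \<otimes> a) = f \<otimes> a \<oplus> (\<Oplus>f\<in>F. f \<otimes> a)"
      using insert E_closed a by (intro finsum_insert) auto
    then show ?case using insert ID(4) assms(3) by simp
  qed (simp add: ID(2))
  from this[OF finite_E subset_refl] have "idem_sum R E \<otimes> a \<in> I"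
    unfolding idem_sum_mult(2)[OF subset_refl a] .
  then show ?thesis using a by (simp add: sum_E)
qed

lemma mult_complement:
  assumes "\<Sigma> \<subseteq> E" "f \<in> E"
  shows "f \<otimes> (\<one> \<ominus> idem_sum R \<Sigma>) = (if f \<in> \<Sigma> then \<zero> else f)"
  using idem_sum_mult(1,3)[OF assms(1)] assms(2) E_closed[OF assms(2)]
  by (simp add: minus_eq r_distr r_minus r_neg)

lemma triangular_iff:
  assumes "\<Sigma> \<subseteq> E"
  shows "triangular R (idem_sum R \<Sigma>) \<longleftrightarrow> peirce R (idem_sum R \<Sigma>) (\<one> \<ominus> idem_sum R \<Sigma>) = {\<zero>}"
proof -
  note S = idem_sum_mult[OF assms]
  have "triangular R (idem_sum R \<Sigma>) \<longleftrightarrow>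
      (\<forall>a\<in>carrier R. idem_sum R \<Sigma> \<otimes> a \<otimes> (\<one> \<ominus> idem_sum R \<Sigma>) = \<zero>)"
    using S(1,5) ring_axioms by (auto simp: triangular_def triangular_axioms_def)
  also have "\<dots> \<longleftrightarrow> peirce R (idem_sum R \<Sigma>) (\<one> \<ominus> idem_sum R \<Sigma>) = {\<zero>}"
  proof -
    have "carrier R \<noteq> {}" using zero_closed by blast
    moreover have "(\<forall>a\<in>C. g a = z) \<longleftrightarrow> g ` C = {z}" if "C \<noteq> {}" for g :: "'a \<Rightarrow> 'a" and C z
      using that by auto
    ultimately show ?thesis unfolding peirce_def by blast
  qed
  finally show ?thesis .
qed

lemma supported_indecomposables_eq:
  assumes "triangular R (idem_sum R \<Sigma>)"
  shows "supported_indecomposables R \<Sigma> = triangular.supported_class R (idem_sum R \<Sigma>) \<inter> ind_mod R"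
proof -
  interpret triangular R "idem_sum R \<Sigma>" by fact
  show ?thesis
    using ind_mod_fg by (auto simp: supported_indecomposables_def supported_class_def supported_def e'_def)
qed

lemma hereditary_injective_subsets_iff:
  "\<Sigma> \<in> hereditary_injective_subsets R E \<longleftrightarrow> \<Sigma> \<subseteq> E \<and> triangular R (idem_sum R \<Sigma>) \<and>
     hereditary_injective (corner_ring R (idem_sum R \<Sigma>))
       (mult_rmod R (peirce R (\<one> \<ominus> idem_sum R \<Sigma>) (idem_sum R \<Sigma>)))"
  using triangular_iff by (auto simp: hereditary_injective_subsets_def Let_def)

text \<open>The module f R tests membership of f. For f in \<open>\<Sigma>\<close> it is supported
  for \<open>\<Sigma>\<close>, hence for \<open>\<Delta>\<close>; then its element f is killed by
  the complement of the sum of \<open>\<Delta>\<close>, which for f outside \<open>\<Delta>\<close>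
  would give f = 0.\<close>

lemma supported_class_mono:
  assumes "\<Sigma> \<subseteq> E" "\<Delta> \<subseteq> E" "triangular R (idem_sum R \<Sigma>)" "triangular R (idem_sum R \<Delta>)"
    and "triangular.supported_class R (idem_sum R \<Sigma>) \<subseteq> triangular.supported_class R (idem_sum R \<Delta>)"
    and art: "right_artinian R"
  shows "\<Sigma> \<subseteq> \<Delta>"
proof
  interpret S: triangular R "idem_sum R \<Sigma>" by fact
  interpret P: triangular R "idem_sum R \<Delta>" by fact
  fix f assume f: "f \<in> \<Sigma>"
  then have fE: "f \<in> E" using assms(1) by blast
  note fR = E_closed[OF fE]
  let ?M = "mult_rmod R (peirce R f \<one>)"
  have M: "right_module R ?M" by (rule ideal_module[OF idem_ideal[OF fR]])
  obtain X u v where X: "X \<in> fg_mod R" "iso_pair R ?M X u v"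
    by (rule fg_rep[OF M ideal_fin_gen[OF art idem_ideal[OF fR]]])
  note XM = fg_modD(1)[OF X(1)] and I = iso_pairD[OF X(2)]
  have "p \<otimes> S.e' = \<zero>" if p: "p \<in> peirce R f \<one>" for p
  proof -
    obtain a where a: "a \<in> carrier R" "p = f \<otimes> a \<otimes> \<one>" using p by (auto simp: peirce_def)
    have "f = f \<otimes> idem_sum R \<Sigma>" using idem_sum_mult(3)[OF assms(1) fE] f by simp
    then have "p = f \<otimes> (idem_sum R \<Sigma> \<otimes> a)" using a fR by (metis S.e_closed m_assoc m_closed r_one)
    then show ?thesis using a(1) fR S.e_a_e'[OF a(1)] by (simp add: m_assoc)
  qed
  then have "S.supported ?M" by (simp add: S.supported_def)
  then have "X \<in> S.supported_class"
    using S.supported_image[OF M XM I(1,9)] X(1) by (simp add: S.supported_class_def)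
  then have "P.supported X" using assms(5) by (auto simp: P.supported_class_def)
  then have "P.supported ?M" by (rule P.supported_inj[OF M XM I(1,8)])
  moreover have "f \<in> peirce R f \<one>"
    unfolding peirce_def using fR E_idem[OF fE] by (intro image_eqI[of _ _ f]) simp_all
  ultimately have "f \<otimes> P.e' = \<zero>" by (simp add: P.supported_def)
  then show "f \<in> \<Delta>" using mult_complement[OF assms(2) fE] E_nonzero[OF fE]
    unfolding P.e'_def by (cases "f \<in> \<Delta>") simp_all
qed

text \<open>Let I be the image of a non-zero map from a torsion module T to a supported module; it
  is generated by vectors g f with f in \<open>\<Sigma>\<close>. A non-zero quotient of I generated
  by one such vector is covered by f R, so it is torsion-free by closure under quotients. Being a
  quotient of T as well, it would have to be zero.\<close>

lemma supported_subset_torsion_free: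
  assumes art: "right_artinian R" and tp: "torsion_pair R \<T> \<F>" and quot: "quotient_closed R \<F>"
    and S: "\<Sigma> \<subseteq> E" "triangular R (idem_sum R \<Sigma>)"
    and proj: "\<And>f. f \<in> \<Sigma> \<Longrightarrow> \<exists>X\<in>\<F>. rmod_iso R (mult_rmod R (peirce R f \<one>)) X"
  shows "triangular.supported_class R (idem_sum R \<Sigma>) \<subseteq> \<F>"
proof
  interpret triangular R "idem_sum R \<Sigma>" by fact
  interpret F: closed_class R \<F> by (rule torsion_free_closed_class[OF ring_axioms art tp quot])
  note TP = torsion_pairD[OF tp]
  fix X assume "X \<in> supported_class"
  then have Xfg: "X \<in> fg_mod R" and Xs: "supported X" by (simp_all add: supported_class_def)
  note XM = fg_modD(1)[OF Xfg]
  interpret X: right_module R X by (rule XM)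
  show "X \<in> \<F>"
  proof (rule TP(4)[OF Xfg], rule ccontr)
    fix T h t assume T: "T \<in> \<T>" "rlinear R T X h" "t \<in> carrier T" and "h t \<noteq> \<zero>\<^bsub>X\<^esub>"
    note TM = fg_modD[OF subsetD[OF TP(1) T(1)]]
    let ?I = "X\<lparr>carrier := h ` carrier T\<rparr>"
    have I_sub: "right_submodule R X (h ` carrier T)" by (rule range_submodule[OF TM(1) XM T(2)])
    note ID = X.submoduleD[OF I_sub]
    have IM: "right_module R ?I" by (rule X.restrict_module[OF I_sub])
    have hI: "rlinear R T ?I h" by (rule rlinear_restrict_range[OF T(2)]) simp
    have I_fg: "fin_gen R ?I" by (rule fin_gen_image[OF TM(1) IM hI _ TM(2)]) simp
    have Is: "supported ?I"
      by (rule supported_inj[OF IM XM rlinear_restrict[OF rlinear_id ID(1)] _ Xs]) simp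
    interpret I: supported_module R "idem_sum R \<Sigma>" ?I by (rule supported_moduleI[OF IM Is])
    obtain G where G: "finite G" "G \<subseteq> carrier ?I" "rspan R ?I G = carrier ?I"
      using I_fg unfolding I.fin_gen_iff by blast
    let ?S = "(\<lambda>(g, f). g \<triangleleft>\<^bsub>?I\<^esub> f) ` (G \<times> \<Sigma>)"
    have fin: "finite ?S" using G(1) finite_subset[OF S(1) finite_E] by simp
    have S_sub: "?S \<subseteq> carrier ?I"
    proof
      fix x assume "x \<in> ?S"
      then obtain g f where gf: "g \<in> G" "f \<in> \<Sigma>" "x = g \<triangleleft>\<^bsub>?I\<^esub> f" by blast
      show "x \<in> carrier ?I"
        unfolding gf(3) using gf(1,2) G(2) S(1) by (intro I.ract_closed E_closed) blast+
    qed
    have S_span: "right_submodule R ?I (rspan R ?I ?S)" by (rule I.rspan_submodule[OF S_sub])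
    have "G \<subseteq> rspan R ?I ?S"
    proof
      fix g assume g: "g \<in> G"
      then have gI: "g \<in> carrier ?I" using G(2) by blast
      \<comment> \<open>The coefficients a with g a in the span form a right ideal. It contains each
        f in \<open>\<Sigma>\<close> by the choice of \<open>?S\<close>, and the other f because g f
        = g e f = 0, where e is the sum of \<open>\<Sigma>\<close>.\<close>
      have "\<one> \<in> {a \<in> carrier R. g \<triangleleft>\<^bsub>?I\<^esub> a \<in> rspan R ?I ?S}"
      proof (rule mem_right_ideal[OF I.colon_submodule[OF S_span gI] one_closed])
        fix f assume f: "f \<in> E"
        have "g \<triangleleft>\<^bsub>?I\<^esub> f \<in> rspan R ?I ?S"
        proof (cases "f \<in> \<Sigma>")
          case True
          then have "g \<triangleleft>\<^bsub>?I\<^esub> f \<in> ?S" using g by (intro image_eqI[of _ _ "(g, f)"]) simp_all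
          then show ?thesis by (rule subsetD[OF rspan_superset])
        next
          case False
          have "g \<triangleleft>\<^bsub>?I\<^esub> f = g \<triangleleft>\<^bsub>?I\<^esub> (idem_sum R \<Sigma> \<otimes> f)"
            using I.act_corner[OF gI E_closed[OF f]] by simp
          also have "\<dots> = \<zero>\<^bsub>?I\<^esub>"
            using idem_sum_mult(4)[OF S(1) f] False I.ract_zero[OF gI] by simp
          finally show ?thesis using I.submoduleD(2)[OF S_span] by simp
        qed
        then show "f \<otimes> \<one> \<in> {a \<in> carrier R. g \<triangleleft>\<^bsub>?I\<^esub> a \<in> rspan R ?I ?S}" using E_closed[OF f] by simp
      qed
      then show "g \<in> rspan R ?I ?S" using I.ract_one[OF gI] by simp
    qed
    then have span: "rspan R ?I ?S = carrier ?I"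
      using rspan_least[OF S_span, of G] G(3) I.submoduleD(1)[OF S_span] by blast
    have "h t \<in> carrier ?I" using T(3) by simp
    then have nz: "carrier ?I \<noteq> {\<zero>\<^bsub>?I\<^esub>}" using \<open>h t \<noteq> \<zero>\<^bsub>X\<^esub>\<close> by auto
    obtain N s where N: "right_submodule R ?I N" "N \<noteq> carrier ?I" and s: "s \<in> ?S"
      and sum: "carrier ?I = N <+>\<^bsub>?I\<^esub> (\<lambda>a. s \<triangleleft>\<^bsub>?I\<^esub> a) ` carrier R"
      by (rule cyclic_quotient[OF IM fin S_sub span nz])
    obtain g f where gf: "g \<in> G" "f \<in> \<Sigma>" "s = g \<triangleleft>\<^bsub>?I\<^esub> f" using s by auto
    have gI: "g \<in> carrier ?I" and fE: "f \<in> E" using gf G(2) S(1) by blast+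
    note fR = E_closed[OF fE]
    obtain C c where C: "C \<in> fg_mod R" "rlinear R ?I C c" "c ` carrier ?I = carrier C"
      "\<And>x. x \<in> carrier ?I \<Longrightarrow> c x = \<zero>\<^bsub>C\<^esub> \<longleftrightarrow> x \<in> N"
      by (rule quot_fg_rep[OF IM N(1) I_fg]) (rule that)
    note CM = fg_modD(1)[OF C(1)]
    interpret C: right_module R C by (rule CM)
    let ?fR = "mult_rmod R (peirce R f \<one>)"
    obtain Y where Y: "Y \<in> \<F>" "rmod_iso R ?fR Y" using proj[OF gf(2)] by blast
    have fM: "right_module R ?fR" by (rule ideal_module[OF idem_ideal[OF fR]])
    obtain u v where uv: "iso_pair R ?fR Y u v" using Y(2) rmod_iso_iff[OF fM] by blast
    have fsub: "peirce R f \<one> \<subseteq> carrier R" using fR by (auto simp: peirce_def)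
    have act: "rlinear R ?fR ?I (\<lambda>a. g \<triangleleft>\<^bsub>?I\<^esub> a)"
      using rlinear_restrict[OF I.rlinear_act[OF gI], of "peirce R f \<one>"] fsub by (simp add: mult_rmod_restrict)
    \<comment> \<open>Acting on g sends f a to s a, so this map from the torsion-free copy of f R
      covers the cyclic quotient C.\<close>
    let ?\<phi> = "\<lambda>y. c (g \<triangleleft>\<^bsub>?I\<^esub> v y)"
    have \<phi>: "rlinear R Y C ?\<phi>" by (rule rlinear_comp[OF rlinear_comp[OF iso_pairD(2)[OF uv] act] C(2)])
    have "carrier C \<subseteq> ?\<phi> ` carrier Y"
    proof
      fix z assume "z \<in> carrier C"
      then obtain x where x: "x \<in> carrier ?I" "z = c x" using C(3) by blast
      then obtain n a where na: "n \<in> N" "a \<in> carrier R" "x = n \<oplus>\<^bsub>?I\<^esub> s \<triangleleft>\<^bsub>?I\<^esub> a"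
        unfolding sum I.set_add_iff by blast
      have nI: "n \<in> carrier ?I" by (rule I.submoduleD(3)[OF N(1) na(1)])
      have sa: "s \<triangleleft>\<^bsub>?I\<^esub> a = g \<triangleleft>\<^bsub>?I\<^esub> (f \<otimes> a)"
        unfolding gf(3) by (rule I.ract_mult[OF gI fR na(2), symmetric])
      have gfa: "g \<triangleleft>\<^bsub>?I\<^esub> (f \<otimes> a) \<in> carrier ?I" using gI fR na(2) by (intro I.ract_closed) simp_all
      have fa: "f \<otimes> a \<in> carrier ?fR" using fR na(2) by (auto simp: peirce_def image_iff)
      have "z = c n \<oplus>\<^bsub>C\<^esub> c (g \<triangleleft>\<^bsub>?I\<^esub> (f \<otimes> a))"
        unfolding x(2) na(3) sa by (rule rlinearD(2)[OF C(2) nI gfa])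
      also have "\<dots> = c (g \<triangleleft>\<^bsub>?I\<^esub> (f \<otimes> a))"
        using C(4)[OF nI] na(1) rlinearD(1)[OF C(2) gfa] by simp
      also have "\<dots> = ?\<phi> (u (f \<otimes> a))" using iso_pairD(3)[OF uv fa] by simp
      finally show "z \<in> ?\<phi> ` carrier Y" using iso_pairD(5)[OF uv fa] by blast
    qed
    then have "?\<phi> ` carrier Y = carrier C" using rlinearD(1)[OF \<phi>] by blast
    then have "C \<in> \<F>" by (rule F.quot_closed[OF Y(1) C(1) \<phi>])
    have "x \<in> N" if xI: "x \<in> carrier ?I" for x
    proof -
      obtain w where w: "w \<in> carrier T" "x = h w" using xI by auto
      have "c (h w) = \<zero>\<^bsub>C\<^esub>" by (rule TP(3)[OF T(1) \<open>C \<in> \<F>\<close> rlinear_comp[OF hI C(2)] w(1)])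
      then show ?thesis using C(4)[OF xI] w(2) by simp
    qed
    then show False using N(2) I.submoduleD(1)[OF N(1)] by blast
  qed
qed

text \<open>\<open>\<Sigma>\<close> collects the f with f R torsion-free. For any other f the
  indecomposable f R is torsion by splitting, so x f = 0 for all x in torsion-free modules. Applied
  to the modules f R with f in \<open>\<Sigma>\<close>, this gives the zero corner.\<close>

lemma subset_of_subcategory:
  assumes art: "right_artinian R" and C: "\<C> \<in> abelian_pred_closed_subcategories R"
  obtains \<Sigma> where "\<Sigma> \<in> hereditary_injective_subsets R E" "supported_indecomposables R \<Sigma> = \<C>"
proof -
  have C': "\<C> \<subseteq> ind_mod R" "pred_closed R \<C>" "abelian_exact_subcategory R (add_closure R \<C>)"
    using C by (simp_all add: abelian_pred_closed_subcategories_def)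
  define \<F> where "\<F> = add_closure R \<C>"
  define \<T> where "\<T> = left_perp R \<F>"
  have split: "split_torsion_pair R \<T> \<F>"
    unfolding \<F>_def \<T>_def by (rule split_torsion_pair_of[OF art C'(1,2)])
  then have tp: "torsion_pair R \<T> \<F>" and ind: "ind_mod R \<subseteq> \<T> \<union> \<F>" by (simp_all add: split_torsion_pair_def)
  have quot: "quotient_closed R \<F>"
    unfolding \<F>_def by (rule quotient_closed_add_closure[OF art C'])
  note TP = torsion_pairD[OF tp]
  let ?P = "\<lambda>f. mult_rmod R (peirce R f \<one>)"
  define \<Sigma> where "\<Sigma> = {f \<in> E. \<exists>X\<in>\<F>. rmod_iso R (?P f) X}"
  have S: "\<Sigma> \<subseteq> E" by (auto simp: \<Sigma>_def)
  let ?e = "idem_sum R \<Sigma>" and ?e' = "\<one> \<ominus> idem_sum R \<Sigma>"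
  note eS = idem_sum_mult[OF S]
  have PM: "right_module R (?P f)" if "f \<in> E" for f by (rule ideal_module[OF idem_ideal[OF E_closed[OF that]]])
  have Psub: "peirce R f \<one> \<subseteq> carrier R" if "f \<in> E" for f using E_closed[OF that] by (auto simp: peirce_def)
  have f_mem: "f \<in> peirce R f \<one>" if "f \<in> E" for f
    unfolding peirce_def using E_closed[OF that] E_idem[OF that] by (intro image_eqI[of _ _ f]) simp_all
  have F_supp: "x \<triangleleft>\<^bsub>X\<^esub> ?e' = \<zero>\<^bsub>X\<^esub>" if X: "X \<in> \<F>" and x: "x \<in> carrier X" for X x
  proof -
    interpret X: right_module R X by (rule fg_modD[OF subsetD[OF TP(2) X]])
    have kill: "x \<triangleleft>\<^bsub>X\<^esub> f = \<zero>\<^bsub>X\<^esub>" if f: "f \<in> E" "f \<notin> \<Sigma>" for f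
    proof -
      obtain Z u v where Z: "Z \<in> ind_mod R" "iso_pair R (?P f) Z u v"
        by (rule indecomposable_rep[OF idem_module_indecomposable[OF ring_axioms primitive[OF f(1)]] ideal_fin_gen[OF art idem_ideal[OF E_closed[OF f(1)]]]])
      have "rmod_iso R (?P f) Z" using Z(2) rmod_iso_iff[OF PM[OF f(1)]] by blast
      then have "Z \<notin> \<F>" using f by (auto simp: \<Sigma>_def)
      then have "Z \<in> \<T>" using ind Z(1) by blast
      have act: "rlinear R (?P f) X (\<lambda>a. x \<triangleleft>\<^bsub>X\<^esub> a)"
        using rlinear_restrict[OF X.rlinear_act[OF x], of "peirce R f \<one>"] Psub[OF f(1)]
        by (simp add: mult_rmod_restrict)
      note I = iso_pairD[OF Z(2)]
      have "x \<triangleleft>\<^bsub>X\<^esub> v (u f) = \<zero>\<^bsub>X\<^esub>"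
        using f_mem[OF f(1)] by (intro TP(3)[OF \<open>Z \<in> \<T>\<close> X rlinear_comp[OF I(2) act]] I(5)) simp
      then show ?thesis using I(3)[of f] f_mem[OF f(1)] by simp
    qed
    \<comment> \<open>The annihilator of x is a right ideal, and each product f \<open>?e'\<close>
      is either zero or an f outside \<open>\<Sigma>\<close>.\<close>
    have "?e' \<in> {a \<in> carrier R. x \<triangleleft>\<^bsub>X\<^esub> a \<in> {\<zero>\<^bsub>X\<^esub>}}"
    proof (rule mem_right_ideal[OF X.colon_submodule[OF X.zero_submodule x]])
      show "?e' \<in> carrier R" using eS(1) by simp
      fix f assume "f \<in> E"
      then show "f \<otimes> ?e' \<in> {a \<in> carrier R. x \<triangleleft>\<^bsub>X\<^esub> a \<in> {\<zero>\<^bsub>X\<^esub>}}"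
        using mult_complement[OF S] kill X.ract_zero[OF x] E_closed by simp
    qed
    then show ?thesis by simp
  qed
  have tri: "triangular R ?e"
  proof (unfold_locales)
    show "?e \<in> carrier R" "?e \<otimes> ?e = ?e" by (rule eS(1), rule eS(5))
    fix a assume a: "a \<in> carrier R"
    have e'R: "?e' \<in> carrier R" using eS(1) by simp
    have "f \<otimes> (a \<otimes> ?e') = \<zero>" if f: "f \<in> \<Sigma>" for f
    proof -
      have fE: "f \<in> E" using f S by blast
      obtain X where X: "X \<in> \<F>" "rmod_iso R (?P f) X" using f by (auto simp: \<Sigma>_def)
      obtain u v where uv: "iso_pair R (?P f) X u v" using X(2) rmod_iso_iff[OF PM[OF fE]] by blast
      note I = iso_pairD[OF uv]
      interpret P: right_module R "?P f" by (rule PM[OF fE])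
      have fa: "f \<otimes> a \<in> carrier (?P f)" using E_closed[OF fE] a by (auto simp: peirce_def image_iff)
      have "u ((f \<otimes> a) \<triangleleft>\<^bsub>?P f\<^esub> ?e') = u (f \<otimes> a) \<triangleleft>\<^bsub>X\<^esub> ?e'" by (rule rlinearD(3)[OF I(1) fa e'R])
      also have "\<dots> = \<zero>\<^bsub>X\<^esub>" by (rule F_supp[OF X(1) I(5)[OF fa]])
      finally have "(f \<otimes> a) \<triangleleft>\<^bsub>?P f\<^esub> ?e' = \<zero>\<^bsub>?P f\<^esub>"
        using I(8) P.ract_closed[OF fa e'R]
        unfolding rlinear_inj_iff[OF PM[OF fE] fg_modD(1)[OF subsetD[OF TP(2) X(1)]] I(1)] by blast
      then show ?thesis using E_closed[OF fE] a e'R by (simp add: m_assoc)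
    qed
    then have "(\<Oplus>f\<in>\<Sigma>. f \<otimes> (a \<otimes> ?e')) = (\<Oplus>f\<in>\<Sigma>. \<zero>)" by (intro finsum_cong') auto
    then have "?e \<otimes> (a \<otimes> ?e') = \<zero>" using eS(2)[of "a \<otimes> ?e'"] a e'R by simp
    then show "?e \<otimes> a \<otimes> (\<one> \<ominus> ?e) = \<zero>" using a eS(1) e'R by (simp add: m_assoc)
  qed
  interpret triangular R ?e by (rule tri)
  have "supported_class \<subseteq> \<F>"
    by (rule supported_subset_torsion_free[OF art tp quot S tri]) (simp add: \<Sigma>_def)
  moreover have "\<F> \<subseteq> supported_class"
    using F_supp TP(2) by (auto simp: supported_class_def supported_def e'_def)
  ultimately have eq: "\<F> = supported_class" by (rule subset_antisym[rotated])
  have "hereditary_injective corner Q"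
    by (rule split_hereditary[OF art torsion_split[OF art split[unfolded eq]]])
  then have "\<Sigma> \<in> hereditary_injective_subsets R E"
    using S tri by (simp add: hereditary_injective_subsets_iff e'_def)
  moreover have "supported_indecomposables R \<Sigma> = \<C>"
    using supported_indecomposables_eq[OF tri] add_closure_Int_ind[OF art C'(1,2)] eq by (simp add: \<F>_def)
  ultimately show thesis by (rule that)
qed

theorem supported_indecomposables_bij:
  assumes art: "right_artinian R"
  shows "bij_betw (supported_indecomposables R)
    (hereditary_injective_subsets R E) (abelian_pred_closed_subcategories R)"
proof (rule bij_betw_imageI)
  show "inj_on (supported_indecomposables R) (hereditary_injective_subsets R E)"
  proof (rule inj_onI)
    fix \<Sigma> \<Delta> assume S: "\<Sigma> \<in> hereditary_injective_subsets R E" and P: "\<Delta> \<in> hereditary_injective_subsets R E"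
      and eq: "supported_indecomposables R \<Sigma> = supported_indecomposables R \<Delta>"
    have SE: "\<Sigma> \<subseteq> E" "triangular R (idem_sum R \<Sigma>)" and PE: "\<Delta> \<subseteq> E" "triangular R (idem_sum R \<Delta>)"
      using S P by (simp_all add: hereditary_injective_subsets_iff)
    \<comment> \<open>The supported class is the additive closure of its indecomposables, so equal
      sets of indecomposables give equal classes.\<close>
    have "triangular.supported_class R (idem_sum R \<Sigma>) = triangular.supported_class R (idem_sum R \<Delta>)"
      using triangular.add_closure_supported[OF SE(2) art] triangular.add_closure_supported[OF PE(2) art]
        eq[unfolded supported_indecomposables_eq[OF SE(2)] supported_indecomposables_eq[OF PE(2)]] by metis
    then show "\<Sigma> = \<Delta>"
      using supported_class_mono[OF SE(1) PE(1) SE(2) PE(2) _ art]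
        supported_class_mono[OF PE(1) SE(1) PE(2) SE(2) _ art] by blast
  qed
  show "supported_indecomposables R ` hereditary_injective_subsets R E = abelian_pred_closed_subcategories R"
  proof
    show "supported_indecomposables R ` hereditary_injective_subsets R E \<subseteq> abelian_pred_closed_subcategories R"
    proof (rule image_subsetI)
      fix \<Sigma> assume "\<Sigma> \<in> hereditary_injective_subsets R E"
      then have S: "triangular R (idem_sum R \<Sigma>)" "hereditary_injective (corner_ring R (idem_sum R \<Sigma>))
          (mult_rmod R (peirce R (\<one> \<ominus> idem_sum R \<Sigma>) (idem_sum R \<Sigma>)))"
        by (simp_all add: hereditary_injective_subsets_iff)
      interpret triangular R "idem_sum R \<Sigma>" by (rule S(1))
      show "supported_indecomposables R \<Sigma> \<in> abelian_pred_closed_subcategories R"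
        unfolding supported_indecomposables_eq[OF S(1)]
        by (rule hereditary_pred_closed[OF art]) (use S(2) in \<open>simp add: e'_def\<close>)
    qed
    show "abelian_pred_closed_subcategories R \<subseteq> supported_indecomposables R ` hereditary_injective_subsets R E"
    proof
      fix \<C> assume "\<C> \<in> abelian_pred_closed_subcategories R"
      then obtain \<Sigma> where "\<Sigma> \<in> hereditary_injective_subsets R E" "supported_indecomposables R \<Sigma> = \<C>"
        by (rule subset_of_subcategory[OF art])
      then show "\<C> \<in> supported_indecomposables R ` hereditary_injective_subsets R E" by blast
    qed
  qed
qed

end

theorem corollary2p6:
  fixes A :: "('a, 'r) ring_scheme" and E :: "'a set"
  assumes "ring A"
    and "right_artinian A"
    and "connected_ring A"
    and "complete_primitive_idempotents A E"
    and "basic_ring A E"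
  shows "bij_betw (torsion_pair_of A)
           (abelian_pred_closed_subcategories A) (split_quotient_closed_torsion_pairs A)
       \<and> bij_betw (supported_indecomposables A)
           (hereditary_injective_subsets A E) (abelian_pred_closed_subcategories A)"
proof
  interpret idempotent_system A E
    using assms(1,4) by (simp add: idempotent_system_def idempotent_system_axioms_def)
  show "bij_betw (torsion_pair_of A)
      (abelian_pred_closed_subcategories A) (split_quotient_closed_torsion_pairs A)"
    by (rule torsion_pair_of_bij[OF assms(1,2)])
  show "bij_betw (supported_indecomposables A)
      (hereditary_injective_subsets A E) (abelian_pred_closed_subcategories A)"
    by (rule supported_indecomposables_bij[OF assms(2)])
qed

end
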